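(* Let $1<q<p<\infty$. Then for each integer $k>0$ the pair $(\lambda_k^D(q),0)$ is a bifurcation point of problem (P); that is, there is a sequence $(\mu_n,u_n)$ with $\mu_n\in\mathbb{R}$ and $u_n\in W^{1,p}_0(\Omega)$, $u_n\not\equiv0$, such that $u_n$ is a weak solution of problem (P) with $\lambda=\mu_n$ for every $n$, $\mu_n\to\lambda_k^D(q)$ and $\|u_n\|_{1,p}\to0$ as $n\to\infty$.
   Context: $\Omega\subset\mathbb{R}^N$ ($N\ge2$) is a bounded open domain with smooth boundary; $\|u\|_{1,s}=(\int_\Omega|\nabla u|^s\,dx)^{1/s}$ and $\Delta_s u=\mathrm{div}(|\nabla u|^{s-2}\nabla u)$ for $s\in(1,\infty)$. Problem (P) is: $-\Delta_p u-\Delta_q u=\lambda|u|^{q-2}u$ in $\Omega$, $u=0$ on $\partial\Omega$. For $p>q$, a weak solution is $u\in W^{1,p}_0(\Omega)$ with $$\int_\Omega|\nabla u|^{p-2}\nabla u\cdot\nabla v\,dx+\int_\Omega|\nabla u|^{q-2}\nabla u\cdot\nabla v\,dx=\lambda\int_\Omega|u|^{q-2}uv\,dx\quad\text{for all } v\in W^{1,p}_0(\Omega).$$ The variational eigenvalues $\lambda_k^D(q)$ of $-\Delta_q u=\lambda|u|^{q-2}u$ in $\Omega$, $u=0$ on $\partial\Omega$, are $\lambda_k^D(q)=\inf_{A\in\Sigma_k}\sup_{u\in A}\int_\Omega|\nabla u|^q\,dx$, where $\Sigma_k$ is the family of sets $A\subset D_1(q)=\{u\in W^{1,q}_0(\Omega):\int_\Omega|u|^q\,dx=1\}$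 that are closed in $W^{1,q}_0(\Omega)$, satisfy $A=-A$ and $\gamma(A)\ge k$. Here $\gamma(A)=\inf\{m\in\mathbb{N}:\exists\varphi\in C(A,\mathbb{R}^m\setminus\{0\}),\ \varphi(-x)=-\varphi(x)\}$ is the Krasnoselskii genus ($+\infty$ if no such $m$ exists). *)

theory Defs
  imports "HOL-Analysis.Analysis"
begin

text \<open>For open \<open>S\<close>: \<open>k\<close> times continuously differentiable, respectively infinitely often
  differentiable, on \<open>S\<close>.\<close>

primrec Ck_on :: "nat \<Rightarrow> 'a::euclidean_space set \<Rightarrow> ('a \<Rightarrow> real) \<Rightarrow> bool" where
  "Ck_on 0 S f \<longleftrightarrow> continuous_on S f"
| "Ck_on (Suc k) S f \<longleftrightarrow> (\<forall>x\<in>S. f differentiable (at x)) \<and>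
     (\<forall>b\<in>Basis. Ck_on k S (\<lambda>x. frechet_derivative f (at x) b))"

definition smooth_on :: "'a::euclidean_space set \<Rightarrow> ('a \<Rightarrow> real) \<Rightarrow> bool" where
  "smooth_on S f \<longleftrightarrow> (\<forall>k. Ck_on k S f)"

text \<open>Smooth boundary, by local defining functions: near each boundary point \<open>\<Omega>\<close> is the strict
  sublevel set of a smooth function without critical points.  For open \<open>\<Omega>\<close> this forces
  \<open>frontier \<Omega> \<inter> U = {y \<in> U. \<rho> y = 0}\<close>, so that \<open>\<Omega>\<close> lies locally on one side of a smooth
  hypersurface.\<close>

definition smooth_boundary :: "'a::euclidean_space set \<Rightarrow> bool" where
  "smooth_boundary \<Omega> \<longleftrightarrow> (\<forall>x\<in>frontier \<Omega>. \<exists>U \<rho>. open U \<and> x \<in> U \<and> smooth_on U \<rho> \<and>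
     (\<forall>y\<in>U. frechet_derivative \<rho> (at y) \<noteq> (\<lambda>_. 0)) \<and>
     \<Omega> \<inter> U = {y\<in>U. \<rho> y < 0})"

definition test_functions :: "'a::euclidean_space set \<Rightarrow> ('a \<Rightarrow> real) set" where
  "test_functions \<Omega> = {\<phi>. smooth_on UNIV \<phi> \<and> compact (closure {x. \<phi> x \<noteq> 0}) \<and>
     closure {x. \<phi> x \<noteq> 0} \<subseteq> \<Omega>}"

text \<open>Lebesgue and Sobolev functions are represented by honest functions; only their values
  on \<open>\<Omega>\<close>, up to null sets, matter.\<close>

definition Lp :: "real \<Rightarrow> 'a::euclidean_space set \<Rightarrow> ('a \<Rightarrow> 'b::euclidean_space) set" where
  "Lp s \<Omega> = {f \<in> borel_measurable (lebesgue_on \<Omega>). integrable (lebesgue_on \<Omega>) (\<lambda>x. norm (f x) powr s)}"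

definition locally_integrable ::
    "'a::euclidean_space set \<Rightarrow> ('a \<Rightarrow> 'b::euclidean_space) \<Rightarrow> bool" where
  "locally_integrable \<Omega> f \<longleftrightarrow> (\<forall>K. compact K \<and> K \<subseteq> \<Omega> \<longrightarrow> set_integrable lebesgue K f)"

definition is_weak_gradient ::
    "'a::euclidean_space set \<Rightarrow> ('a \<Rightarrow> real) \<Rightarrow> ('a \<Rightarrow> 'a) \<Rightarrow> bool" where
  "is_weak_gradient \<Omega> u g \<longleftrightarrow> locally_integrable \<Omega> u \<and> locally_integrable \<Omega> g \<and>
     (\<forall>\<phi>\<in>test_functions \<Omega>. \<forall>b\<in>Basis.
        (\<integral>x. u x * frechet_derivative \<phi> (at x) b \<partial>lebesgue_on \<Omega>)
          = - (\<integral>x. (g x \<bullet> b) * \<phi> x \<partial>lebesgue_on \<Omega>))"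

text \<open>Weak gradients on an open set are unique up to null sets, so the choice is immaterial.\<close>

definition weak_grad :: "'a::euclidean_space set \<Rightarrow> ('a \<Rightarrow> real) \<Rightarrow> 'a \<Rightarrow> 'a" where
  "weak_grad \<Omega> u = (SOME g. is_weak_gradient \<Omega> u g)"

definition W1 :: "real \<Rightarrow> 'a::euclidean_space set \<Rightarrow> ('a \<Rightarrow> real) set" where
  "W1 s \<Omega> = {u \<in> Lp s \<Omega>. \<exists>g \<in> Lp s \<Omega>. is_weak_gradient \<Omega> u g}"

definition W1_norm :: "real \<Rightarrow> 'a::euclidean_space set \<Rightarrow> ('a \<Rightarrow> real) \<Rightarrow> real" where
  "W1_norm s \<Omega> u = ((\<integral>x. \<bar>u x\<bar> powr s \<partial>lebesgue_on \<Omega>) +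
     (\<integral>x. norm (weak_grad \<Omega> u x) powr s \<partial>lebesgue_on \<Omega>)) powr (1 / s)"

definition W10 :: "real \<Rightarrow> 'a::euclidean_space set \<Rightarrow> ('a \<Rightarrow> real) set" where
  "W10 s \<Omega> = {u \<in> W1 s \<Omega>. \<exists>\<phi>. (\<forall>n. \<phi> n \<in> test_functions \<Omega>) \<and>
     (\<lambda>n. W1_norm s \<Omega> (u - \<phi> n)) \<longlonglongrightarrow> 0}"

definition grad_norm :: "real \<Rightarrow> 'a::euclidean_space set \<Rightarrow> ('a \<Rightarrow> real) \<Rightarrow> real" where
  "grad_norm s \<Omega> u = (\<integral>x. norm (weak_grad \<Omega> u x) powr s \<partial>lebesgue_on \<Omega>) powr (1 / s)"

text \<open>The norm topology of \<open>W\<^sub>0\<^sup>1\<^sup>,\<^sup>s\<close>.  On representatives the norm is a seminorm that vanishes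
  exactly on the functions that are zero almost everywhere in \<open>\<Omega>\<close>.  Hence closed sets are
  saturated under equality almost everywhere, continuous maps into Hausdorff spaces respect it,
  and closedness and continuity mean the same as in the quotient space.\<close>

definition W10_topology :: "real \<Rightarrow> 'a::euclidean_space set \<Rightarrow> ('a \<Rightarrow> real) topology" where
  "W10_topology s \<Omega> = topology (\<lambda>U. U \<subseteq> W10 s \<Omega> \<and>
     (\<forall>u\<in>U. \<exists>e>0. \<forall>v\<in>W10 s \<Omega>. grad_norm s \<Omega> (v - u) < e \<longrightarrow> v \<in> U))"

lemma openin_W10_topology:
  "openin (W10_topology s \<Omega>) U \<longleftrightarrow> U \<subseteq> W10 s \<Omega> \<and>
     (\<forall>u\<in>U. \<exists>e>0. \<forall>v\<in>W10 s \<Omega>. grad_norm s \<Omega> (v - u) < e \<longrightarrow> v \<in> U)"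
proof -
  let ?P = "\<lambda>U. U \<subseteq> W10 s \<Omega> \<and>
     (\<forall>u\<in>U. \<exists>e>0. \<forall>v\<in>W10 s \<Omega>. grad_norm s \<Omega> (v - u) < e \<longrightarrow> v \<in> U)"
  have "istopology ?P"
    unfolding istopology_def
  proof (intro conjI allI impI)
    fix S T assume S: "?P S" and T: "?P T"
    show "S \<inter> T \<subseteq> W10 s \<Omega>" using S by blast
    show "\<forall>u\<in>S \<inter> T. \<exists>e>0. \<forall>v\<in>W10 s \<Omega>. grad_norm s \<Omega> (v - u) < e \<longrightarrow> v \<in> S \<inter> T"
    proof
      fix u assume u: "u \<in> S \<inter> T"
      obtain d where "d > 0" "\<forall>v\<in>W10 s \<Omega>. grad_norm s \<Omega> (v - u) < d \<longrightarrow> v \<in> S"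
        using S u by blast
      moreover obtain e where "e > 0" "\<forall>v\<in>W10 s \<Omega>. grad_norm s \<Omega> (v - u) < e \<longrightarrow> v \<in> T"
        using T u by blast
      ultimately show "\<exists>e>0. \<forall>v\<in>W10 s \<Omega>. grad_norm s \<Omega> (v - u) < e \<longrightarrow> v \<in> S \<inter> T"
        by (intro exI[of _ "min d e"]) auto
    qed
  next
    fix K assume K: "\<forall>S\<in>K. ?P S"
    show "\<Union>K \<subseteq> W10 s \<Omega>" using K by blast
    show "\<forall>u\<in>\<Union>K. \<exists>e>0. \<forall>v\<in>W10 s \<Omega>. grad_norm s \<Omega> (v - u) < e \<longrightarrow> v \<in> \<Union>K"
      using K by (meson UnionE UnionI)
  qed
  then show ?thesis
    unfolding W10_topology_def by (simp add: topology_inverse')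
qed

lemma topspace_W10_topology [simp]: "topspace (W10_topology s \<Omega>) = W10 s \<Omega>"
proof -
  have "openin (W10_topology s \<Omega>) (W10 s \<Omega>)"
    unfolding openin_W10_topology by (auto intro: exI[of _ 1])
  moreover have "U \<subseteq> W10 s \<Omega>" if "openin (W10_topology s \<Omega>) U" for U
    using that by (simp add: openin_W10_topology)
  ultimately show ?thesis
    by (auto simp: topspace_def)
qed

text \<open>Krasnoselskii genus of a symmetric set.  The infimum in \<^typ>\<open>enat\<close> of the empty set
  is \<open>\<infinity>\<close>.  The value \<open>m = 0\<close> is admitted, and is attained only by the empty set.\<close>

definition genus :: "'b::uminus topology \<Rightarrow> 'b set \<Rightarrow> enat" where
  "genus X A = Inf {enat m | m. \<exists>\<phi>.
     continuous_map (subtopology X A) (subtopology (Euclidean_space m) (- {\<lambda>_. 0})) \<phi> \<and>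
     (\<forall>x\<in>A. \<phi> (- x) = - \<phi> x)}"

definition D1 :: "real \<Rightarrow> 'a::euclidean_space set \<Rightarrow> ('a \<Rightarrow> real) set" where
  "D1 q \<Omega> = {u \<in> W10 q \<Omega>. (\<integral>x. \<bar>u x\<bar> powr q \<partial>lebesgue_on \<Omega>) = 1}"

definition Sigma_k :: "real \<Rightarrow> 'a::euclidean_space set \<Rightarrow> nat \<Rightarrow> ('a \<Rightarrow> real) set set" where
  "Sigma_k q \<Omega> k = {A. A \<subseteq> D1 q \<Omega> \<and> closedin (W10_topology q \<Omega>) A \<and>
     A = uminus ` A \<and> enat k \<le> genus (W10_topology q \<Omega>) A}"

text \<open>Extended reals, because the supremum over an unbounded \<open>A\<close> is \<open>\<infinity>\<close>.\<close>

definition dirichlet_eigenvalue :: "real \<Rightarrow> 'a::euclidean_space set \<Rightarrow> nat \<Rightarrow> ereal" where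
  "dirichlet_eigenvalue q \<Omega> k = (INF A\<in>Sigma_k q \<Omega> k. SUP u\<in>A.
     ereal (\<integral>x. norm (weak_grad \<Omega> u x) powr q \<partial>lebesgue_on \<Omega>))"

text \<open>The products below are \<open>0\<close> wherever the gradient, respectively \<open>u\<close>, vanishes, also for
  exponents less than \<open>2\<close>.\<close>

definition weak_solution ::
    "real \<Rightarrow> real \<Rightarrow> 'a::euclidean_space set \<Rightarrow> real \<Rightarrow> ('a \<Rightarrow> real) \<Rightarrow> bool" where
  "weak_solution p q \<Omega> l u \<longleftrightarrow> u \<in> W10 p \<Omega> \<and> (\<forall>v\<in>W10 p \<Omega>.
     (\<integral>x. norm (weak_grad \<Omega> u x) powr (p - 2) * (weak_grad \<Omega> u x \<bullet> weak_grad \<Omega> v x) \<partial>lebesgue_on \<Omega>) +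
     (\<integral>x. norm (weak_grad \<Omega> u x) powr (q - 2) * (weak_grad \<Omega> u x \<bullet> weak_grad \<Omega> v x) \<partial>lebesgue_on \<Omega>)
     = l * (\<integral>x. \<bar>u x\<bar> powr (q - 2) * u x * v x \<partial>lebesgue_on \<Omega>))"

text \<open>\<open>(l, 0)\<close> is a bifurcation point.\<close>

definition bifurcation_point :: "real \<Rightarrow> real \<Rightarrow> 'a::euclidean_space set \<Rightarrow> real \<Rightarrow> bool" where
  "bifurcation_point p q \<Omega> l \<longleftrightarrow> (\<exists>(\<mu> :: nat \<Rightarrow> real) (u :: nat \<Rightarrow> 'a \<Rightarrow> real).
     (\<forall>n. u n \<in> W10 p \<Omega> \<and> \<not> (AE x in lebesgue_on \<Omega>. u n x = 0) \<and>
          weak_solution p q \<Omega> (\<mu> n) (u n)) \<and>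
     \<mu> \<longlonglongrightarrow> l \<and> (\<lambda>n. grad_norm p \<Omega> (u n)) \<longlonglongrightarrow> 0)"

end

theory Submission
  imports Defs "HOL-Complex_Analysis.Great_Picard" "HOL-Homology.Simplices"
begin

text \<open>
  Put \<open>u = t w\<close> with \<open>t > 0\<close>. Then \<open>u\<close> solves (P) with parameter \<open>l\<close> exactly if \<open>w\<close> solves
  \<open>- e div(|grad w|^(p-2) grad w) - div(|grad w|^(q-2) grad w) = l |w|^(q-2) w\<close> with
  \<open>e = t^(p-q)\<close>. Since \<open>q < p\<close>, small \<open>t\<close> means small \<open>e\<close>, so bifurcation from zero is a
  perturbation question about the eigenvalue problem of the \<open>q\<close>-Laplacian: for a sequence \<open>e\<close> tending
  to \<open>0\<close> one looks for critical points \<open>w\<close> of \<open>e \<integral>|grad w|^p + \<integral>|grad w|^q\<close> on the unit sphere of \<open>L^q\<close>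
  whose levels tend to the minimax value; here \<open>e\<close> is rescaled by a constant. If moreover
  \<open>e \<integral>|grad w|^p\<close> tends to \<open>0\<close>, then the multipliers \<open>l\<close> tend to the same value, and the functions
  \<open>t w\<close> tend to \<open>0\<close> in the gradient norm of exponent \<open>p\<close> (\<open>rescaled_weak_solution\<close>, \<open>bifurcation_at_minimax_level\<close>).

  The minimax class lives in the space of exponent \<open>q\<close>, where the perturbed energy need not be finite.
  Hence critical points are not produced by a deformation along a flow but by an inverse iteration. For
  \<open>u\<close> on the sphere let \<open>T u\<close> be the normalised minimiser of the energy among all \<open>v\<close> with
  \<open>\<integral>|u|^(q-2) u v = 1\<close>. The minimiser has finite energy for every \<open>u\<close> in \<open>L^q\<close>; \<open>T\<close> is odd, does not
  increase the energy, and is continuous from \<open>L^q\<close> to the Sobolev space (\<open>stepE\<close>, \<open>step_minus\<close>,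
  \<open>step_tendsto\<close>); its fixed points are the critical points (\<open>euler_lagrange\<close>). An odd continuous map
  does not lower the genus, so all iterates of a symmetric set of genus at least \<open>k\<close> stay in the class
  over which the minimax value is formed (\<open>step_set_admissible\<close>), and each of them contains functions
  with energy at least almost the minimax value. On the other hand, starting from an almost optimal set,
  one step brings the energy down to slightly more than that value, uniformly for small \<open>e\<close>
  (\<open>uniform_bound_on_closure\<close>). So an orbit of length \<open>n\<close> loses in total a bounded amount of
  energy, hence at most a multiple of \<open>1/n\<close> in one of its steps (\<open>almost_fixed_point\<close>), and
  compactness turns these almost fixed points into a fixed point (\<open>fixed_point_exists\<close>). That the part
  \<open>e \<integral>|grad w|^p\<close> of the energy vanishes in the limit follows from semicontinuity: otherwise the limit of
  the \<open>w\<close> would be a function of too small \<open>q\<close>-energy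
  (\<open>critical_sequence_perturbation_vanishes\<close>).

  Two further ingredients are needed. The minimax value is finite because the normalised span of \<open>k\<close>
  functions with disjoint supports has genus at least \<open>k\<close> (\<open>Sigma_k_bounded_member\<close>); this is the
  Borsuk-Ulam theorem, which is derived from a descent over the dimension for singular chains
  (\<open>tower_reduce\<close>, \<open>borsuk_ulam\<close>). The analysis of the Sobolev spaces rests on one estimate for
  translates of test functions (\<open>translation_estimate\<close>), which gives the Poincare inequality and
  Rellich's theorem, and on the uniform convexity of \<open>s\<close>-th powers of norms, which replaces weak
  compactness in the existence of minimisers and in lower semicontinuity
  (\<open>midpoint_minimizing_sequence\<close>).
\<close>

section \<open>Inequalities for powers of norms\<close>

text \<open>The set on which \<open>f\<close> is not small on the unit sphere is compact and misses the zeros of \<open>g\<close>, so a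
  multiple of \<open>g\<close> dominates \<open>f\<close> there; homogeneity carries the estimate to the whole space. The
  moduli of continuity and of convexity for \<open>s\<close>-th powers are obtained from it by choosing \<open>f\<close> and \<open>g\<close>.\<close>

lemma homogeneous_comparison:
  fixes f g :: "'e::euclidean_space \<Rightarrow> real"
  assumes contf: "continuous_on UNIV f" and contg: "continuous_on UNIV g"
    and homf: "\<And>t x. 0 < t \<Longrightarrow> f (t *\<^sub>R x) = t powr s * f x"
    and homg: "\<And>t x. 0 < t \<Longrightarrow> g (t *\<^sub>R x) = t powr s * g x"
    and g_nonneg: "\<And>x. 0 \<le> g x" and zero: "\<And>x. g x = 0 \<Longrightarrow> f x \<le> 0" and f0: "f 0 \<le> 0"
    and \<eta>: "0 < \<eta>"
  obtains C where "0 \<le> C" "\<And>x. f x \<le> \<eta> * norm x powr s + C * g x"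
proof -
  let ?S = "sphere (0::'e) 1"
  define K where "K = {x \<in> ?S. \<eta> \<le> f x}"
  have "closed {x. \<eta> \<le> f x}"
    using contf by (intro closed_Collect_le) auto
  then have K: "compact K"
    unfolding K_def by (metis Collect_conj_eq compact_Int_closed compact_sphere Collect_mem_eq)
  have "\<exists>C\<ge>0. \<forall>x\<in>?S. f x \<le> \<eta> + C * g x"
  proof (cases "K = {}")
    case True
    then show ?thesis by (intro exI[of _ 0]) (force simp: K_def)
  next
    case False
    obtain a where a: "a \<in> K" "\<And>x. x \<in> K \<Longrightarrow> g a \<le> g x"
      using continuous_attains_inf[OF K False continuous_on_subset[OF contg]] by auto
    obtain b where b: "b \<in> K" "\<And>x. x \<in> K \<Longrightarrow> f x \<le> f b"
      using continuous_attains_sup[OF K False continuous_on_subset[OF contf]] by auto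
    have ga: "0 < g a" using a(1) zero[of a] g_nonneg[of a] \<eta> by (force simp: K_def)
    have fb: "0 < f b" using b(1) \<eta> by (auto simp: K_def)
    have "f x \<le> \<eta> + f b / g a * g x" if "x \<in> ?S" for x
    proof (cases "x \<in> K")
      case True
      have "f x \<le> f b / g a * g a" using b(2)[OF True] ga by simp
      also have "\<dots> \<le> f b / g a * g x" using a(2)[OF True] ga fb by (intro mult_left_mono) auto
      finally show ?thesis using \<eta> by linarith
    next
      case False
      moreover have "0 \<le> f b / g a * g x" using fb ga g_nonneg by auto
      ultimately show ?thesis using that unfolding K_def by force
    qed
    then show ?thesis using fb ga by (intro exI[of _ "f b / g a"]) auto
  qed
  then obtain C where C: "0 \<le> C" "\<And>x. x \<in> ?S \<Longrightarrow> f x \<le> \<eta> + C * g x" by blast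
  have "f x \<le> \<eta> * norm x powr s + C * g x" for x
  proof (cases "x = 0")
    case True
    then show ?thesis using f0 C(1) g_nonneg[of 0] by (smt (verit) \<eta> mult_nonneg_nonneg powr_ge_zero)
  next
    case False
    let ?t = "norm x" and ?y = "(1 / norm x) *\<^sub>R x"
    have x: "x = ?t *\<^sub>R ?y" using False by simp
    have "f x = ?t powr s * f ?y" "g x = ?t powr s * g ?y"
      using homf[of ?t ?y] homg[of ?t ?y] False by auto
    moreover have "f ?y \<le> \<eta> + C * g ?y" using False by (intro C(2)) auto
    then have "?t powr s * f ?y \<le> ?t powr s * (\<eta> + C * g ?y)" by (intro mult_left_mono) auto
    ultimately show ?thesis by (simp add: algebra_simps)
  qed
  then show ?thesis using that C(1) by blast
qed

lemma norm_Pair_powr_le: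
  fixes a :: "'e::real_normed_vector" and b :: "'f::real_normed_vector"
  assumes "0 < s"
  shows "norm (a, b) powr s \<le> 2 powr s * (norm a powr s + norm b powr s)"
proof -
  have "norm (a, b) \<le> 2 * max (norm a) (norm b)" using norm_Pair_le[of a b] by linarith
  then have "norm (a, b) powr s \<le> (2 * max (norm a) (norm b)) powr s"
    using assms by (intro powr_mono2) auto
  also have "\<dots> = 2 powr s * max (norm a) (norm b) powr s"
    by (subst powr_mult) (auto simp: le_max_iff_disj)
  also have "\<dots> \<le> 2 powr s * (norm a powr s + norm b powr s)"
    by (intro mult_left_mono) (auto simp: max_def)
  finally show ?thesis .
qed

text \<open>This crude inequality replaces Minkowski's inequality: all convergence statements are formulated with
  \<open>s\<close>-th powers of norms, for which a constant in the triangle inequality is harmless.\<close>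

lemma norm_add_powr_le:
  fixes a b :: "'e::real_normed_vector"
  assumes "0 < s"
  shows "norm (a + b) powr s \<le> 2 powr s * (norm a powr s + norm b powr s)"
proof -
  have "norm (a + b) \<le> 2 * max (norm a) (norm b)" using norm_triangle_ineq[of a b] by linarith
  then have "norm (a + b) powr s \<le> (2 * max (norm a) (norm b)) powr s"
    using assms by (intro powr_mono2) auto
  also have "\<dots> = 2 powr s * max (norm a) (norm b) powr s"
    by (subst powr_mult) (auto simp: le_max_iff_disj)
  also have "\<dots> \<le> 2 powr s * (norm a powr s + norm b powr s)"
    by (intro mult_left_mono) (auto simp: max_def)
  finally show ?thesis .
qed

lemma norm_diff_powr_le:
  fixes a b :: "'e::real_normed_vector"
  assumes "0 < s"
  shows "norm (a - b) powr s \<le> 2 powr s * (norm a powr s + norm b powr s)"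
  using norm_add_powr_le[OF assms, of a "-b"] by simp

lemma continuous_on_norm_powr [continuous_intros]:
  fixes f :: "'a::topological_space \<Rightarrow> 'e::real_normed_vector"
  assumes "continuous_on A f" "0 < s"
  shows "continuous_on A (\<lambda>x. norm (f x) powr s)"
  using assms by (intro continuous_on_powr') (auto intro!: continuous_intros)

lemma norm_scaleR_powr: "0 < t \<Longrightarrow> norm (t *\<^sub>R x) powr s = t powr s * norm x powr s"
  by (simp add: powr_mult)

lemma powr_diff_modulus:
  assumes s: "0 < s" and \<eta>: "0 < \<eta>"
  obtains C where "0 \<le> C" "\<And>a b :: 'e::euclidean_space.
    \<bar>norm a powr s - norm b powr s\<bar> \<le> \<eta> * (norm a powr s + norm b powr s) + C * norm (a - b) powr s"
proof -
  let ?f = "\<lambda>x::'e \<times> 'e. \<bar>norm (fst x) powr s - norm (snd x) powr s\<bar>"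
  let ?g = "\<lambda>x::'e \<times> 'e. norm (fst x - snd x) powr s"
  have hf: "?f (t *\<^sub>R x) = t powr s * ?f x" if "0 < t" for t x
  proof -
    have "?f (t *\<^sub>R x) = \<bar>t powr s * (norm (fst x) powr s - norm (snd x) powr s)\<bar>"
      using that by (simp add: powr_mult algebra_simps)
    then show ?thesis by (simp add: abs_mult)
  qed
  have hg: "?g (t *\<^sub>R x) = t powr s * ?g x" if "0 < t" for t x
    using that norm_scaleR_powr[OF that, of "fst x - snd x" s] by (simp add: scaleR_diff_right)
  obtain C where C: "0 \<le> C" "\<And>x. ?f x \<le> \<eta> / 2 powr s * norm x powr s + C * ?g x"
    by (rule homogeneous_comparison[of ?f ?g s "\<eta> / 2 powr s"])
      (use s \<eta> hf hg in \<open>auto intro!: continuous_intros simp del: fst_scaleR snd_scaleR\<close>)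
  show ?thesis
  proof (rule that[OF C(1)])
    fix a b :: 'e
    have "\<eta> / 2 powr s * norm (a, b) powr s \<le> \<eta> / 2 powr s * (2 powr s * (norm a powr s + norm b powr s))"
      using \<eta> by (intro mult_left_mono norm_Pair_powr_le s) auto
    then show "\<bar>norm a powr s - norm b powr s\<bar> \<le> \<eta> * (norm a powr s + norm b powr s) + C * norm (a - b) powr s"
      using C(2)[of "(a, b)"] by simp
  qed
qed

lemma powr_MVT:
  fixes x y s :: real
  assumes "0 \<le> x" "x < y" "1 < s"
  obtains z where "x < z" "z < y" "y powr s - x powr s = (y - x) * (s * z powr (s - 1))"
proof -
  have "\<exists>l z. x < z \<and> z < y \<and> ((\<lambda>t. t powr s) has_real_derivative l) (at z) \<and> y powr s - x powr s = (y - x) * l"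
  proof (rule MVT)
    show "continuous_on {x..y} (\<lambda>t. t powr s)"
      using assms by (intro continuous_on_powr') (auto intro!: continuous_intros)
    show "(\<lambda>t. t powr s) differentiable (at z)" if "x < z" "z < y" for z
      using that assms
      using has_real_derivative_powr[of z s] real_differentiable_def by auto
  qed (use assms in auto)
  then obtain l z where z: "x < z" "z < y" "((\<lambda>t. t powr s) has_real_derivative l) (at z)"
    "y powr s - x powr s = (y - x) * l" by blast
  have "((\<lambda>t. t powr s) has_real_derivative s * z powr (s - 1)) (at z)"
    using z(1) assms by (intro has_real_derivative_powr) auto
  then have "l = s * z powr (s - 1)" using z(3) DERIV_unique by blast
  then show ?thesis using z that by blast
qed

lemma powr_midpoint_strict:
  fixes x y s :: real
  assumes "0 \<le> x" "0 \<le> y" "x \<noteq> y" "1 < s"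
  shows "((x + y) / 2) powr s < (x powr s + y powr s) / 2"
proof -
  have *: "((x + y) / 2) powr s < (x powr s + y powr s) / 2" if xy: "0 \<le> x" "x < y" for x y :: real
  proof -
    let ?m = "(x + y) / 2"
    have m: "x < ?m" "?m < y" "0 \<le> ?m" using xy by auto
    obtain a where a: "x < a" "a < ?m" "?m powr s - x powr s = (?m - x) * (s * a powr (s - 1))"
      by (rule powr_MVT[OF xy(1) m(1) assms(4)])
    obtain b where b: "?m < b" "b < y" "y powr s - ?m powr s = (y - ?m) * (s * b powr (s - 1))"
      by (rule powr_MVT[OF m(3) m(2) assms(4)])
    have "a powr (s - 1) < b powr (s - 1)"
      using a b xy assms(4) by (intro powr_less_mono2) auto
    then have "(?m - x) * (s * a powr (s - 1)) < (?m - x) * (s * b powr (s - 1))"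
      using xy assms(4) by (intro mult_strict_left_mono) auto
    moreover have "?m - x = y - ?m" by (simp add: field_simps)
    then have "y powr s - ?m powr s = (?m - x) * (s * b powr (s - 1))" using b(3) by metis
    ultimately have "?m powr s - x powr s < y powr s - ?m powr s" using a(3) by metis
    moreover have "c < (a + b) / 2" if "c - a < b - c" for a b c :: real using that by (simp add: field_simps)
    ultimately show ?thesis by blast
  qed
  show ?thesis
    using *[of x y] *[of y x] assms by (cases "x < y") (auto simp: add.commute)
qed

lemma powr_midpoint_le:
  fixes x y s :: real
  assumes "0 \<le> x" "0 \<le> y" "1 < s"
  shows "((x + y) / 2) powr s \<le> (x powr s + y powr s) / 2"
  using powr_midpoint_strict[of x y s] assms by (cases "x = y") auto

text \<open>The defect vanishes only for \<open>a = b\<close> if \<open>s > 1\<close>, which is strict convexity; by homogeneity it is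
  then a quantitative measure of the distance.\<close>

definition midpoint_defect :: "real \<Rightarrow> 'e::real_normed_vector \<Rightarrow> 'e \<Rightarrow> real" where
  "midpoint_defect s a b = (norm a powr s + norm b powr s) / 2 - norm ((1/2) *\<^sub>R (a + b)) powr s"

lemma midpoint_defect_nonneg:
  assumes "1 < s" shows "0 \<le> midpoint_defect s a b"
proof -
  have "norm ((1/2) *\<^sub>R (a + b)) powr s \<le> ((norm a + norm b) / 2) powr s"
    using assms norm_triangle_ineq[of a b] by (intro powr_mono2) auto
  also have "\<dots> \<le> (norm a powr s + norm b powr s) / 2"
    using assms by (intro powr_midpoint_le) auto
  finally show ?thesis by (simp add: midpoint_defect_def)
qed

lemma midpoint_defect_eq_0D:
  fixes a b :: "'e::real_inner"
  assumes "1 < s" "midpoint_defect s a b = 0" shows "a = b"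
proof -
  have tri: "norm ((1/2) *\<^sub>R (a + b)) \<le> (norm a + norm b) / 2" using norm_triangle_ineq[of a b] by simp
  then have le: "norm ((1/2) *\<^sub>R (a + b)) powr s \<le> ((norm a + norm b) / 2) powr s"
    using assms by (intro powr_mono2) auto
  have eq: "norm a = norm b"
    using powr_midpoint_strict[of "norm a" "norm b" s] le assms by (auto simp: midpoint_defect_def)
  have "norm ((1/2) *\<^sub>R (a + b)) powr s = norm a powr s"
    using assms(2) eq by (simp add: midpoint_defect_def)
  then have "norm ((1/2) *\<^sub>R (a + b)) = norm a"
    using assms(1) powr_less_mono2[of s "norm ((1/2) *\<^sub>R (a + b))" "norm a"]
      powr_less_mono2[of s "norm a" "norm ((1/2) *\<^sub>R (a + b))"]
    by (cases "norm ((1/2) *\<^sub>R (a + b))" "norm a" rule: linorder_cases) auto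
  then have "norm (a + b) = norm a + norm b" using eq by simp
  then have "norm a *\<^sub>R b = norm b *\<^sub>R a" by (simp add: norm_triangle_eq)
  then show ?thesis using eq by (cases "norm a = 0") auto
qed

text \<open>\<open>homogeneous_comparison\<close> makes strict convexity quantitative without the case distinction
  between exponents above and below \<open>2\<close> of the Clarkson inequalities.\<close>

lemma uniform_convexity_modulus:
  assumes s: "1 < s" and \<eta>: "0 < \<eta>"
  obtains C where "0 \<le> C" "\<And>a b :: 'e::euclidean_space.
    norm (a - b) powr s \<le> \<eta> * (norm a powr s + norm b powr s) + C * midpoint_defect s a b"
proof -
  let ?f = "\<lambda>x::'e \<times> 'e. norm (fst x - snd x) powr s"
  let ?g = "\<lambda>x::'e \<times> 'e. midpoint_defect s (fst x) (snd x)"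
  have hf: "?f (t *\<^sub>R x) = t powr s * ?f x" if "0 < t" for t x
    using that norm_scaleR_powr[OF that, of "fst x - snd x" s] by (simp add: scaleR_diff_right)
  have hg: "?g (t *\<^sub>R x) = t powr s * ?g x" if "0 < t" for t x
  proof -
    have "(1/2) *\<^sub>R (t *\<^sub>R fst x + t *\<^sub>R snd x) = t *\<^sub>R ((1/2) *\<^sub>R (fst x + snd x))"
      by (simp add: algebra_simps)
    then show ?thesis
      unfolding midpoint_defect_def fst_scaleR snd_scaleR
      by (simp only: norm_scaleR_powr[OF that]) (simp add: algebra_simps)
  qed
  obtain C where C: "0 \<le> C" "\<And>x. ?f x \<le> \<eta> / 2 powr s * norm x powr s + C * ?g x"
  proof (rule homogeneous_comparison[of ?f ?g s "\<eta> / 2 powr s"])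
    show "?f x \<le> 0" if "?g x = 0" for x using midpoint_defect_eq_0D[OF s that] by simp
    show "continuous_on UNIV ?g" using s unfolding midpoint_defect_def by (intro continuous_intros) auto
  qed (use s \<eta> hf hg in \<open>auto intro!: continuous_intros midpoint_defect_nonneg simp del: fst_scaleR snd_scaleR\<close>)
  show ?thesis
  proof (rule that[OF C(1)])
    fix a b :: 'e
    have "\<eta> / 2 powr s * norm (a, b) powr s \<le> \<eta> / 2 powr s * (2 powr s * (norm a powr s + norm b powr s))"
      using \<eta> s by (intro mult_left_mono norm_Pair_powr_le) auto
    then show "norm (a - b) powr s \<le> \<eta> * (norm a powr s + norm b powr s) + C * midpoint_defect s a b"
      using C(2)[of "(a, b)"] by simp
  qed
qed

text \<open>The derivative of \<open>|a|^q / q\<close>.\<close>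

definition spow :: "real \<Rightarrow> real \<Rightarrow> real" where
  "spow q a = \<bar>a\<bar> powr (q - 2) * a"

lemma spow_sgn: "spow q a = \<bar>a\<bar> powr (q - 1) * sgn a"
proof (cases "a = 0")
  case False
  then have "\<bar>a\<bar> powr (q - 1) = \<bar>a\<bar> powr (q - 2) * \<bar>a\<bar>"
    using powr_add[of "\<bar>a\<bar>" "q - 2" 1] by simp
  then show ?thesis by (simp add: spow_def abs_mult_sgn mult.assoc)
qed (simp add: spow_def)

lemma spow_mult_self: "spow q a * a = \<bar>a\<bar> powr q"
proof (cases "a = 0")
  case False
  then have "\<bar>a\<bar> powr q = \<bar>a\<bar> powr (q - 1) * \<bar>a\<bar>" using powr_add[of "\<bar>a\<bar>" "q - 1" 1] by simp
  then show ?thesis by (simp add: spow_sgn mult.assoc sgn_mult_self_eq) (simp add: sgn_if)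
qed (simp add: spow_def)

lemma spow_minus [simp]: "spow q (- a) = - spow q a" by (simp add: spow_def)

lemma abs_spow: "\<bar>spow q a\<bar> = \<bar>a\<bar> powr (q - 1)"
  by (cases "a = 0") (auto simp: spow_sgn abs_mult abs_sgn_eq)

lemma spow_scale: "0 < t \<Longrightarrow> spow q (t * a) = t powr (q - 1) * spow q a"
  by (simp add: spow_sgn abs_mult powr_mult sgn_mult)

lemma continuous_on_spow: assumes "1 < q" shows "continuous_on UNIV (spow q)"
proof -
  have eq: "spow q a = max a 0 powr (q - 1) - max (- a) 0 powr (q - 1)" for a
    using assms by (auto simp: spow_sgn max_def sgn_if)
  show ?thesis
    unfolding eq using assms by (intro continuous_intros continuous_on_powr') auto
qed

text \<open>Young's inequality for the conjugate exponents \<open>s\<close> and \<open>s / (s - 1)\<close>, in the form in which one factor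
  is already a power.\<close>

lemma young_powr:
  fixes x m s :: real
  assumes "0 \<le> x" "0 \<le> m" "1 < s"
  shows "m powr (s - 1) * x \<le> x powr s / s + (1 - 1 / s) * m powr s"
proof -
  have "x * m powr (s - 1) \<le> x powr s / s + (m powr (s - 1)) powr (s / (s - 1)) / (s / (s - 1))"
    using assms by (intro Youngs_inequality) (auto simp: field_simps)
  also have "(m powr (s - 1)) powr (s / (s - 1)) = m powr s" using assms by (simp add: powr_powr)
  finally show ?thesis using assms by (simp add: field_simps)
qed

lemma spow_young:
  assumes "1 < q" shows "\<bar>spow q a * c\<bar> \<le> \<bar>c\<bar> powr q / q + (1 - 1 / q) * \<bar>a\<bar> powr q"
  using young_powr[of "\<bar>c\<bar>" "\<bar>a\<bar>" q] assms by (simp add: abs_mult abs_spow)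

lemma spow_pairing_modulus:
  assumes q: "1 < q" and \<eta>: "0 < \<eta>"
  obtains C where "0 \<le> C" "\<And>a b c d :: real.
    \<bar>spow q a * c - spow q b * d\<bar> \<le> \<eta> * (\<bar>a\<bar> powr q + \<bar>b\<bar> powr q + \<bar>c\<bar> powr q + \<bar>d\<bar> powr q)
      + C * (\<bar>a - b\<bar> powr q + \<bar>c - d\<bar> powr q)"
proof -
  let ?f = "\<lambda>x::(real \<times> real) \<times> (real \<times> real).
    \<bar>spow q (fst (fst x)) * fst (snd x) - spow q (snd (fst x)) * snd (snd x)\<bar>"
  let ?g = "\<lambda>x::(real \<times> real) \<times> (real \<times> real).
    \<bar>fst (fst x) - snd (fst x)\<bar> powr q + \<bar>fst (snd x) - snd (snd x)\<bar> powr q"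
  have hf: "?f (t *\<^sub>R x) = t powr q * ?f x" if "0 < t" for t x
  proof -
    have "t powr q = t powr (q - 1) * t" using that powr_add[of t "q - 1" 1] by simp
    then have "?f (t *\<^sub>R x) = \<bar>t powr q * (spow q (fst (fst x)) * fst (snd x) - spow q (snd (fst x)) * snd (snd x))\<bar>"
      using that by (simp add: spow_scale algebra_simps)
    then show ?thesis by (simp add: abs_mult)
  qed
  have hg: "?g (t *\<^sub>R x) = t powr q * ?g x" if "0 < t" for t x
  proof -
    have *: "\<bar>t * u - t * v\<bar> powr q = t powr q * \<bar>u - v\<bar> powr q" for u v
      unfolding right_diff_distrib[symmetric] using that by (simp add: abs_mult powr_mult)
    show ?thesis by (simp only: fst_scaleR snd_scaleR real_scaleR_def * distrib_left)
  qed
  have cs: "continuous_on UNIV (\<lambda>x. spow q (h x))" if "continuous_on UNIV h" for h :: "(real \<times> real) \<times> (real \<times> real) \<Rightarrow> real"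
    using continuous_on_compose2[OF continuous_on_spow[OF q] that] by simp
  let ?\<eta> = "\<eta> / (2 powr q * 2 powr q)"
  obtain C where C: "0 \<le> C" "\<And>x. ?f x \<le> ?\<eta> * norm x powr q + C * ?g x"
  proof (rule homogeneous_comparison[of ?f ?g q ?\<eta>])
    show "continuous_on UNIV ?f" by (intro continuous_intros cs)
    have *: "continuous_on UNIV (\<lambda>x. \<bar>h x\<bar> powr q)" if "continuous_on UNIV h" for h :: "(real \<times> real) \<times> (real \<times> real) \<Rightarrow> real"
      using continuous_on_norm_powr[OF that] q by simp
    show "continuous_on UNIV ?g" using q by (intro continuous_intros *)
    show "?f x \<le> 0" if "?g x = 0" for x
      using that by (simp add: add_nonneg_eq_0_iff)
  qed (use q \<eta> hf hg in \<open>auto simp del: fst_scaleR snd_scaleR\<close>)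
  show ?thesis
  proof (rule that[OF C(1)])
    fix a b c d :: real
    have q0: "0 < q" using q by simp
    have "norm ((a, b), (c, d)) powr q \<le> 2 powr q * (norm (a, b) powr q + norm (c, d) powr q)"
      by (rule norm_Pair_powr_le[OF q0])
    also have "\<dots> \<le> 2 powr q * (2 powr q * (norm a powr q + norm b powr q) + 2 powr q * (norm c powr q + norm d powr q))"
      by (intro mult_left_mono add_mono norm_Pair_powr_le[OF q0]) auto
    finally have "?\<eta> * norm ((a, b), (c, d)) powr q \<le> ?\<eta> * (2 powr q * 2 powr q * (norm a powr q + norm b powr q + norm c powr q + norm d powr q))"
      using \<eta> by (intro mult_left_mono) (auto simp: algebra_simps)
    then show "\<bar>spow q a * c - spow q b * d\<bar> \<le> \<eta> * (\<bar>a\<bar> powr q + \<bar>b\<bar> powr q + \<bar>c\<bar> powr q + \<bar>d\<bar> powr q)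
      + C * (\<bar>a - b\<bar> powr q + \<bar>c - d\<bar> powr q)"
      using C(2)[of "((a, b), (c, d))"] by simp
  qed
qed

section \<open>Integrals of powers on a bounded domain\<close>

locale bounded_domain =
  fixes \<Omega> :: "'a::euclidean_space set"
  assumes open_dom: "open \<Omega>" and bounded_dom: "bounded \<Omega>"
begin

abbreviation "M \<equiv> lebesgue_on \<Omega>"

lemma sets_dom [measurable, simp]: "\<Omega> \<in> sets lebesgue"
  using open_dom by (simp add: borel_open sets_completionI_sets)

lemma finite_measure_M: "finite_measure M"
proof
  show "emeasure M (space M) \<noteq> \<infinity>"
    using fmeasurableD2[OF lmeasurable_open[OF bounded_dom open_dom]]
    by (simp add: emeasure_restrict_space space_restrict_space)
qed

lemma complete_measure_M: "complete_measure M"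
proof
  fix A B assume "B \<subseteq> A" "A \<in> null_sets M"
  then have "A \<subseteq> \<Omega>" "A \<in> null_sets lebesgue" "B \<subseteq> A" by (auto simp: null_sets_restrict_space)
  then have "B \<in> null_sets lebesgue" "B \<subseteq> \<Omega>" using completion.complete2 by blast+
  then show "B \<in> sets M" by (auto simp: sets_restrict_space_iff)
qed

lemma integrable_const_M [simp, intro]: "integrable M (\<lambda>x. c :: 'b::{banach, second_countable_topology})"
  using finite_measure.integrable_const[OF finite_measure_M] .

text \<open>The \<open>s\<close>-th power of the norm of \<open>L^s\<close>. Working with powers keeps energies additive and homogeneous.\<close>

definition powint :: "real \<Rightarrow> ('a \<Rightarrow> 'b::real_normed_vector) \<Rightarrow> real" where
  "powint s f = (\<integral>x. norm (f x) powr s \<partial>M)"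

definition defect_int :: "real \<Rightarrow> ('a \<Rightarrow> 'b::real_normed_vector) \<Rightarrow> ('a \<Rightarrow> 'b) \<Rightarrow> real" where
  "defect_int s f g = (powint s f + powint s g) / 2 - powint s (\<lambda>x. (1/2) *\<^sub>R (f x + g x))"

lemma LpD:
  assumes "f \<in> Lp s \<Omega>"
  shows "f \<in> borel_measurable M" "integrable M (\<lambda>x. norm (f x) powr s)"
  using assms by (auto simp: Lp_def)

lemma LpI:
  "f \<in> borel_measurable M \<Longrightarrow> integrable M (\<lambda>x. norm (f x) powr s) \<Longrightarrow> f \<in> Lp s \<Omega>"
  by (auto simp: Lp_def)

lemma Lp_dominated:
  fixes f :: "'a \<Rightarrow> 'b::euclidean_space"
  assumes "f \<in> borel_measurable M" "integrable M h" "AE x in M. norm (f x) powr s \<le> h x"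
  shows "f \<in> Lp s \<Omega>"
proof (rule LpI[OF assms(1)])
  show "integrable M (\<lambda>x. norm (f x) powr s)"
  proof (rule Bochner_Integration.integrable_bound[OF assms(2)])
    show "AE x in M. norm (norm (f x) powr s) \<le> norm (h x)"
      using assms(3) by eventually_elim auto
  qed (use assms(1) in measurable)
qed

lemma powint_nonneg [simp]: "0 \<le> powint s f"
  unfolding powint_def by (intro integral_nonneg_AE) auto

lemma Lp_add:
  assumes "f \<in> Lp s \<Omega>" "g \<in> Lp s \<Omega>" "0 < s"
  shows "(\<lambda>x. f x + g x) \<in> Lp s \<Omega>"
  using LpD[OF assms(1)] LpD[OF assms(2)]
  by (intro Lp_dominated[where h="\<lambda>x. 2 powr s * (norm (f x) powr s + norm (g x) powr s)"])
    (auto intro!: norm_add_powr_le assms(3))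

lemma powint_add_le:
  assumes "f \<in> Lp s \<Omega>" "g \<in> Lp s \<Omega>" "0 < s"
  shows "powint s (\<lambda>x. f x + g x) \<le> 2 powr s * (powint s f + powint s g)"
proof -
  have "powint s (\<lambda>x. f x + g x) \<le> (\<integral>x. 2 powr s * (norm (f x) powr s + norm (g x) powr s) \<partial>M)"
    unfolding powint_def using LpD[OF assms(1)] LpD[OF assms(2)] LpD[OF Lp_add[OF assms]]
    by (intro integral_mono) (auto intro!: norm_add_powr_le assms(3))
  also have "\<dots> = 2 powr s * (powint s f + powint s g)"
    unfolding powint_def using LpD[OF assms(1)] LpD[OF assms(2)] by simp
  finally show ?thesis .
qed

lemma Lp_scaleR:
  assumes "f \<in> Lp s \<Omega>" shows "(\<lambda>x. c *\<^sub>R f x) \<in> Lp s \<Omega>"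
  using LpD[OF assms] by (intro LpI) (auto simp: powr_mult)

lemma powint_scaleR: "powint s (\<lambda>x. c *\<^sub>R f x) = \<bar>c\<bar> powr s * powint s f"
  unfolding powint_def by (simp add: powr_mult)

lemma powint_mult: "powint s (\<lambda>x. c * f x :: real) = \<bar>c\<bar> powr s * powint s f"
  using powint_scaleR[of s c f] by simp

lemma Lp_mult: "f \<in> Lp s \<Omega> \<Longrightarrow> (\<lambda>x. c * f x :: real) \<in> Lp s \<Omega>"
  using Lp_scaleR[of f s c] by simp

lemma Lp_minus: "f \<in> Lp s \<Omega> \<Longrightarrow> (\<lambda>x. - f x) \<in> Lp s \<Omega>"
  using Lp_scaleR[of f s "-1"] by simp

lemma powint_minus [simp]: "powint s (\<lambda>x. - f x) = powint s f"
  by (simp add: powint_def)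

lemma powint_minus_commute: "powint s (\<lambda>x. f x - g x) = powint s (\<lambda>x. g x - f x)"
  by (simp add: powint_def norm_minus_commute)

lemma Lp_diff:
  assumes "f \<in> Lp s \<Omega>" "g \<in> Lp s \<Omega>" "0 < s"
  shows "(\<lambda>x. f x - g x) \<in> Lp s \<Omega>"
  using Lp_add[OF assms(1) Lp_minus[OF assms(2)] assms(3)] by simp

lemma powint_diff_le:
  assumes "f \<in> Lp s \<Omega>" "g \<in> Lp s \<Omega>" "0 < s"
  shows "powint s (\<lambda>x. f x - g x) \<le> 2 powr s * (powint s f + powint s g)"
  using powint_add_le[OF assms(1) Lp_minus[OF assms(2)] assms(3)] by simp

lemma powint_triangle:
  assumes "f \<in> Lp s \<Omega>" "g \<in> Lp s \<Omega>" "h \<in> Lp s \<Omega>" "0 < s"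
  shows "powint s (\<lambda>x. f x - h x) \<le> 2 powr s * (powint s (\<lambda>x. f x - g x) + powint s (\<lambda>x. g x - h x))"
  using powint_add_le[OF Lp_diff[OF assms(1,2,4)] Lp_diff[OF assms(2,3,4)] assms(4)] by simp

lemma powint_zero [simp]: "powint s (\<lambda>x. 0) = 0"
  by (simp add: powint_def)

lemma Lp_cong_AE:
  fixes f g :: "'a \<Rightarrow> 'b::euclidean_space"
  assumes "f \<in> Lp s \<Omega>" "AE x in M. f x = g x"
  shows "g \<in> Lp s \<Omega>"
proof -
  have "g \<in> borel_measurable M"
  proof (rule measurableI)
    fix A :: "'b set" assume A: "A \<in> sets borel"
    have 1: "f -` A \<inter> space M \<in> sets M" using LpD(1)[OF assms(1)] A by (rule measurable_sets)
    have 2: "AE x in M. x \<in> f -` A \<inter> space M \<longleftrightarrow> x \<in> g -` A \<inter> space M"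
      using assms(2) by eventually_elim auto
    show "g -` A \<inter> space M \<in> sets M"
      by (rule complete_measure.in_sets_AE[OF complete_measure_M 2 1]) (rule Int_lower2)
  qed simp
  then show ?thesis
    using assms(2) by (intro Lp_dominated[OF _ LpD(2)[OF assms(1)]]) (auto elim!: eventually_mono)
qed

lemma powint_cong_AE:
  fixes f g :: "'a \<Rightarrow> 'b::euclidean_space"
  assumes "f \<in> borel_measurable M" "g \<in> borel_measurable M" "AE x in M. f x = g x"
  shows "powint s f = powint s g"
  unfolding powint_def using assms(3) assms(1,2) by (intro integral_cong_AE) (auto elim!: eventually_mono)

lemma powint_eq_0D:
  assumes "f \<in> Lp s \<Omega>" "powint s f = 0"
  shows "AE x in M. f x = 0"
proof -
  have "AE x in M. norm (f x) powr s = 0"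
    using assms integral_nonneg_eq_0_iff_AE[OF LpD(2)[OF assms(1)]] by (simp add: powint_def)
  then show ?thesis by eventually_elim auto
qed

lemma defect_int_eq:
  assumes "f \<in> Lp s \<Omega>" "g \<in> Lp s \<Omega>" "0 < s"
  shows "defect_int s f g = (\<integral>x. midpoint_defect s (f x) (g x) \<partial>M)"
    and "integrable M (\<lambda>x. midpoint_defect s (f x) (g x))"
proof -
  have i: "integrable M (\<lambda>x. norm ((1/2) *\<^sub>R (f x + g x)) powr s)"
    by (rule LpD(2)[OF Lp_scaleR[OF Lp_add[OF assms]]])
  show "defect_int s f g = (\<integral>x. midpoint_defect s (f x) (g x) \<partial>M)"
    "integrable M (\<lambda>x. midpoint_defect s (f x) (g x))"
    using LpD(2)[OF assms(1)] LpD(2)[OF assms(2)] i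
    unfolding defect_int_def powint_def midpoint_defect_def
    by (simp_all del: norm_scaleR)
qed

lemma defect_int_nonneg:
  assumes "f \<in> Lp s \<Omega>" "g \<in> Lp s \<Omega>" "1 < s"
  shows "0 \<le> defect_int s f g"
  using defect_int_eq(1)[OF assms(1,2)] assms(3)
  by (simp add: midpoint_defect_nonneg integral_nonneg_AE)

text \<open>Uniformity on bounded sets is what makes limits of sequences that are only known to be bounded
  tractable.\<close>

lemma powint_continuity_modulus:
  assumes s: "0 < s" and e: "0 < e"
  obtains d where "0 < d" "\<And>f g :: 'a \<Rightarrow> 'b::euclidean_space. f \<in> Lp s \<Omega> \<Longrightarrow> g \<in> Lp s \<Omega> \<Longrightarrow>
    powint s f \<le> B \<Longrightarrow> powint s g \<le> B \<Longrightarrow> powint s (\<lambda>x. f x - g x) < d \<Longrightarrow> \<bar>powint s f - powint s g\<bar> < e"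
proof -
  let ?\<eta> = "e / (4 * (\<bar>B\<bar> + 1))"
  have \<eta>: "0 < ?\<eta>" using e by (intro divide_pos_pos) auto
  obtain C where C: "0 \<le> C" "\<And>a b :: 'b. \<bar>norm a powr s - norm b powr s\<bar>
      \<le> ?\<eta> * (norm a powr s + norm b powr s) + C * norm (a - b) powr s"
    by (rule powr_diff_modulus[OF s \<eta>]) blast
  show ?thesis
  proof (rule that[of "e / (2 * (C + 1))"])
    show "0 < e / (2 * (C + 1))" using C(1) e by (intro divide_pos_pos mult_pos_pos) auto
    fix f g :: "'a \<Rightarrow> 'b" assume f: "f \<in> Lp s \<Omega>" and g: "g \<in> Lp s \<Omega>"
      and B: "powint s f \<le> B" "powint s g \<le> B" and d: "powint s (\<lambda>x. f x - g x) < e / (2 * (C + 1))"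
    note i = LpD(2)[OF f] LpD(2)[OF g] LpD(2)[OF Lp_diff[OF f g s]]
    have "\<bar>powint s f - powint s g\<bar> = \<bar>\<integral>x. norm (f x) powr s - norm (g x) powr s \<partial>M\<bar>"
      unfolding powint_def using i by simp
    also have "\<dots> \<le> (\<integral>x. \<bar>norm (f x) powr s - norm (g x) powr s\<bar> \<partial>M)"
      by (rule integral_abs_bound)
    also have "\<dots> \<le> (\<integral>x. ?\<eta> * (norm (f x) powr s + norm (g x) powr s) + C * norm (f x - g x) powr s \<partial>M)"
      using i by (intro integral_mono C(2)) auto
    also have "\<dots> = ?\<eta> * (powint s f + powint s g) + C * powint s (\<lambda>x. f x - g x)"
      unfolding powint_def using i by simp
    also have "\<dots> < e"
    proof -
      have "?\<eta> * (powint s f + powint s g) \<le> ?\<eta> * (2 * (\<bar>B\<bar> + 1))" using B e by (intro mult_left_mono) auto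
      also have "\<dots> = e / 2" by (simp add: field_simps)
      finally have 1: "?\<eta> * (powint s f + powint s g) \<le> e / 2" .
      have "C * powint s (\<lambda>x. f x - g x) \<le> C * (e / (2 * (C + 1)))" using d C(1) by (intro mult_left_mono) auto
      also have "\<dots> < e / 2" using C(1) e by (simp add: field_simps)
      finally show ?thesis using 1 by linarith
    qed
    finally show "\<bar>powint s f - powint s g\<bar> < e" .
  qed
qed

text \<open>Uniform convexity of \<open>L^s\<close>: in a bounded set, functions whose midpoint has almost the mean energy are
  close to each other.\<close>

lemma uniform_convexity_powint:
  assumes s: "1 < s" and e: "0 < e"
  obtains d where "0 < d" "\<And>f g :: 'a \<Rightarrow> 'b::euclidean_space. f \<in> Lp s \<Omega> \<Longrightarrow> g \<in> Lp s \<Omega> \<Longrightarrow>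
    powint s f \<le> B \<Longrightarrow> powint s g \<le> B \<Longrightarrow> defect_int s f g < d \<Longrightarrow> powint s (\<lambda>x. f x - g x) < e"
proof -
  let ?\<eta> = "e / (4 * (\<bar>B\<bar> + 1))"
  have \<eta>: "0 < ?\<eta>" using e by (intro divide_pos_pos) auto
  obtain C where C: "0 \<le> C" "\<And>a b :: 'b. norm (a - b) powr s
      \<le> ?\<eta> * (norm a powr s + norm b powr s) + C * midpoint_defect s a b"
    by (rule uniform_convexity_modulus[OF s \<eta>]) blast
  have s0: "0 < s" using s by simp
  show ?thesis
  proof (rule that[of "e / (2 * (C + 1))"])
    show "0 < e / (2 * (C + 1))" using C(1) e by (intro divide_pos_pos mult_pos_pos) auto
    fix f g :: "'a \<Rightarrow> 'b" assume f: "f \<in> Lp s \<Omega>" and g: "g \<in> Lp s \<Omega>"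
      and B: "powint s f \<le> B" "powint s g \<le> B" and d: "defect_int s f g < e / (2 * (C + 1))"
    note i = LpD(2)[OF f] LpD(2)[OF g] LpD(2)[OF Lp_diff[OF f g s0]] defect_int_eq(2)[OF f g s0]
    have "powint s (\<lambda>x. f x - g x)
      \<le> (\<integral>x. ?\<eta> * (norm (f x) powr s + norm (g x) powr s) + C * midpoint_defect s (f x) (g x) \<partial>M)"
      unfolding powint_def using i by (intro integral_mono C(2)) auto
    also have "\<dots> = ?\<eta> * (powint s f + powint s g) + C * defect_int s f g"
      unfolding powint_def defect_int_eq(1)[OF f g s0] using i by simp
    also have "\<dots> < e"
    proof -
      have "?\<eta> * (powint s f + powint s g) \<le> ?\<eta> * (2 * (\<bar>B\<bar> + 1))" using B e by (intro mult_left_mono) auto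
      also have "\<dots> = e / 2" by (simp add: field_simps)
      finally have 1: "?\<eta> * (powint s f + powint s g) \<le> e / 2" .
      have "C * defect_int s f g \<le> C * (e / (2 * (C + 1)))" using d C(1) by (intro mult_left_mono) auto
      also have "\<dots> < e / 2" using C(1) e by (simp add: field_simps)
      finally show ?thesis using 1 by linarith
    qed
    finally show "powint s (\<lambda>x. f x - g x) < e" .
  qed
qed

lemma powint_le_of_nn_integral:
  fixes f :: "'a \<Rightarrow> 'b::euclidean_space"
  assumes "f \<in> borel_measurable M" "(\<integral>\<^sup>+x. ennreal (norm (f x) powr s) \<partial>M) \<le> ennreal e" "0 \<le> e"
  shows "f \<in> Lp s \<Omega>" "powint s f \<le> e"
proof -
  have i: "integrable M (\<lambda>x. norm (f x) powr s)"
    using assms by (intro integrableI_bounded) (auto simp: le_less_trans[OF assms(2)])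
  then show "f \<in> Lp s \<Omega>" by (rule LpI[OF assms(1)])
  show "powint s f \<le> e"
    using assms(2,3) nn_integral_eq_integral[OF i] unfolding powint_def by simp
qed

lemma nn_integral_powint:
  assumes "f \<in> Lp s \<Omega>" shows "(\<integral>\<^sup>+x. ennreal (norm (f x) powr s) \<partial>M) = ennreal (powint s f)"
  unfolding powint_def using LpD(2)[OF assms] by (intro nn_integral_eq_integral) auto

text \<open>The embedding of \<open>L^s\<close> into \<open>L^r\<close> on a set of finite measure, as continuity at zero.\<close>

lemma powint_lower_exponent:
  assumes r: "0 < r" "r \<le> s" and e: "0 < e"
  obtains d where "0 < d" "\<And>f :: 'a \<Rightarrow> 'b::euclidean_space. f \<in> Lp s \<Omega> \<Longrightarrow> f \<in> Lp r \<Omega>"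
    "\<And>f :: 'a \<Rightarrow> 'b::euclidean_space. f \<in> Lp s \<Omega> \<Longrightarrow> powint s f < d \<Longrightarrow> powint r f < e"
proof -
  let ?m = "measure M \<Omega>"
  define \<eta> where "\<eta> = e / (2 * (?m + 1))"
  \<comment> \<open>Where \<open>t powr r\<close> is not at most \<open>\<eta>\<close>, it is at most \<open>C * t powr s\<close>.\<close>
  define C where "C = \<eta> powr ((r - s) / r)"
  have \<eta>: "0 < \<eta>" using e by (simp add: \<eta>_def add_nonneg_pos)
  have le: "t powr r \<le> \<eta> + C * t powr s" if "0 \<le> t" for t
  proof (cases "t powr r \<le> \<eta>")
    case True
    then show ?thesis using \<eta> by (simp add: C_def add_increasing2)
  next
    case False
    then have t: "0 < t" using that \<eta> r by (cases "t = 0") auto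
    have "t powr r = (t powr r) powr ((r - s) / r) * t powr s"
      using t r by (simp add: powr_powr flip: powr_add)
    also have "\<dots> \<le> C * t powr s"
      unfolding C_def using False \<eta> r by (intro mult_right_mono powr_mono2') (auto simp: divide_nonpos_pos)
    finally show ?thesis using \<eta> by linarith
  qed
  have mem: "f \<in> Lp r \<Omega>" if "f \<in> Lp s \<Omega>" for f :: "'a \<Rightarrow> 'b"
    using LpD[OF that] le by (intro Lp_dominated[where h="\<lambda>x. \<eta> + C * norm (f x) powr s"]) auto
  show ?thesis
  proof (rule that[of "e / (2 * (C + 1))"])
    show "0 < e / (2 * (C + 1))" using e by (simp add: C_def add_nonneg_pos)
    fix f :: "'a \<Rightarrow> 'b" assume f: "f \<in> Lp s \<Omega>"
    show "f \<in> Lp r \<Omega>" by (rule mem[OF f])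
    assume d: "powint s f < e / (2 * (C + 1))"
    have "powint r f \<le> (\<integral>x. \<eta> + C * norm (f x) powr s \<partial>M)"
      unfolding powint_def using LpD(2)[OF mem[OF f]] LpD(2)[OF f] le by (intro integral_mono) auto
    also have "\<dots> = \<eta> * ?m + C * powint s f"
      unfolding powint_def using LpD(2)[OF f] by (simp add: mult.commute)
    also have "\<dots> < e"
    proof -
      have "\<eta> * ?m \<le> \<eta> * (?m + 1)" using \<eta> by (intro mult_left_mono) auto
      also have "\<dots> = e / 2" by (simp add: \<eta>_def field_simps add_nonneg_eq_0_iff)
      finally have 1: "\<eta> * ?m \<le> e / 2" .
      have C0: "0 < C" using \<eta> by (simp add: C_def)
      have "C * powint s f \<le> C * (e / (2 * (C + 1)))" using d C0 by (intro mult_left_mono) auto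
      also have "\<dots> < e / 2" using C0 e by (simp add: field_simps)
      finally show ?thesis using 1 by linarith
    qed
    finally show "powint r f < e" .
  qed
qed

lemma Lp_lower_exponent:
  fixes f :: "'a \<Rightarrow> 'b::euclidean_space"
  assumes "f \<in> Lp s \<Omega>" "0 < r" "r \<le> s" shows "f \<in> Lp r \<Omega>"
  by (rule powint_lower_exponent[OF assms(2,3) zero_less_one]) (use assms(1) in blast)

lemma powint_tendsto_lower_exponent:
  fixes f :: "nat \<Rightarrow> 'a \<Rightarrow> 'b::euclidean_space"
  assumes "\<And>n. f n \<in> Lp s \<Omega>" "0 < r" "r \<le> s" "(\<lambda>n. powint s (f n)) \<longlonglongrightarrow> 0"
  shows "(\<lambda>n. powint r (f n)) \<longlonglongrightarrow> 0"
proof (rule LIMSEQ_I)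
  fix e :: real assume "0 < e"
  obtain d where d: "0 < d" "\<And>f :: 'a \<Rightarrow> 'b. f \<in> Lp s \<Omega> \<Longrightarrow> powint s f < d \<Longrightarrow> powint r f < e"
    by (rule powint_lower_exponent[OF assms(2,3) \<open>0 < e\<close>]) blast
  obtain N where "\<And>n. N \<le> n \<Longrightarrow> norm (powint s (f n) - 0) < d"
    using LIMSEQ_D[OF assms(4) d(1)] by blast
  then have "norm (powint r (f n) - 0) < e" if "N \<le> n" for n
    using d(2)[OF assms(1), of n] that by simp
  then show "\<exists>N. \<forall>n\<ge>N. norm (powint r (f n) - 0) < e" by blast
qed

text \<open>A Cauchy sequence for the exponent \<open>s\<close> is one for the exponent \<open>1\<close>, so a subsequence converges almost
  everywhere, and Fatou's lemma identifies the limit for the exponent \<open>s\<close>.\<close>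

lemma Lp_complete:
  fixes F :: "nat \<Rightarrow> 'a \<Rightarrow> 'b::euclidean_space"
  assumes F: "\<And>n. F n \<in> Lp s \<Omega>" and s: "1 \<le> s"
    and cauchy: "\<And>e. 0 < e \<Longrightarrow> \<exists>N. \<forall>i\<ge>N. \<forall>j\<ge>N. powint s (\<lambda>x. F i x - F j x) < e"
  obtains f where "f \<in> Lp s \<Omega>" "(\<lambda>n. powint s (\<lambda>x. F n x - f x)) \<longlonglongrightarrow> 0"
proof -
  have s0: "0 < s" using s by simp
  have int: "integrable M (F n)" for n
    using LpD[OF Lp_lower_exponent[OF F[of n] zero_less_one s]]
    by (simp add: integrable_norm_iff)
  have c: "\<exists>N. \<forall>i\<ge>N. \<forall>j\<ge>N. (\<integral>x. norm (F i x - F j x) \<partial>M) < e" if e: "0 < e" for e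
  proof -
    obtain d where d: "0 < d" "\<And>f :: 'a \<Rightarrow> 'b. f \<in> Lp s \<Omega> \<Longrightarrow> powint s f < d \<Longrightarrow> powint 1 f < e"
      by (rule powint_lower_exponent[OF zero_less_one s e]) blast
    obtain N where N: "\<And>i j. N \<le> i \<Longrightarrow> N \<le> j \<Longrightarrow> powint s (\<lambda>x. F i x - F j x) < d"
      using cauchy[OF d(1)] by blast
    have "(\<integral>x. norm (F i x - F j x) \<partial>M) < e" if "N \<le> i" "N \<le> j" for i j
      using d(2)[OF Lp_diff[OF F F s0] N[OF that]] by (simp add: powint_def)
    then show ?thesis by blast
  qed
  obtain r where r: "strict_mono r" "AE x in M. Cauchy (\<lambda>i. F (r i) x)"
    by (rule cauchy_L1_AE_cauchy_subseq[OF int c])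
  define f where "f x = lim (\<lambda>i. F (r i) x)" for x
  have f: "f \<in> borel_measurable M"
    unfolding f_def[abs_def] by (rule borel_measurable_lim_metric) (rule LpD(1)[OF F])
  have meas: "(\<lambda>x. ennreal (norm (F i x - F j x) powr s)) \<in> borel_measurable M" for i j
    using LpD(1)[OF F[of i]] LpD(1)[OF F[of j]] by measurable
  have AE: "AE x in M. (\<lambda>i. F (r i) x) \<longlonglongrightarrow> f x"
    using r(2) by eventually_elim (auto simp: f_def Cauchy_convergent_iff convergent_LIMSEQ_iff)
  have bound: "(\<integral>\<^sup>+x. ennreal (norm (F i x - f x) powr s) \<partial>M) \<le> ennreal e"
    if e: "0 < e" and N: "\<forall>i\<ge>N. \<forall>j\<ge>N. powint s (\<lambda>x. F i x - F j x) < e" and i: "N \<le> i" for e N i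
  proof -
    have "(\<integral>\<^sup>+x. ennreal (norm (F i x - f x) powr s) \<partial>M)
        = (\<integral>\<^sup>+x. liminf (\<lambda>n. ennreal (norm (F i x - F (r n) x) powr s)) \<partial>M)"
    proof (rule nn_integral_cong_AE, use AE in eventually_elim)
      fix x assume "(\<lambda>i. F (r i) x) \<longlonglongrightarrow> f x"
      then have "(\<lambda>n. ennreal (norm (F i x - F (r n) x) powr s)) \<longlonglongrightarrow> ennreal (norm (F i x - f x) powr s)"
        using s0 by (intro tendsto_ennrealI tendsto_powr' tendsto_intros) auto
      then show "ennreal (norm (F i x - f x) powr s) = liminf (\<lambda>n. ennreal (norm (F i x - F (r n) x) powr s))"
        by (rule lim_imp_Liminf[OF sequentially_bot, symmetric])
    qed
    also have "\<dots> \<le> liminf (\<lambda>n. \<integral>\<^sup>+x. ennreal (norm (F i x - F (r n) x) powr s) \<partial>M)"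
      by (rule nn_integral_liminf[OF meas])
    also have "\<dots> \<le> liminf (\<lambda>n. ennreal e)"
    proof (rule Liminf_mono, rule eventually_sequentiallyI[of N])
      fix n assume "N \<le> n"
      then have "N \<le> r n" using seq_suble[OF r(1), of n] by linarith
      then have "powint s (\<lambda>x. F i x - F (r n) x) \<le> e" using N i by (simp add: less_imp_le)
      then show "(\<integral>\<^sup>+x. ennreal (norm (F i x - F (r n) x) powr s) \<partial>M) \<le> ennreal e"
        unfolding nn_integral_powint[OF Lp_diff[OF F[of i] F[of "r n"] s0]] by (rule ennreal_leI)
    qed
    also have "\<dots> = ennreal e" by (rule Liminf_const) simp
    finally show ?thesis .
  qed
  have le: "(\<lambda>x. F i x - f x) \<in> Lp s \<Omega> \<and> powint s (\<lambda>x. F i x - f x) \<le> e"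
    if "0 < e" "\<forall>i\<ge>N. \<forall>j\<ge>N. powint s (\<lambda>x. F i x - F j x) < e" "N \<le> i" for e N i
    using powint_le_of_nn_integral[OF borel_measurable_diff[OF LpD(1)[OF F] f] bound[OF that]] that(1) by auto
  obtain N where N: "\<forall>i\<ge>N. \<forall>j\<ge>N. powint s (\<lambda>x. F i x - F j x) < 1"
    using cauchy[OF zero_less_one] by blast
  show ?thesis
  proof (rule that)
    have "(\<lambda>x. F N x - (F N x - f x)) \<in> Lp s \<Omega>"
      by (rule Lp_diff[OF F conjunct1[OF le[OF zero_less_one N order_refl]] s0])
    then show "f \<in> Lp s \<Omega>" by simp
    show "(\<lambda>n. powint s (\<lambda>x. F n x - f x)) \<longlonglongrightarrow> 0"
    proof (rule LIMSEQ_I)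
      fix e :: real assume e: "0 < e"
      then have e2: "0 < e / 2" by simp
      obtain N where N: "\<forall>i\<ge>N. \<forall>j\<ge>N. powint s (\<lambda>x. F i x - F j x) < e/2"
        using cauchy[OF e2] by blast
      have "powint s (\<lambda>x. F i x - f x) < e" if "N \<le> i" for i
        using conjunct2[OF le[OF e2 N that]] e by linarith
      then show "\<exists>N. \<forall>n\<ge>N. norm (powint s (\<lambda>x. F n x - f x) - 0) < e"
        by (intro exI[of _ N]) simp
    qed
  qed
qed

lemma powint_tendsto:
  fixes f :: "nat \<Rightarrow> 'a \<Rightarrow> 'b::euclidean_space"
  assumes f: "\<And>n. f n \<in> Lp s \<Omega>" "g \<in> Lp s \<Omega>" and s: "0 < s"
    and lim: "(\<lambda>n. powint s (\<lambda>x. f n x - g x)) \<longlonglongrightarrow> 0"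
  shows "(\<lambda>n. powint s (f n)) \<longlonglongrightarrow> powint s g"
proof (rule LIMSEQ_I)
  fix e :: real assume e: "0 < e"
  define B where "B = powint s g + 2 powr s * (1 + powint s g)"
  obtain d where d: "0 < d" "\<And>f g :: 'a \<Rightarrow> 'b. f \<in> Lp s \<Omega> \<Longrightarrow> g \<in> Lp s \<Omega> \<Longrightarrow>
    powint s f \<le> B \<Longrightarrow> powint s g \<le> B \<Longrightarrow> powint s (\<lambda>x. f x - g x) < d \<Longrightarrow> \<bar>powint s f - powint s g\<bar> < e"
    by (rule powint_continuity_modulus[OF s e]) blast
  obtain N where N: "\<And>n. N \<le> n \<Longrightarrow> powint s (\<lambda>x. f n x - g x) < min d 1"
    using LIMSEQ_D[OF lim, of "min d 1"] d(1) by auto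
  have "\<bar>powint s (f n) - powint s g\<bar> < e" if "N \<le> n" for n
  proof (rule d(2)[OF f])
    have "powint s (\<lambda>x. (f n x - g x) + g x) \<le> 2 powr s * (powint s (\<lambda>x. f n x - g x) + powint s g)"
      by (intro powint_add_le Lp_diff f s)
    also have "\<dots> \<le> 2 powr s * (1 + powint s g)" using N[OF that] by (intro mult_left_mono) auto
    also have "\<dots> \<le> B" unfolding B_def using powint_nonneg[of s g] by linarith
    finally show "powint s (f n) \<le> B" by simp
    show "powint s g \<le> B" by (simp add: B_def)
  qed (use N[OF that] in auto)
  then show "\<exists>N. \<forall>n\<ge>N. norm (powint s (f n) - powint s g) < e" by (intro exI[of _ N]) simp
qed

text \<open>Limits are unique only up to null sets, since functions and not classes of functions are used.\<close>

lemma Lp_lim_unique: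
  fixes f :: "nat \<Rightarrow> 'a \<Rightarrow> 'b::euclidean_space"
  assumes f: "\<And>n. f n \<in> Lp s \<Omega>" "g \<in> Lp s \<Omega>" "h \<in> Lp s \<Omega>" and s: "0 < s"
    and "(\<lambda>n. powint s (\<lambda>x. f n x - g x)) \<longlonglongrightarrow> 0" "(\<lambda>n. powint s (\<lambda>x. f n x - h x)) \<longlonglongrightarrow> 0"
  shows "AE x in M. g x = h x"
proof -
  have "(\<lambda>n. 2 powr s * (powint s (\<lambda>x. g x - f n x) + powint s (\<lambda>x. f n x - h x))) \<longlonglongrightarrow> 2 powr s * (0 + 0)"
    using assms(5,6) by (intro tendsto_intros) (simp_all add: powint_minus_commute)
  then have "powint s (\<lambda>x. g x - h x) \<le> 2 powr s * (0 + 0)"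
    by (rule LIMSEQ_le_const) (use powint_triangle[OF f(2,1,3) s] in auto)
  then have "powint s (\<lambda>x. g x - h x) = 0" using powint_nonneg[of s "\<lambda>x. g x - h x"] by simp
  then show ?thesis using powint_eq_0D[OF Lp_diff[OF f(2,3) s]] by (auto elim!: eventually_mono)
qed

end

section \<open>The pairing of \<open>L^q\<close> functions\<close>

context bounded_domain
begin

text \<open>Up to the factor \<open>q\<close>, the derivative of \<open>\<integral>|u|^q\<close> in the direction \<open>v\<close>. It is linear in \<open>v\<close> only.\<close>

definition pairing :: "real \<Rightarrow> ('a \<Rightarrow> real) \<Rightarrow> ('a \<Rightarrow> real) \<Rightarrow> real" where
  "pairing q u v = (\<integral>x. spow q (u x) * v x \<partial>M)"

lemma spow_measurable [measurable]:
  assumes "1 < q" shows "spow q \<in> borel_measurable borel"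
  using continuous_on_spow[OF assms] by (rule borel_measurable_continuous_onI)

lemma integrable_young:
  fixes u v :: "'a \<Rightarrow> real"
  assumes "u \<in> Lp q \<Omega>" "v \<in> Lp q \<Omega>"
  shows "integrable M (\<lambda>x. \<bar>v x\<bar> powr q / q + (1 - 1 / q) * \<bar>u x\<bar> powr q)"
proof -
  have a: "integrable M (\<lambda>x. \<bar>v x\<bar> powr q)" "integrable M (\<lambda>x. \<bar>u x\<bar> powr q)"
    using LpD(2)[OF assms(1)] LpD(2)[OF assms(2)] unfolding real_norm_def by auto
  have "integrable M (\<lambda>x. \<bar>v x\<bar> powr q / q)" using a(1) by (simp only: integrable_divide)
  moreover have "integrable M (\<lambda>x. (1 - 1 / q) * \<bar>u x\<bar> powr q)" using a(2) by (simp only: integrable_mult_right)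
  ultimately show ?thesis by (rule Bochner_Integration.integrable_add)
qed

lemma integrable_pairing:
  assumes "1 < q" "u \<in> Lp q \<Omega>" "v \<in> Lp q \<Omega>"
  shows "integrable M (\<lambda>x. spow q (u x) * v x)"
proof (rule Bochner_Integration.integrable_bound)
  show "integrable M (\<lambda>x. \<bar>v x\<bar> powr q / q + (1 - 1 / q) * \<bar>u x\<bar> powr q)"
    by (rule integrable_young[OF assms(2,3)])
  show "(\<lambda>x. spow q (u x) * v x) \<in> borel_measurable M"
    using LpD(1)[OF assms(2)] LpD(1)[OF assms(3)] measurable_compose[OF _ spow_measurable[OF assms(1)]] by measurable
  show "AE x in M. norm (spow q (u x) * v x) \<le> norm (\<bar>v x\<bar> powr q / q + (1 - 1 / q) * \<bar>u x\<bar> powr q)"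
  proof (rule AE_I2)
    fix x show "norm (spow q (u x) * v x) \<le> norm (\<bar>v x\<bar> powr q / q + (1 - 1 / q) * \<bar>u x\<bar> powr q)"
      using order_trans[OF spow_young[OF assms(1), of "u x" "v x"] abs_ge_self] unfolding real_norm_def .
  qed
qed

lemma pairing_young:
  assumes "1 < q" "u \<in> Lp q \<Omega>" "v \<in> Lp q \<Omega>"
  shows "pairing q u v \<le> powint q v / q + (1 - 1 / q) * powint q u"
proof -
  have le: "spow q (u x) * v x \<le> \<bar>v x\<bar> powr q / q + (1 - 1 / q) * \<bar>u x\<bar> powr q" for x
    using order_trans[OF abs_ge_self spow_young[OF assms(1)]] .
  have "integrable M (\<lambda>x. \<bar>v x\<bar> powr q / q + (1 - 1 / q) * \<bar>u x\<bar> powr q)"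
    by (rule integrable_young[OF assms(2,3)])
  then have "pairing q u v \<le> (\<integral>x. \<bar>v x\<bar> powr q / q + (1 - 1 / q) * \<bar>u x\<bar> powr q \<partial>M)"
    unfolding pairing_def using integrable_pairing[OF assms] le by (intro integral_mono)
  then show ?thesis using LpD(2)[OF assms(2)] LpD(2)[OF assms(3)] by (simp add: powint_def)
qed

lemma pairing_self: "pairing q u u = powint q u"
  by (simp add: pairing_def powint_def spow_mult_self)

lemma pairing_add:
  assumes "1 < q" "u \<in> Lp q \<Omega>" "v \<in> Lp q \<Omega>" "w \<in> Lp q \<Omega>"
  shows "pairing q u (\<lambda>x. v x + w x) = pairing q u v + pairing q u w"
  using integrable_pairing[OF assms(1,2,3)] integrable_pairing[OF assms(1,2,4)]
  by (simp add: pairing_def distrib_left)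

lemma pairing_mult: "pairing q u (\<lambda>x. c * v x) = c * pairing q u v"
  by (simp add: pairing_def mult.left_commute)

lemma pairing_minus_minus [simp]: "pairing q (\<lambda>x. - u x) (\<lambda>x. - v x) = pairing q u v"
  by (simp add: pairing_def)

lemma pairing_continuity_modulus:
  assumes q: "1 < q" and e: "0 < e"
  obtains d where "0 < d" "\<And>u v u' v'. u \<in> Lp q \<Omega> \<Longrightarrow> v \<in> Lp q \<Omega> \<Longrightarrow> u' \<in> Lp q \<Omega> \<Longrightarrow> v' \<in> Lp q \<Omega> \<Longrightarrow>
    powint q u \<le> B \<Longrightarrow> powint q v \<le> B \<Longrightarrow> powint q u' \<le> B \<Longrightarrow> powint q v' \<le> B \<Longrightarrow>
    powint q (\<lambda>x. u x - u' x) < d \<Longrightarrow> powint q (\<lambda>x. v x - v' x) < d \<Longrightarrow> \<bar>pairing q u v - pairing q u' v'\<bar> < e"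
proof -
  let ?\<eta> = "e / (8 * (\<bar>B\<bar> + 1))"
  have \<eta>: "0 < ?\<eta>" using e by (intro divide_pos_pos) auto
  obtain C where C: "0 \<le> C" "\<And>a b c d. \<bar>spow q a * c - spow q b * d\<bar>
      \<le> ?\<eta> * (\<bar>a\<bar> powr q + \<bar>b\<bar> powr q + \<bar>c\<bar> powr q + \<bar>d\<bar> powr q)
      + C * (\<bar>a - b\<bar> powr q + \<bar>c - d\<bar> powr q)"
    by (rule spow_pairing_modulus[OF q \<eta>]) blast
  have q0: "0 < q" using q by simp
  show ?thesis
  proof (rule that[of "e / (4 * (C + 1))"])
    show "0 < e / (4 * (C + 1))" using C(1) e by (intro divide_pos_pos mult_pos_pos) auto
    fix u v u' v' :: "'a \<Rightarrow> real" assume u: "u \<in> Lp q \<Omega>" and v: "v \<in> Lp q \<Omega>" and u': "u' \<in> Lp q \<Omega>" and v': "v' \<in> Lp q \<Omega>"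
      and B: "powint q u \<le> B" "powint q v \<le> B" "powint q u' \<le> B" "powint q v' \<le> B"
      and d: "powint q (\<lambda>x. u x - u' x) < e / (4 * (C + 1))" "powint q (\<lambda>x. v x - v' x) < e / (4 * (C + 1))"
    note i = LpD(2)[OF u, simplified] LpD(2)[OF v, simplified] LpD(2)[OF u', simplified] LpD(2)[OF v', simplified]
      LpD(2)[OF Lp_diff[OF u u' q0], simplified] LpD(2)[OF Lp_diff[OF v v' q0], simplified]
    note ip = integrable_pairing[OF q u v] integrable_pairing[OF q u' v']
    have "\<bar>pairing q u v - pairing q u' v'\<bar> = \<bar>\<integral>x. spow q (u x) * v x - spow q (u' x) * v' x \<partial>M\<bar>"
      unfolding pairing_def using ip by simp
    also have "\<dots> \<le> (\<integral>x. \<bar>spow q (u x) * v x - spow q (u' x) * v' x\<bar> \<partial>M)"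
      by (rule integral_abs_bound)
    also have "\<dots> \<le> (\<integral>x. ?\<eta> * (\<bar>u x\<bar> powr q + \<bar>u' x\<bar> powr q + \<bar>v x\<bar> powr q + \<bar>v' x\<bar> powr q)
      + C * (\<bar>u x - u' x\<bar> powr q + \<bar>v x - v' x\<bar> powr q) \<partial>M)"
      using i ip by (intro integral_mono C(2)) auto
    also have "\<dots> = ?\<eta> * (powint q u + powint q u' + powint q v + powint q v')
        + C * (powint q (\<lambda>x. u x - u' x) + powint q (\<lambda>x. v x - v' x))"
      unfolding powint_def using i by simp
    also have "\<dots> < e"
    proof -
      have "?\<eta> * (powint q u + powint q u' + powint q v + powint q v') \<le> ?\<eta> * (4 * (\<bar>B\<bar> + 1))"
        using B e by (intro mult_left_mono) auto
      also have "\<dots> = e / 2" by (simp add: field_simps)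
      finally have 1: "?\<eta> * (powint q u + powint q u' + powint q v + powint q v') \<le> e / 2" .
      have "C * (powint q (\<lambda>x. u x - u' x) + powint q (\<lambda>x. v x - v' x)) \<le> C * (2 * (e / (4 * (C + 1))))"
        using d C(1) by (intro mult_left_mono) auto
      also have "\<dots> < e / 2" using C(1) e by (simp add: field_simps)
      finally show ?thesis using 1 by linarith
    qed
    finally show "\<bar>pairing q u v - pairing q u' v'\<bar> < e" .
  qed
qed

end

section \<open>Test functions\<close>

text \<open>Smoothness is proved for whole families at once: a family of differentiable functions that is closed
  under partial derivatives consists of smooth functions. Closing a family under sums and products makes
  this applicable, because Leibniz' rule leads out of the family itself.\<close>

inductive_set ring_closure :: "('a \<Rightarrow> real) set \<Rightarrow> ('a \<Rightarrow> real) set" for S where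
  base: "f \<in> S \<Longrightarrow> f \<in> ring_closure S"
| add: "f \<in> ring_closure S \<Longrightarrow> g \<in> ring_closure S \<Longrightarrow> (\<lambda>x. f x + g x) \<in> ring_closure S"
| mult: "f \<in> ring_closure S \<Longrightarrow> g \<in> ring_closure S \<Longrightarrow> (\<lambda>x. f x * g x) \<in> ring_closure S"

lemma smooth_onI_closed:
  fixes F :: "('a::euclidean_space \<Rightarrow> real) set"
  assumes diff: "\<And>f x. f \<in> F \<Longrightarrow> f differentiable (at x)"
    and closed: "\<And>f b. f \<in> F \<Longrightarrow> b \<in> Basis \<Longrightarrow> (\<lambda>x. frechet_derivative f (at x) b) \<in> F"
    and "f \<in> F"
  shows "smooth_on UNIV f"
proof -
  have "Ck_on k UNIV f" for k
    using assms(3)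
  proof (induction k arbitrary: f)
    case 0
    then have "f differentiable_on UNIV" using diff by (simp add: differentiable_on_def)
    then show ?case by (simp add: differentiable_imp_continuous_on)
  next
    case (Suc k)
    then show ?case using diff closed by simp
  qed
  then show ?thesis by (simp add: smooth_on_def)
qed

lemma smooth_on_differentiable: "smooth_on UNIV f \<Longrightarrow> f differentiable (at x)"
  unfolding smooth_on_def using Ck_on.simps(2)[of 0 UNIV f] by blast

lemma smooth_on_partial:
  "smooth_on UNIV f \<Longrightarrow> b \<in> Basis \<Longrightarrow> smooth_on UNIV (\<lambda>x. frechet_derivative f (at x) b)"
  unfolding smooth_on_def using Ck_on.simps(2) by blast

lemma frechet_derivative_add:
  assumes "f differentiable (at x)" "g differentiable (at x)"
  shows "frechet_derivative (\<lambda>x. f x + g x) (at x) = (\<lambda>h. frechet_derivative f (at x) h + frechet_derivative g (at x) h)"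
  using assms by (intro frechet_derivative_at[symmetric] has_derivative_add) (simp_all add: frechet_derivative_works)

lemma frechet_derivative_mult:
  fixes f g :: "'a::euclidean_space \<Rightarrow> real"
  assumes "f differentiable (at x)" "g differentiable (at x)"
  shows "frechet_derivative (\<lambda>x. f x * g x) (at x)
    = (\<lambda>h. f x * frechet_derivative g (at x) h + frechet_derivative f (at x) h * g x)"
  using assms by (intro frechet_derivative_at[symmetric] has_derivative_mult) (simp_all add: frechet_derivative_works)

lemma smooth_on_ring_closure:
  fixes S :: "('a::euclidean_space \<Rightarrow> real) set"
  assumes diff: "\<And>f x. f \<in> S \<Longrightarrow> f differentiable (at x)"
    and closed: "\<And>f b. f \<in> S \<Longrightarrow> b \<in> Basis \<Longrightarrow> (\<lambda>x. frechet_derivative f (at x) b) \<in> ring_closure S"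
    and "f \<in> ring_closure S"
  shows "smooth_on UNIV f"
proof -
  have *: "(\<forall>x. f differentiable (at x)) \<and> (\<forall>b\<in>Basis. (\<lambda>x. frechet_derivative f (at x) b) \<in> ring_closure S)"
    if "f \<in> ring_closure S" for f
    using that
  proof induction
    case (add f g)
    then show ?case
      by (auto simp: frechet_derivative_add intro: ring_closure.add)
  next
    case (mult f g)
    then show ?case
      by (auto simp: frechet_derivative_mult intro!: ring_closure.add ring_closure.mult[of _ S "\<lambda>x. frechet_derivative _ (at x) _"]
        ring_closure.mult[of "\<lambda>x. frechet_derivative _ (at x) _" S])
  qed (use diff closed in auto)
  show ?thesis by (rule smooth_onI_closed[of "ring_closure S"]) (use * assms(3) in auto)
qed

lemma smooth_on_add: "smooth_on UNIV f \<Longrightarrow> smooth_on UNIV g \<Longrightarrow> smooth_on UNIV (\<lambda>x. f x + g x)"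
  by (rule smooth_on_ring_closure[of "{f. smooth_on UNIV f}"])
    (auto intro: ring_closure.intros smooth_on_differentiable smooth_on_partial)

lemma smooth_on_mult: "smooth_on UNIV f \<Longrightarrow> smooth_on UNIV g \<Longrightarrow> smooth_on UNIV (\<lambda>x. f x * g x)"
  by (rule smooth_on_ring_closure[of "{f. smooth_on UNIV f}"])
    (auto intro: ring_closure.intros smooth_on_differentiable smooth_on_partial)

lemma smooth_on_const: "smooth_on UNIV (\<lambda>x. c)"
  by (rule smooth_onI_closed[of "range (\<lambda>c x. c)"]) auto

text \<open>The factor \<open>(1/t)^m\<close> is included so that the family is closed under differentiation up to sums;
  \<open>m = 0\<close> is the classical smooth function that vanishes exactly on the negative half line.\<close>

definition flat_exp :: "nat \<Rightarrow> real \<Rightarrow> real" where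
  "flat_exp m t = (if 0 < t then (1 / t) ^ m * exp (- (1 / t)) else 0)"

lemma flat_exp_div_tendsto_0: "((\<lambda>t. flat_exp m t / t) \<longlongrightarrow> 0) (at 0)"
proof (rule filterlim_split_at)
  have "((\<lambda>t. 0) \<longlongrightarrow> (0::real)) (at_left 0)" by simp
  moreover have "eventually (\<lambda>t::real. 0 = flat_exp m t / t) (at_left 0)"
    by (rule eventually_at_leftI[of "-1"]) (auto simp: flat_exp_def)
  ultimately show "((\<lambda>t. flat_exp m t / t) \<longlongrightarrow> 0) (at_left 0)"
    by (rule Lim_transform_eventually)
  have "((\<lambda>t::real. inverse t ^ Suc m / exp (inverse t)) \<longlongrightarrow> 0) (at_right 0)"
    by (rule filterlim_compose[OF tendsto_power_div_exp_0 filterlim_inverse_at_top_right])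
  moreover have "eventually (\<lambda>t::real. inverse t ^ Suc m / exp (inverse t) = flat_exp m t / t) (at_right 0)"
    by (rule eventually_at_rightI[of 0 1]) (auto simp: flat_exp_def exp_minus field_simps)
  ultimately show "((\<lambda>t. flat_exp m t / t) \<longlongrightarrow> 0) (at_right 0)"
    by (rule Lim_transform_eventually)
qed

lemma flat_exp_DERIV:
  "(flat_exp m has_real_derivative - real m * flat_exp (m + 1) t + flat_exp (m + 2) t) (at t)"
proof (cases t "0::real" rule: linorder_cases)
  case equal
  have "(\<lambda>h. (flat_exp m (0 + h) - flat_exp m 0) / h) \<midarrow>0\<rightarrow> 0"
    using flat_exp_div_tendsto_0[of m] by (simp add: flat_exp_def)
  then show ?thesis using equal by (simp add: DERIV_def flat_exp_def)
next
  case less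
  have "((\<lambda>t::real. 0::real) has_real_derivative 0) (at t)" by simp
  then have "(flat_exp m has_real_derivative 0) (at t)"
    by (rule DERIV_cong_ev[OF refl _ refl, THEN iffD1, rotated])
      (use less in \<open>auto simp: flat_exp_def eventually_nhds intro!: exI[of _ "{..<0}"]\<close>)
  then show ?thesis using less by (simp add: flat_exp_def)
next
  case greater
  have "((\<lambda>t. (1 / t) ^ m * exp (- (1 / t))) has_real_derivative
      (real m * (1 / t) ^ (m - 1) * (- ((1 / t)\<^sup>2))) * exp (- (1 / t)) + (1 / t) ^ m * (exp (- (1 / t)) * (1 / t)\<^sup>2)) (at t)"
    using greater by (auto intro!: derivative_eq_intros simp: power2_eq_square)
  moreover have "(real m * (1 / t) ^ (m - 1) * (- ((1 / t)\<^sup>2))) * exp (- (1 / t)) + (1 / t) ^ m * (exp (- (1 / t)) * (1 / t)\<^sup>2)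
      = - real m * flat_exp (m + 1) t + flat_exp (m + 2) t"
  proof -
    define y where "y = 1 / t"
    have f: "flat_exp n t = y ^ n * exp (- y)" for n using greater by (simp add: flat_exp_def y_def)
    show ?thesis unfolding f y_def[symmetric] by (cases m) (simp_all add: power2_eq_square algebra_simps)
  qed
  ultimately have "((\<lambda>t. (1 / t) ^ m * exp (- (1 / t))) has_real_derivative
      - real m * flat_exp (m + 1) t + flat_exp (m + 2) t) (at t)" by simp
  moreover have ev: "eventually (\<lambda>t. (1 / t) ^ m * exp (- (1 / t)) = flat_exp m t) (nhds t)"
    using greater by (auto simp: flat_exp_def eventually_nhds intro!: exI[of _ "{0<..}"])
  ultimately show ?thesis using DERIV_cong_ev[OF refl ev refl] by blast
qed

lemma smooth_on_flat_exp_affine: "smooth_on UNIV (\<lambda>x::'a::euclidean_space. flat_exp m (c * (x \<bullet> i) + d))"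
proof -
  let ?S = "range (\<lambda>(c::real) (x::'a). c) \<union> {\<lambda>x. flat_exp m (c * (x \<bullet> i) + d) | m c i d. True}"
  have der: "((\<lambda>x::'a. flat_exp m (c * (x \<bullet> i) + d)) has_derivative
      (\<lambda>h. (- real m * flat_exp (m + 1) (c * (x \<bullet> i) + d) + flat_exp (m + 2) (c * (x \<bullet> i) + d)) * (c * (h \<bullet> i)))) (at x)"
    for m c i d x
  proof -
    have "(flat_exp m has_derivative (\<lambda>h. (- real m * flat_exp (m + 1) (c * (x \<bullet> i) + d) + flat_exp (m + 2) (c * (x \<bullet> i) + d)) * h))
       (at (c * (x \<bullet> i) + d))"
      using flat_exp_DERIV[of m "c * (x \<bullet> i) + d"] by (simp add: has_field_derivative_def)
    moreover have "((\<lambda>x. c * (x \<bullet> i) + d) has_derivative (\<lambda>h. c * (h \<bullet> i))) (at x)"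
      by (auto intro!: derivative_eq_intros)
    ultimately show ?thesis using diff_chain_at by (fastforce simp: o_def)
  qed
  have c: "(\<lambda>x. c) \<in> ring_closure ?S" for c by (rule ring_closure.base) auto
  have f: "(\<lambda>x. flat_exp m (c * (x \<bullet> i) + d)) \<in> ring_closure ?S" for m c i d by (rule ring_closure.base) blast
  show ?thesis
  proof (rule smooth_on_ring_closure[of ?S])
    fix f b x assume "f \<in> ?S"
    then consider c where "f = (\<lambda>x. c)" | m c i d where "f = (\<lambda>x. flat_exp m (c * (x \<bullet> i) + d))" by blast
    then have "f differentiable (at x) \<and> (\<lambda>x. frechet_derivative f (at x) b) \<in> ring_closure ?S"
    proof cases
      case 1
      then show ?thesis using c[of 0] by simp
    next
      case 2
      have "frechet_derivative f (at x) = (\<lambda>h. (- real m * flat_exp (m + 1) (c * (x \<bullet> i) + d) + flat_exp (m + 2) (c * (x \<bullet> i) + d)) * (c * (h \<bullet> i)))" for x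
        using frechet_derivative_at[OF der] unfolding 2 by simp
      moreover have "(\<lambda>x. (- real m * flat_exp (m + 1) (c * (x \<bullet> i) + d) + flat_exp (m + 2) (c * (x \<bullet> i) + d)) * (c * (b \<bullet> i))) \<in> ring_closure ?S"
        by (intro ring_closure.mult ring_closure.add c f)
      moreover have "f differentiable (at x)" unfolding 2 differentiable_def by (rule exI, rule der)
      ultimately show ?thesis by auto
    qed
    then show "f differentiable (at x)" "(\<lambda>x. frechet_derivative f (at x) b) \<in> ring_closure ?S" by auto
  qed (rule f)
qed

lemma smooth_on_prod:
  assumes "finite I" "\<And>i. i \<in> I \<Longrightarrow> smooth_on UNIV (f i)"
  shows "smooth_on UNIV (\<lambda>x. \<Prod>i\<in>I. f i x)"
  using assms by (induction I rule: finite_induct) (auto intro: smooth_on_const smooth_on_mult)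

text \<open>For growing \<open>n\<close> the function converges to the indicator function of the box, by \<open>bump_tendsto\<close>.\<close>

definition bump :: "real \<Rightarrow> 'a::euclidean_space \<Rightarrow> 'a \<Rightarrow> 'a \<Rightarrow> real" where
  "bump n a b x = (\<Prod>i\<in>Basis. flat_exp 0 (n * (x \<bullet> i) + - n * (a \<bullet> i)) * flat_exp 0 (- n * (x \<bullet> i) + n * (b \<bullet> i)))"

lemma smooth_on_bump: "smooth_on UNIV (bump n a b)"
  unfolding bump_def[abs_def] by (intro smooth_on_prod smooth_on_mult smooth_on_flat_exp_affine) auto

lemma flat_exp_0_bounds: "0 \<le> flat_exp 0 t" "flat_exp 0 t \<le> 1"
  by (auto simp: flat_exp_def)

lemma bump_bounds: "0 \<le> bump n a b x" "bump n a b x \<le> 1"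
  unfolding bump_def using flat_exp_0_bounds
  by (auto intro!: prod_nonneg prod_le_1 mult_nonneg_nonneg mult_le_one)

lemma bump_nonzero_iff: "0 < n \<Longrightarrow> bump n a b x \<noteq> 0 \<longleftrightarrow> x \<in> box a b"
proof -
  assume n: "0 < n"
  have "flat_exp 0 (n * (x \<bullet> i) + - n * (a \<bullet> i)) \<noteq> 0 \<longleftrightarrow> a \<bullet> i < x \<bullet> i"
    "flat_exp 0 (- n * (x \<bullet> i) + n * (b \<bullet> i)) \<noteq> 0 \<longleftrightarrow> x \<bullet> i < b \<bullet> i" for i
    using n by (auto simp: flat_exp_def)
  then show ?thesis by (auto simp: bump_def mem_box)
qed

lemma bump_tendsto: "(\<lambda>n. bump (real (Suc n)) a b x) \<longlonglongrightarrow> indicator (box a b) x"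
proof (cases "x \<in> box a b")
  case False
  then show ?thesis using bump_nonzero_iff[of "real (Suc _)" a b x] by simp
next
  case True
  have lim: "(\<lambda>n. flat_exp 0 (real (Suc n) * t)) \<longlonglongrightarrow> 1" if "0 < t" for t
  proof -
    have "(\<lambda>n. exp (- ((1 / t) * inverse (real (Suc n))))) \<longlonglongrightarrow> exp (- ((1 / t) * 0))"
      by (intro tendsto_intros LIMSEQ_inverse_real_of_nat)
    moreover have "flat_exp 0 (real (Suc n) * t) = exp (- ((1 / t) * inverse (real (Suc n))))" for n
    proof -
      have "0 < real (Suc n) * t" using that by (intro mult_pos_pos) auto
      then show ?thesis by (simp add: flat_exp_def inverse_eq_divide)
    qed
    ultimately show ?thesis by simp
  qed
  have "(\<lambda>n. \<Prod>i\<in>Basis. flat_exp 0 (real (Suc n) * (x \<bullet> i - a \<bullet> i)) * flat_exp 0 (real (Suc n) * (b \<bullet> i - x \<bullet> i))) \<longlonglongrightarrow> (\<Prod>i\<in>(Basis::'a set). 1 * 1)"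
    using True by (intro tendsto_prod tendsto_mult lim) (auto simp: mem_box)
  then show ?thesis using True by (simp add: bump_def algebra_simps)
qed

text \<open>The derivative as a vector, for comparison with weak gradients.\<close>

definition gradient :: "('a::euclidean_space \<Rightarrow> real) \<Rightarrow> 'a \<Rightarrow> 'a" where
  "gradient \<phi> x = (\<Sum>b\<in>Basis. frechet_derivative \<phi> (at x) b *\<^sub>R b)"

lemma has_derivative_gradient:
  assumes "\<phi> differentiable (at x)"
  shows "(\<phi> has_derivative (\<lambda>h. gradient \<phi> x \<bullet> h)) (at x)"
proof -
  let ?D = "frechet_derivative \<phi> (at x)"
  have D: "(\<phi> has_derivative ?D) (at x)" using assms by (simp add: frechet_derivative_works)
  then have lin: "linear ?D" using has_derivative_linear by blast
  have "?D h = gradient \<phi> x \<bullet> h" for h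
  proof -
    have "?D h = ?D (\<Sum>b\<in>Basis. (h \<bullet> b) *\<^sub>R b)" by (simp add: euclidean_representation)
    also have "\<dots> = (\<Sum>b\<in>Basis. (h \<bullet> b) * ?D b)" by (simp add: linear_sum[OF lin] linear_cmul[OF lin])
    also have "\<dots> = gradient \<phi> x \<bullet> h"
      unfolding gradient_def inner_sum_left by (intro sum.cong) (auto simp: inner_commute)
    finally show ?thesis .
  qed
  then have "?D = (\<lambda>h. gradient \<phi> x \<bullet> h)" by auto
  then show ?thesis using D by simp
qed

lemma gradient_eqI:
  assumes "(\<phi> has_derivative (\<lambda>h. g \<bullet> h)) (at x)" shows "gradient \<phi> x = g"
proof -
  have "frechet_derivative \<phi> (at x) = (\<lambda>h. g \<bullet> h)" using frechet_derivative_at[OF assms] by simp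
  then show ?thesis by (simp add: gradient_def euclidean_representation)
qed

lemma frechet_derivative_gradient:
  "\<phi> differentiable (at x) \<Longrightarrow> frechet_derivative \<phi> (at x) h = gradient \<phi> x \<bullet> h"
  using frechet_derivative_at[OF has_derivative_gradient] by metis

lemma test_functionsD:
  assumes "\<phi> \<in> test_functions \<Omega>"
  shows "smooth_on UNIV \<phi>" "compact (closure {x. \<phi> x \<noteq> 0})" "closure {x. \<phi> x \<noteq> 0} \<subseteq> \<Omega>"
    "\<phi> differentiable (at x)" "(\<phi> has_derivative (\<lambda>h. gradient \<phi> x \<bullet> h)) (at x)"
    "frechet_derivative \<phi> (at x) h = gradient \<phi> x \<bullet> h"
    "continuous_on UNIV \<phi>" "continuous_on UNIV (gradient \<phi>)"
proof -
  show sm: "smooth_on UNIV \<phi>" and "compact (closure {x. \<phi> x \<noteq> 0})" and "closure {x. \<phi> x \<noteq> 0} \<subseteq> \<Omega>"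
    using assms by (auto simp: test_functions_def)
  show d: "\<phi> differentiable (at x)" for x using smooth_on_differentiable[OF sm] .
  show "(\<phi> has_derivative (\<lambda>h. gradient \<phi> x \<bullet> h)) (at x)" by (rule has_derivative_gradient[OF d])
  show "frechet_derivative \<phi> (at x) h = gradient \<phi> x \<bullet> h" by (rule frechet_derivative_gradient[OF d])
  have cont: "smooth_on UNIV f \<Longrightarrow> continuous_on UNIV f" for f
    unfolding smooth_on_def using Ck_on.simps(1) by blast
  show "continuous_on UNIV \<phi>" by (rule cont[OF sm])
  show "continuous_on UNIV (gradient \<phi>)"
    unfolding gradient_def[abs_def] by (intro continuous_intros cont smooth_on_partial[OF sm])
qed

lemma test_functions_outside_support:
  assumes "x \<notin> closure {x. \<phi> x \<noteq> 0}"
  shows "\<phi> x = 0" "gradient \<phi> x = 0"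
proof -
  show "\<phi> x = 0" using assms closure_subset[of "{x. \<phi> x \<noteq> 0}"] by blast
  have "((\<lambda>x. 0) has_derivative (\<lambda>h. 0 \<bullet> h)) (at x)" by simp
  then have "(\<phi> has_derivative (\<lambda>h. 0 \<bullet> h)) (at x)"
    by (rule has_derivative_transform_within_open[where s="- closure {x. \<phi> x \<noteq> 0}"])
      (use assms closure_subset[of "{x. \<phi> x \<noteq> 0}"] in auto)
  then show "gradient \<phi> x = 0" by (rule gradient_eqI)
qed

lemma test_functions_outside:
  assumes "\<phi> \<in> test_functions \<Omega>" "x \<notin> \<Omega>"
  shows "\<phi> x = 0" "gradient \<phi> x = 0"
  using test_functionsD(3)[OF assms(1)] assms(2) test_functions_outside_support[of x \<phi>] by auto

lemma test_functions_bounded: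
  assumes "\<phi> \<in> test_functions \<Omega>"
  obtains B where "\<And>x. \<bar>\<phi> x\<bar> \<le> B" "\<And>x. norm (gradient \<phi> x) \<le> B"
proof -
  let ?K = "closure {x. \<phi> x \<noteq> 0}"
  have "bounded (\<phi> ` ?K)" "bounded (gradient \<phi> ` ?K)"
    using test_functionsD(2,7,8)[OF assms]
    by (auto intro!: compact_imp_bounded compact_continuous_image elim: continuous_on_subset)
  then obtain B1 B2 where B: "\<And>x. x \<in> ?K \<Longrightarrow> \<bar>\<phi> x\<bar> \<le> B1" "\<And>x. x \<in> ?K \<Longrightarrow> norm (gradient \<phi> x) \<le> B2"
    unfolding bounded_iff by (auto simp: real_norm_def)
  have "\<bar>\<phi> x\<bar> \<le> max 0 (max B1 B2) \<and> norm (gradient \<phi> x) \<le> max 0 (max B1 B2)" for x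
    using B[of x] test_functions_outside_support[of x \<phi>] by (cases "x \<in> ?K") auto
  then show ?thesis using that by blast
qed

lemma test_functions_subset:
  assumes "smooth_on UNIV \<psi>" "{x. \<psi> x \<noteq> 0} \<subseteq> K" "compact K" "K \<subseteq> \<Omega>"
  shows "\<psi> \<in> test_functions \<Omega>"
proof -
  have sub: "closure {x. \<psi> x \<noteq> 0} \<subseteq> K" using assms(2,3) by (simp add: closure_minimal compact_imp_closed)
  have "compact (K \<inter> closure {x. \<psi> x \<noteq> 0})" by (rule compact_Int_closed[OF assms(3) closed_closure])
  then have "compact (closure {x. \<psi> x \<noteq> 0})" using sub by (simp add: Int_absorb1)
  then show ?thesis
    using assms(1) order_trans[OF sub assms(4)] by (simp add: test_functions_def)
qed

lemma test_functions_add: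
  assumes "\<phi> \<in> test_functions \<Omega>" "\<psi> \<in> test_functions \<Omega>"
  shows "(\<lambda>x. \<phi> x + \<psi> x) \<in> test_functions \<Omega>"
proof (rule test_functions_subset)
  show "smooth_on UNIV (\<lambda>x. \<phi> x + \<psi> x)" by (intro smooth_on_add test_functionsD(1)[OF assms(1)] test_functionsD(1)[OF assms(2)])
  show "compact (closure {x. \<phi> x \<noteq> 0} \<union> closure {x. \<psi> x \<noteq> 0})"
    by (intro compact_Un test_functionsD(2)[OF assms(1)] test_functionsD(2)[OF assms(2)])
  show "closure {x. \<phi> x \<noteq> 0} \<union> closure {x. \<psi> x \<noteq> 0} \<subseteq> \<Omega>"
    by (intro Un_least test_functionsD(3)[OF assms(1)] test_functionsD(3)[OF assms(2)])
  have "{x. \<phi> x + \<psi> x \<noteq> 0} \<subseteq> {x. \<phi> x \<noteq> 0} \<union> {x. \<psi> x \<noteq> 0}" by auto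
  also have "\<dots> \<subseteq> closure {x. \<phi> x \<noteq> 0} \<union> closure {x. \<psi> x \<noteq> 0}" by (intro Un_mono closure_subset)
  finally show "{x. \<phi> x + \<psi> x \<noteq> 0} \<subseteq> closure {x. \<phi> x \<noteq> 0} \<union> closure {x. \<psi> x \<noteq> 0}" .
qed

lemma test_functions_mult:
  assumes "\<phi> \<in> test_functions \<Omega>" "smooth_on UNIV \<psi>"
  shows "(\<lambda>x. \<psi> x * \<phi> x) \<in> test_functions \<Omega>"
proof (rule test_functions_subset)
  show "smooth_on UNIV (\<lambda>x. \<psi> x * \<phi> x)" by (intro smooth_on_mult assms(2) test_functionsD(1)[OF assms(1)])
  have "{x. \<psi> x * \<phi> x \<noteq> 0} \<subseteq> {x. \<phi> x \<noteq> 0}" by auto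
  also have "\<dots> \<subseteq> closure {x. \<phi> x \<noteq> 0}" by (rule closure_subset)
  finally show "{x. \<psi> x * \<phi> x \<noteq> 0} \<subseteq> closure {x. \<phi> x \<noteq> 0}" .
qed (rule test_functionsD(2,3)[OF assms(1)])+

lemma test_functions_cmult: "\<phi> \<in> test_functions \<Omega> \<Longrightarrow> (\<lambda>x. c * \<phi> x) \<in> test_functions \<Omega>"
  by (rule test_functions_mult[OF _ smooth_on_const])

lemma gradient_add:
  "\<phi> differentiable (at x) \<Longrightarrow> \<psi> differentiable (at x) \<Longrightarrow> gradient (\<lambda>x. \<phi> x + \<psi> x) x = gradient \<phi> x + gradient \<psi> x"
  by (rule gradient_eqI) (auto intro!: derivative_eq_intros has_derivative_gradient simp: inner_add_left)

lemma gradient_cmult: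
  "\<phi> differentiable (at x) \<Longrightarrow> gradient (\<lambda>x. c * \<phi> x) x = c *\<^sub>R gradient \<phi> x"
  by (rule gradient_eqI) (auto intro!: derivative_eq_intros has_derivative_gradient)

lemma gradient_mult:
  "\<phi> differentiable (at x) \<Longrightarrow> \<psi> differentiable (at x) \<Longrightarrow> gradient (\<lambda>x. \<phi> x * \<psi> x) x = \<phi> x *\<^sub>R gradient \<psi> x + \<psi> x *\<^sub>R gradient \<phi> x"
  by (rule gradient_eqI) (auto intro!: derivative_eq_intros has_derivative_gradient simp: inner_add_left)

lemma bump_test_function:
  assumes "0 < n" "cbox a b \<subseteq> \<Omega>" shows "bump n a b \<in> test_functions \<Omega>"
  using assms bump_nonzero_iff[OF assms(1), of a b] box_subset_cbox[of a b]
  by (intro test_functions_subset[OF smooth_on_bump, where K="cbox a b"]) auto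

section \<open>Translates of test functions\<close>

lemma test_function_lipschitz:
  assumes f: "f \<in> test_functions \<Omega>" and B: "\<And>x. norm (gradient f x) \<le> B"
  shows "\<bar>f y - f x\<bar> \<le> B * norm (y - x)"
proof -
  have "norm (f y - f x) \<le> B * norm (y - x)"
  proof (rule differentiable_bound[of UNIV f "\<lambda>x h. gradient f x \<bullet> h" B y x])
    show "(f has_derivative (\<lambda>h. gradient f x \<bullet> h)) (at x within UNIV)" for x
      using test_functionsD(5)[OF f] by simp
    show "onorm (\<lambda>h. gradient f x \<bullet> h) \<le> B" for x
    proof (rule onorm_bound)
      show "0 \<le> B" using order_trans[OF norm_ge_zero B] .
      show "norm (gradient f x \<bullet> h) \<le> B * norm h" for h
        using Cauchy_Schwarz_ineq2[of "gradient f x" h] mult_right_mono[OF B norm_ge_zero, of x h] by simp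
    qed
  qed auto
  then show ?thesis by simp
qed

text \<open>The difference quotients are bounded by a multiple of the indicator function of one large ball, because
  the step sizes are at most \<open>1\<close>. Steps \<open>(1/2)^n\<close> suit the doubling argument in
  \<open>translation_estimate\<close>.\<close>

lemma test_function_difference_quotient:
  fixes f :: "'a::euclidean_space \<Rightarrow> real" and h :: 'a
  assumes f: "f \<in> test_functions \<Omega>"
  obtains w where "integrable lborel w" "\<And>p. 0 < p \<Longrightarrow> integrable lborel (\<lambda>x. w x powr p)"
    "\<And>n x. \<bar>(f (x + (1/2)^n *\<^sub>R h) - f x) / (1/2)^n\<bar> \<le> w x"
    "\<And>x. (\<lambda>n. (f (x + (1/2)^n *\<^sub>R h) - f x) / (1/2)^n) \<longlonglongrightarrow> gradient f x \<bullet> h"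
proof -
  obtain B where B: "\<And>x. \<bar>f x\<bar> \<le> B" "\<And>x. norm (gradient f x) \<le> B"
    using test_functions_bounded[OF f] by blast
  have B0: "0 \<le> B" using order_trans[OF norm_ge_zero B(2)] .
  obtain R where R: "\<And>x. x \<in> closure {x. f x \<noteq> 0} \<Longrightarrow> norm x \<le> R"
    using compact_imp_bounded[OF test_functionsD(2)[OF f]] unfolding bounded_iff by blast
  have R: "norm x \<le> R" if "f x \<noteq> 0" for x using R test_functions_outside_support(1)[of x f] that by blast
  define w where "w x = B * norm h * indicat_real (cball 0 (R + norm h)) x" for x :: 'a
  have c: "emeasure lborel (cball (0::'a) r) < \<infinity>" for r
    using emeasure_lborel_cball_finite[of "0::'a" r] by simp
  show ?thesis
  proof (rule that[of w])
    show "integrable lborel w" unfolding w_def using c by (intro integrable_mult_right integrable_real_indicator) auto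
    have "(\<lambda>x. w x powr p) = (\<lambda>x. (B * norm h) powr p * indicat_real (cball 0 (R + norm h)) x)" if "0 < p" for p
      by (auto simp: w_def indicator_def fun_eq_iff)
    then show "integrable lborel (\<lambda>x. w x powr p)" if "0 < p" for p
      using that c by (auto intro!: integrable_mult_right integrable_real_indicator)
    show "\<bar>(f (x + (1/2)^n *\<^sub>R h) - f x) / (1/2)^n\<bar> \<le> w x" for n x
    proof (cases "norm x \<le> R + norm h")
      case True
      have "\<bar>f (x + (1/2)^n *\<^sub>R h) - f x\<bar> \<le> B * norm ((1/2)^n *\<^sub>R h)"
        using test_function_lipschitz[OF f B(2), of "x + (1/2)^n *\<^sub>R h" x] by simp
      then have "\<bar>f (x + (1/2)^n *\<^sub>R h) - f x\<bar> / (1/2)^n \<le> B * norm h"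
        by (subst pos_divide_le_eq) (simp_all add: mult_ac)
      moreover have "\<bar>(f (x + (1/2)^n *\<^sub>R h) - f x) / (1/2)^n\<bar> = \<bar>f (x + (1/2)^n *\<^sub>R h) - f x\<bar> / (1/2)^n"
        by (simp only: abs_divide) simp
      ultimately show ?thesis using True by (simp only: w_def) simp
    next
      case False
      have "norm ((1/2)^n *\<^sub>R h) \<le> norm h" by (simp add: power_le_one mult_left_le_one_le)
      moreover have "norm x \<le> norm (x + (1/2)^n *\<^sub>R h) + norm ((1/2)^n *\<^sub>R h)"
        using norm_triangle_ineq4[of "x + (1/2)^n *\<^sub>R h" "(1/2)^n *\<^sub>R h"] by simp
      ultimately have "f (x + (1/2)^n *\<^sub>R h) = 0" "f x = 0"
        using R[of x] R[of "x + (1/2)^n *\<^sub>R h"] False norm_ge_zero[of h] by force+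
      then show ?thesis using B0 by (simp add: w_def)
    qed
    show "(\<lambda>n. (f (x + (1/2)^n *\<^sub>R h) - f x) / (1/2)^n) \<longlonglongrightarrow> gradient f x \<bullet> h" for x
    proof -
      have "((\<lambda>t. f (x + t *\<^sub>R h)) has_derivative (\<lambda>t. gradient f x \<bullet> (t *\<^sub>R h))) (at 0)"
      proof (rule has_derivative_compose[where g=f, of "\<lambda>t. x + t *\<^sub>R h"])
        show "((\<lambda>t. x + t *\<^sub>R h) has_derivative (\<lambda>t. t *\<^sub>R h)) (at 0)"
          by (auto intro!: derivative_eq_intros)
        show "(f has_derivative (\<lambda>h. gradient f x \<bullet> h)) (at (x + 0 *\<^sub>R h))"
          using test_functionsD(5)[OF f] by simp
      qed
      moreover have "(\<lambda>t. gradient f x \<bullet> (t *\<^sub>R h)) = (*) (gradient f x \<bullet> h)" by (auto simp: fun_eq_iff)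
      ultimately have "((\<lambda>t. f (x + t *\<^sub>R h)) has_real_derivative (gradient f x \<bullet> h)) (at 0)"
        by (simp only: has_field_derivative_def)
      then have "(\<lambda>t. (f (x + (0 + t) *\<^sub>R h) - f (x + 0 *\<^sub>R h)) / t) \<midarrow>0\<rightarrow> gradient f x \<bullet> h"
        unfolding DERIV_def by simp
      moreover have "filterlim (\<lambda>n. (1/2::real)^n) (at 0) sequentially"
        by (intro filterlim_atI LIMSEQ_power_zero) auto
      ultimately have "(\<lambda>n. (f (x + (0 + (1/2)^n) *\<^sub>R h) - f (x + 0 *\<^sub>R h)) / (1/2)^n) \<longlonglongrightarrow> gradient f x \<bullet> h"
        by (rule filterlim_compose)
      then show ?thesis by simp
    qed
  qed
qed

lemma lborel_integral_translate:
  fixes f :: "'a::euclidean_space \<Rightarrow> 'b::{banach, second_countable_topology}"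
  assumes "f \<in> borel_measurable borel"
  shows "(\<integral>x. f (x + c) \<partial>lborel) = (\<integral>x. f x \<partial>lborel)"
proof -
  have "(\<integral>x. f x \<partial>lborel) = (\<integral>x. f x \<partial>distr lborel borel ((+) c))" by (simp add: lborel_distr_plus)
  also have "\<dots> = (\<integral>x. f (c + x) \<partial>lborel)" using assms by (intro integral_distr) auto
  finally show ?thesis by (simp add: add.commute)
qed

lemma lborel_integrable_translate:
  fixes f :: "'a::euclidean_space \<Rightarrow> 'b::{banach, second_countable_topology}"
  assumes "integrable lborel f"
  shows "integrable lborel (\<lambda>x. f (x + c))"
proof -
  have "integrable (distr lborel borel ((+) c)) f" using assms by (simp add: lborel_distr_plus)
  then have "integrable lborel (\<lambda>x. f (c + x))" by (rule integrable_distr[rotated]) auto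
  then show ?thesis by (simp add: add.commute)
qed

lemma test_function_measurable:
  assumes "f \<in> test_functions \<Omega>"
  shows "f \<in> borel_measurable borel" "gradient f \<in> borel_measurable borel"
  using test_functionsD(7,8)[OF assms] by (auto intro: borel_measurable_continuous_onI)

lemma test_function_integrable:
  assumes f: "f \<in> test_functions \<Omega>"
  shows "integrable lborel f" "0 < q \<Longrightarrow> integrable lborel (\<lambda>x. \<bar>f x\<bar> powr q)"
    "0 < q \<Longrightarrow> integrable lborel (\<lambda>x. norm (gradient f x) powr q)" "integrable lborel (gradient f)"
proof -
  let ?K = "closure {x. f x \<noteq> 0}"
  obtain B where B: "\<And>x. \<bar>f x\<bar> \<le> B" "\<And>x. norm (gradient f x) \<le> B"
    using test_functions_bounded[OF f] by blast
  have i: "integrable lborel (\<lambda>x. c * indicat_real ?K x)" for c :: real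
    using emeasure_compact_finite[OF test_functionsD(2)[OF f]] by (intro integrable_mult_right integrable_real_indicator) auto
  note m = test_function_measurable[OF f]
  have out: "x \<notin> ?K \<Longrightarrow> f x = 0" "x \<notin> ?K \<Longrightarrow> gradient f x = 0" for x
    using test_functions_outside_support[of x f] by auto
  have B0: "0 \<le> B" using order_trans[OF norm_ge_zero B(2)] .
  have le: "\<bar>f x\<bar> \<le> \<bar>B * indicat_real ?K x\<bar>" "norm (gradient f x) \<le> \<bar>B * indicat_real ?K x\<bar>" for x
    using B0 B[of x] out[of x] by (cases "x \<in> ?K"; simp)+
  show "integrable lborel f"
    by (rule Bochner_Integration.integrable_bound[OF i[of B]]) (use m le in \<open>simp_all\<close>)
  show "integrable lborel (gradient f)"
    by (rule Bochner_Integration.integrable_bound[OF i[of B]]) (use m le in \<open>simp_all\<close>)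
  assume q: "0 < q"
  have le: "\<bar>f x\<bar> powr q \<le> \<bar>B powr q * indicat_real ?K x\<bar>" "norm (gradient f x) powr q \<le> \<bar>B powr q * indicat_real ?K x\<bar>" for x
    using B0 B[of x] out[of x] q by (cases "x \<in> ?K"; simp add: powr_mono2)+
  show "integrable lborel (\<lambda>x. \<bar>f x\<bar> powr q)"
    by (rule Bochner_Integration.integrable_bound[OF i[of "B powr q"]]) (use m le in \<open>simp_all\<close>)
  show "integrable lborel (\<lambda>x. norm (gradient f x) powr q)"
    by (rule Bochner_Integration.integrable_bound[OF i[of "B powr q"]]) (use m le in \<open>simp_all\<close>)
qed

text \<open>By translation invariance the integrals of the difference quotients vanish, and dominated convergence
  passes to the limit.\<close>

lemma integral_gradient_eq_0:
  assumes f: "f \<in> test_functions \<Omega>"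
  shows "(\<integral>x. gradient f x \<bullet> h \<partial>lborel) = 0"
proof -
  obtain w where w: "integrable lborel w" "\<And>n x. \<bar>(f (x + (1/2)^n *\<^sub>R h) - f x) / (1/2)^n\<bar> \<le> w x"
    "\<And>x. (\<lambda>n. (f (x + (1/2)^n *\<^sub>R h) - f x) / (1/2)^n) \<longlonglongrightarrow> gradient f x \<bullet> h"
    by (rule test_function_difference_quotient[OF f, of h]) (rule that)
  note [measurable] = test_function_measurable[OF f]
  have "(\<lambda>n. \<integral>x. (f (x + (1/2)^n *\<^sub>R h) - f x) / (1/2)^n \<partial>lborel) \<longlonglongrightarrow> (\<integral>x. gradient f x \<bullet> h \<partial>lborel)"
    by (rule integral_dominated_convergence[where w=w]) (use w in auto)
  moreover have "(\<integral>x. (f (x + (1/2)^n *\<^sub>R h) - f x) / (1/2)^n \<partial>lborel) = 0" for n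
    using test_function_integrable(1)[OF f] lborel_integrable_translate[OF test_function_integrable(1)[OF f]]
      lborel_integral_translate[OF test_function_measurable(1)[OF f]]
    by simp
  ultimately show ?thesis by (simp add: LIMSEQ_const_iff)
qed

text \<open>Writing \<open>D z\<close> for the left-hand side, the triangle inequality and translation invariance give
  \<open>D (2 z) \<le> 2^q D z\<close>. So \<open>D z\<close> is bounded by \<open>D (z / 2^n)\<close> scaled by \<open>2^(n q)\<close>,
  which tends to the integral of \<open>|grad f \<bullet> z|^q\<close>. This avoids integration along segments.\<close>

lemma translation_estimate:
  assumes f: "f \<in> test_functions \<Omega>" and q: "1 < q"
  shows "(\<integral>x. \<bar>f (x + z) - f x\<bar> powr q \<partial>lborel) \<le> norm z powr q * (\<integral>x. norm (gradient f x) powr q \<partial>lborel)"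
proof -
  note [measurable] = test_function_measurable[OF f]
  have q0: "0 < q" using q by simp
  define D where "D z = (\<integral>x. \<bar>f (x + z) - f x\<bar> powr q \<partial>lborel)" for z
  have fi: "integrable lborel (\<lambda>x. \<bar>f (x + z) - f x\<bar> powr q)" for z
  proof (rule Bochner_Integration.integrable_bound)
    show "integrable lborel (\<lambda>x. 2 powr q * (\<bar>f (x + z)\<bar> powr q + \<bar>f x\<bar> powr q))"
      using test_function_integrable(2)[OF f q0] lborel_integrable_translate[OF test_function_integrable(2)[OF f q0]]
      by (intro integrable_mult_right Bochner_Integration.integrable_add)
    show "AE x in lborel. norm (\<bar>f (x + z) - f x\<bar> powr q) \<le> norm (2 powr q * (\<bar>f (x + z)\<bar> powr q + \<bar>f x\<bar> powr q))"
    proof (rule AE_I2)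
      fix x show "norm (\<bar>f (x + z) - f x\<bar> powr q) \<le> norm (2 powr q * (\<bar>f (x + z)\<bar> powr q + \<bar>f x\<bar> powr q))"
        using norm_diff_powr_le[OF q0, of "f (x + z)" "f x"] by simp
    qed
  qed measurable
  have double: "D (2 *\<^sub>R z) \<le> 2 powr q * D z" for z
  proof -
    have le: "\<bar>f (x + 2 *\<^sub>R z) - f x\<bar> powr q \<le> 2 powr q * ((\<bar>f (x + z + z) - f (x + z)\<bar> powr q + \<bar>f (x + z) - f x\<bar> powr q) / 2)" for x
    proof -
      let ?a = "f (x + z + z) - f (x + z)" and ?b = "f (x + z) - f x"
      have "f (x + 2 *\<^sub>R z) - f x = ?a + ?b" by (simp add: scaleR_2 add.assoc)
      then have "\<bar>f (x + 2 *\<^sub>R z) - f x\<bar> powr q \<le> (2 * ((\<bar>?a\<bar> + \<bar>?b\<bar>) / 2)) powr q"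
        using q0 abs_triangle_ineq[of ?a ?b] by (intro powr_mono2) auto
      also have "\<dots> = 2 powr q * ((\<bar>?a\<bar> + \<bar>?b\<bar>) / 2) powr q" by (subst powr_mult) auto
      also have "\<dots> \<le> 2 powr q * ((\<bar>?a\<bar> powr q + \<bar>?b\<bar> powr q) / 2)"
        by (intro mult_left_mono powr_midpoint_le q) auto
      finally show ?thesis .
    qed
    have i2: "integrable lborel (\<lambda>x. \<bar>f (x + z + z) - f (x + z)\<bar> powr q)"
      using lborel_integrable_translate[OF fi, of z z] .
    have e2: "(\<integral>x. \<bar>f (x + z + z) - f (x + z)\<bar> powr q \<partial>lborel) = D z"
      using lborel_integral_translate[of "\<lambda>x. \<bar>f (x + z) - f x\<bar> powr q" z] unfolding D_def by simp
    have "D (2 *\<^sub>R z) \<le> (\<integral>x. 2 powr q * ((\<bar>f (x + z + z) - f (x + z)\<bar> powr q + \<bar>f (x + z) - f x\<bar> powr q) / 2) \<partial>lborel)"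
      unfolding D_def using fi i2 by (intro integral_mono le) auto
    also have "\<dots> = 2 powr q * ((D z + D z) / 2)"
      using fi i2 e2 by (simp add: D_def)
    finally show ?thesis by simp
  qed
  have scaled: "D z \<le> (2 ^ n) powr q * D ((1/2)^n *\<^sub>R z)" for n
  proof (induction n)
    case (Suc n)
    have "(1/2)^n *\<^sub>R z = 2 *\<^sub>R ((1/2)^Suc n *\<^sub>R z)" by simp
    then have "D ((1/2)^n *\<^sub>R z) \<le> 2 powr q * D ((1/2)^Suc n *\<^sub>R z)" using double by metis
    then have "(2 ^ n) powr q * D ((1/2)^n *\<^sub>R z) \<le> (2 ^ n) powr q * (2 powr q * D ((1/2)^Suc n *\<^sub>R z))"
      by (intro mult_left_mono) auto
    also have "\<dots> = (2 ^ Suc n) powr q * D ((1/2)^Suc n *\<^sub>R z)" by (simp add: powr_mult mult_ac)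
    finally show ?case using Suc by linarith
  qed simp
  obtain w where w: "\<And>p. 0 < p \<Longrightarrow> integrable lborel (\<lambda>x. w x powr p)" "\<And>n x. \<bar>(f (x + (1/2)^n *\<^sub>R z) - f x) / (1/2)^n\<bar> \<le> w x"
    "\<And>x. (\<lambda>n. (f (x + (1/2)^n *\<^sub>R z) - f x) / (1/2)^n) \<longlonglongrightarrow> gradient f x \<bullet> z"
    by (rule test_function_difference_quotient[OF f, of z]) (rule that)
  have lim: "(\<lambda>n. \<integral>x. \<bar>(f (x + (1/2)^n *\<^sub>R z) - f x) / (1/2)^n\<bar> powr q \<partial>lborel) \<longlonglongrightarrow> (\<integral>x. \<bar>gradient f x \<bullet> z\<bar> powr q \<partial>lborel)"
  proof (rule integral_dominated_convergence[where w="\<lambda>x. w x powr q"])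
    show "AE x in lborel. (\<lambda>n. \<bar>(f (x + (1/2)^n *\<^sub>R z) - f x) / (1/2)^n\<bar> powr q) \<longlonglongrightarrow> \<bar>gradient f x \<bullet> z\<bar> powr q"
      using q0 by (intro AE_I2 tendsto_powr' tendsto_rabs w(3)) auto
    show "AE x in lborel. norm (\<bar>(f (x + (1/2)^n *\<^sub>R z) - f x) / (1/2)^n\<bar> powr q) \<le> w x powr q" for n
    proof (rule AE_I2)
      fix x show "norm (\<bar>(f (x + (1/2)^n *\<^sub>R z) - f x) / (1/2)^n\<bar> powr q) \<le> w x powr q"
        using powr_mono2[OF less_imp_le[OF q0] abs_ge_zero w(2)] by simp
    qed
    show "(\<lambda>x. \<bar>gradient f x \<bullet> z\<bar> powr q) \<in> borel_measurable lborel" by measurable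
    show "(\<lambda>x. \<bar>(f (x + (1/2)^n *\<^sub>R z) - f x) / (1/2)^n\<bar> powr q) \<in> borel_measurable lborel" for n by measurable
  qed (rule w(1)[OF q0])
  have "D z \<le> (\<integral>x. \<bar>gradient f x \<bullet> z\<bar> powr q \<partial>lborel)"
  proof (rule LIMSEQ_le_const[OF lim], intro exI[of _ 0] allI impI)
    fix n :: nat
    have "(2 ^ n) powr q * D ((1/2)^n *\<^sub>R z) = (\<integral>x. \<bar>(f (x + (1/2)^n *\<^sub>R z) - f x) / (1/2)^n\<bar> powr q \<partial>lborel)"
    proof -
      have *: "(2 ^ n) powr q * \<bar>a\<bar> powr q = \<bar>a / (1/2)^n\<bar> powr q" for a :: real
      proof -
        have "\<bar>a / (1/2)^n\<bar> = 2 ^ n * \<bar>a\<bar>" by (simp add: power_one_over abs_mult)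
        then show ?thesis by (simp add: powr_mult)
      qed
      show ?thesis unfolding D_def *[symmetric] by simp
    qed
    then show "D z \<le> (\<integral>x. \<bar>(f (x + (1/2)^n *\<^sub>R z) - f x) / (1/2)^n\<bar> powr q \<partial>lborel)"
      using scaled[of n] by simp
  qed
  also have "\<dots> \<le> (\<integral>x. norm z powr q * norm (gradient f x) powr q \<partial>lborel)"
  proof (rule integral_mono')
    show "integrable lborel (\<lambda>x. norm z powr q * norm (gradient f x) powr q)"
      using test_function_integrable(3)[OF f q0] by (rule integrable_mult_right)
    show "\<bar>gradient f x \<bullet> z\<bar> powr q \<le> norm z powr q * norm (gradient f x) powr q" for x
      using Cauchy_Schwarz_ineq2[of "gradient f x" z] q0
      by (auto simp: mult.commute intro!: powr_mono2 simp flip: powr_mult)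
  qed auto
  finally show ?thesis unfolding D_def by simp
qed

section \<open>Weak gradients\<close>

context bounded_domain
begin

lemma borel_imp_lebesgue: "A \<in> sets borel \<Longrightarrow> A \<in> sets lebesgue"
  by (simp add: sets_completionI_sets)

lemma borel_measurable_M: "f \<in> borel_measurable borel \<Longrightarrow> f \<in> borel_measurable M"
  by (simp add: measurable_completion measurable_restrict_space1)

lemma M_integrable_lebesgue: 
  fixes g :: "'a \<Rightarrow> 'b::{banach, second_countable_topology}"
  shows "integrable M g \<longleftrightarrow> integrable lebesgue (\<lambda>x. indicator \<Omega> x *\<^sub>R g x)"
    "(\<integral>x. g x \<partial>M) = (\<integral>x. indicator \<Omega> x *\<^sub>R g x \<partial>lebesgue)"
  by (simp_all add: integrable_restrict_space integral_restrict_space)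

lemma M_lborel:
  fixes g :: "'a \<Rightarrow> 'b::{banach, second_countable_topology}"
  assumes g: "g \<in> borel_measurable borel" and out: "\<And>x. x \<notin> \<Omega> \<Longrightarrow> g x = 0"
  shows "(\<integral>x. g x \<partial>M) = (\<integral>x. g x \<partial>lborel)" "integrable M g \<longleftrightarrow> integrable lborel g"
proof -
  have eq: "(\<lambda>x. indicator \<Omega> x *\<^sub>R g x) = g" using out by (auto simp: indicator_def fun_eq_iff)
  show "(\<integral>x. g x \<partial>M) = (\<integral>x. g x \<partial>lborel)" "integrable M g \<longleftrightarrow> integrable lborel g"
    using g by (simp_all add: M_integrable_lebesgue eq integral_completion integrable_completion)
qed

lemma test_function_Lp:
  assumes f: "f \<in> test_functions \<Omega>" and s: "0 < s"
  shows "f \<in> Lp s \<Omega>" "gradient f \<in> Lp s \<Omega>"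
    "powint s f = (\<integral>x. \<bar>f x\<bar> powr s \<partial>lborel)" "powint s (gradient f) = (\<integral>x. norm (gradient f x) powr s \<partial>lborel)"
proof -
  note m = test_function_measurable[OF f]
  have m2: "(\<lambda>x. norm (f x) powr s) \<in> borel_measurable borel" "(\<lambda>x. norm (gradient f x) powr s) \<in> borel_measurable borel"
    using m by measurable
  have o: "x \<notin> \<Omega> \<Longrightarrow> norm (f x) powr s = 0" "x \<notin> \<Omega> \<Longrightarrow> norm (gradient f x) powr s = 0" for x
    using test_functions_outside[OF f, of x] by auto
  show "f \<in> Lp s \<Omega>"
    using M_lborel(2)[OF m2(1) o(1)] test_function_integrable(2)[OF f s] borel_measurable_M[OF m(1)] by (intro LpI) auto
  show "gradient f \<in> Lp s \<Omega>"
    using M_lborel(2)[OF m2(2) o(2)] test_function_integrable(3)[OF f s] borel_measurable_M[OF m(2)] by (intro LpI) auto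
  show "powint s f = (\<integral>x. \<bar>f x\<bar> powr s \<partial>lborel)"
    using M_lborel(1)[OF m2(1) o(1)] by (simp add: powint_def)
  show "powint s (gradient f) = (\<integral>x. norm (gradient f x) powr s \<partial>lborel)"
    using M_lborel(1)[OF m2(2) o(2)] by (simp add: powint_def)
qed

lemma Lp_integrable:
  fixes f :: "'a \<Rightarrow> 'b::euclidean_space"
  assumes "f \<in> Lp s \<Omega>" "1 \<le> s" shows "integrable M f"
  using LpD[OF Lp_lower_exponent[OF assms(1) zero_less_one assms(2)]]
  by (simp add: integrable_norm_iff)

lemma Lp_locally_integrable:
  fixes f :: "'a \<Rightarrow> 'b::euclidean_space"
  assumes "f \<in> Lp s \<Omega>" "1 \<le> s" shows "locally_integrable \<Omega> f"
  unfolding locally_integrable_def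
proof (intro allI impI, elim conjE)
  fix K assume K: "compact K" "K \<subseteq> \<Omega>"
  have "set_integrable lebesgue \<Omega> f"
    using Lp_integrable[OF assms] by (simp add: set_integrable_def M_integrable_lebesgue)
  then show "set_integrable lebesgue K f"
    by (rule set_integrable_subset) (use K borel_imp_lebesgue[OF borel_compact[OF K(1)]] in auto)
qed

lemma integrable_mult_compact:
  fixes g :: "'a \<Rightarrow> 'b::euclidean_space" and m :: "'a \<Rightarrow> real"
  assumes g: "locally_integrable \<Omega> g" and K: "compact K" "K \<subseteq> \<Omega>"
    and m: "m \<in> borel_measurable borel" "\<And>x. \<bar>m x\<bar> \<le> B" "\<And>x. x \<notin> K \<Longrightarrow> m x = 0"
  shows "integrable M (\<lambda>x. m x *\<^sub>R g x)"
proof -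
  have eq: "(\<lambda>x. indicator \<Omega> x *\<^sub>R m x *\<^sub>R g x) = (\<lambda>x. m x *\<^sub>R (indicator K x *\<^sub>R g x))"
    using m(3) K(2) by (auto simp: indicator_def fun_eq_iff)
  have i: "integrable lebesgue (\<lambda>x. indicator K x *\<^sub>R g x)"
    using g K unfolding locally_integrable_def set_integrable_def by blast
  have "integrable lebesgue (\<lambda>x. m x *\<^sub>R (indicator K x *\<^sub>R g x))"
  proof (rule Bochner_Integration.integrable_bound[OF integrable_mult_right[OF integrable_norm[OF i], of B]])
    have "m \<in> borel_measurable lebesgue" using m(1) by (simp add: measurable_completion)
    then show "(\<lambda>x. m x *\<^sub>R (indicator K x *\<^sub>R g x)) \<in> borel_measurable lebesgue"
      using borel_measurable_integrable[OF i] by measurable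
    show "AE x in lebesgue. norm (m x *\<^sub>R (indicator K x *\<^sub>R g x)) \<le> norm (B * norm (indicator K x *\<^sub>R g x))"
    proof (rule AE_I2)
      fix x
      have "norm (m x *\<^sub>R (indicator K x *\<^sub>R g x)) = \<bar>m x\<bar> * norm (indicator K x *\<^sub>R g x)" by (simp add: abs_mult)
      also have "\<dots> \<le> B * norm (indicator K x *\<^sub>R g x)" by (rule mult_right_mono[OF m(2) norm_ge_zero])
      also have "\<dots> \<le> norm (B * norm (indicator K x *\<^sub>R g x))" unfolding real_norm_def by (rule abs_ge_self)
      finally show "norm (m x *\<^sub>R (indicator K x *\<^sub>R g x)) \<le> norm (B * norm (indicator K x *\<^sub>R g x))" .
    qed
  qed
  then show ?thesis unfolding M_integrable_lebesgue eq .
qed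

lemma integrable_mult_test:
  fixes g :: "'a \<Rightarrow> 'b::euclidean_space"
  assumes "locally_integrable \<Omega> g" "\<phi> \<in> test_functions \<Omega>"
  shows "integrable M (\<lambda>x. \<phi> x *\<^sub>R g x)" "integrable M (\<lambda>x. (gradient \<phi> x \<bullet> h) *\<^sub>R g x)"
proof -
  obtain B where B: "\<And>x. \<bar>\<phi> x\<bar> \<le> B" "\<And>x. norm (gradient \<phi> x) \<le> B"
    using test_functions_bounded[OF assms(2)] by blast
  note m = test_function_measurable[OF assms(2)]
  show "integrable M (\<lambda>x. \<phi> x *\<^sub>R g x)"
    by (rule integrable_mult_compact[OF assms(1) test_functionsD(2,3)[OF assms(2)] m(1) B(1)])
      (erule test_functions_outside_support(1))
  have le: "\<bar>gradient \<phi> x \<bullet> h\<bar> \<le> B * norm h" for x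
    using Cauchy_Schwarz_ineq2[of "gradient \<phi> x" h] mult_right_mono[OF B(2) norm_ge_zero, of x h] by linarith
  show "integrable M (\<lambda>x. (gradient \<phi> x \<bullet> h) *\<^sub>R g x)"
  proof (rule integrable_mult_compact[OF assms(1) test_functionsD(2,3)[OF assms(2)] _ le])
    show "(\<lambda>x. gradient \<phi> x \<bullet> h) \<in> borel_measurable borel" using m(2) by measurable
  qed (simp add: test_functions_outside_support(2))
qed

text \<open>The bump functions of the box are bounded test functions that converge to its indicator function.\<close>

lemma integral_box_eq_0:
  fixes h :: "'a \<Rightarrow> real"
  assumes h: "locally_integrable \<Omega> h" and zero: "\<And>\<phi>. \<phi> \<in> test_functions \<Omega> \<Longrightarrow> (\<integral>x. h x * \<phi> x \<partial>M) = 0"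
    and K: "cbox c d \<subseteq> \<Omega>"
  shows "(\<integral>x. indicator (box c d) x * h x \<partial>lebesgue) = 0"
proof -
  let ?b = "\<lambda>n. bump (real (Suc n)) c d"
  have t: "?b n \<in> test_functions \<Omega>" for n by (rule bump_test_function[OF _ K]) simp
  have i: "integrable lebesgue (\<lambda>x. indicator (cbox c d) x * h x)"
    using h K compact_cbox[of c d] unfolding locally_integrable_def set_integrable_def by force
  have "(\<lambda>n. \<integral>x. ?b n x * (indicator (cbox c d) x * h x) \<partial>lebesgue) \<longlonglongrightarrow> (\<integral>x. indicator (box c d) x * (indicator (cbox c d) x * h x) \<partial>lebesgue)"
  proof (rule integral_dominated_convergence[OF _ _ integrable_norm[OF i]])
    have m: "?b n \<in> borel_measurable lebesgue" for n
      using test_function_measurable(1)[OF t[of n]] by (simp add: measurable_completion)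
    show "(\<lambda>x. ?b n x * (indicator (cbox c d) x * h x)) \<in> borel_measurable lebesgue" for n
      by (rule borel_measurable_times[OF m borel_measurable_integrable[OF i]])
    have "indicat_real (box c d) \<in> borel_measurable lebesgue" by (intro borel_measurable_indicator borel_imp_lebesgue) simp
    then show "(\<lambda>x. indicator (box c d) x * (indicator (cbox c d) x * h x)) \<in> borel_measurable lebesgue"
      by (rule borel_measurable_times[OF _ borel_measurable_integrable[OF i]])
    show "AE x in lebesgue. (\<lambda>n. ?b n x * (indicator (cbox c d) x * h x)) \<longlonglongrightarrow> indicator (box c d) x * (indicator (cbox c d) x * h x)"
      by (intro AE_I2 tendsto_mult bump_tendsto tendsto_const)
    show "AE x in lebesgue. norm (?b n x * (indicator (cbox c d) x * h x)) \<le> norm (indicator (cbox c d) x * h x)" for n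
    proof (rule AE_I2)
      fix x
      have "norm (?b n x * (indicator (cbox c d) x * h x)) = ?b n x * norm (indicator (cbox c d) x * h x)"
        using bump_bounds(1)[of "real (Suc n)" c d x] by (simp add: abs_mult)
      also have "\<dots> \<le> 1 * norm (indicator (cbox c d) x * h x)" by (intro mult_right_mono bump_bounds norm_ge_zero)
      finally show "norm (?b n x * (indicator (cbox c d) x * h x)) \<le> norm (indicator (cbox c d) x * h x)" by simp
    qed
  qed
  moreover have "(\<integral>x. ?b n x * (indicator (cbox c d) x * h x) \<partial>lebesgue) = 0" for n
  proof -
    have eq: "?b n x * (indicator (cbox c d) x * h x) = indicator \<Omega> x *\<^sub>R (h x * ?b n x)" for x
    proof (cases "x \<in> cbox c d")
      case True then show ?thesis using K by (auto simp: indicator_def)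
    next
      case False
      then have "?b n x = 0" using bump_nonzero_iff[of "real (Suc n)" c d x] box_subset_cbox[of c d] by auto
      then show ?thesis by simp
    qed
    show ?thesis unfolding eq using zero[OF t[of n]] by (simp only: M_integrable_lebesgue(2))
  qed
  moreover have "indicator (box c d) x * (indicator (cbox c d) x * h x) = indicator (box c d) x * h x" for x
    using box_subset_cbox[of c d] by (auto simp: indicator_def)
  ultimately show ?thesis by (simp add: LIMSEQ_const_iff)
qed

text \<open>Boxes form an intersection-stable generator of the Borel sets, so a function that is integrable and has
  zero integral over all boxes has zero integral over all Borel sets. The passage to a Borel measurable
  version is needed because the given function is only Lebesgue measurable.\<close>

lemma AE_box_eq_0:
  fixes h :: "'a \<Rightarrow> real"
  assumes h: "locally_integrable \<Omega> h" and zero: "\<And>\<phi>. \<phi> \<in> test_functions \<Omega> \<Longrightarrow> (\<integral>x. h x * \<phi> x \<partial>M) = 0"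
    and K: "cbox c d \<subseteq> \<Omega>"
  shows "AE x in lborel. indicator (box c d) x * h x = 0"
proof -
  define f where "f x = indicator (box c d) x * h x" for x
  have "set_integrable lebesgue (cbox c d) h"
    using h K compact_cbox[of c d] unfolding locally_integrable_def by blast
  then have "set_integrable lebesgue (box c d) h"
    by (rule set_integrable_subset) (auto simp: box_subset_cbox)
  then have i: "integrable lebesgue f" unfolding f_def set_integrable_def by simp
  obtain f' where f': "f' \<in> borel_measurable lborel" "AE x in lborel. f x = f' x"
    using completion_ex_borel_measurable_real[OF borel_measurable_integrable[OF i]] by blast
  have f'l: "f' \<in> borel_measurable lebesgue" using f'(1) by (simp add: measurable_completion)
  have AEl: "AE x in lebesgue. f x = f' x" using f'(2) by (rule AE_completion)
  have "integrable lebesgue f'"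
    using integrable_cong_AE[OF borel_measurable_integrable[OF i] f'l AEl] i by simp
  then have i': "integrable lborel f'" using f'(1) by (simp add: integrable_completion)
  define I where "I A = (\<integral>x. indicator A x *\<^sub>R f' x \<partial>lborel)" for A
  have iA: "set_integrable lborel A f'" if "A \<in> sets borel" for A
    using i' that unfolding set_integrable_def by (intro integrable_mult_indicator) auto
  have I_leb: "I A = (\<integral>x. indicator A x * f x \<partial>lebesgue)" if "A \<in> sets borel" for A
  proof -
    have "I A = (\<integral>x. indicator A x *\<^sub>R f' x \<partial>lebesgue)"
      unfolding I_def using borel_measurable_integrable[OF iA[OF that, unfolded set_integrable_def]] by (simp add: integral_completion)
    also have "\<dots> = (\<integral>x. indicator A x * f x \<partial>lebesgue)"
    proof (rule integral_cong_AE)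
      have A: "indicat_real A \<in> borel_measurable lebesgue" by (intro borel_measurable_indicator borel_imp_lebesgue that)
      show "(\<lambda>x. indicator A x *\<^sub>R f' x) \<in> borel_measurable lebesgue" using borel_measurable_times[OF A f'l] by simp
      show "(\<lambda>x. indicator A x * f x) \<in> borel_measurable lebesgue"
        using borel_measurable_times[OF A borel_measurable_integrable[OF i]] by simp
      show "AE x in lebesgue. indicator A x *\<^sub>R f' x = indicator A x * f x" using AEl by eventually_elim simp
    qed
    finally show ?thesis .
  qed
  have I_box: "I (box a b) = 0" for a b
  proof -
    let ?a = "\<Sum>i\<in>Basis. max (a \<bullet> i) (c \<bullet> i) *\<^sub>R i" and ?b = "\<Sum>i\<in>Basis. min (b \<bullet> i) (d \<bullet> i) *\<^sub>R i"
    have eq: "box a b \<inter> box c d = box ?a ?b" by (rule box_Int_box)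
    have "cbox ?a ?b \<subseteq> cbox c d" by (auto simp: mem_box inner_sum_left_Basis)
    then have sub: "cbox ?a ?b \<subseteq> \<Omega>" using K by blast
    have "(\<integral>x. indicator (box ?a ?b) x * h x \<partial>lebesgue) = 0" by (rule integral_box_eq_0[OF h zero sub])
    moreover have "indicator (box a b) x * f x = indicator (box ?a ?b) x * h x" for x
      unfolding f_def eq[symmetric] by (simp add: indicator_inter_arith mult.assoc)
    ultimately show ?thesis using I_leb[of "box a b"] by simp
  qed
  have I_UNIV: "I UNIV = 0"
  proof -
    have "(\<integral>x. indicator (box c d) x * h x \<partial>lebesgue) = 0" by (rule integral_box_eq_0[OF h zero K])
    then show ?thesis using I_leb[of UNIV] by (simp add: f_def)
  qed
  have borel: "(borel :: 'a measure) = sigma UNIV (range (\<lambda>(a, b). box a b))" by (rule borel_eq_box)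
  have I0: "I A = 0" if "A \<in> sets borel" for A
  proof -
    have "A \<in> sigma_sets UNIV (range (\<lambda>(a, b). box a b))" using that by (simp add: borel_eq_box)
    then show ?thesis
    proof (rule sigma_sets_induct_disjoint[where P="\<lambda>A. I A = 0", rotated 2])
      show "Int_stable (range (\<lambda>(a, b). box a b :: 'a set))"
        by (auto simp: Int_stable_def box_Int_box)
      show "I A = 0" if "A \<in> range (\<lambda>(a, b). box a b)" for A using that I_box by auto
      show "I {} = 0" by (simp add: I_def)
    next
      fix A assume A: "A \<in> sigma_sets UNIV (range (\<lambda>(a, b). box a b :: 'a set))" "I A = 0"
      then have Ab: "A \<in> sets borel" by (simp add: borel_eq_box)
      have "I (UNIV - A) = (\<integral>x. indicator UNIV x *\<^sub>R f' x - indicator A x *\<^sub>R f' x \<partial>lborel)"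
        unfolding I_def by (intro Bochner_Integration.integral_cong) (auto simp: indicator_def)
      also have "\<dots> = I UNIV - I A"
        unfolding I_def using iA[of UNIV] iA[OF Ab] by (intro Bochner_Integration.integral_diff) (auto simp: set_integrable_def)
      finally show "I (UNIV - A) = 0" using I_UNIV A by simp
    next
      fix A :: "nat \<Rightarrow> 'a set"
      assume d: "disjoint_family A" and r: "range A \<subseteq> sigma_sets UNIV (range (\<lambda>(a, b). box a b))" and 0: "\<And>i. I (A i) = 0"
      have Ab: "A i \<in> sets borel" for i using r by (auto simp: borel_eq_box)
      have "(LINT x:(\<Union>i. A i)|lborel. f' x) = suminf (\<lambda>i. LINT x:A i|lborel. f' x)"
        by (rule lebesgue_integral_countable_add) (use Ab d iA in \<open>auto simp: disjoint_family_on_def\<close>)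
      then show "I (\<Union>i. A i) = 0" using 0 by (simp add: I_def set_lebesgue_integral_def)
    qed auto
  qed
  have "AE x in lborel. f' x = 0"
    by (rule density_unique_real[OF i' integrable_zero]) (use I0 in \<open>simp add: I_def set_lebesgue_integral_def\<close>)
  with f'(2) have "AE x in lborel. f x = 0" by eventually_elim simp
  then show ?thesis by (simp add: f_def)
qed

text \<open>The fundamental lemma of the calculus of variations, by covering the open set with countably many
  boxes.\<close>

lemma fundamental_lemma:
  fixes h :: "'a \<Rightarrow> real"
  assumes h: "locally_integrable \<Omega> h" and zero: "\<And>\<phi>. \<phi> \<in> test_functions \<Omega> \<Longrightarrow> (\<integral>x. h x * \<phi> x \<partial>M) = 0"
  shows "AE x in M. h x = 0"
proof -
  obtain D where D: "countable D" "D \<subseteq> Pow \<Omega>" "\<And>X. X \<in> D \<Longrightarrow> \<exists>a b. X = cbox a b" "\<Union>D = \<Omega>"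
    using open_countable_Union_open_cbox[OF open_dom] by metis
  have "AE x in lebesgue. x \<in> X \<longrightarrow> h x = 0" if XD: "X \<in> D" for X
  proof -
    obtain a b where X: "X = cbox a b" using D(3)[OF XD] by blast
    then have sub: "cbox a b \<subseteq> \<Omega>" using D(2) XD by blast
    have "AE x in lborel. indicator (box a b) x * h x = 0" by (rule AE_box_eq_0[OF h zero sub])
    then have 1: "AE x in lebesgue. indicator (box a b) x * h x = 0" by (rule AE_completion)
    have "cbox a b - box a b \<in> null_sets lebesgue"
      using negligible_frontier_interval[of a b] by (simp add: negligible_iff_null_sets)
    then have "AE x in lebesgue. x \<notin> cbox a b - box a b" by (rule AE_not_in)
    with 1 show ?thesis unfolding X by eventually_elim (auto simp: indicator_def split: if_splits)
  qed
  then have "AE x in lebesgue. \<forall>X\<in>D. x \<in> X \<longrightarrow> h x = 0" by (subst AE_ball_countable[OF D(1)]) blast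
  then have "AE x in lebesgue. x \<in> \<Omega> \<longrightarrow> h x = 0" using D(4) by (auto elim!: eventually_mono)
  then show ?thesis by (simp add: AE_restrict_space_iff)
qed

lemma locally_integrable_diff:
  fixes f g :: "'a \<Rightarrow> 'b::euclidean_space"
  assumes "locally_integrable \<Omega> f" "locally_integrable \<Omega> g"
  shows "locally_integrable \<Omega> (\<lambda>x. f x - g x)"
  using assms unfolding locally_integrable_def by (auto intro!: set_integral_diff(1))

lemma locally_integrable_inner:
  fixes f :: "'a \<Rightarrow> 'b::euclidean_space"
  assumes "locally_integrable \<Omega> f"
  shows "locally_integrable \<Omega> (\<lambda>x. f x \<bullet> b)"
  unfolding locally_integrable_def set_integrable_def
proof (intro allI impI, elim conjE)
  fix K assume K: "compact K" "K \<subseteq> \<Omega>"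
  have "integrable lebesgue (\<lambda>x. (indicator K x *\<^sub>R f x) \<bullet> b)"
    using assms K unfolding locally_integrable_def set_integrable_def by (intro integrable_inner_left) blast
  then show "integrable lebesgue (\<lambda>x. indicator K x *\<^sub>R (f x \<bullet> b))" by simp
qed

lemma is_weak_gradient_iff:
  "is_weak_gradient \<Omega> u g \<longleftrightarrow> locally_integrable \<Omega> u \<and> locally_integrable \<Omega> g \<and>
     (\<forall>\<phi>\<in>test_functions \<Omega>. \<forall>b\<in>Basis. (\<integral>x. (gradient \<phi> x \<bullet> b) * u x \<partial>M) = - (\<integral>x. \<phi> x * (g x \<bullet> b) \<partial>M))"
  unfolding is_weak_gradient_def by (simp add: test_functionsD(6) mult.commute)

lemma is_weak_gradient_diff:
  assumes u: "is_weak_gradient \<Omega> u g" and v: "is_weak_gradient \<Omega> v h"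
  shows "is_weak_gradient \<Omega> (\<lambda>x. u x - v x) (\<lambda>x. g x - h x)"
  unfolding is_weak_gradient_iff
proof (intro conjI ballI)
  have l: "locally_integrable \<Omega> u" "locally_integrable \<Omega> v" "locally_integrable \<Omega> g" "locally_integrable \<Omega> h"
    using u v by (auto simp: is_weak_gradient_iff)
  show "locally_integrable \<Omega> (\<lambda>x. u x - v x)" "locally_integrable \<Omega> (\<lambda>x. g x - h x)"
    by (intro locally_integrable_diff l)+
  fix \<phi> and b :: 'a assume \<phi>: "\<phi> \<in> test_functions \<Omega>" and b: "b \<in> Basis"
  have i: "integrable M (\<lambda>x. (gradient \<phi> x \<bullet> b) * u x)" "integrable M (\<lambda>x. (gradient \<phi> x \<bullet> b) * v x)"
    "integrable M (\<lambda>x. \<phi> x * (g x \<bullet> b))" "integrable M (\<lambda>x. \<phi> x * (h x \<bullet> b))"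
    using integrable_mult_test(2)[OF l(1) \<phi>] integrable_mult_test(2)[OF l(2) \<phi>]
      integrable_mult_test(1)[OF locally_integrable_inner[OF l(3)] \<phi>] integrable_mult_test(1)[OF locally_integrable_inner[OF l(4)] \<phi>]
    by simp_all
  have "(\<integral>x. (gradient \<phi> x \<bullet> b) * u x \<partial>M) = - (\<integral>x. \<phi> x * (g x \<bullet> b) \<partial>M)"
    "(\<integral>x. (gradient \<phi> x \<bullet> b) * v x \<partial>M) = - (\<integral>x. \<phi> x * (h x \<bullet> b) \<partial>M)"
    using u v \<phi> b by (auto simp: is_weak_gradient_iff)
  then show "(\<integral>x. (gradient \<phi> x \<bullet> b) * (u x - v x) \<partial>M) = - (\<integral>x. \<phi> x * ((g x - h x) \<bullet> b) \<partial>M)"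
    using i by (simp add: right_diff_distrib inner_diff_left)
qed

lemma is_weak_gradient_unique:
  assumes u: "is_weak_gradient \<Omega> u g" "is_weak_gradient \<Omega> u h"
  shows "AE x in M. g x = h x"
proof -
  have d: "is_weak_gradient \<Omega> (\<lambda>x. u x - u x) (\<lambda>x. g x - h x)" by (rule is_weak_gradient_diff[OF u])
  have l: "locally_integrable \<Omega> (\<lambda>x. g x - h x)" using d by (simp add: is_weak_gradient_iff)
  have "AE x in M. (g x - h x) \<bullet> b = 0" if b: "b \<in> Basis" for b
  proof (rule fundamental_lemma[OF locally_integrable_inner[OF l]])
    fix \<phi> assume "\<phi> \<in> test_functions \<Omega>"
    then have "(\<integral>x. \<phi> x * ((g x - h x) \<bullet> b) \<partial>M) = 0" using d b unfolding is_weak_gradient_iff by simp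
    then show "(\<integral>x. ((g x - h x) \<bullet> b) * \<phi> x \<partial>M) = 0" by (simp add: mult.commute)
  qed
  then have "AE x in M. \<forall>b\<in>Basis. (g x - h x) \<bullet> b = 0" by (intro AE_finite_allI finite_Basis)
  then show ?thesis by eventually_elim (auto intro: euclidean_eqI simp: inner_diff_left)
qed

lemma weak_grad_AE:
  assumes "is_weak_gradient \<Omega> u g" shows "AE x in M. weak_grad \<Omega> u x = g x"
  by (rule is_weak_gradient_unique[OF _ assms]) (unfold weak_grad_def, rule someI[of "is_weak_gradient \<Omega> u", OF assms])

text \<open>Integration by parts is the vanishing of the integral of the gradient of a product.\<close>

lemma test_function_weak_gradient:
  assumes f: "f \<in> test_functions \<Omega>"
  shows "is_weak_gradient \<Omega> f (gradient f)"
  unfolding is_weak_gradient_iff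
proof (intro conjI ballI)
  show "locally_integrable \<Omega> f" "locally_integrable \<Omega> (gradient f)"
    using Lp_locally_integrable[of _ 1] test_function_Lp(1,2)[OF f, of 1] by auto
  fix \<phi> and b :: 'a assume \<phi>: "\<phi> \<in> test_functions \<Omega>" and b: "b \<in> Basis"
  have t: "(\<lambda>x. f x * \<phi> x) \<in> test_functions \<Omega>" by (rule test_functions_mult[OF \<phi> test_functionsD(1)[OF f]])
  have g: "gradient (\<lambda>x. f x * \<phi> x) x \<bullet> b = (gradient \<phi> x \<bullet> b) * f x + \<phi> x * (gradient f x \<bullet> b)" for x
    unfolding gradient_mult[OF test_functionsD(4)[OF f] test_functionsD(4)[OF \<phi>]] inner_add_left inner_scaleR_left by simp
  have i: "integrable M (\<lambda>x. (gradient \<phi> x \<bullet> b) * f x)" "integrable M (\<lambda>x. \<phi> x * (gradient f x \<bullet> b))"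
    using integrable_mult_test(2)[OF \<open>locally_integrable \<Omega> f\<close> \<phi>]
      integrable_mult_test(1)[OF locally_integrable_inner[OF \<open>locally_integrable \<Omega> (gradient f)\<close>] \<phi>] by simp_all
  have "(\<integral>x. gradient (\<lambda>x. f x * \<phi> x) x \<bullet> b \<partial>M) = (\<integral>x. gradient (\<lambda>x. f x * \<phi> x) x \<bullet> b \<partial>lborel)"
    by (rule M_lborel(1)) (use test_function_measurable(2)[OF t] test_functions_outside[OF t] in auto)
  then have "(\<integral>x. gradient (\<lambda>x. f x * \<phi> x) x \<bullet> b \<partial>M) = 0" using integral_gradient_eq_0[OF t] by simp
  then show "(\<integral>x. (gradient \<phi> x \<bullet> b) * f x \<partial>M) = - (\<integral>x. \<phi> x * (gradient f x \<bullet> b) \<partial>M)"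
    unfolding g using i by simp
qed

end

section \<open>Averages over small balls\<close>

text \<open>Jensen's inequality for the mean over a set: integrate Young's inequality with the mean as the fixed
  factor.\<close>

lemma jensen_powr:
  fixes t :: "'a \<Rightarrow> real"
  assumes q: "1 < q" and t: "\<And>x. 0 \<le> t x" and V: "0 < V"
    and i: "integrable N (\<lambda>x. indicator B x * t x)" "integrable N (\<lambda>x. indicator B x * t x powr q)"
    and iB: "integrable N (indicat_real B)" "(\<integral>x. indicat_real B x \<partial>N) = V"
  shows "((\<integral>x. indicator B x * t x \<partial>N) / V) powr q \<le> (\<integral>x. indicator B x * t x powr q \<partial>N) / V"
proof -
  define I J where "I = (\<integral>x. indicator B x * t x \<partial>N)" and "J = (\<integral>x. indicator B x * t x powr q \<partial>N)"
  define m where "m = I / V"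
  have "0 \<le> I" unfolding I_def by (intro integral_nonneg_AE AE_I2) (simp add: t)
  then have m: "0 \<le> m" using V by (simp add: m_def)
  have le: "m powr (q - 1) * (indicator B x * t x) \<le> indicator B x * t x powr q / q + (1 - 1 / q) * m powr q * indicator B x" for x
    using young_powr[OF t[of x] m q] by (cases "x \<in> B") auto
  have "m powr (q - 1) * I \<le> (\<integral>x. indicator B x * t x powr q / q + (1 - 1 / q) * m powr q * indicator B x \<partial>N)"
    unfolding I_def integral_mult_right_zero[symmetric]
    by (intro integral_mono le Bochner_Integration.integrable_add integrable_divide integrable_mult_right i iB)
  also have "\<dots> = J / q + (1 - 1 / q) * m powr q * V"
    unfolding J_def using i iB by simp
  finally have "m powr (q - 1) * (m * V) \<le> J / q + (1 - 1 / q) * m powr q * V" using V by (simp add: m_def)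
  moreover have "m powr (q - 1) * m = m powr q"
    using powr_add[of m "q - 1" 1] m by (cases "m = 0") (auto simp: q)
  then have "m powr (q - 1) * (m * V) = m powr q * V" by (simp add: mult.assoc[symmetric])
  ultimately have "m powr q * V / q \<le> J / q" by (simp add: left_diff_distrib)
  then have "m powr q * V \<le> J" using q by (simp add: divide_le_cancel)
  then show ?thesis using V unfolding m_def I_def[symmetric] J_def[symmetric] by (simp add: pos_le_divide_eq)
qed

text \<open>Tonelli's theorem and \<open>translation_estimate\<close> for every translation vector in the ball.\<close>

lemma nn_integral_translation_le:
  fixes h :: "'a::euclidean_space \<Rightarrow> real"
  assumes h: "h \<in> test_functions \<Omega>" and q: "1 < q" and r: "0 < r"
  shows "(\<integral>\<^sup>+x. (\<integral>\<^sup>+z. ennreal (indicator (ball 0 r) z * \<bar>h (x + z) - h x\<bar> powr q) \<partial>lborel) \<partial>lborel)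
    \<le> ennreal (measure lborel (ball (0::'a) r) * (r powr q * (\<integral>x. norm (gradient h x) powr q \<partial>lborel)))"
proof -
  let ?E = "\<integral>x. norm (gradient h x) powr q \<partial>lborel"
  have [measurable]: "h \<in> borel_measurable borel" by (rule test_function_measurable(1)[OF h])
  have q0: "0 < q" using q by simp
  have eq: "borel_measurable (lborel \<Otimes>\<^sub>M lborel) = (borel_measurable (borel \<Otimes>\<^sub>M borel) :: ('a \<times> 'a \<Rightarrow> ennreal) set)"
    by (rule measurable_cong_sets) (simp_all cong: sets_pair_measure_cong)
  have [measurable]: "ball (0::'a) r \<in> sets borel" by simp
  have m: "(\<lambda>(x, z). ennreal (indicator (ball 0 r) z * \<bar>h (x + z) - h x\<bar> powr q)) \<in> borel_measurable (lborel \<Otimes>\<^sub>M lborel)"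
    unfolding eq by measurable
  have "(\<integral>\<^sup>+x. (\<integral>\<^sup>+z. ennreal (indicator (ball 0 r) z * \<bar>h (x + z) - h x\<bar> powr q) \<partial>lborel) \<partial>lborel)
      = (\<integral>\<^sup>+z. (\<integral>\<^sup>+x. ennreal (indicator (ball 0 r) z * \<bar>h (x + z) - h x\<bar> powr q) \<partial>lborel) \<partial>lborel)"
    using lborel_pair.Fubini'[OF m] by simp
  also have "\<dots> \<le> (\<integral>\<^sup>+z. ennreal (r powr q * ?E) * indicator (ball (0::'a) r) z \<partial>lborel)"
  proof (rule nn_integral_mono)
    fix z :: 'a
    show "(\<integral>\<^sup>+x. ennreal (indicator (ball 0 r) z * \<bar>h (x + z) - h x\<bar> powr q) \<partial>lborel) \<le> ennreal (r powr q * ?E) * indicator (ball 0 r) z"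
    proof (cases "z \<in> ball 0 r")
      case True
      have i: "integrable lborel (\<lambda>x. \<bar>h (x + z) - h x\<bar> powr q)"
      proof (rule Bochner_Integration.integrable_bound)
        show "integrable lborel (\<lambda>x. 2 powr q * (\<bar>h (x + z)\<bar> powr q + \<bar>h x\<bar> powr q))"
          using test_function_integrable(2)[OF h q0] lborel_integrable_translate[OF test_function_integrable(2)[OF h q0]]
          by (intro integrable_mult_right Bochner_Integration.integrable_add)
        show "AE x in lborel. norm (\<bar>h (x + z) - h x\<bar> powr q) \<le> norm (2 powr q * (\<bar>h (x + z)\<bar> powr q + \<bar>h x\<bar> powr q))"
        proof (rule AE_I2)
          fix x show "norm (\<bar>h (x + z) - h x\<bar> powr q) \<le> norm (2 powr q * (\<bar>h (x + z)\<bar> powr q + \<bar>h x\<bar> powr q))"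
            using norm_diff_powr_le[OF q0, of "h (x + z)" "h x"] by simp
        qed
      qed measurable
      have "(\<integral>\<^sup>+x. ennreal (\<bar>h (x + z) - h x\<bar> powr q) \<partial>lborel) = ennreal (\<integral>x. \<bar>h (x + z) - h x\<bar> powr q \<partial>lborel)"
        by (rule nn_integral_eq_integral[OF i]) simp
      also have "\<dots> \<le> ennreal (r powr q * ?E)"
      proof (rule ennreal_leI)
        have "norm z powr q \<le> r powr q" using True q0 by (intro powr_mono2) auto
        then have "norm z powr q * ?E \<le> r powr q * ?E" by (intro mult_right_mono integral_nonneg_AE AE_I2) auto
        then show "(\<integral>x. \<bar>h (x + z) - h x\<bar> powr q \<partial>lborel) \<le> r powr q * ?E"
          using translation_estimate[OF h q, of z] by linarith
      qed
      finally show ?thesis using True by simp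
    qed simp
  qed
  also have "\<dots> = ennreal (r powr q * ?E) * emeasure lborel (ball (0::'a) r)"
    by (subst nn_integral_cmult_indicator) auto
  also have "\<dots> = ennreal (measure lborel (ball (0::'a) r) * (r powr q * ?E))"
  proof -
    have "emeasure lborel (ball (0::'a) r) = ennreal (measure lborel (ball (0::'a) r))"
      using emeasure_lborel_ball_finite[of "0::'a" r] by (simp add: emeasure_eq_ennreal_measure)
    moreover have "0 \<le> r powr q * ?E" by (intro mult_nonneg_nonneg integral_nonneg_AE AE_I2) auto
    ultimately show ?thesis by (simp add: ennreal_mult'[symmetric] mult.commute)
  qed
  finally show ?thesis .
qed

definition ball_average :: "real \<Rightarrow> ('a::euclidean_space \<Rightarrow> real) \<Rightarrow> 'a \<Rightarrow> real" where
  "ball_average r h c = (\<integral>y. indicator (ball c r) y * h y \<partial>lborel) / measure lborel (ball c r)"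

text \<open>The deviation from the mean over a ball containing the point is controlled by differences with points
  at distance at most \<open>2 r\<close>, which become translates.\<close>

lemma pointwise_average_bound:
  fixes h :: "'a::euclidean_space \<Rightarrow> real"
  assumes h: "h \<in> test_functions \<Omega>" and q: "1 < q" and r: "0 < r" and x: "dist c x < r"
  shows "ennreal (\<bar>h x\<bar> powr q) \<le> ennreal (2 powr q) *
    (ennreal (1 / measure lborel (ball (0::'a) r)) * (\<integral>\<^sup>+z. ennreal (indicator (ball 0 (2 * r)) z * \<bar>h (x + z) - h x\<bar> powr q) \<partial>lborel)
      + ennreal (\<bar>ball_average r h c\<bar> powr q))"
proof -
  define V where "V = measure lborel (ball c r)"
  have V: "0 < V" "V = measure lborel (ball (0::'a) r)"
    using r by (simp_all add: V_def content_ball content_ball_pos)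
  have q0: "0 < q" using q by simp
  have [measurable]: "h \<in> borel_measurable borel" by (rule test_function_measurable(1)[OF h])
  obtain B where B: "\<And>x. \<bar>h x\<bar> \<le> B" "\<And>x. norm (gradient h x) \<le> B" by (rule test_functions_bounded[OF h]) (rule that)
  note B = B(1)
  have B0: "0 \<le> B" using order_trans[OF abs_ge_zero B] .
  have iB: "integrable lborel (indicat_real (ball d s))" for d :: 'a and s
    using emeasure_lborel_ball_finite[of d s] by (intro integrable_real_indicator) auto
  have bd: "integrable lborel (\<lambda>y. indicator (ball d s) y * g y)"
    if "g \<in> borel_measurable borel" "\<And>y. \<bar>g y\<bar> \<le> K" for d :: 'a and g :: "'a \<Rightarrow> real" and K s
  proof (rule Bochner_Integration.integrable_bound[OF integrable_mult_right[OF iB, of K d s]])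
    show "(\<lambda>y. indicat_real (ball d s) y * g y) \<in> borel_measurable lborel"
      using that(1) by (intro borel_measurable_times borel_measurable_indicator) simp_all
    show "AE y in lborel. norm (indicat_real (ball d s) y * g y) \<le> norm (K * indicat_real (ball d s) y)"
    proof (rule AE_I2)
      fix y show "norm (indicat_real (ball d s) y * g y) \<le> norm (K * indicat_real (ball d s) y)"
        using order_trans[OF that(2) abs_ge_self, of y] by (cases "y \<in> ball d s") simp_all
    qed
  qed
  let ?t = "\<lambda>y. \<bar>h x - h y\<bar>"
  have tb: "\<bar>?t y\<bar> \<le> 2 * B" for y using B[of x] B[of y] by simp
  have tq: "\<bar>?t y powr q\<bar> \<le> (2 * B) powr q" for y using powr_mono2[OF less_imp_le[OF q0] abs_ge_zero, of "h x - h y" "2 * B"] tb[of y] by simp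
  have it: "integrable lborel (\<lambda>y. indicator (ball c r) y * ?t y)" by (rule bd[OF _ tb]) measurable
  have itq: "integrable lborel (\<lambda>y. indicator (ball d s) y * ?t y powr q)" for d s by (rule bd[OF _ tq]) measurable
  have ih: "integrable lborel (\<lambda>y. indicator (ball c r) y * h y)" by (rule bd[OF _ B]) measurable
  have iV: "(\<integral>y. indicat_real (ball c r) y \<partial>lborel) = V" by (simp add: V_def)
  have "(h x - ball_average r h c) = (\<integral>y. indicator (ball c r) y * (h x - h y) \<partial>lborel) / V"
  proof -
    have "(\<integral>y. indicator (ball c r) y * (h x - h y) \<partial>lborel) = (\<integral>y. h x * indicator (ball c r) y - indicator (ball c r) y * h y \<partial>lborel)"
      by (simp add: algebra_simps)
    also have "\<dots> = h x * V - (\<integral>y. indicator (ball c r) y * h y \<partial>lborel)"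
      using ih iB[of c r] iV by simp
    finally show ?thesis using V(1) by (simp add: ball_average_def V_def[symmetric] field_simps)
  qed
  then have "\<bar>h x - ball_average r h c\<bar> = \<bar>\<integral>y. indicator (ball c r) y * (h x - h y) \<partial>lborel\<bar> / V" using V(1) by simp
  also have "\<dots> \<le> (\<integral>y. indicator (ball c r) y * ?t y \<partial>lborel) / V"
  proof -
    have "\<bar>\<integral>y. indicator (ball c r) y * (h x - h y) \<partial>lborel\<bar> \<le> (\<integral>y. \<bar>indicator (ball c r) y * (h x - h y)\<bar> \<partial>lborel)"
      by (rule integral_abs_bound)
    then show ?thesis using V(1) by (simp add: abs_mult divide_right_mono)
  qed
  finally have "\<bar>h x - ball_average r h c\<bar> powr q \<le> ((\<integral>y. indicator (ball c r) y * ?t y \<partial>lborel) / V) powr q"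
    using q0 by (intro powr_mono2) auto
  also have "\<dots> \<le> (\<integral>y. indicator (ball c r) y * ?t y powr q \<partial>lborel) / V"
    by (rule jensen_powr[OF q abs_ge_zero V(1) it itq iB iV])
  also have "\<dots> \<le> (\<integral>y. indicator (ball x (2 * r)) y * ?t y powr q \<partial>lborel) / V"
  proof (rule divide_right_mono[OF integral_mono[OF itq itq]])
    fix y
    have "y \<in> ball c r \<Longrightarrow> y \<in> ball x (2 * r)"
      using x dist_triangle[of x y c] by (simp add: dist_commute)
    then show "indicator (ball c r) y * ?t y powr q \<le> indicator (ball x (2 * r)) y * ?t y powr q"
      by (auto simp: indicator_def)
  qed (use V(1) in simp)
  also have "(\<integral>y. indicator (ball x (2 * r)) y * ?t y powr q \<partial>lborel) = (\<integral>z. indicator (ball 0 (2 * r)) z * \<bar>h (x + z) - h x\<bar> powr q \<partial>lborel)"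
  proof -
    have "(\<integral>y. indicator (ball x (2 * r)) y * ?t y powr q \<partial>lborel) = (\<integral>z. indicator (ball x (2 * r)) (z + x) * ?t (z + x) powr q \<partial>lborel)"
    proof (rule lborel_integral_translate[symmetric])
      have [measurable]: "ball x (2 * r) \<in> sets borel" by simp
      show "(\<lambda>y. indicator (ball x (2 * r)) y * ?t y powr q) \<in> borel_measurable borel" by measurable
    qed
    also have "\<dots> = (\<integral>z. indicator (ball 0 (2 * r)) z * \<bar>h (x + z) - h x\<bar> powr q \<partial>lborel)"
      by (intro Bochner_Integration.integral_cong) (auto simp: indicator_def dist_norm add.commute abs_minus_commute)
    finally show ?thesis .
  qed
  finally have 1: "\<bar>h x - ball_average r h c\<bar> powr q \<le> (\<integral>z. indicator (ball 0 (2 * r)) z * \<bar>h (x + z) - h x\<bar> powr q \<partial>lborel) / V" .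
  have iz: "integrable lborel (\<lambda>z. indicator (ball 0 (2 * r)) z * \<bar>h (x + z) - h x\<bar> powr q)"
  proof (rule bd)
    show "(\<lambda>z. \<bar>h (x + z) - h x\<bar> powr q) \<in> borel_measurable borel" by measurable
    show "\<bar>\<bar>h (x + z) - h x\<bar> powr q\<bar> \<le> (2 * B) powr q" for z using tq[of "x + z"] by (simp add: abs_minus_commute)
  qed
  have "\<bar>h x\<bar> powr q \<le> 2 powr q * (\<bar>h x - ball_average r h c\<bar> powr q + \<bar>ball_average r h c\<bar> powr q)"
    using norm_add_powr_le[OF q0, of "h x - ball_average r h c" "ball_average r h c"] by simp
  also have "\<dots> \<le> 2 powr q * ((\<integral>z. indicator (ball 0 (2 * r)) z * \<bar>h (x + z) - h x\<bar> powr q \<partial>lborel) / V + \<bar>ball_average r h c\<bar> powr q)"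
    using 1 by (intro mult_left_mono add_mono) auto
  finally have "\<bar>h x\<bar> powr q \<le> 2 powr q * (1 / V * (\<integral>z. indicator (ball 0 (2 * r)) z * \<bar>h (x + z) - h x\<bar> powr q \<partial>lborel) + \<bar>ball_average r h c\<bar> powr q)"
    by simp
  moreover have "0 \<le> (\<integral>z. indicator (ball 0 (2 * r)) z * \<bar>h (x + z) - h x\<bar> powr q \<partial>lborel)"
    by (intro integral_nonneg_AE AE_I2) auto
  moreover have "(\<integral>\<^sup>+z. ennreal (indicator (ball 0 (2 * r)) z * \<bar>h (x + z) - h x\<bar> powr q) \<partial>lborel)
      = ennreal (\<integral>z. indicator (ball 0 (2 * r)) z * \<bar>h (x + z) - h x\<bar> powr q \<partial>lborel)"
    by (rule nn_integral_eq_integral[OF iz]) auto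
  ultimately show ?thesis
    using V by (simp add: ennreal_mult[symmetric] ennreal_plus[symmetric] ennreal_leI del: ennreal_plus)
qed

text \<open>The compactness mechanism: up to an error of order \<open>r^q\<close> controlled by the gradient, a test function is
  determined by finitely many averages.\<close>

lemma average_estimate:
  fixes h :: "'a::euclidean_space \<Rightarrow> real"
  assumes \<Omega>: "bounded \<Omega>" "open \<Omega>" and h: "h \<in> test_functions \<Omega>" and q: "1 < q" and r: "0 < r"
    and F: "\<Omega> \<subseteq> (\<Union>c\<in>F. ball c r)" and S: "\<And>c. c \<in> F \<Longrightarrow> \<bar>ball_average r h c\<bar> powr q \<le> S" "0 \<le> S"
  shows "(\<integral>x. \<bar>h x\<bar> powr q \<partial>lborel)
    \<le> 2 powr q * (2 ^ DIM('a) * (2 * r) powr q * (\<integral>x. norm (gradient h x) powr q \<partial>lborel) + measure lborel \<Omega> * S)"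
proof -
  let ?E = "\<integral>x. norm (gradient h x) powr q \<partial>lborel"
  define V where "V = measure lborel (ball (0::'a) r)"
  define V2 where "V2 = measure lborel (ball (0::'a) (2 * r))"
  have V: "0 < V" "V2 = 2 ^ DIM('a) * V"
    using r by (auto simp: V_def V2_def content_ball content_ball_pos power_mult_distrib)
  have q0: "0 < q" using q by simp
  have [measurable]: "h \<in> borel_measurable borel" by (rule test_function_measurable(1)[OF h])
  let ?G = "\<lambda>x. \<integral>\<^sup>+z. ennreal (indicator (ball 0 (2 * r)) z * \<bar>h (x + z) - h x\<bar> powr q) \<partial>lborel"
  have E0: "0 \<le> ?E" by (intro integral_nonneg_AE AE_I2) auto
  have fin: "emeasure lborel \<Omega> = ennreal (measure lborel \<Omega>)"
    using emeasure_bounded_finite[OF \<Omega>(1)] by (simp add: emeasure_eq_ennreal_measure)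
  have "ennreal (\<integral>x. \<bar>h x\<bar> powr q \<partial>lborel) = (\<integral>\<^sup>+x. ennreal (\<bar>h x\<bar> powr q) \<partial>lborel)"
    by (rule nn_integral_eq_integral[symmetric, OF test_function_integrable(2)[OF h q0]]) auto
  also have "\<dots> \<le> (\<integral>\<^sup>+x. ennreal (2 powr q) * (ennreal (1 / V) * ?G x + ennreal S * indicator \<Omega> x) \<partial>lborel)"
  proof (rule nn_integral_mono)
    fix x
    show "ennreal (\<bar>h x\<bar> powr q) \<le> ennreal (2 powr q) * (ennreal (1 / V) * ?G x + ennreal S * indicator \<Omega> x)"
    proof (cases "x \<in> \<Omega>")
      case True
      then obtain c where c: "c \<in> F" "dist c x < r" using F by auto
      have "ennreal (\<bar>h x\<bar> powr q) \<le> ennreal (2 powr q) * (ennreal (1 / V) * ?G x + ennreal (\<bar>ball_average r h c\<bar> powr q))"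
        unfolding V_def by (rule pointwise_average_bound[OF h q r c(2)])
      also have "\<dots> \<le> ennreal (2 powr q) * (ennreal (1 / V) * ?G x + ennreal S * indicator \<Omega> x)"
        using S(1)[OF c(1)] True by (intro mult_left_mono add_mono order_refl) (auto intro: ennreal_leI)
      finally show ?thesis .
    next
      case False
      then show ?thesis using test_functions_outside(1)[OF h False] by simp
    qed
  qed
  also have "\<dots> = ennreal (2 powr q) * (ennreal (1 / V) * (\<integral>\<^sup>+x. ?G x \<partial>lborel) + ennreal S * emeasure lborel \<Omega>)"
  proof -
    have [measurable]: "\<Omega> \<in> sets borel" using \<Omega>(2) by simp
    have [measurable]: "ball (0::'a) (2 * r) \<in> sets borel" by simp
    have eq: "borel_measurable (lborel \<Otimes>\<^sub>M lborel) = (borel_measurable (borel \<Otimes>\<^sub>M borel) :: ('a \<times> 'a \<Rightarrow> ennreal) set)"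
      by (rule measurable_cong_sets) (simp_all cong: sets_pair_measure_cong)
    have "(\<lambda>(x, z). ennreal (indicator (ball 0 (2 * r)) z * \<bar>h (x + z) - h x\<bar> powr q)) \<in> borel_measurable (lborel \<Otimes>\<^sub>M lborel)"
      unfolding eq by measurable
    then have m: "?G \<in> borel_measurable lborel"
      by (rule lborel.borel_measurable_nn_integral)
    show ?thesis
      using m by (simp add: nn_integral_cmult nn_integral_add nn_integral_cmult_indicator)
  qed
  also have "\<dots> \<le> ennreal (2 powr q) * (ennreal (1 / V) * ennreal (V2 * ((2 * r) powr q * ?E)) + ennreal S * ennreal (measure lborel \<Omega>))"
    unfolding fin V2_def using r by (intro mult_left_mono add_mono order_refl nn_integral_translation_le[OF h q]) auto
  also have "\<dots> = ennreal (2 powr q * (1 / V * (V2 * ((2 * r) powr q * ?E)) + S * measure lborel \<Omega>))"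
    using V E0 S(2) by (simp add: ennreal_mult[symmetric] ennreal_plus[symmetric] del: ennreal_plus)
  finally have "ennreal (\<integral>x. \<bar>h x\<bar> powr q \<partial>lborel) \<le> ennreal (2 powr q * (1 / V * (V2 * ((2 * r) powr q * ?E)) + S * measure lborel \<Omega>))" .
  moreover have "0 \<le> 2 powr q * (1 / V * (V2 * ((2 * r) powr q * ?E)) + S * measure lborel \<Omega>)"
    using V E0 S(2) by (intro mult_nonneg_nonneg add_nonneg_nonneg) auto
  ultimately have "(\<integral>x. \<bar>h x\<bar> powr q \<partial>lborel) \<le> 2 powr q * (1 / V * (V2 * ((2 * r) powr q * ?E)) + S * measure lborel \<Omega>)"
    by (simp only: ennreal_le_iff)
  also have "1 / V * (V2 * ((2 * r) powr q * ?E)) = 2 ^ DIM('a) * (2 * r) powr q * ?E" using V by simp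
  finally show ?thesis by (simp add: mult.commute)
qed

section \<open>Sobolev functions with zero boundary values\<close>

lemma test_functions_diff:
  assumes "\<phi> \<in> test_functions \<Omega>" "\<psi> \<in> test_functions \<Omega>"
  shows "(\<lambda>x. \<phi> x - \<psi> x) \<in> test_functions \<Omega>"
  using test_functions_add[OF assms(1) test_functions_cmult[OF assms(2), of "-1"]] by simp

lemma gradient_diff:
  "\<phi> differentiable (at x) \<Longrightarrow> \<psi> differentiable (at x) \<Longrightarrow> gradient (\<lambda>x. \<phi> x - \<psi> x) x = gradient \<phi> x - gradient \<psi> x"
  by (rule gradient_eqI) (auto intro!: derivative_eq_intros has_derivative_gradient simp: inner_diff_left)

lemma ball_average_diff:
  assumes "f \<in> test_functions \<Omega>" "g \<in> test_functions \<Omega>"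
  shows "ball_average r (\<lambda>x. f x - g x) c = ball_average r f c - ball_average r g c"
proof -
  have i: "integrable lborel (\<lambda>y. indicator (ball c r) y * h y)" if "h \<in> test_functions \<Omega>" for h
    using integrable_mult_indicator[OF _ test_function_integrable(1)[OF that], of "ball c r"] by simp
  show ?thesis
    unfolding ball_average_def using i[OF assms(1)] i[OF assms(2)] by (simp add: right_diff_distrib diff_divide_distrib)
qed

context bounded_domain
begin

text \<open>Translate by a vector longer than the diameter: then \<open>f (x + z)\<close> vanishes where \<open>f x\<close> does not.\<close>

lemma poincare_test:
  assumes q: "1 < q"
  obtains C where "0 < C" "\<And>f. f \<in> test_functions \<Omega> \<Longrightarrow> powint q f \<le> C * powint q (gradient f)"
proof -
  obtain R where R: "0 < R" "\<Omega> \<subseteq> ball 0 R" using bounded_subset_ballD[OF bounded_dom, of 0] by blast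
  \<comment> \<open>Any vector of length \<open>2 R\<close> moves the domain off itself.\<close>
  define z :: 'a where "z = (2 * R) *\<^sub>R (SOME b. b \<in> Basis)"
  have z: "norm z = 2 * R" using R(1) by (simp add: z_def)
  have q0: "0 < q" using q by simp
  have out: "x + z \<notin> \<Omega>" if "x \<in> \<Omega>" for x
  proof
    assume "x + z \<in> \<Omega>"
    then have "norm (x + z) < R" "norm x < R" using R(2) that by auto
    then show False using norm_triangle_ineq4[of "x + z" x] z by simp
  qed
  show ?thesis
  proof (rule that[of "(2 * R) powr q"])
    fix f assume f: "f \<in> test_functions \<Omega>"
    have m: "f \<in> borel_measurable borel" by (rule test_function_measurable(1)[OF f])
    have "powint q f = (\<integral>x. \<bar>f x\<bar> powr q \<partial>lborel)" by (rule test_function_Lp(3)[OF f q0])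
    also have "\<dots> \<le> (\<integral>x. \<bar>f (x + z) - f x\<bar> powr q \<partial>lborel)"
    proof (rule integral_mono[OF test_function_integrable(2)[OF f q0]])
      show "integrable lborel (\<lambda>x. \<bar>f (x + z) - f x\<bar> powr q)"
      proof (rule Bochner_Integration.integrable_bound)
        show "integrable lborel (\<lambda>x. 2 powr q * (\<bar>f (x + z)\<bar> powr q + \<bar>f x\<bar> powr q))"
          using test_function_integrable(2)[OF f q0] lborel_integrable_translate[OF test_function_integrable(2)[OF f q0]]
          by (intro integrable_mult_right Bochner_Integration.integrable_add)
        show "(\<lambda>x. \<bar>f (x + z) - f x\<bar> powr q) \<in> borel_measurable lborel" using m by measurable
        show "AE x in lborel. norm (\<bar>f (x + z) - f x\<bar> powr q) \<le> norm (2 powr q * (\<bar>f (x + z)\<bar> powr q + \<bar>f x\<bar> powr q))"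
        proof (rule AE_I2)
          fix x show "norm (\<bar>f (x + z) - f x\<bar> powr q) \<le> norm (2 powr q * (\<bar>f (x + z)\<bar> powr q + \<bar>f x\<bar> powr q))"
            using norm_diff_powr_le[OF q0, of "f (x + z)" "f x"] by simp
        qed
      qed
      show "\<bar>f x\<bar> powr q \<le> \<bar>f (x + z) - f x\<bar> powr q" for x
        using test_functions_outside(1)[OF f, of "x + z"] test_functions_outside(1)[OF f, of x] out[of x]
        by (cases "x \<in> \<Omega>") auto
    qed
    also have "\<dots> \<le> norm z powr q * (\<integral>x. norm (gradient f x) powr q \<partial>lborel)" by (rule translation_estimate[OF f q])
    finally show "powint q f \<le> (2 * R) powr q * powint q (gradient f)"
      by (simp only: z test_function_Lp(4)[OF f q0])
  qed (use R(1) in simp)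
qed

text \<open>Choose a subsequence along which all averages over the balls of countably many finite covers converge;
  \<open>average_estimate\<close>, applied to differences, shows that it is a Cauchy sequence.\<close>

lemma rellich_test:
  assumes q: "1 < q" and f: "\<And>n. f n \<in> test_functions \<Omega>" and R: "\<And>n. powint q (gradient (f n)) \<le> R"
  obtains \<sigma> :: "nat \<Rightarrow> nat" where "strict_mono \<sigma>"
    "\<And>e. 0 < e \<Longrightarrow> \<exists>N. \<forall>i\<ge>N. \<forall>j\<ge>N. powint q (\<lambda>x. f (\<sigma> i) x - f (\<sigma> j) x) < e"
proof -
  have q0: "0 < q" using q by simp
  obtain C where C: "0 < C" "\<And>f. f \<in> test_functions \<Omega> \<Longrightarrow> powint q f \<le> C * powint q (gradient f)"
    by (rule poincare_test[OF q]) blast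
  have R0: "0 \<le> R" using order_trans[OF powint_nonneg R] .
  define r where "r k = inverse (real (Suc k))" for k
  have r: "0 < r k" for k by (simp add: r_def)
  have "\<exists>F. finite F \<and> \<Omega> \<subseteq> (\<Union>c\<in>F. ball c (r k))" for k
  proof -
    have "compact (closure \<Omega>)" using bounded_dom by simp
    then obtain F where "finite F" "closure \<Omega> \<subseteq> (\<Union>c\<in>F. ball c (r k))"
      using r[of k] unfolding compact_eq_totally_bounded by blast
    then show ?thesis using closure_subset by blast
  qed
  then obtain F where F: "\<And>k. finite (F k)" "\<And>k. \<Omega> \<subseteq> (\<Union>c\<in>F k. ball c (r k))" by metis
  \<comment> \<open>Pairs of a scale and a centre; the averages are needed only for these.\<close>
  define S where "S = Sigma UNIV F"
  have S: "countable S" unfolding S_def using F(1) by (intro countable_SIGMA) (auto intro: countable_finite)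
  define a where "a n = (\<lambda>(k, c). \<integral>y. indicator (ball c (r k)) y * f n y \<partial>lborel)" for n
  have a_bound: "norm (a n x) \<le> measure M \<Omega> + C * R" for n x
  proof -
    obtain k c where x: "x = (k, c)" by (cases x)
    have i1: "integrable lborel (f n)" by (rule test_function_integrable(1)[OF f])
    have "norm (a n x) \<le> (\<integral>y. \<bar>indicator (ball c (r k)) y * f n y\<bar> \<partial>lborel)"
      unfolding a_def x by simp
    also have "\<dots> \<le> (\<integral>y. \<bar>f n y\<bar> \<partial>lborel)"
    proof (rule integral_mono)
      show "integrable lborel (\<lambda>y. \<bar>indicator (ball c (r k)) y * f n y\<bar>)"
        using integrable_mult_indicator[OF _ i1, of "ball c (r k)"] by simp
      show "integrable lborel (\<lambda>y. \<bar>f n y\<bar>)" using i1 by simp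
      show "\<bar>indicator (ball c (r k)) y * f n y\<bar> \<le> \<bar>f n y\<bar>" for y by (cases "y \<in> ball c (r k)") auto
    qed
    also have "\<dots> = (\<integral>y. \<bar>f n y\<bar> \<partial>M)"
      using test_function_measurable(1)[OF f[of n]] test_functions_outside(1)[OF f[of n]]
      by (intro M_lborel(1)[symmetric]) auto
    also have "\<dots> \<le> (\<integral>y. 1 + \<bar>f n y\<bar> powr q \<partial>M)"
    proof (rule integral_mono)
      show "integrable M (\<lambda>y. \<bar>f n y\<bar>)"
        using Lp_integrable[OF test_function_Lp(1)[OF f q0]] q by simp
      show "integrable M (\<lambda>y. 1 + \<bar>f n y\<bar> powr q)"
        using LpD(2)[OF test_function_Lp(1)[OF f q0]] by simp
      show "\<bar>f n y\<bar> \<le> 1 + \<bar>f n y\<bar> powr q" for y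
      proof (cases "\<bar>f n y\<bar> \<le> 1")
        case False
        then have "\<bar>f n y\<bar> powr 1 \<le> \<bar>f n y\<bar> powr q" using q by (intro powr_mono) auto
        then show ?thesis using False by simp
      qed (simp add: add_increasing2)
    qed
    also have "\<dots> = measure M \<Omega> + powint q (f n)"
      using LpD(2)[OF test_function_Lp(1)[OF f q0]] by (simp add: powint_def)
    also have "\<dots> \<le> measure M \<Omega> + C * R"
      using C(2)[OF f[of n]] mult_left_mono[OF R[of n], of C] C(1) by linarith
    finally show ?thesis .
  qed
  obtain \<sigma> where \<sigma>: "strict_mono \<sigma>" "\<And>x. x \<in> S \<Longrightarrow> \<exists>l. (\<lambda>n. a (\<sigma> n) x) \<longlonglongrightarrow> l"
    by (rule function_convergent_subsequence[where f=a, OF S a_bound]) (rule that)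
  show ?thesis
  proof (rule that[OF \<sigma>(1)])
    fix e :: real assume e: "0 < e"
    \<comment> \<open>\<open>A\<close> collects the constants of \<open>average_estimate\<close> for a difference of two functions, and \<open>s\<close> is the
      tolerance for its averages.\<close>
    define A where "A = 2 powr q * (2 ^ DIM('a) * 2 powr q * (2 powr q * (R + R)))"
    define s where "s = e / (2 * 2 powr q * (measure lborel \<Omega> + 1))"
    have s: "0 < s" using e unfolding s_def by (intro divide_pos_pos mult_pos_pos add_nonneg_pos) auto
    have "(\<lambda>k. A * r k powr q) \<longlonglongrightarrow> A * 0 powr q"
      unfolding r_def using q0 by (intro tendsto_intros tendsto_powr' LIMSEQ_inverse_real_of_nat) auto
    then have "(\<lambda>k. A * r k powr q) \<longlonglongrightarrow> 0" by simp
    then have "eventually (\<lambda>k. A * r k powr q < e / 2) sequentially"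
      by (rule order_tendstoD) (use e in simp)
    then obtain k where k: "A * r k powr q < e / 2" by (auto simp: eventually_sequentially)
    define V where "V = measure lborel (ball (0::'a) (r k))"
    have V: "0 < V" "\<And>c. measure lborel (ball (c::'a) (r k)) = V"
      using r[of k] by (simp_all add: V_def content_ball content_ball_pos)
    have "\<exists>N. \<forall>i\<ge>N. \<forall>j\<ge>N. \<bar>a (\<sigma> i) (k, c) - a (\<sigma> j) (k, c)\<bar> < V * s powr (1 / q)" if "c \<in> F k" for c
    proof -
      have "(k, c) \<in> S" using that by (simp add: S_def)
      then have "Cauchy (\<lambda>n. a (\<sigma> n) (k, c))" using \<sigma>(2) LIMSEQ_imp_Cauchy by blast
      then show ?thesis
        using V(1) s unfolding Cauchy_def by (metis dist_real_def mult_pos_pos powr_gt_zero less_irrefl)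
    qed
    then obtain N where N: "\<And>c i j. c \<in> F k \<Longrightarrow> N c \<le> i \<Longrightarrow> N c \<le> j \<Longrightarrow> \<bar>a (\<sigma> i) (k, c) - a (\<sigma> j) (k, c)\<bar> < V * s powr (1 / q)"
      by metis
    have "powint q (\<lambda>x. f (\<sigma> i) x - f (\<sigma> j) x) < e" if ij: "sum N (F k) \<le> i" "sum N (F k) \<le> j" for i j
    proof -
      let ?h = "\<lambda>x. f (\<sigma> i) x - f (\<sigma> j) x"
      have h: "?h \<in> test_functions \<Omega>" by (rule test_functions_diff[OF f f])
      have avg: "\<bar>ball_average (r k) ?h c\<bar> powr q \<le> s" if c: "c \<in> F k" for c
      proof -
        have Nc: "N c \<le> i" "N c \<le> j" using ij member_le_sum[OF c _ F(1), of N] by auto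
        have "ball_average (r k) ?h c = (a (\<sigma> i) (k, c) - a (\<sigma> j) (k, c)) / V"
          unfolding ball_average_diff[OF f f] by (simp add: ball_average_def a_def V(2) diff_divide_distrib)
        then have "\<bar>ball_average (r k) ?h c\<bar> = \<bar>a (\<sigma> i) (k, c) - a (\<sigma> j) (k, c)\<bar> / V" using V(1) by simp
        also have "\<dots> \<le> s powr (1 / q)" using N[OF c Nc] V(1) by (simp add: pos_divide_le_eq mult.commute)
        finally have "\<bar>ball_average (r k) ?h c\<bar> powr q \<le> (s powr (1 / q)) powr q" using q0 by (intro powr_mono2) auto
        also have "\<dots> = s" using s q0 by (simp add: powr_powr)
        finally show ?thesis .
      qed
      have "powint q (gradient ?h) = powint q (\<lambda>x. gradient (f (\<sigma> i)) x - gradient (f (\<sigma> j)) x)"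
        using gradient_diff[OF test_functionsD(4)[OF f] test_functionsD(4)[OF f]] by (simp add: powint_def)
      also have "\<dots> \<le> 2 powr q * (powint q (gradient (f (\<sigma> i))) + powint q (gradient (f (\<sigma> j))))"
        by (intro powint_diff_le test_function_Lp f q0)
      also have "\<dots> \<le> 2 powr q * (R + R)" using R by (intro mult_left_mono add_mono) auto
      finally have grad: "powint q (gradient ?h) \<le> 2 powr q * (R + R)" .
      have "powint q ?h = (\<integral>x. \<bar>?h x\<bar> powr q \<partial>lborel)" by (rule test_function_Lp(3)[OF h q0])
      also have "\<dots> \<le> 2 powr q * (2 ^ DIM('a) * (2 * r k) powr q * (\<integral>x. norm (gradient ?h x) powr q \<partial>lborel) + measure lborel \<Omega> * s)"
        by (rule average_estimate[OF bounded_dom open_dom h q r F(2) avg]) (use s in auto)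
      also have "\<dots> = 2 powr q * (2 ^ DIM('a) * (2 * r k) powr q * powint q (gradient ?h) + measure lborel \<Omega> * s)"
        by (simp only: test_function_Lp(4)[OF h q0])
      also have "\<dots> \<le> 2 powr q * (2 ^ DIM('a) * (2 * r k) powr q * (2 powr q * (R + R)) + measure lborel \<Omega> * s)"
        using grad by (intro mult_left_mono add_mono order_refl) auto
      also have "\<dots> = A * r k powr q + 2 powr q * measure lborel \<Omega> * s"
        using r[of k] by (simp add: A_def powr_mult algebra_simps)
      also have "\<dots> < e"
      proof -
        have "2 powr q * measure lborel \<Omega> * s \<le> 2 powr q * (measure lborel \<Omega> + 1) * s"
          using s by (intro mult_right_mono mult_left_mono) auto
        also have "\<dots> = e / 2"
        proof -
          have "0 < measure lborel \<Omega> + 1" by (intro add_nonneg_pos) auto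
          have *: "b * m * (e / (2 * b * m)) = e / 2" if "0 < b" "0 < m" for b m :: real
            using that by (simp add: field_simps)
          show ?thesis unfolding s_def by (rule *) (use \<open>0 < measure lborel \<Omega> + 1\<close> in auto)
        qed
        finally show ?thesis using k by linarith
      qed
      finally show ?thesis .
    qed
    then show "\<exists>N. \<forall>i\<ge>N. \<forall>j\<ge>N. powint q (\<lambda>x. f (\<sigma> i) x - f (\<sigma> j) x) < e" by blast
  qed
qed

text \<open>The space with zero boundary values as the closure of test functions, with the gradient carried along
  as a second component. The pair formulation makes closure properties independent of the choice made
  by \<open>weak_grad\<close>; \<open>W10_iff\<close> connects it with \<open>W10\<close>.\<close>

definition W0 :: "real \<Rightarrow> ('a \<Rightarrow> real) \<Rightarrow> ('a \<Rightarrow> 'a) \<Rightarrow> bool" where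
  "W0 s u g \<longleftrightarrow> u \<in> Lp s \<Omega> \<and> g \<in> Lp s \<Omega> \<and>
    (\<forall>e>0. \<exists>f\<in>test_functions \<Omega>. powint s (\<lambda>x. u x - f x) < e \<and> powint s (\<lambda>x. g x - gradient f x) < e)"

lemma W0_Lp: assumes "W0 s u g" shows "u \<in> Lp s \<Omega>" "g \<in> Lp s \<Omega>"
  using assms by (auto simp: W0_def)

lemma W0_approx:
  assumes "W0 s u g" "0 < e"
  obtains f where "f \<in> test_functions \<Omega>" "powint s (\<lambda>x. u x - f x) < e" "powint s (\<lambda>x. g x - gradient f x) < e"
  using assms unfolding W0_def by blast

lemma W0_approx_seq:
  assumes "W0 s u g"
  obtains f where "\<And>n. f n \<in> test_functions \<Omega>" "(\<lambda>n. powint s (\<lambda>x. f n x - u x)) \<longlonglongrightarrow> 0" "(\<lambda>n. powint s (\<lambda>x. gradient (f n) x - g x)) \<longlonglongrightarrow> 0"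
proof -
  have "\<exists>f\<in>test_functions \<Omega>. powint s (\<lambda>x. u x - f x) < inverse (real (Suc n)) \<and> powint s (\<lambda>x. g x - gradient f x) < inverse (real (Suc n))" for n
    using assms unfolding W0_def by simp
  then obtain f where f: "\<And>n. f n \<in> test_functions \<Omega>" "\<And>n. powint s (\<lambda>x. u x - f n x) < inverse (real (Suc n))"
    "\<And>n. powint s (\<lambda>x. g x - gradient (f n) x) < inverse (real (Suc n))" by metis
  have "(\<lambda>n. powint s (\<lambda>x. u x - f n x)) \<longlonglongrightarrow> 0" "(\<lambda>n. powint s (\<lambda>x. g x - gradient (f n) x)) \<longlonglongrightarrow> 0"
    by (rule tendsto_sandwich[OF _ _ tendsto_const LIMSEQ_inverse_real_of_nat]; use f(2,3) in \<open>auto intro!: always_eventually less_imp_le\<close>)+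
  then show ?thesis using that[OF f(1)] by (simp add: powint_minus_commute)
qed

lemma W0_test:
  assumes "f \<in> test_functions \<Omega>" "0 < s" shows "W0 s f (gradient f)"
  unfolding W0_def using test_function_Lp(1,2)[OF assms] assms(1) by (auto intro!: bexI[of _ f])

lemma W0_closed:
  assumes W: "\<And>n. W0 s (u n) (g n)" and L: "v \<in> Lp s \<Omega>" "h \<in> Lp s \<Omega>" and s: "0 < s"
    and lim: "(\<lambda>n. powint s (\<lambda>x. u n x - v x)) \<longlonglongrightarrow> 0" "(\<lambda>n. powint s (\<lambda>x. g n x - h x)) \<longlonglongrightarrow> 0"
  shows "W0 s v h"
  unfolding W0_def
proof (intro conjI L allI impI)
  fix e :: real assume e: "0 < e"
  define d where "d = e / (2 * 2 powr s)"
  have d: "0 < d" using e by (simp add: d_def)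
  have "eventually (\<lambda>n. powint s (\<lambda>x. u n x - v x) < d \<and> powint s (\<lambda>x. g n x - h x) < d) sequentially"
    using order_tendstoD(2)[OF lim(1) d] order_tendstoD(2)[OF lim(2) d] by (rule eventually_conj)
  then obtain n where n: "powint s (\<lambda>x. u n x - v x) < d" "powint s (\<lambda>x. g n x - h x) < d"
    by (auto simp: eventually_sequentially)
  obtain f where f: "f \<in> test_functions \<Omega>" "powint s (\<lambda>x. u n x - f x) < d" "powint s (\<lambda>x. g n x - gradient f x) < d"
    by (rule W0_approx[OF W[of n] d])
  have "powint s (\<lambda>x. v x - f x) \<le> 2 powr s * (powint s (\<lambda>x. v x - u n x) + powint s (\<lambda>x. u n x - f x))"
    by (intro powint_triangle L W0_Lp(1)[OF W] test_function_Lp(1)[OF f(1)] s)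
  also have "\<dots> < 2 powr s * (d + d)" using n(1) f(2) by (intro mult_strict_left_mono add_strict_mono) (auto simp: powint_minus_commute)
  also have "\<dots> = e" by (simp add: d_def)
  finally have 1: "powint s (\<lambda>x. v x - f x) < e" .
  have "powint s (\<lambda>x. h x - gradient f x) \<le> 2 powr s * (powint s (\<lambda>x. h x - g n x) + powint s (\<lambda>x. g n x - gradient f x))"
    by (intro powint_triangle L W0_Lp(2)[OF W] test_function_Lp(2)[OF f(1)] s)
  also have "\<dots> < 2 powr s * (d + d)" using n(2) f(3) by (intro mult_strict_left_mono add_strict_mono) (auto simp: powint_minus_commute)
  also have "\<dots> = e" by (simp add: d_def)
  finally show "\<exists>f\<in>test_functions \<Omega>. powint s (\<lambda>x. v x - f x) < e \<and> powint s (\<lambda>x. h x - gradient f x) < e"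
    using 1 f(1) by blast
qed

lemma W0_add:
  assumes u: "W0 s u g" and v: "W0 s v h" and s: "0 < s"
  shows "W0 s (\<lambda>x. u x + v x) (\<lambda>x. g x + h x)"
  unfolding W0_def
proof (intro conjI Lp_add W0_Lp[OF u] W0_Lp[OF v] s allI impI)
  fix e :: real assume e: "0 < e"
  define d where "d = e / (2 * 2 powr s)"
  have d: "0 < d" using e by (simp add: d_def)
  obtain f where f: "f \<in> test_functions \<Omega>" "powint s (\<lambda>x. u x - f x) < d" "powint s (\<lambda>x. g x - gradient f x) < d"
    by (rule W0_approx[OF u d])
  obtain k where k: "k \<in> test_functions \<Omega>" "powint s (\<lambda>x. v x - k x) < d" "powint s (\<lambda>x. h x - gradient k x) < d"
    by (rule W0_approx[OF v d])
  note Lf = test_function_Lp(1,2)[OF f(1) s] and Lk = test_function_Lp(1,2)[OF k(1) s]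
  have "powint s (\<lambda>x. (u x - f x) + (v x - k x)) \<le> 2 powr s * (powint s (\<lambda>x. u x - f x) + powint s (\<lambda>x. v x - k x))"
    by (intro powint_add_le Lp_diff W0_Lp(1)[OF u] W0_Lp(1)[OF v] Lf(1) Lk(1) s)
  also have "\<dots> < 2 powr s * (d + d)" using f(2) k(2) by (intro mult_strict_left_mono add_strict_mono) auto
  also have "\<dots> = e" by (simp add: d_def)
  finally have 1: "powint s (\<lambda>x. u x + v x - (f x + k x)) < e" by (simp add: algebra_simps)
  have "powint s (\<lambda>x. (g x - gradient f x) + (h x - gradient k x)) \<le> 2 powr s * (powint s (\<lambda>x. g x - gradient f x) + powint s (\<lambda>x. h x - gradient k x))"
    by (intro powint_add_le Lp_diff W0_Lp(2)[OF u] W0_Lp(2)[OF v] Lf(2) Lk(2) s)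
  also have "\<dots> < 2 powr s * (d + d)" using f(3) k(3) by (intro mult_strict_left_mono add_strict_mono) auto
  also have "\<dots> = e" by (simp add: d_def)
  finally have 2: "powint s (\<lambda>x. g x + h x - gradient (\<lambda>x. f x + k x) x) < e"
    by (simp add: algebra_simps gradient_add[OF test_functionsD(4)[OF f(1)] test_functionsD(4)[OF k(1)]])
  show "\<exists>f\<in>test_functions \<Omega>. powint s (\<lambda>x. u x + v x - f x) < e \<and> powint s (\<lambda>x. g x + h x - gradient f x) < e"
    by (rule bexI[of _ "\<lambda>x. f x + k x"]) (intro conjI 1 2, rule test_functions_add[OF f(1) k(1)])
qed

lemma W0_scale:
  assumes u: "W0 s u g" and s: "0 < s"
  shows "W0 s (\<lambda>x. c * u x) (\<lambda>x. c *\<^sub>R g x)"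
  unfolding W0_def
proof (intro conjI Lp_mult Lp_scaleR W0_Lp[OF u] allI impI)
  fix e :: real assume e: "0 < e"
  define d where "d = e / (\<bar>c\<bar> powr s + 1)"
  have c: "0 < \<bar>c\<bar> powr s + 1" by (intro add_nonneg_pos) auto
  have d: "0 < d" using e c by (simp add: d_def)
  have cd: "\<bar>c\<bar> powr s * t < e" if "t < d" "0 \<le> t" for t
  proof -
    have "\<bar>c\<bar> powr s * t \<le> (\<bar>c\<bar> powr s + 1) * t" using that by (intro mult_right_mono) auto
    also have "\<dots> < (\<bar>c\<bar> powr s + 1) * d" using that c by (intro mult_strict_left_mono)
    also have "\<dots> = e" using c by (simp add: d_def)
    finally show ?thesis .
  qed
  obtain f where f: "f \<in> test_functions \<Omega>" "powint s (\<lambda>x. u x - f x) < d" "powint s (\<lambda>x. g x - gradient f x) < d"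
    by (rule W0_approx[OF u d])
  have 1: "powint s (\<lambda>x. c * u x - c * f x) < e"
    using cd[OF f(2)] powint_mult[of s c "\<lambda>x. u x - f x"] by (simp add: right_diff_distrib)
  have 2: "powint s (\<lambda>x. c *\<^sub>R g x - gradient (\<lambda>x. c * f x) x) < e"
    using cd[OF f(3)] powint_scaleR[of s c "\<lambda>x. g x - gradient f x"]
    by (simp add: scaleR_diff_right gradient_cmult[OF test_functionsD(4)[OF f(1)]])
  show "\<exists>f\<in>test_functions \<Omega>. powint s (\<lambda>x. c * u x - f x) < e \<and> powint s (\<lambda>x. c *\<^sub>R g x - gradient f x) < e"
    by (rule bexI[of _ "\<lambda>x. c * f x"]) (intro conjI 1 2, rule test_functions_cmult[OF f(1)])
qed

lemma W0_minus: "W0 s u g \<Longrightarrow> 0 < s \<Longrightarrow> W0 s (\<lambda>x. - u x) (\<lambda>x. - g x)"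
  using W0_scale[of s u g "-1"] by simp

lemma W0_diff:
  assumes u: "W0 s u g" and v: "W0 s v h" and s: "0 < s"
  shows "W0 s (\<lambda>x. u x - v x) (\<lambda>x. g x - h x)"
  using W0_add[OF u W0_minus[OF v s] s] by simp

lemma W0_midpoint:
  assumes "W0 s u g" "W0 s v h" "0 < s"
  shows "W0 s (\<lambda>x. (1/2) * (u x + v x)) (\<lambda>x. (1/2) *\<^sub>R (g x + h x))"
  by (rule W0_scale[OF W0_add[OF assms] assms(3)])

lemma W0_cong_AE:
  assumes W: "W0 s u g" and AE: "AE x in M. u x = v x" "AE x in M. g x = h x" and s: "0 < s"
  shows "W0 s v h"
proof -
  have L: "v \<in> Lp s \<Omega>" "h \<in> Lp s \<Omega>" using Lp_cong_AE W0_Lp[OF W] AE by blast+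
  have "powint s (\<lambda>x. u x - v x) = powint s (\<lambda>x. 0 :: real)"
    by (rule powint_cong_AE[OF LpD(1)[OF Lp_diff[OF W0_Lp(1)[OF W] L(1) s]]]) (use AE(1) in \<open>auto elim!: eventually_mono\<close>)
  moreover have "powint s (\<lambda>x. g x - h x) = powint s (\<lambda>x. 0 :: 'a)"
    by (rule powint_cong_AE[OF LpD(1)[OF Lp_diff[OF W0_Lp(2)[OF W] L(2) s]]]) (use AE(2) in \<open>auto elim!: eventually_mono\<close>)
  ultimately show ?thesis
    using W0_closed[of s "\<lambda>n. u" "\<lambda>n. g" v h] W L s by simp
qed

lemma W0_lower_exponent:
  assumes W: "W0 p u g" and q: "0 < q" "q \<le> p" shows "W0 q u g"
proof -
  obtain f where f: "\<And>n. f n \<in> test_functions \<Omega>" "(\<lambda>n. powint p (\<lambda>x. f n x - u x)) \<longlonglongrightarrow> 0"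
    "(\<lambda>n. powint p (\<lambda>x. gradient (f n) x - g x)) \<longlonglongrightarrow> 0" by (rule W0_approx_seq[OF W]) (rule that)
  have p: "0 < p" using q by simp
  note L = W0_Lp[OF W] and Lf = test_function_Lp(1,2)[OF f(1) p]
  show ?thesis
    by (rule W0_closed[OF W0_test[OF f(1) q(1)] Lp_lower_exponent[OF L(1) q] Lp_lower_exponent[OF L(2) q] q(1)
      powint_tendsto_lower_exponent[OF Lp_diff[OF Lf(1) L(1) p] q f(2)]
      powint_tendsto_lower_exponent[OF Lp_diff[OF Lf(2) L(2) p] q f(3)]])
qed

lemma poincare:
  assumes q: "1 < q"
  obtains C where "0 < C" "\<And>u g. W0 q u g \<Longrightarrow> powint q u \<le> C * powint q g"
proof -
  obtain C where C: "0 < C" "\<And>f. f \<in> test_functions \<Omega> \<Longrightarrow> powint q f \<le> C * powint q (gradient f)"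
    by (rule poincare_test[OF q]) blast
  have q0: "0 < q" using q by simp
  have "powint q u \<le> C * powint q g" if W: "W0 q u g" for u g
  proof -
    obtain f where f: "\<And>n. f n \<in> test_functions \<Omega>" "(\<lambda>n. powint q (\<lambda>x. f n x - u x)) \<longlonglongrightarrow> 0"
      "(\<lambda>n. powint q (\<lambda>x. gradient (f n) x - g x)) \<longlonglongrightarrow> 0" by (rule W0_approx_seq[OF W]) (rule that)
    have 1: "(\<lambda>n. powint q (f n)) \<longlonglongrightarrow> powint q u"
      by (rule powint_tendsto[OF test_function_Lp(1)[OF f(1) q0] W0_Lp(1)[OF W] q0 f(2)])
    have 2: "(\<lambda>n. C * powint q (gradient (f n))) \<longlonglongrightarrow> C * powint q g"
      by (intro tendsto_mult tendsto_const powint_tendsto[OF test_function_Lp(2)[OF f(1) q0] W0_Lp(2)[OF W] q0 f(3)])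
    show ?thesis by (rule LIMSEQ_le[OF 1 2]) (use C(2)[OF f(1)] in blast)
  qed
  then show ?thesis using that C(1) by blast
qed

lemma rellich:
  assumes q: "1 < q" and W: "\<And>n. W0 q (u n) (g n)" and R: "\<And>n. powint q (g n) \<le> R"
  obtains \<sigma> :: "nat \<Rightarrow> nat" and v where "strict_mono \<sigma>" "v \<in> Lp q \<Omega>" "(\<lambda>n. powint q (\<lambda>x. u (\<sigma> n) x - v x)) \<longlonglongrightarrow> 0"
proof -
  have q0: "0 < q" using q by simp
  have "\<exists>f\<in>test_functions \<Omega>. powint q (\<lambda>x. u n x - f x) < inverse (real (Suc n)) \<and> powint q (\<lambda>x. g n x - gradient f x) < inverse (real (Suc n))" for n
    using W[of n] unfolding W0_def by simp
  then obtain f where f: "\<And>n. f n \<in> test_functions \<Omega>" "\<And>n. powint q (\<lambda>x. u n x - f n x) < inverse (real (Suc n))"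
    "\<And>n. powint q (\<lambda>x. g n x - gradient (f n) x) < inverse (real (Suc n))" by metis
  have R1: "powint q (gradient (f n)) \<le> 2 powr q * (R + 1)" for n
  proof -
    have "powint q (\<lambda>x. g n x - (g n x - gradient (f n) x)) \<le> 2 powr q * (powint q (g n) + powint q (\<lambda>x. g n x - gradient (f n) x))"
      by (intro powint_diff_le Lp_diff W0_Lp(2)[OF W] test_function_Lp(2)[OF f(1)] q0)
    also have "\<dots> \<le> 2 powr q * (R + 1)"
    proof -
      have "inverse (real (Suc n)) \<le> 1" by (simp add: inverse_le_1_iff)
      then show ?thesis using f(3)[of n] R[of n] by (intro mult_left_mono add_mono) auto
    qed
    finally show ?thesis by simp
  qed
  obtain \<sigma> :: "nat \<Rightarrow> nat" where \<sigma>: "strict_mono \<sigma>"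
    "\<And>e. 0 < e \<Longrightarrow> \<exists>N. \<forall>i\<ge>N. \<forall>j\<ge>N. powint q (\<lambda>x. f (\<sigma> i) x - f (\<sigma> j) x) < e"
    by (rule rellich_test[OF q f(1) R1]) (rule that)
  obtain v where v: "v \<in> Lp q \<Omega>" "(\<lambda>n. powint q (\<lambda>x. f (\<sigma> n) x - v x)) \<longlonglongrightarrow> 0"
    by (rule Lp_complete[OF test_function_Lp(1)[OF f(1) q0], of \<sigma>]) (use q \<sigma>(2) in auto)
  have 1: "(\<lambda>n. powint q (\<lambda>x. u n x - f n x)) \<longlonglongrightarrow> 0"
    by (rule tendsto_sandwich[OF _ _ tendsto_const LIMSEQ_inverse_real_of_nat]) (use f(2) in \<open>auto intro!: always_eventually less_imp_le\<close>)
  have 2: "(\<lambda>n. 2 powr q * (powint q (\<lambda>x. u (\<sigma> n) x - f (\<sigma> n) x) + powint q (\<lambda>x. f (\<sigma> n) x - v x))) \<longlonglongrightarrow> 2 powr q * (0 + 0)"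
    using LIMSEQ_subseq_LIMSEQ[OF 1 \<sigma>(1)] v(2) by (intro tendsto_intros) (simp_all add: o_def)
  have "(\<lambda>n. powint q (\<lambda>x. u (\<sigma> n) x - v x)) \<longlonglongrightarrow> 2 powr q * (0 + 0)"
  proof (rule tendsto_sandwich[OF _ _ _ 2])
    show "eventually (\<lambda>n. powint q (\<lambda>x. u (\<sigma> n) x - v x) \<le> 2 powr q * (powint q (\<lambda>x. u (\<sigma> n) x - f (\<sigma> n) x) + powint q (\<lambda>x. f (\<sigma> n) x - v x))) sequentially"
      by (intro always_eventually allI powint_triangle W0_Lp(1)[OF W] test_function_Lp(1)[OF f(1)] v(1) q0)
    show "eventually (\<lambda>n. 2 powr q * (0 + 0) \<le> powint q (\<lambda>x. u (\<sigma> n) x - v x)) sequentially" by simp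
  qed simp
  then show ?thesis using that[OF \<sigma>(1) v(1)] by simp
qed

lemma integral_mult_tendsto:
  fixes F :: "nat \<Rightarrow> 'a \<Rightarrow> real"
  assumes F: "\<And>n. F n \<in> Lp s \<Omega>" and f: "f \<in> Lp s \<Omega>" and s: "1 \<le> s" and lim: "(\<lambda>n. powint s (\<lambda>x. F n x - f x)) \<longlonglongrightarrow> 0"
    and m: "m \<in> borel_measurable M" "\<And>x. \<bar>m x\<bar> \<le> B"
  shows "(\<lambda>n. \<integral>x. m x * F n x \<partial>M) \<longlonglongrightarrow> (\<integral>x. m x * f x \<partial>M)"
proof -
  have s0: "0 < s" using s by simp
  have i: "integrable M (\<lambda>x. m x * h x)" if "h \<in> Lp s \<Omega>" for h :: "'a \<Rightarrow> real"
  proof (rule Bochner_Integration.integrable_bound[OF integrable_mult_right[OF integrable_norm[OF Lp_integrable[OF that s]], of B]])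
    show "(\<lambda>x. m x * h x) \<in> borel_measurable M" using m(1) LpD(1)[OF that] by measurable
    show "AE x in M. norm (m x * h x) \<le> norm (B * norm (h x))"
    proof (rule AE_I2)
      fix x show "norm (m x * h x) \<le> norm (B * norm (h x))"
        using mult_right_mono[OF order_trans[OF m(2) abs_ge_self] norm_ge_zero, of x "h x"] by (simp add: abs_mult)
    qed
  qed
  have "(\<lambda>n. powint 1 (\<lambda>x. F n x - f x)) \<longlonglongrightarrow> 0"
    by (rule powint_tendsto_lower_exponent[OF Lp_diff[OF F f s0] zero_less_one s lim])
  then have 1: "(\<lambda>n. B * powint 1 (\<lambda>x. F n x - f x)) \<longlonglongrightarrow> 0" using tendsto_mult_right_zero by blast
  have "(\<lambda>n. (\<integral>x. m x * F n x \<partial>M) - (\<integral>x. m x * f x \<partial>M)) \<longlonglongrightarrow> 0"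
  proof (rule Lim_null_comparison[OF always_eventually[OF allI] 1])
    fix n
    note d = Lp_diff[OF F[of n] f s0]
    have "norm ((\<integral>x. m x * F n x \<partial>M) - (\<integral>x. m x * f x \<partial>M)) = \<bar>\<integral>x. m x * (F n x - f x) \<partial>M\<bar>"
      using i[OF F[of n]] i[OF f] by (simp add: right_diff_distrib)
    also have "\<dots> \<le> (\<integral>x. \<bar>m x * (F n x - f x)\<bar> \<partial>M)" by (rule integral_abs_bound)
    also have "\<dots> \<le> (\<integral>x. B * norm (F n x - f x) \<partial>M)"
    proof (rule integral_mono)
      show "integrable M (\<lambda>x. \<bar>m x * (F n x - f x)\<bar>)" using i[OF d] by simp
      show "integrable M (\<lambda>x. B * norm (F n x - f x))" using Lp_integrable[OF d s] by simp
      show "\<bar>m x * (F n x - f x)\<bar> \<le> B * norm (F n x - f x)" for x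
        using mult_right_mono[OF m(2) norm_ge_zero, of x "F n x - f x"] by (simp add: abs_mult)
    qed
    also have "\<dots> = B * powint 1 (\<lambda>x. F n x - f x)" by (simp add: powint_def)
    finally show "norm ((\<integral>x. m x * F n x \<partial>M) - (\<integral>x. m x * f x \<partial>M)) \<le> B * powint 1 (\<lambda>x. F n x - f x)" .
  qed
  then show ?thesis by (rule LIM_zero_cancel)
qed

lemma Lp_inner:
  fixes g :: "'a \<Rightarrow> 'a"
  assumes "g \<in> Lp s \<Omega>" "b \<in> Basis" "0 < s" shows "(\<lambda>x. g x \<bullet> b) \<in> Lp s \<Omega>" "powint s (\<lambda>x. g x \<bullet> b) \<le> powint s g"
proof -
  have le: "norm (g x \<bullet> b) powr s \<le> norm (g x) powr s" for x
    using Basis_le_norm[OF assms(2), of "g x"] assms(3) by (intro powr_mono2) auto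
  show L: "(\<lambda>x. g x \<bullet> b) \<in> Lp s \<Omega>"
    using LpD[OF assms(1)] le by (intro Lp_dominated[where h="\<lambda>x. norm (g x) powr s"]) auto
  show "powint s (\<lambda>x. g x \<bullet> b) \<le> powint s g"
    unfolding powint_def by (rule integral_mono[OF LpD(2)[OF L] LpD(2)[OF assms(1)] le])
qed

text \<open>Both sides of the integration by parts formula are continuous in the approximating test functions.\<close>

lemma W0_is_weak_gradient:
  assumes W: "W0 s u g" and s: "1 \<le> s"
  shows "is_weak_gradient \<Omega> u g"
  unfolding is_weak_gradient_iff
proof (intro conjI ballI)
  show "locally_integrable \<Omega> u" "locally_integrable \<Omega> g" using Lp_locally_integrable[OF _ s] W0_Lp[OF W] by blast+
  fix \<phi> and b :: 'a assume \<phi>: "\<phi> \<in> test_functions \<Omega>" and b: "b \<in> Basis"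
  have s0: "0 < s" using s by simp
  obtain f where f: "\<And>n. f n \<in> test_functions \<Omega>" "(\<lambda>n. powint s (\<lambda>x. f n x - u x)) \<longlonglongrightarrow> 0"
    "(\<lambda>n. powint s (\<lambda>x. gradient (f n) x - g x)) \<longlonglongrightarrow> 0" by (rule W0_approx_seq[OF W]) (rule that)
  obtain B where B: "\<And>x. \<bar>\<phi> x\<bar> \<le> B" "\<And>x. norm (gradient \<phi> x) \<le> B" by (rule test_functions_bounded[OF \<phi>]) (rule that)
  note m = test_function_measurable[OF \<phi>, THEN borel_measurable_M]
  note L = W0_Lp[OF W] and Lf = test_function_Lp(1,2)[OF f(1) s0]
  have 1: "(\<lambda>n. \<integral>x. (gradient \<phi> x \<bullet> b) * f n x \<partial>M) \<longlonglongrightarrow> (\<integral>x. (gradient \<phi> x \<bullet> b) * u x \<partial>M)"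
  proof (rule integral_mult_tendsto[OF Lf(1) L(1) s f(2)])
    show "(\<lambda>x. gradient \<phi> x \<bullet> b) \<in> borel_measurable M" using m(2) by measurable
    show "\<bar>gradient \<phi> x \<bullet> b\<bar> \<le> B" for x using order_trans[OF Basis_le_norm[OF b] B(2)] .
  qed
  have "(\<lambda>n. powint s (\<lambda>x. gradient (f n) x \<bullet> b - g x \<bullet> b)) \<longlonglongrightarrow> 0"
  proof (rule tendsto_sandwich[OF _ _ tendsto_const f(3)])
    show "eventually (\<lambda>n. powint s (\<lambda>x. gradient (f n) x \<bullet> b - g x \<bullet> b) \<le> powint s (\<lambda>x. gradient (f n) x - g x)) sequentially"
      using Lp_inner(2)[OF Lp_diff[OF Lf(2) L(2) s0] b s0] by (simp add: inner_diff_left)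
  qed simp
  then have 2: "(\<lambda>n. \<integral>x. \<phi> x * (gradient (f n) x \<bullet> b) \<partial>M) \<longlonglongrightarrow> (\<integral>x. \<phi> x * (g x \<bullet> b) \<partial>M)"
    by (rule integral_mult_tendsto[OF Lp_inner(1)[OF Lf(2) b s0] Lp_inner(1)[OF L(2) b s0] s _ m(1) B(1)])
  have "(\<integral>x. (gradient \<phi> x \<bullet> b) * f n x \<partial>M) = - (\<integral>x. \<phi> x * (gradient (f n) x \<bullet> b) \<partial>M)" for n
    using test_function_weak_gradient[OF f(1)[of n]] \<phi> b by (simp add: is_weak_gradient_iff)
  then show "(\<integral>x. (gradient \<phi> x \<bullet> b) * u x \<partial>M) = - (\<integral>x. \<phi> x * (g x \<bullet> b) \<partial>M)"
    using LIMSEQ_unique[OF 1] tendsto_minus[OF 2] by simp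
qed

lemma weak_grad_W0:
  assumes W: "W0 s u g" and s: "1 \<le> s"
  shows "AE x in M. weak_grad \<Omega> u x = g x" "W0 s u (weak_grad \<Omega> u)" "powint s (weak_grad \<Omega> u) = powint s g"
proof -
  show 1: "AE x in M. weak_grad \<Omega> u x = g x" by (rule weak_grad_AE[OF W0_is_weak_gradient[OF assms]])
  then have "AE x in M. g x = weak_grad \<Omega> u x" by eventually_elim simp
  then show 2: "W0 s u (weak_grad \<Omega> u)" using W0_cong_AE[OF W] s by simp
  show "powint s (weak_grad \<Omega> u) = powint s g"
    by (rule powint_cong_AE[OF LpD(1)[OF W0_Lp(2)[OF 2]] LpD(1)[OF W0_Lp(2)[OF W]] 1])
qed

lemma W1_norm_tendsto_iff:
  assumes s: "1 \<le> s" and u: "u \<in> Lp s \<Omega>" and g: "g \<in> Lp s \<Omega>" "is_weak_gradient \<Omega> u g" and f: "\<And>n. f n \<in> test_functions \<Omega>"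
  shows "(\<lambda>n. W1_norm s \<Omega> (u - f n)) \<longlonglongrightarrow> 0 \<longleftrightarrow>
    (\<lambda>n. powint s (\<lambda>x. u x - f n x)) \<longlonglongrightarrow> 0 \<and> (\<lambda>n. powint s (\<lambda>x. g x - gradient (f n) x)) \<longlonglongrightarrow> 0"
proof -
  have s0: "0 < s" using s by simp
  let ?a = "\<lambda>n. powint s (\<lambda>x. u x - f n x)" and ?b = "\<lambda>n. powint s (\<lambda>x. g x - gradient (f n) x)"
  have norm: "W1_norm s \<Omega> (u - f n) = (?a n + ?b n) powr (1 / s)" for n
  proof -
    have d: "u - f n = (\<lambda>x. u x - f n x)" by (simp add: fun_diff_def)
    have wg: "is_weak_gradient \<Omega> (u - f n) (\<lambda>x. g x - gradient (f n) x)"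
      unfolding d by (rule is_weak_gradient_diff[OF g(2) test_function_weak_gradient[OF f]])
    have AE: "AE x in M. g x - gradient (f n) x = weak_grad \<Omega> (u - f n) x"
      using weak_grad_AE[OF wg] by eventually_elim simp
    have L: "(\<lambda>x. g x - gradient (f n) x) \<in> Lp s \<Omega>" by (rule Lp_diff[OF g(1) test_function_Lp(2)[OF f s0] s0])
    have "powint s (\<lambda>x. g x - gradient (f n) x) = powint s (weak_grad \<Omega> (u - f n))"
      by (rule powint_cong_AE[OF LpD(1)[OF L] LpD(1)[OF Lp_cong_AE[OF L AE]] AE])
    then show ?thesis unfolding W1_norm_def d powint_def by simp
  qed
  have nn: "0 \<le> ?a n" "0 \<le> ?b n" for n by simp_all
  show ?thesis
  proof
    assume "(\<lambda>n. W1_norm s \<Omega> (u - f n)) \<longlonglongrightarrow> 0"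
    then have "(\<lambda>n. (W1_norm s \<Omega> (u - f n)) powr s) \<longlonglongrightarrow> 0 powr s"
      using s0 by (intro tendsto_powr') (auto simp: norm)
    then have ab: "(\<lambda>n. ?a n + ?b n) \<longlonglongrightarrow> 0" using s0 nn by (simp add: norm powr_powr)
    have "?a \<longlonglongrightarrow> 0" by (rule tendsto_sandwich[OF _ _ tendsto_const ab]) simp_all
    moreover have "?b \<longlonglongrightarrow> 0" by (rule tendsto_sandwich[OF _ _ tendsto_const ab]) simp_all
    ultimately show "?a \<longlonglongrightarrow> 0 \<and> ?b \<longlonglongrightarrow> 0" ..
  next
    assume ab: "?a \<longlonglongrightarrow> 0 \<and> ?b \<longlonglongrightarrow> 0"
    then have "(\<lambda>n. ?a n + ?b n) \<longlonglongrightarrow> 0" using tendsto_add[of ?a 0 sequentially ?b 0] by simp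
    then have "(\<lambda>n. (?a n + ?b n) powr (1 / s)) \<longlonglongrightarrow> 0 powr (1 / s)"
      using s0 by (intro tendsto_powr') (auto simp: add_nonneg_nonneg)
    then show "(\<lambda>n. W1_norm s \<Omega> (u - f n)) \<longlonglongrightarrow> 0" using s0 by (simp add: norm)
  qed
qed

lemma W10_iff:
  assumes s: "1 \<le> s" shows "u \<in> W10 s \<Omega> \<longleftrightarrow> (\<exists>g. W0 s u g)"
proof
  assume "u \<in> W10 s \<Omega>"
  then obtain g f where g: "u \<in> Lp s \<Omega>" "g \<in> Lp s \<Omega>" "is_weak_gradient \<Omega> u g" and f: "\<And>n. f n \<in> test_functions \<Omega>"
    and lim: "(\<lambda>n. W1_norm s \<Omega> (u - f n)) \<longlonglongrightarrow> 0"
    unfolding W10_def W1_def by auto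
  have "(\<lambda>n. powint s (\<lambda>x. f n x - u x)) \<longlonglongrightarrow> 0" "(\<lambda>n. powint s (\<lambda>x. gradient (f n) x - g x)) \<longlonglongrightarrow> 0"
    using lim unfolding W1_norm_tendsto_iff[OF s g f] by (auto simp: powint_minus_commute)
  then have "W0 s u g" using W0_closed[OF W0_test[OF f] g(1,2)] s by simp
  then show "\<exists>g. W0 s u g" by blast
next
  assume "\<exists>g. W0 s u g"
  then obtain g where W: "W0 s u g" by blast
  obtain f where f: "\<And>n. f n \<in> test_functions \<Omega>" "(\<lambda>n. powint s (\<lambda>x. f n x - u x)) \<longlonglongrightarrow> 0"
    "(\<lambda>n. powint s (\<lambda>x. gradient (f n) x - g x)) \<longlonglongrightarrow> 0" by (rule W0_approx_seq[OF W]) (rule that)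
  have "(\<lambda>n. W1_norm s \<Omega> (u - f n)) \<longlonglongrightarrow> 0"
    unfolding W1_norm_tendsto_iff[OF s W0_Lp[OF W] W0_is_weak_gradient[OF W s] f(1)]
    using f(2,3) by (simp add: powint_minus_commute)
  then show "u \<in> W10 s \<Omega>"
    unfolding W10_def W1_def using W0_Lp[OF W] W0_is_weak_gradient[OF W s] f(1) by blast
qed

end

section \<open>Semicontinuity and constrained minimisers of the energy\<close>

text \<open>Midpoints suffice in place of convex combinations, since uniform convexity is used in midpoint form.\<close>

inductive_set midpoint_hull :: "(('a \<Rightarrow> real) \<times> ('a \<Rightarrow> 'b::real_vector)) set \<Rightarrow> (('a \<Rightarrow> real) \<times> ('a \<Rightarrow> 'b)) set" for S where
  base: "x \<in> S \<Longrightarrow> x \<in> midpoint_hull S"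
| mid: "(u, g) \<in> midpoint_hull S \<Longrightarrow> (v, h) \<in> midpoint_hull S \<Longrightarrow>
    (\<lambda>x. (1/2) * (u x + v x), \<lambda>x. (1/2) *\<^sub>R (g x + h x)) \<in> midpoint_hull S"

lemma midpoint_hull_mono: "S \<subseteq> T \<Longrightarrow> midpoint_hull S \<subseteq> midpoint_hull T"
proof
  fix x assume "x \<in> midpoint_hull S" "S \<subseteq> T"
  then show "x \<in> midpoint_hull T"
  proof induction
    case (mid u g v h)
    show ?case by (rule midpoint_hull.mid[OF mid(3)[OF mid.prems] mid(4)[OF mid.prems]])
  qed (auto intro: midpoint_hull.base)
qed

context bounded_domain
begin

text \<open>The second arguments need not converge; this is used when only a bound for them is known.\<close>

lemma pairing_tendsto:
  assumes q: "1 < q" and L: "\<And>n. u n \<in> Lp q \<Omega>" "u' \<in> Lp q \<Omega>" "\<And>n. v n \<in> Lp q \<Omega>" "\<And>n. v' n \<in> Lp q \<Omega>"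
    and u: "(\<lambda>n. powint q (\<lambda>x. u n x - u' x)) \<longlonglongrightarrow> 0" and v: "(\<lambda>n. powint q (\<lambda>x. v n x - v' n x)) \<longlonglongrightarrow> 0"
    and B: "\<And>n. powint q (v n) \<le> B" "\<And>n. powint q (v' n) \<le> B"
  shows "(\<lambda>n. pairing q (u n) (v n) - pairing q u' (v' n)) \<longlonglongrightarrow> 0"
proof (rule LIMSEQ_I)
  fix e :: real assume e: "0 < e"
  have q0: "0 < q" using q by simp
  have "(\<lambda>n. powint q (u n)) \<longlonglongrightarrow> powint q u'" by (rule powint_tendsto[OF L(1,2) q0 u])
  then obtain K where K: "\<And>n. norm (powint q (u n)) \<le> K" using convergent_imp_Bseq[of "\<lambda>n. powint q (u n)"]
    by (auto simp: convergent_def Bseq_def)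
  define D where "D = max B (max K (powint q u'))"
  have D: "powint q (v n) \<le> D" "powint q (v' n) \<le> D" "powint q (u n) \<le> D" "powint q u' \<le> D" for n
    using B[of n] K[of n] by (auto simp: D_def)
  obtain d where d: "0 < d" "\<And>u v u' v'. u \<in> Lp q \<Omega> \<Longrightarrow> v \<in> Lp q \<Omega> \<Longrightarrow> u' \<in> Lp q \<Omega> \<Longrightarrow> v' \<in> Lp q \<Omega> \<Longrightarrow>
    powint q u \<le> D \<Longrightarrow> powint q v \<le> D \<Longrightarrow> powint q u' \<le> D \<Longrightarrow> powint q v' \<le> D \<Longrightarrow>
    powint q (\<lambda>x. u x - u' x) < d \<Longrightarrow> powint q (\<lambda>x. v x - v' x) < d \<Longrightarrow> \<bar>pairing q u v - pairing q u' v'\<bar> < e"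
    by (rule pairing_continuity_modulus[OF q e, of D]) (rule that)
  have "eventually (\<lambda>n. powint q (\<lambda>x. u n x - u' x) < d \<and> powint q (\<lambda>x. v n x - v' n x) < d) sequentially"
    using order_tendstoD(2)[OF u d(1)] order_tendstoD(2)[OF v d(1)] by (rule eventually_conj)
  then obtain N where N: "\<And>n. N \<le> n \<Longrightarrow> powint q (\<lambda>x. u n x - u' x) < d" "\<And>n. N \<le> n \<Longrightarrow> powint q (\<lambda>x. v n x - v' n x) < d"
    by (auto simp: eventually_sequentially)
  have "\<bar>pairing q (u n) (v n) - pairing q u' (v' n)\<bar> < e" if "N \<le> n" for n
    by (rule d(2)[OF L(1) L(3) L(2) L(4) D(3) D(1) D(4) D(2) N(1)[OF that] N(2)[OF that]])
  then show "\<exists>N. \<forall>n\<ge>N. norm (pairing q (u n) (v n) - pairing q u' (v' n) - 0) < e"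
    by (intro exI[of _ N]) simp
qed

lemma pairing_tendsto_both:
  assumes q: "1 < q" and L: "\<And>n. u n \<in> Lp q \<Omega>" "u' \<in> Lp q \<Omega>" "\<And>n. v n \<in> Lp q \<Omega>" "v' \<in> Lp q \<Omega>"
    and u: "(\<lambda>n. powint q (\<lambda>x. u n x - u' x)) \<longlonglongrightarrow> 0" and v: "(\<lambda>n. powint q (\<lambda>x. v n x - v' x)) \<longlonglongrightarrow> 0"
  shows "(\<lambda>n. pairing q (u n) (v n)) \<longlonglongrightarrow> pairing q u' v'"
proof -
  have q0: "0 < q" using q by simp
  have "(\<lambda>n. powint q (v n)) \<longlonglongrightarrow> powint q v'" by (rule powint_tendsto[OF L(3,4) q0 v])
  then obtain K where K: "\<And>n. norm (powint q (v n)) \<le> K" using convergent_imp_Bseq[of "\<lambda>n. powint q (v n)"]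
    by (auto simp: convergent_def Bseq_def)
  have "powint q (v n) \<le> max K (powint q v')" "powint q v' \<le> max K (powint q v')" for n using K[of n] by auto
  then have "(\<lambda>n. pairing q (u n) (v n) - pairing q u' v') \<longlonglongrightarrow> 0"
    by (rule pairing_tendsto[OF q L(1,2,3) L(4) u v])
  then show ?thesis by (rule LIM_zero_cancel)
qed

lemma powint_conv_bound:
  fixes f :: "nat \<Rightarrow> 'a \<Rightarrow> 'b::euclidean_space"
  assumes "\<And>n. f n \<in> Lp s \<Omega>" "g \<in> Lp s \<Omega>" "0 < s" "(\<lambda>n. powint s (\<lambda>x. f n x - g x)) \<longlonglongrightarrow> 0"
  obtains B where "\<And>n. powint s (f n) \<le> B"
proof -
  have "(\<lambda>n. powint s (f n)) \<longlonglongrightarrow> powint s g" by (rule powint_tendsto[OF assms])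
  then obtain K where "\<And>n. norm (powint s (f n)) \<le> K" using convergent_imp_Bseq[of "\<lambda>n. powint s (f n)"]
    by (auto simp: convergent_def Bseq_def)
  then show ?thesis using that[of K] by simp
qed

text \<open>By the fundamental lemma, a function that is orthogonal to all test functions vanishes. So the constraint
  set of the minimisation contains a function of finite energy.\<close>

lemma exists_test_pairing:
  assumes q: "1 < q" and u: "u \<in> Lp q \<Omega>" "powint q u = 1"
  obtains f where "f \<in> test_functions \<Omega>" "pairing q u f = 1"
proof -
  have "\<exists>f\<in>test_functions \<Omega>. pairing q u f \<noteq> 0"
  proof (rule ccontr)
    assume "\<not> ?thesis"
    then have z: "\<And>f. f \<in> test_functions \<Omega> \<Longrightarrow> (\<integral>x. spow q (u x) * f x \<partial>M) = 0" by (auto simp: pairing_def)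
    have loc: "locally_integrable \<Omega> (\<lambda>x. spow q (u x))"
    proof (rule Lp_locally_integrable[OF LpI order_refl])
      show "(\<lambda>x. spow q (u x)) \<in> borel_measurable M"
        by (rule measurable_compose[OF LpD(1)[OF u(1)] spow_measurable[OF q]])
      have c: "(\<lambda>x. 1::real) \<in> Lp q \<Omega>" by (rule LpI) auto
      show "integrable M (\<lambda>x. norm (spow q (u x)) powr 1)" using integrable_norm[OF integrable_pairing[OF q u(1) c]] by simp
    qed
    have "AE x in M. spow q (u x) = 0" by (rule fundamental_lemma[OF loc z])
    then have "AE x in M. u x = 0" by eventually_elim (auto simp: spow_def)
    then have "powint q u = powint q (\<lambda>x. 0 :: real)"
      by (intro powint_cong_AE LpD(1)[OF u(1)]) auto
    then show False using u(2) by simp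
  qed
  then obtain f where f: "f \<in> test_functions \<Omega>" "pairing q u f \<noteq> 0" by blast
  show ?thesis
    by (rule that[OF test_functions_cmult[OF f(1), of "1 / pairing q u f"]]) (use f(2) in \<open>simp only: pairing_mult\<close>, simp)
qed

end

text \<open>The case \<open>p = q\<close> is included because semicontinuity of the \<open>q\<close>-energy alone is obtained by
  interpretation with equal exponents.\<close>

locale two_exponents = bounded_domain \<Omega> for \<Omega> :: "'a::euclidean_space set" +
  fixes p q :: real
  assumes q_gt_1: "1 < q" and q_le_p: "q \<le> p"
begin

lemma exponents: "0 < q" "1 \<le> q" "1 < p" "0 < p" "1 \<le> p"
  using q_gt_1 q_le_p by auto

lemma Lp_p_q: "f \<in> Lp p \<Omega> \<Longrightarrow> (f :: 'a \<Rightarrow> 'b::euclidean_space) \<in> Lp q \<Omega>"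
  using Lp_lower_exponent exponents(1) q_le_p by blast

lemma W0_p_q: "W0 p u g \<Longrightarrow> W0 q u g"
  using W0_lower_exponent exponents(1) q_le_p by blast

text \<open>The normalising factors \<open>1/p\<close> and \<open>1/q\<close> are omitted; they reappear as the factor \<open>p / q\<close> in
  \<open>rescaled_weak_solution\<close>.\<close>

definition energy :: "real \<Rightarrow> ('a \<Rightarrow> 'a) \<Rightarrow> real" where
  "energy e g = e * powint p g + powint q g"

lemma energy_nonneg: "0 \<le> e \<Longrightarrow> 0 \<le> energy e g"
  by (simp add: energy_def)

lemma energy_ge: "0 \<le> e \<Longrightarrow> powint q g \<le> energy e g" "0 \<le> e \<Longrightarrow> e * powint p g \<le> energy e g"
  by (simp_all add: energy_def)

lemma energy_minus [simp]: "energy e (\<lambda>x. - g x) = energy e g"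
  by (simp add: energy_def)

lemma energy_midpoint:
  assumes "g \<in> Lp p \<Omega>" "h \<in> Lp p \<Omega>" "0 < e"
  shows "energy e (\<lambda>x. (1/2) *\<^sub>R (g x + h x)) + e * defect_int p g h \<le> (energy e g + energy e h) / 2"
proof -
  have "(energy e g + energy e h) / 2 - energy e (\<lambda>x. (1/2) *\<^sub>R (g x + h x)) = e * defect_int p g h + defect_int q g h"
    by (simp add: energy_def defect_int_def field_simps)
  moreover have "0 \<le> defect_int q g h"
    by (rule defect_int_nonneg[OF Lp_p_q[OF assms(1)] Lp_p_q[OF assms(2)] q_gt_1])
  ultimately show ?thesis by linarith
qed

lemma energy_uniform_convexity:
  assumes e: "0 < e" and \<eta>: "0 < \<eta>"
  obtains d where "0 < d" "\<And>g h. g \<in> Lp p \<Omega> \<Longrightarrow> h \<in> Lp p \<Omega> \<Longrightarrow> energy e g \<le> B \<Longrightarrow> energy e h \<le> B \<Longrightarrow>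
    (energy e g + energy e h) / 2 - energy e (\<lambda>x. (1/2) *\<^sub>R (g x + h x)) < d \<Longrightarrow> powint p (\<lambda>x. g x - h x) < \<eta>"
proof -
  obtain d where d: "0 < d" "\<And>f g :: 'a \<Rightarrow> 'a. f \<in> Lp p \<Omega> \<Longrightarrow> g \<in> Lp p \<Omega> \<Longrightarrow>
    powint p f \<le> B / e \<Longrightarrow> powint p g \<le> B / e \<Longrightarrow> defect_int p f g < d \<Longrightarrow> powint p (\<lambda>x. f x - g x) < \<eta>"
    by (rule uniform_convexity_powint[OF exponents(3) \<eta>, of "B / e"]) (rule that)
  show ?thesis
  proof (rule that[of "e * d"])
    show "0 < e * d" using e d(1) by simp
    fix g h :: "'a \<Rightarrow> 'a" assume L: "g \<in> Lp p \<Omega>" "h \<in> Lp p \<Omega>" and B: "energy e g \<le> B" "energy e h \<le> B"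
      and lt: "(energy e g + energy e h) / 2 - energy e (\<lambda>x. (1/2) *\<^sub>R (g x + h x)) < e * d"
    have "e * defect_int p g h < e * d" using energy_midpoint[OF L e] lt by linarith
    then have 1: "defect_int p g h < d" using e by simp
    have "e * powint p g \<le> B" "e * powint p h \<le> B" using energy_ge(2)[of e g] energy_ge(2)[of e h] B e by linarith+
    then have "powint p g \<le> B / e" "powint p h \<le> B / e" using e by (simp_all add: pos_le_divide_eq mult.commute)
    then show "powint p (\<lambda>x. g x - h x) < \<eta>" by (rule d(2)[OF L _ _ 1])
  qed
qed

lemma energy_tendsto:
  assumes "\<And>n. g n \<in> Lp p \<Omega>" "h \<in> Lp p \<Omega>" "(\<lambda>n. powint p (\<lambda>x. g n x - h x)) \<longlonglongrightarrow> 0"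
  shows "(\<lambda>n. energy e (g n)) \<longlonglongrightarrow> energy e h"
  unfolding energy_def
proof (intro tendsto_intros)
  show "(\<lambda>n. powint p (g n)) \<longlonglongrightarrow> powint p h" by (rule powint_tendsto[OF assms(1,2) exponents(4) assms(3)])
  have "(\<lambda>n. powint q (\<lambda>x. g n x - h x)) \<longlonglongrightarrow> 0"
    by (rule powint_tendsto_lower_exponent[OF Lp_diff[OF assms(1,2) exponents(4)] exponents(1) q_le_p assms(3)])
  then show "(\<lambda>n. powint q (g n)) \<longlonglongrightarrow> powint q h"
    by (rule powint_tendsto[OF Lp_p_q[OF assms(1)] Lp_p_q[OF assms(2)] exponents(1)])
qed

lemma energy_scaleR_le:
  assumes e: "0 \<le> e" shows "energy e (\<lambda>x. c *\<^sub>R g x) \<le> max 1 (\<bar>c\<bar> powr p) * energy e g"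
proof -
  have "\<bar>c\<bar> powr q \<le> max 1 (\<bar>c\<bar> powr p)"
  proof (cases "\<bar>c\<bar> \<le> 1")
    case True then show ?thesis using powr_le1[of q "\<bar>c\<bar>"] exponents by simp
  next
    case False then show ?thesis using powr_mono[OF q_le_p, of "\<bar>c\<bar>"] by (simp add: le_max_iff_disj)
  qed
  then have "\<bar>c\<bar> powr q * powint q g \<le> max 1 (\<bar>c\<bar> powr p) * powint q g" by (intro mult_right_mono) auto
  moreover have "\<bar>c\<bar> powr p * (e * powint p g) \<le> max 1 (\<bar>c\<bar> powr p) * (e * powint p g)"
    using e by (intro mult_right_mono) auto
  ultimately show ?thesis by (simp add: energy_def powint_scaleR algebra_simps)
qed

lemma energy_cong_AE:
  assumes "g \<in> Lp p \<Omega>" "AE x in M. g x = h x" shows "energy e g = energy e h"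
proof -
  have m: "g \<in> borel_measurable M" "h \<in> borel_measurable M" using LpD(1)[OF assms(1)] LpD(1)[OF Lp_cong_AE[OF assms]] .
  show ?thesis unfolding energy_def using powint_cong_AE[OF m assms(2)] by metis
qed

text \<open>The infima of the energy over a decreasing sequence of midpoint convex sets increase to a limit. Members
  that almost attain the infima have midpoints that cannot lie much below, so uniform convexity makes them
  a Cauchy sequence. For a constant sequence of sets this yields a minimiser; for hulls of tails of a
  sequence it yields lower semicontinuity, as Mazur's lemma does for weak convergence.\<close>

lemma midpoint_minimizing_sequence:
  fixes C :: "nat \<Rightarrow> (('a \<Rightarrow> real) \<times> ('a \<Rightarrow> 'a)) set"
  assumes e: "0 < e" and W: "\<And>n u g. (u, g) \<in> C n \<Longrightarrow> W0 p u g" and dec: "\<And>n m. n \<le> m \<Longrightarrow> C m \<subseteq> C n"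
    and mid: "\<And>n u g v h. (u, g) \<in> C n \<Longrightarrow> (v, h) \<in> C n \<Longrightarrow> (\<lambda>x. (1/2) * (u x + v x), \<lambda>x. (1/2) *\<^sub>R (g x + h x)) \<in> C n"
    and B: "\<And>n. \<exists>(u, g)\<in>C n. energy e g \<le> B"
  obtains z k z' k' where "\<And>n. (z n, k n) \<in> C n" "W0 p z' k'" "(\<lambda>n. powint p (\<lambda>x. z n x - z' x)) \<longlonglongrightarrow> 0"
    "\<forall>b. (\<forall>n. \<exists>(u, g)\<in>C n. energy e g \<le> b) \<longrightarrow> energy e k' \<le> b"
proof -
  define m where "m n = Inf ((\<lambda>x. energy e (snd x)) ` C n)" for n
  have bdd: "bdd_below ((\<lambda>x. energy e (snd x)) ` C n)" for n
    using energy_nonneg[of e] e by (intro bdd_belowI[of _ 0]) auto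
  have ne: "C n \<noteq> {}" for n using B[of n] by auto
  have m_le: "m n \<le> energy e g" if "(u, g) \<in> C n" for n u g
    unfolding m_def using bdd that by (intro cInf_lower) force+
  have m_bound: "m n \<le> b" if "\<exists>(u, g)\<in>C n. energy e g \<le> b" for n b using that m_le order_trans by fast
  have m_mono: "m n \<le> m k" if "n \<le> k" for n k
    unfolding m_def using ne bdd dec[OF that] by (intro cInf_superset_mono) auto
  have "\<exists>x\<in>C n. energy e (snd x) < m n + inverse (real (Suc n))" for n
    using cInf_lessD[of "(\<lambda>x. energy e (snd x)) ` C n" "m n + inverse (real (Suc n))"] ne[of n] by (auto simp: m_def)
  then obtain x where x: "\<And>n. x n \<in> C n" "\<And>n. energy e (snd (x n)) < m n + inverse (real (Suc n))" by metis
  define z k where "z n = fst (x n)" and "k n = snd (x n)" for n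
  have zk: "(z n, k n) \<in> C n" "energy e (k n) < m n + inverse (real (Suc n))" for n using x[of n] by (simp_all add: z_def k_def)
  have Wn: "W0 p (z n) (k n)" for n using W zk(1) by blast
  note L = W0_Lp[OF Wn]
  have mB: "m n \<le> B" for n using m_bound[OF B] .
  have "incseq m" using m_mono by (simp add: incseq_def)
  then obtain l where l: "m \<longlonglongrightarrow> l" using incseq_convergent[of m B] mB by blast
  have kB: "energy e (k n) \<le> B + 1" for n
  proof -
    have "inverse (real (Suc n)) \<le> 1" by (simp add: inverse_le_1_iff)
    then show ?thesis using zk(2)[of n] mB[of n] by linarith
  qed
  have cauchy_k: "\<exists>N. \<forall>i\<ge>N. \<forall>j\<ge>N. powint p (\<lambda>x. k i x - k j x) < \<eta>" if \<eta>: "0 < \<eta>" for \<eta>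
  proof -
    obtain d where d: "0 < d" "\<And>g h. g \<in> Lp p \<Omega> \<Longrightarrow> h \<in> Lp p \<Omega> \<Longrightarrow> energy e g \<le> B + 1 \<Longrightarrow> energy e h \<le> B + 1 \<Longrightarrow>
      (energy e g + energy e h) / 2 - energy e (\<lambda>x. (1/2) *\<^sub>R (g x + h x)) < d \<Longrightarrow> powint p (\<lambda>x. g x - h x) < \<eta>"
      by (rule energy_uniform_convexity[OF e \<eta>, of "B + 1"]) (rule that)
    have "eventually (\<lambda>n. l - d / 4 < m n \<and> m n < l + d / 4 \<and> inverse (real (Suc n)) < d / 4) sequentially"
      using order_tendstoD[OF l] order_tendstoD(2)[OF LIMSEQ_inverse_real_of_nat, of "d / 4"] d(1)
      by (intro eventually_conj) auto
    then obtain N where N: "\<And>n. N \<le> n \<Longrightarrow> l - d / 4 < m n \<and> m n < l + d / 4 \<and> inverse (real (Suc n)) < d / 4"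
      by (auto simp: eventually_sequentially)
    have "powint p (\<lambda>x. k i x - k j x) < \<eta>" if ij: "N \<le> i" "N \<le> j" for i j
    proof (rule d(2)[OF L(2) L(2) kB kB])
      \<comment> \<open>The midpoint lies in the larger of the two sets, so its energy is at least an infimum close to \<open>l\<close>.\<close>
      obtain n where n: "n \<le> i" "n \<le> j" "N \<le> n" using ij by (meson le_cases order_refl)
      have "(z i, k i) \<in> C n" "(z j, k j) \<in> C n" using zk(1) dec[OF n(1)] dec[OF n(2)] by auto
      from mid[OF this] have mn: "m n \<le> energy e (\<lambda>x. (1/2) *\<^sub>R (k i x + k j x))" by (rule m_le)
      define E where "E = energy e (\<lambda>x. (1/2) *\<^sub>R (k i x + k j x))"
      show "(energy e (k i) + energy e (k j)) / 2 - energy e (\<lambda>x. (1/2) *\<^sub>R (k i x + k j x)) < d"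
        using mn d(1) N[OF n(3)] N[OF ij(1)] N[OF ij(2)] zk(2)[of i] zk(2)[of j] unfolding E_def[symmetric] by argo
    qed
    then show ?thesis by blast
  qed
  obtain c where c: "0 < c" "\<And>u g. W0 p u g \<Longrightarrow> powint p u \<le> c * powint p g"
    by (rule poincare[OF exponents(3)]) (rule that)
  have cauchy_z: "\<exists>N. \<forall>i\<ge>N. \<forall>j\<ge>N. powint p (\<lambda>x. z i x - z j x) < \<eta>" if \<eta>: "0 < \<eta>" for \<eta>
  proof -
    obtain N where N: "\<forall>i\<ge>N. \<forall>j\<ge>N. powint p (\<lambda>x. k i x - k j x) < \<eta> / c"
      using cauchy_k[of "\<eta> / c"] \<eta> c(1) by auto
    have "powint p (\<lambda>x. z i x - z j x) < \<eta>" if "N \<le> i" "N \<le> j" for i j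
    proof -
      have "powint p (\<lambda>x. z i x - z j x) \<le> c * powint p (\<lambda>x. k i x - k j x)"
        by (rule c(2)[OF W0_diff[OF Wn Wn exponents(4)]])
      also have "\<dots> < c * (\<eta> / c)" using N that c(1) by (intro mult_strict_left_mono) auto
      finally show ?thesis using c(1) by simp
    qed
    then show ?thesis by blast
  qed
  obtain k' where k': "k' \<in> Lp p \<Omega>" "(\<lambda>n. powint p (\<lambda>x. k n x - k' x)) \<longlonglongrightarrow> 0"
    by (rule Lp_complete[OF L(2) exponents(5) cauchy_k])
  obtain z' where z': "z' \<in> Lp p \<Omega>" "(\<lambda>n. powint p (\<lambda>x. z n x - z' x)) \<longlonglongrightarrow> 0"
    by (rule Lp_complete[OF L(1) exponents(5) cauchy_z])
  show ?thesis
  proof (rule that[OF zk(1) W0_closed[OF Wn z'(1) k'(1) exponents(4) z'(2) k'(2)] z'(2)], intro allI impI)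
    fix b assume b: "\<forall>n. \<exists>(u, g)\<in>C n. energy e g \<le> b"
    have 1: "(\<lambda>n. energy e (k n)) \<longlonglongrightarrow> energy e k'" by (rule energy_tendsto[OF L(2) k'])
    have 2: "(\<lambda>n. b + inverse (real (Suc n))) \<longlonglongrightarrow> b + 0" by (intro tendsto_intros LIMSEQ_inverse_real_of_nat)
    have "energy e (k n) \<le> b + inverse (real (Suc n))" for n using zk(2)[of n] m_bound[OF b[rule_format, of n]] by linarith
    then have "energy e k' \<le> b + 0" using LIMSEQ_le[OF 1 2] by blast
    then show "energy e k' \<le> b" by simp
  qed
qed

text \<open>Convergence in \<open>L^q\<close> is inherited by the midpoint hulls of the tails, so the limit provided by
  \<open>midpoint_minimizing_sequence\<close> has the given limit as its first component.\<close>

lemma energy_lower_semicontinuous: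
  assumes e: "0 < e" and W: "\<And>n. W0 p (u n) (g n)" and B: "\<And>n. energy e (g n) \<le> B"
    and u': "u' \<in> Lp q \<Omega>" "(\<lambda>n. powint q (\<lambda>x. u n x - u' x)) \<longlonglongrightarrow> 0"
  obtains h where "W0 p u' h" "energy e h \<le> B"
proof -
  define C where "C N = midpoint_hull {(u n, g n) | n. N \<le> n}" for N
  have CW: "W0 p v h" if "(v, h) \<in> C N" for N v h
  proof -
    have "W0 p (fst x) (snd x)" if "x \<in> C N" for x
      using that unfolding C_def
    proof induction
      case (mid u g v h)
      then show ?case using W0_midpoint[OF _ _ exponents(4), of u g v h] by (simp only: fst_conv snd_conv)
    qed (use W in auto)
    then show ?thesis using that by fastforce
  qed
  have dec: "C m \<subseteq> C n" if "n \<le> m" for n m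
    unfolding C_def using that by (intro midpoint_hull_mono) auto
  have mid: "(\<lambda>x. (1/2) * (v x + w x), \<lambda>x. (1/2) *\<^sub>R (h x + k x)) \<in> C n" if "(v, h) \<in> C n" "(w, k) \<in> C n" for n v h w k
    using that unfolding C_def by (rule midpoint_hull.mid)
  have mem: "(u n, g n) \<in> C n" for n unfolding C_def by (rule midpoint_hull.base) auto
  have ex: "\<exists>(v, h)\<in>C n. energy e h \<le> B" for n using mem[of n] B[of n] by blast
  have near: "powint q (\<lambda>x. v x - u' x) \<le> d" if "(v, h) \<in> C N" "\<And>n. N \<le> n \<Longrightarrow> powint q (\<lambda>x. u n x - u' x) \<le> d" for v h N d
  proof -
    have Wq: "W0 q (fst x) (snd x)" if "x \<in> C N" for x using CW[of "fst x" "snd x" N] that W0_p_q by simp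
    have "powint q (\<lambda>y. fst x y - u' y) \<le> d" if "x \<in> C N" for x
      using that unfolding C_def
    proof induction
      case (base x)
      then show ?case using \<open>\<And>n. N \<le> n \<Longrightarrow> powint q (\<lambda>x. u n x - u' x) \<le> d\<close> by auto
    next
      case (mid v h w k)
      have L: "(\<lambda>x. v x - u' x) \<in> Lp q \<Omega>" "(\<lambda>x. w x - u' x) \<in> Lp q \<Omega>"
        using W0_Lp(1)[OF Wq[of "(v, h)"]] W0_Lp(1)[OF Wq[of "(w, k)"]] mid(1,2) u'(1) exponents(1)
        by (auto simp: C_def intro!: Lp_diff)
      have "powint q (\<lambda>x. (1/2) *\<^sub>R ((v x - u' x) + (w x - u' x))) \<le> (powint q (\<lambda>x. v x - u' x) + powint q (\<lambda>x. w x - u' x)) / 2"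
        using defect_int_nonneg[OF L q_gt_1] by (simp add: defect_int_def)
      also have "\<dots> \<le> d" using mid(3,4) by simp
      also have "(\<lambda>x. (1/2) *\<^sub>R ((v x - u' x) + (w x - u' x))) = (\<lambda>x. (1/2) * (v x + w x) - u' x)"
        by (auto simp: field_simps)
      finally show ?case by simp
    qed
    then show ?thesis using that(1) by fastforce
  qed
  obtain z k z' k' where z: "\<And>n. (z n, k n) \<in> C n" "W0 p z' k'" "(\<lambda>n. powint p (\<lambda>x. z n x - z' x)) \<longlonglongrightarrow> 0"
    "\<forall>b. (\<forall>n. \<exists>(u, g)\<in>C n. energy e g \<le> b) \<longrightarrow> energy e k' \<le> b"
    by (rule midpoint_minimizing_sequence[of e C B]) (rule e, erule CW, erule dec, erule (1) mid, rule ex, rule that)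
  note Lz = W0_Lp(1)[OF CW[OF z(1)]]
  have "(\<lambda>n. powint q (\<lambda>x. z n x - z' x)) \<longlonglongrightarrow> 0"
    by (rule powint_tendsto_lower_exponent[OF Lp_diff[OF Lz W0_Lp(1)[OF z(2)] exponents(4)] exponents(1) q_le_p z(3)])
  moreover have "(\<lambda>n. powint q (\<lambda>x. z n x - u' x)) \<longlonglongrightarrow> 0"
  proof (rule LIMSEQ_I)
    fix d :: real assume d: "0 < d"
    then have "eventually (\<lambda>n. powint q (\<lambda>x. u n x - u' x) < d / 2) sequentially" by (intro order_tendstoD(2)[OF u'(2)]) simp
    then obtain N where N: "\<And>n. N \<le> n \<Longrightarrow> powint q (\<lambda>x. u n x - u' x) \<le> d / 2"
      unfolding eventually_sequentially using less_imp_le by blast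
    have "powint q (\<lambda>x. z n x - u' x) \<le> d / 2" if "N \<le> n" for n
      by (rule near[OF z(1)]) (use N that in force)
    then show "\<exists>N. \<forall>n\<ge>N. norm (powint q (\<lambda>x. z n x - u' x) - 0) < d"
      using d by (intro exI[of _ N]) force
  qed
  ultimately have AE: "AE x in M. z' x = u' x"
    by (rule Lp_lim_unique[OF Lp_p_q[OF Lz] Lp_p_q[OF W0_Lp(1)[OF z(2)]] u'(1) exponents(1)])
  have "W0 p u' k'" by (rule W0_cong_AE[OF z(2) AE _ exponents(4)]) simp
  moreover have "energy e k' \<le> B" using z(4) ex by blast
  ultimately show ?thesis by (rule that)
qed

text \<open>The linear constraint stands for the linearisation at \<open>u\<close> of the constraint \<open>\<integral>|v|^q = 1\<close>; fixed
  points \<open>v = u\<close> are the constrained critical points.\<close>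

definition is_min :: "real \<Rightarrow> ('a \<Rightarrow> real) \<Rightarrow> ('a \<Rightarrow> real) \<Rightarrow> ('a \<Rightarrow> 'a) \<Rightarrow> bool" where
  "is_min e u v g \<longleftrightarrow> W0 p v g \<and> pairing q u v = 1 \<and>
    (\<forall>v' g'. W0 p v' g' \<longrightarrow> pairing q u v' = 1 \<longrightarrow> energy e g \<le> energy e g')"

definition unit_sphere :: "('a \<Rightarrow> real) set" where
  "unit_sphere = {u \<in> Lp q \<Omega>. powint q u = 1}"

lemma is_minD:
  assumes "is_min e u v g"
  shows "W0 p v g" "pairing q u v = 1" "\<And>v' g'. W0 p v' g' \<Longrightarrow> pairing q u v' = 1 \<Longrightarrow> energy e g \<le> energy e g'"
  using assms by (auto simp: is_min_def)

text \<open>Any function that does not annihilate the constraint competes after rescaling.\<close>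

lemma is_min_le_scaled:
  assumes m: "is_min e u v g" and e: "0 \<le> e" and W: "W0 p w k" and s: "pairing q u w \<noteq> 0"
  shows "energy e g \<le> max 1 (\<bar>1 / pairing q u w\<bar> powr p) * energy e k"
proof -
  have "energy e g \<le> energy e (\<lambda>x. (1 / pairing q u w) *\<^sub>R k x)"
    by (rule is_minD(3)[OF m W0_scale[OF W exponents(4)]]) (simp only: pairing_mult, use s in simp)
  then show ?thesis using energy_scaleR_le[OF e, of "1 / pairing q u w" k] by linarith
qed

lemma is_min_exists:
  assumes u: "u \<in> unit_sphere" and e: "0 < e"
  obtains v g where "is_min e u v g"
proof -
  have uL: "u \<in> Lp q \<Omega>" "powint q u = 1" using u by (auto simp: unit_sphere_def)
  define C where "C = {(v, g). W0 p v g \<and> pairing q u v = 1}"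
  obtain f where f: "f \<in> test_functions \<Omega>" "pairing q u f = 1" by (rule exists_test_pairing[OF q_gt_1 uL])
  have CW: "W0 p v g" if "(v, g) \<in> C" for v g using that by (simp add: C_def)
  have mid: "(\<lambda>x. (1/2) * (v x + w x), \<lambda>x. (1/2) *\<^sub>R (g x + h x)) \<in> C" if "(v, g) \<in> C" "(w, h) \<in> C" for v g w h
  proof -
    have W: "W0 p v g" "W0 p w h" "pairing q u v = 1" "pairing q u w = 1" using that by (auto simp: C_def)
    have "pairing q u (\<lambda>x. (1/2) * (v x + w x)) = 1"
      unfolding pairing_mult using pairing_add[OF q_gt_1 uL(1) Lp_p_q[OF W0_Lp(1)[OF W(1)]] Lp_p_q[OF W0_Lp(1)[OF W(2)]]] W by simp
    then show ?thesis unfolding C_def using W0_midpoint[OF W(1,2) exponents(4)] by simp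
  qed
  have ex: "\<exists>(v, g)\<in>C. energy e g \<le> energy e (gradient f)"
    using W0_test[OF f(1) exponents(4)] f(2) by (intro bexI[of _ "(f, gradient f)"]) (auto simp: C_def)
  obtain z k z' k' where z: "\<And>n::nat. (z n, k n) \<in> C" "W0 p z' k'" "(\<lambda>n. powint p (\<lambda>x. z n x - z' x)) \<longlonglongrightarrow> 0"
    "\<forall>b. (\<forall>n::nat. \<exists>(u, g)\<in>C. energy e g \<le> b) \<longrightarrow> energy e k' \<le> b"
    by (rule midpoint_minimizing_sequence[of e "\<lambda>_. C" "energy e (gradient f)"]) (rule e, erule CW, rule order_refl, erule (1) mid, rule ex, rule that)
  note Lz = W0_Lp(1)[OF CW[OF z(1)]]
  have "(\<lambda>n. powint q (\<lambda>x. z n x - z' x)) \<longlonglongrightarrow> 0"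
    by (rule powint_tendsto_lower_exponent[OF Lp_diff[OF Lz W0_Lp(1)[OF z(2)] exponents(4)] exponents(1) q_le_p z(3)])
  then have "(\<lambda>n. pairing q u (z n)) \<longlonglongrightarrow> pairing q u z'"
    by (intro pairing_tendsto_both[OF q_gt_1 uL(1) uL(1) Lp_p_q[OF Lz] Lp_p_q[OF W0_Lp(1)[OF z(2)]]]) auto
  moreover have "pairing q u (z n) = 1" for n using z(1)[of n] by (simp add: C_def)
  ultimately have "pairing q u z' = 1" by (simp add: LIMSEQ_const_iff)
  moreover have "energy e k' \<le> energy e g'" if "W0 p v' g'" "pairing q u v' = 1" for v' g'
    by (rule z(4)[rule_format]) (use that in \<open>auto simp: C_def intro!: bexI[of _ "(v', g')"]\<close>)
  ultimately show ?thesis using that z(2) by (auto simp: is_min_def)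
qed

text \<open>Each of the two minimisers, after rescaling by a factor tending to \<open>1\<close>, competes in the problem of the
  other. Hence the energies converge, and the midpoint of the rescaled minimiser and the limiting one is
  again a competitor, so uniform convexity gives strong convergence.\<close>

lemma is_min_tendsto:
  assumes e: "0 < e" and u: "\<And>n. u n \<in> unit_sphere" "u' \<in> unit_sphere" and lim: "(\<lambda>n. powint q (\<lambda>x. u n x - u' x)) \<longlonglongrightarrow> 0"
    and m: "\<And>n. is_min e (u n) (v n) (g n)" and m': "is_min e u' v' g'"
  shows "(\<lambda>n. powint p (\<lambda>x. g n x - g' x)) \<longlonglongrightarrow> 0" "(\<lambda>n. energy e (g n)) \<longlonglongrightarrow> energy e g'"
proof -
  have uL: "\<And>n. u n \<in> Lp q \<Omega>" "u' \<in> Lp q \<Omega>" using u by (auto simp: unit_sphere_def)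
  note W = is_minD(1)[OF m] and W' = is_minD(1)[OF m']
  note L = W0_Lp[OF W] and L' = W0_Lp[OF W']
  note Lq = Lp_p_q[OF L(1)] and Lq' = Lp_p_q[OF L'(1)]
  define s t where "s n = pairing q (u n) v'" and "t n = pairing q u' (v n)" for n
  define F where "F x = max 1 (\<bar>1 / x\<bar> powr p)" for x :: real
  have F_lim: "(\<lambda>n. F (r n)) \<longlonglongrightarrow> 1" if "r \<longlonglongrightarrow> 1" for r
  proof -
    have "(\<lambda>n. max 1 (\<bar>1 / r n\<bar> powr p)) \<longlonglongrightarrow> max 1 (\<bar>1 / 1\<bar> powr p)"
      using that by (intro tendsto_intros) auto
    then show ?thesis by (simp add: F_def)
  qed
  have F1: "1 \<le> F x" for x by (simp add: F_def)
  have E0: "0 \<le> energy e h" for h using energy_nonneg e by simp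
  have s: "s \<longlonglongrightarrow> 1"
    using pairing_tendsto_both[OF q_gt_1 uL Lq' Lq' lim] is_minD(2)[OF m'] by (simp add: s_def[abs_def])
  have ev_s: "eventually (\<lambda>n. energy e (g n) \<le> F (s n) * energy e g') sequentially"
  proof -
    have "eventually (\<lambda>n. 0 < s n) sequentially" by (rule order_tendstoD(1)[OF s]) simp
    then show ?thesis
    proof eventually_elim
      case (elim n)
      show ?case unfolding F_def s_def
        by (rule is_min_le_scaled[OF m less_imp_le[OF e] W']) (use elim in \<open>simp add: s_def\<close>)
    qed
  qed
  have "(\<lambda>n. F (s n) * energy e g') \<longlonglongrightarrow> 1 * energy e g'" by (intro tendsto_intros F_lim s)
  then have "eventually (\<lambda>n. F (s n) * energy e g' < energy e g' + 1) sequentially" by (rule order_tendstoD(2)) simp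
  with ev_s have "eventually (\<lambda>n. energy e (g n) \<le> energy e g' + 1) sequentially" by eventually_elim simp
  then obtain N where N: "\<And>n. N \<le> n \<Longrightarrow> energy e (g n) \<le> energy e g' + 1" by (auto simp: eventually_sequentially)
  obtain c where c: "0 < c" "\<And>u g. W0 q u g \<Longrightarrow> powint q u \<le> c * powint q g" by (rule poincare[OF q_gt_1]) (rule that)
  \<comment> \<open>A bound for the minimisers is available only from some index on.\<close>
  have vB: "powint q (v (n + N)) \<le> c * (energy e g' + 1)" for n
  proof -
    have "powint q (v (n + N)) \<le> c * powint q (g (n + N))" by (rule c(2)[OF W0_p_q[OF W]])
    also have "\<dots> \<le> c * (energy e g' + 1)"
      using c(1) N[of "n + N"] energy_ge(1)[of e "g (n + N)"] e by (intro mult_left_mono) auto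
    finally show ?thesis .
  qed
  have t: "t \<longlonglongrightarrow> 1"
  proof -
    have lim': "(\<lambda>n. powint q (\<lambda>x. u (n + N) x - u' x)) \<longlonglongrightarrow> 0" using lim by (rule LIMSEQ_ignore_initial_segment)
    have "(\<lambda>n. pairing q (u (n + N)) (v (n + N)) - pairing q u' (v (n + N))) \<longlonglongrightarrow> 0"
      by (rule pairing_tendsto[OF q_gt_1 uL Lq Lq lim' _ vB vB]) simp
    then have "(\<lambda>n. 1 - (1 - t (n + N))) \<longlonglongrightarrow> 1 - 0" using is_minD(2)[OF m] by (intro tendsto_diff tendsto_const) (simp add: t_def)
    then have "(\<lambda>n. t (n + N)) \<longlonglongrightarrow> 1" by simp
    then show ?thesis by (rule LIMSEQ_offset)
  qed
  define k where "k n = (\<lambda>x. (1 / t n) *\<^sub>R g n x)" for n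
  have Wk: "W0 p (\<lambda>x. (1 / t n) * v n x) (k n)" for n unfolding k_def by (rule W0_scale[OF W exponents(4)])
  note Lk = W0_Lp[OF Wk]
  have k_le: "eventually (\<lambda>n. energy e (k n) \<le> F (t n) * (F (s n) * energy e g')) sequentially"
    using ev_s
  proof eventually_elim
    case (elim n)
    have "energy e (k n) \<le> F (t n) * energy e (g n)" unfolding k_def F_def by (rule energy_scaleR_le) (use e in simp)
    also have "\<dots> \<le> F (t n) * (F (s n) * energy e g')" using elim F1[of "t n"] by (intro mult_left_mono) auto
    finally show ?case .
  qed
  have lim_FF: "(\<lambda>n. F (t n) * (F (s n) * energy e g')) \<longlonglongrightarrow> 1 * (1 * energy e g')" by (intro tendsto_intros F_lim s t)
  have k_lim: "(\<lambda>n. powint p (\<lambda>x. k n x - g' x)) \<longlonglongrightarrow> 0"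
  proof (rule LIMSEQ_I)
    fix \<eta> :: real assume \<eta>: "0 < \<eta>"
    obtain d where d: "0 < d" "\<And>g h. g \<in> Lp p \<Omega> \<Longrightarrow> h \<in> Lp p \<Omega> \<Longrightarrow> energy e g \<le> energy e g' + 1 \<Longrightarrow> energy e h \<le> energy e g' + 1 \<Longrightarrow>
      (energy e g + energy e h) / 2 - energy e (\<lambda>x. (1/2) *\<^sub>R (g x + h x)) < d \<Longrightarrow> powint p (\<lambda>x. g x - h x) < \<eta>"
      by (rule energy_uniform_convexity[OF e \<eta>, of "energy e g' + 1"]) (rule that)
    have "eventually (\<lambda>n. F (t n) * (F (s n) * energy e g') < energy e g' + min 1 d) sequentially"
      by (rule order_tendstoD(2)[OF lim_FF]) (use d(1) in simp)
    moreover have "eventually (\<lambda>n. 0 < t n) sequentially" by (rule order_tendstoD(1)[OF t]) simp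
    ultimately have "eventually (\<lambda>n. powint p (\<lambda>x. k n x - g' x) < \<eta>) sequentially"
      using k_le
    proof eventually_elim
      case (elim n)
      have kn: "energy e (k n) < energy e g' + min 1 d" using elim by linarith
      have "pairing q u' (v n) = t n" by (simp only: t_def)
      then have p1: "pairing q u' (\<lambda>x. (1 / t n) * v n x) = 1" unfolding pairing_mult using elim by simp
      have "pairing q u' (\<lambda>x. (1/2) * ((1 / t n) * v n x + v' x)) = 1"
        unfolding pairing_mult[of q u' "1/2" "\<lambda>x. (1 / t n) * v n x + v' x"]
          pairing_add[OF q_gt_1 uL(2) Lp_p_q[OF Lk(1)] Lq'] p1 is_minD(2)[OF m'] by simp
      then have "energy e g' \<le> energy e (\<lambda>x. (1/2) *\<^sub>R (k n x + g' x))"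
        by (rule is_minD(3)[OF m' W0_midpoint[OF Wk W' exponents(4)]])
      then have "(energy e (k n) + energy e g') / 2 - energy e (\<lambda>x. (1/2) *\<^sub>R (k n x + g' x)) < d"
      proof -
        have "energy e (k n) < energy e g' + d" using kn by linarith
        with \<open>energy e g' \<le> energy e (\<lambda>x. (1/2) *\<^sub>R (k n x + g' x))\<close> show ?thesis using d(1) by argo
      qed
      then show ?case by (intro d(2)[OF Lk(2) L'(2)]) (use kn in auto)
    qed
    then show "\<exists>N. \<forall>n\<ge>N. norm (powint p (\<lambda>x. k n x - g' x) - 0) < \<eta>" by (auto simp: eventually_sequentially)
  qed
  obtain K where K: "\<And>n. powint p (k n) \<le> K" by (rule powint_conv_bound[OF Lk(2) L'(2) exponents(4) k_lim]) (rule that)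
  show gl: "(\<lambda>n. powint p (\<lambda>x. g n x - g' x)) \<longlonglongrightarrow> 0"
  proof (rule tendsto_sandwich[OF _ _ tendsto_const])
    show "eventually (\<lambda>n. powint p (\<lambda>x. g n x - g' x) \<le> 2 powr p * (\<bar>t n - 1\<bar> powr p * K + powint p (\<lambda>x. k n x - g' x))) sequentially"
    proof -
      have "eventually (\<lambda>n. 0 < t n) sequentially" by (rule order_tendstoD(1)[OF t]) simp
      then show ?thesis
      proof eventually_elim
        case (elim n)
        have eq: "(\<lambda>x. g n x - g' x) = (\<lambda>x. (t n - 1) *\<^sub>R k n x + (k n x - g' x))"
        proof
          fix x have "g n x = t n *\<^sub>R k n x" using elim by (simp add: k_def)
          then show "g n x - g' x = (t n - 1) *\<^sub>R k n x + (k n x - g' x)" by (simp add: scaleR_left_diff_distrib)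
        qed
        have "powint p (\<lambda>x. g n x - g' x) \<le> 2 powr p * (powint p (\<lambda>x. (t n - 1) *\<^sub>R k n x) + powint p (\<lambda>x. k n x - g' x))"
          unfolding eq by (intro powint_add_le Lp_scaleR Lp_diff Lk(2) L'(2) exponents(4))
        also have "\<dots> \<le> 2 powr p * (\<bar>t n - 1\<bar> powr p * K + powint p (\<lambda>x. k n x - g' x))"
          unfolding powint_scaleR using K[of n] by (intro mult_left_mono add_right_mono) auto
        finally show ?case .
      qed
    qed
    have "(\<lambda>n. 2 powr p * (\<bar>t n - 1\<bar> powr p * K + powint p (\<lambda>x. k n x - g' x))) \<longlonglongrightarrow> 2 powr p * (\<bar>1 - 1\<bar> powr p * K + 0)"
      using exponents(4) by (intro tendsto_intros tendsto_powr' t k_lim) auto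
    then show "(\<lambda>n. 2 powr p * (\<bar>t n - 1\<bar> powr p * K + powint p (\<lambda>x. k n x - g' x))) \<longlonglongrightarrow> 0" by simp
  qed simp
  show "(\<lambda>n. energy e (g n)) \<longlonglongrightarrow> energy e g'" by (rule energy_tendsto[OF L(2) L'(2) gl])
qed

text \<open>The limit function need not have finite \<open>p\<close>-energy. A test function close to it does, and as a fixed
  competitor it makes the perturbation term disappear when \<open>e\<close> tends to \<open>0\<close>.\<close>

lemma energy_recovery:
  assumes e: "\<And>n. 0 < e n" "e \<longlonglongrightarrow> 0" and u: "\<And>n. u n \<in> unit_sphere" "u' \<in> unit_sphere"
    and lim: "(\<lambda>n. powint q (\<lambda>x. u n x - u' x)) \<longlonglongrightarrow> 0" and W: "W0 q u' g'"
    and m: "\<And>n. is_min (e n) (u n) (v n) (g n)" and \<eta>: "powint q g' < \<eta>"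
  shows "eventually (\<lambda>n. energy (e n) (g n) < \<eta>) sequentially"
proof -
  have uL: "\<And>n. u n \<in> Lp q \<Omega>" "u' \<in> Lp q \<Omega>" "powint q u' = 1" using u by (auto simp: unit_sphere_def)
  obtain f where f: "\<And>n. f n \<in> test_functions \<Omega>" "(\<lambda>n. powint q (\<lambda>x. f n x - u' x)) \<longlonglongrightarrow> 0"
    "(\<lambda>n. powint q (\<lambda>x. gradient (f n) x - g' x)) \<longlonglongrightarrow> 0" by (rule W0_approx_seq[OF W]) (rule that)
  note Lf = test_function_Lp(1,2)[OF f(1) exponents(1)]
  have 1: "(\<lambda>j. pairing q u' (f j)) \<longlonglongrightarrow> 1"
    using pairing_tendsto_both[OF q_gt_1 uL(2) uL(2) Lf(1) uL(2) _ f(2)] uL(3) by (simp add: pairing_self)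
  have 2: "(\<lambda>j. powint q (gradient (f j))) \<longlonglongrightarrow> powint q g'"
    by (rule powint_tendsto[OF Lf(2) W0_Lp(2)[OF W] exponents(1) f(3)])
  have "(\<lambda>j. max 1 (\<bar>1 / pairing q u' (f j)\<bar> powr p) * powint q (gradient (f j))) \<longlonglongrightarrow> max 1 (\<bar>1 / 1\<bar> powr p) * powint q g'"
    using 1 2 by (intro tendsto_intros) auto
  then have "eventually (\<lambda>j. max 1 (\<bar>1 / pairing q u' (f j)\<bar> powr p) * powint q (gradient (f j)) < \<eta>) sequentially"
    by (rule order_tendstoD(2)) (use \<eta> in simp)
  moreover have "eventually (\<lambda>j. 0 < pairing q u' (f j)) sequentially" by (rule order_tendstoD(1)[OF 1]) simp
  ultimately have "eventually (\<lambda>j. max 1 (\<bar>1 / pairing q u' (f j)\<bar> powr p) * powint q (gradient (f j)) < \<eta> \<and> 0 < pairing q u' (f j)) sequentially"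
    by (rule eventually_conj)
  then obtain j where j: "max 1 (\<bar>1 / pairing q u' (f j)\<bar> powr p) * powint q (gradient (f j)) < \<eta>" "0 < pairing q u' (f j)"
    by (auto simp: eventually_sequentially)
  \<comment> \<open>From here on \<open>f j\<close> is the fixed competitor.\<close>
  have s: "(\<lambda>n. pairing q (u n) (f j)) \<longlonglongrightarrow> pairing q u' (f j)"
    by (rule pairing_tendsto_both[OF q_gt_1 uL(1,2) Lf(1) Lf(1) lim]) simp
  have "(\<lambda>n. max 1 (\<bar>1 / pairing q (u n) (f j)\<bar> powr p) * energy (e n) (gradient (f j)))
      \<longlonglongrightarrow> max 1 (\<bar>1 / pairing q u' (f j)\<bar> powr p) * (0 * powint p (gradient (f j)) + powint q (gradient (f j)))"
    unfolding energy_def using j(2) by (intro tendsto_intros s e) auto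
  then have "eventually (\<lambda>n. max 1 (\<bar>1 / pairing q (u n) (f j)\<bar> powr p) * energy (e n) (gradient (f j)) < \<eta>) sequentially"
    by (rule order_tendstoD(2)) (use j(1) in simp)
  moreover have "eventually (\<lambda>n. 0 < pairing q (u n) (f j)) sequentially" by (rule order_tendstoD(1)[OF s j(2)])
  ultimately show ?thesis
  proof eventually_elim
    case (elim n)
    then show ?case
      using is_min_le_scaled[OF m less_imp_le[OF e(1)] W0_test[OF f(1) exponents(4)], of n j] by linarith
  qed
qed

end

section \<open>The iteration step and the genus\<close>

lemma le_genus_iff:
  "enat k \<le> genus X A \<longleftrightarrow> (\<forall>m \<phi>. continuous_map (subtopology X A) (subtopology (Euclidean_space m) (- {\<lambda>_. 0})) \<phi> \<and>
     (\<forall>x\<in>A. \<phi> (- x) = - \<phi> x) \<longrightarrow> k \<le> m)"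
proof -
  have "(\<forall>x\<in>{enat m |m. P m}. enat k \<le> x) \<longleftrightarrow> (\<forall>m. P m \<longrightarrow> k \<le> m)" for P :: "nat \<Rightarrow> bool"
    by force
  then show ?thesis unfolding genus_def le_Inf_iff by simp
qed

context two_exponents
begin

text \<open>A power of the distance that defines the topology of \<open>W10\<close>. It is not itself a metric, but it defines
  the same open sets and convergent sequences.\<close>

definition gdist :: "('a \<Rightarrow> real) \<Rightarrow> ('a \<Rightarrow> real) \<Rightarrow> real" where
  "gdist u v = powint q (\<lambda>x. weak_grad \<Omega> v x - weak_grad \<Omega> u x)"

lemma W10_q: "u \<in> W10 q \<Omega> \<Longrightarrow> W0 q u (weak_grad \<Omega> u)"
  using W10_iff[OF exponents(2)] weak_grad_W0(2)[OF _ exponents(2)] by blast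

lemma W0_W10_q: "W0 q u g \<Longrightarrow> u \<in> W10 q \<Omega>"
  using W10_iff[OF exponents(2)] by blast

lemma gdist_W0:
  assumes "W0 q u g" "W0 q v h" shows "gdist u v = powint q (\<lambda>x. h x - g x)"
proof -
  note u = weak_grad_W0[OF assms(1) exponents(2)] and v = weak_grad_W0[OF assms(2) exponents(2)]
  show ?thesis unfolding gdist_def
  proof (rule powint_cong_AE)
    show "(\<lambda>x. weak_grad \<Omega> v x - weak_grad \<Omega> u x) \<in> borel_measurable M"
      by (rule LpD(1)[OF Lp_diff[OF W0_Lp(2)[OF v(2)] W0_Lp(2)[OF u(2)] exponents(1)]])
    show "(\<lambda>x. h x - g x) \<in> borel_measurable M"
      by (rule LpD(1)[OF Lp_diff[OF W0_Lp(2)[OF assms(2)] W0_Lp(2)[OF assms(1)] exponents(1)]])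
    show "AE x in M. weak_grad \<Omega> v x - weak_grad \<Omega> u x = h x - g x" using u(1) v(1) by eventually_elim simp
  qed
qed

lemma gdist_triangle:
  assumes "u \<in> W10 q \<Omega>" "v \<in> W10 q \<Omega>" "w \<in> W10 q \<Omega>"
  shows "gdist u w \<le> 2 powr q * (gdist u v + gdist v w)"
  using powint_triangle[OF W0_Lp(2)[OF W10_q[OF assms(3)]] W0_Lp(2)[OF W10_q[OF assms(2)]] W0_Lp(2)[OF W10_q[OF assms(1)]] exponents(1)]
  unfolding gdist_def by (simp add: add.commute)

lemma gdist_self [simp]: "gdist u u = 0" by (simp add: gdist_def)

lemma gdist_nonneg [simp]: "0 \<le> gdist u v" by (simp add: gdist_def)

lemma grad_norm_diff:
  assumes "u \<in> W10 q \<Omega>" "v \<in> W10 q \<Omega>"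
  shows "grad_norm q \<Omega> (v - u) = gdist u v powr (1 / q)"
proof -
  have "v - u = (\<lambda>x. v x - u x)" by (simp add: fun_diff_def)
  then have "powint q (weak_grad \<Omega> (v - u)) = gdist u v"
    unfolding gdist_def
    by (simp only:) (rule weak_grad_W0(3)[OF W0_diff[OF W10_q[OF assms(2)] W10_q[OF assms(1)] exponents(1)] exponents(2)])
  then show ?thesis unfolding grad_norm_def powint_def by simp
qed

lemma openin_W10_iff:
  "openin (W10_topology q \<Omega>) U \<longleftrightarrow> U \<subseteq> W10 q \<Omega> \<and> (\<forall>u\<in>U. \<exists>e>0. \<forall>v\<in>W10 q \<Omega>. gdist u v < e \<longrightarrow> v \<in> U)"
proof -
  have *: "(\<exists>e>0. \<forall>v\<in>W10 q \<Omega>. grad_norm q \<Omega> (v - u) < e \<longrightarrow> v \<in> U) \<longleftrightarrow> (\<exists>e>0. \<forall>v\<in>W10 q \<Omega>. gdist u v < e \<longrightarrow> v \<in> U)"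
    (is "?L \<longleftrightarrow> ?R") if uW: "u \<in> W10 q \<Omega>" for u
  proof
    assume ?L
    then obtain e where e: "0 < e" "\<And>v. v \<in> W10 q \<Omega> \<Longrightarrow> gdist u v powr (1 / q) < e \<Longrightarrow> v \<in> U"
      using grad_norm_diff[OF uW] by auto
    have "gdist u v powr (1 / q) < e" if "gdist u v < e powr q" for v
    proof -
      have "gdist u v powr (1 / q) < (e powr q) powr (1 / q)" using that exponents(1) by (intro powr_less_mono2) auto
      then show ?thesis using e(1) exponents(1) by (simp add: powr_powr)
    qed
    then show ?R using e by (intro exI[of _ "e powr q"]) auto
  next
    assume ?R
    then obtain e where e: "0 < e" "\<And>v. v \<in> W10 q \<Omega> \<Longrightarrow> gdist u v < e \<Longrightarrow> v \<in> U" by blast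
    have "gdist u v < e" if "gdist u v powr (1 / q) < e powr (1 / q)" for v
    proof (rule ccontr)
      assume "\<not> gdist u v < e"
      then have "e powr (1 / q) \<le> gdist u v powr (1 / q)" using e(1) exponents(1) by (intro powr_mono2) auto
      then show False using that by simp
    qed
    then show ?L using e grad_norm_diff[OF uW] by (intro exI[of _ "e powr (1 / q)"]) auto
  qed
  show ?thesis unfolding openin_W10_topology
  proof (intro conj_cong refl ball_cong)
    fix u assume "U \<subseteq> W10 q \<Omega>" "u \<in> U"
    then have "u \<in> W10 q \<Omega>" by (rule subsetD)
    then show "(\<exists>e>0. \<forall>v\<in>W10 q \<Omega>. grad_norm q \<Omega> (v - u) < e \<longrightarrow> v \<in> U) \<longleftrightarrow> (\<exists>e>0. \<forall>v\<in>W10 q \<Omega>. gdist u v < e \<longrightarrow> v \<in> U)"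
      by (rule *)
  qed
qed

lemma gdist_tendsto_imp_Lp:
  assumes "\<And>n. u n \<in> W10 q \<Omega>" "v \<in> W10 q \<Omega>" "(\<lambda>n. gdist v (u n)) \<longlonglongrightarrow> 0"
  shows "(\<lambda>n. powint q (\<lambda>x. u n x - v x)) \<longlonglongrightarrow> 0"
proof -
  obtain c where c: "0 < c" "\<And>u g. W0 q u g \<Longrightarrow> powint q u \<le> c * powint q g" by (rule poincare[OF q_gt_1]) (rule that)
  have "(\<lambda>n. c * gdist v (u n)) \<longlonglongrightarrow> 0" using tendsto_mult_right_zero[OF assms(3)] .
  then show ?thesis
  proof (rule tendsto_sandwich[OF _ _ tendsto_const, rotated 2])
    show "eventually (\<lambda>n. powint q (\<lambda>x. u n x - v x) \<le> c * gdist v (u n)) sequentially"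
      unfolding gdist_def
      by (intro always_eventually allI c(2) W0_diff[OF W10_q W10_q exponents(1)] assms(1,2))
  qed simp
qed

lemma continuous_map_imp_tendsto:
  assumes cm: "continuous_map (subtopology (W10_topology q \<Omega>) B) (subtopology (Euclidean_space m) (- {\<lambda>_. 0})) \<phi>"
    and B: "B \<subseteq> W10 q \<Omega>" and u: "\<And>n. u n \<in> B" "v \<in> B" and lim: "(\<lambda>n. gdist v (u n)) \<longlonglongrightarrow> 0"
  shows "(\<lambda>n. \<phi> (u n) i) \<longlonglongrightarrow> \<phi> v i"
proof -
  have "continuous_map (subtopology (W10_topology q \<Omega>) B) (powertop_real UNIV) \<phi>"
    using cm unfolding Euclidean_space_def by (simp add: continuous_map_in_subtopology)
  then have h: "continuous_map (subtopology (W10_topology q \<Omega>) B) euclideanreal (\<lambda>x. \<phi> x i)"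
    using continuous_map_compose[OF _ continuous_map_product_projection[of i UNIV "\<lambda>_. euclideanreal"]] by (auto simp: o_def)
  show ?thesis
  proof (rule topological_tendstoI)
    fix S :: "real set" assume S: "open S" "\<phi> v i \<in> S"
    have "openin (subtopology (W10_topology q \<Omega>) B) {x \<in> topspace (subtopology (W10_topology q \<Omega>) B). \<phi> x i \<in> S}"
      using h S(1) by (intro openin_continuous_map_preimage) auto
    then obtain T where T: "openin (W10_topology q \<Omega>) T" "{x \<in> B. \<phi> x i \<in> S} = T \<inter> B"
      using B unfolding openin_subtopology by (auto simp: Int_absorb1)
    have "v \<in> T" using T(2) u(2) S(2) by blast
    then obtain e where e: "0 < e" "\<And>w. w \<in> W10 q \<Omega> \<Longrightarrow> gdist v w < e \<Longrightarrow> w \<in> T"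
      using T(1) unfolding openin_W10_iff by blast
    have "eventually (\<lambda>n. gdist v (u n) < e) sequentially" by (rule order_tendstoD(2)[OF lim e(1)])
    then show "eventually (\<lambda>n. \<phi> (u n) i \<in> S) sequentially"
      by eventually_elim (use e(2) u(1) B T(2) in blast)
  qed
qed

lemma continuous_map_nonzero:
  assumes cm: "continuous_map (subtopology (W10_topology q \<Omega>) B) (subtopology (Euclidean_space m) (- {\<lambda>_. 0})) \<phi>"
    and B: "B \<subseteq> W10 q \<Omega>" and u: "u \<in> B"
  shows "\<exists>i<m. \<phi> u i \<noteq> 0"
proof -
  have "\<phi> u \<in> topspace (subtopology (Euclidean_space m) (- {\<lambda>_. 0}))"
  proof -
    have "u \<in> topspace (subtopology (W10_topology q \<Omega>) B)" using B u by auto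
    then show ?thesis using continuous_map_image_subset_topspace[OF cm] by blast
  qed
  then have "\<forall>i\<ge>m. \<phi> u i = 0" "\<phi> u \<noteq> (\<lambda>_. 0)" by (auto simp: topspace_Euclidean_space)
  then show ?thesis by (metis leI ext)
qed

lemma tendsto_imp_continuous_map:
  assumes B: "B \<subseteq> W10 q \<Omega>"
    and h: "\<And>u v. (\<And>n. u n \<in> B) \<Longrightarrow> v \<in> B \<Longrightarrow> (\<lambda>n. gdist v (u n)) \<longlonglongrightarrow> 0 \<Longrightarrow> (\<lambda>n. h (u n)) \<longlonglongrightarrow> h v"
  shows "continuous_map (subtopology (W10_topology q \<Omega>) B) euclideanreal h"
  unfolding continuous_map_def
proof (intro conjI allI impI)
  fix S :: "real set" assume S: "openin euclideanreal S"
  define T where "T = {v \<in> W10 q \<Omega>. \<exists>e>0. \<forall>a\<in>B. gdist v a < e \<longrightarrow> h a \<in> S}"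
  have "openin (W10_topology q \<Omega>) T"
    unfolding openin_W10_iff
  proof (intro conjI ballI)
    fix v assume "v \<in> T"
    then obtain e where v: "v \<in> W10 q \<Omega>" and e: "0 < e" "\<And>a. a \<in> B \<Longrightarrow> gdist v a < e \<Longrightarrow> h a \<in> S" by (auto simp: T_def)
    define d where "d = e / (2 * 2 powr q)"
    have d: "0 < d" using e(1) by (simp add: d_def)
    have "w \<in> T" if w: "w \<in> W10 q \<Omega>" "gdist v w < d" for w
    proof -
      have "h a \<in> S" if a: "a \<in> B" "gdist w a < d" for a
      proof (rule e(2)[OF a(1)])
        have "gdist v a \<le> 2 powr q * (gdist v w + gdist w a)" using v w a B by (intro gdist_triangle) auto
        also have "\<dots> < 2 powr q * (d + d)" using w a by (intro mult_strict_left_mono) auto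
        also have "\<dots> = e" by (simp add: d_def)
        finally show "gdist v a < e" .
      qed
      then show ?thesis using w d unfolding T_def by blast
    qed
    then show "\<exists>e>0. \<forall>w\<in>W10 q \<Omega>. gdist v w < e \<longrightarrow> w \<in> T" using d by blast
  qed (auto simp: T_def)
  moreover have "{x \<in> topspace (subtopology (W10_topology q \<Omega>) B). h x \<in> S} = T \<inter> B"
  proof (intro equalityI subsetI)
    fix v assume "v \<in> T \<inter> B"
    then obtain e where e: "0 < e" "\<And>a. a \<in> B \<Longrightarrow> gdist v a < e \<Longrightarrow> h a \<in> S" "v \<in> B" by (auto simp: T_def)
    then have "h v \<in> S" by simp
    then show "v \<in> {x \<in> topspace (subtopology (W10_topology q \<Omega>) B). h x \<in> S}" using e(3) B by auto
  next
    fix v assume "v \<in> {x \<in> topspace (subtopology (W10_topology q \<Omega>) B). h x \<in> S}"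
    then have v: "v \<in> B" "h v \<in> S" by auto
    have "\<exists>e>0. \<forall>a\<in>B. gdist v a < e \<longrightarrow> h a \<in> S"
    proof (rule ccontr)
      assume "\<not> ?thesis"
      then have "\<exists>a\<in>B. gdist v a < inverse (real (Suc n)) \<and> h a \<notin> S" for n by auto
      then obtain a where a: "\<And>n. a n \<in> B" "\<And>n. gdist v (a n) < inverse (real (Suc n))" "\<And>n. h (a n) \<notin> S" by metis
      have "(\<lambda>n. gdist v (a n)) \<longlonglongrightarrow> 0"
        by (rule tendsto_sandwich[OF _ _ tendsto_const LIMSEQ_inverse_real_of_nat])
          (use a(2) in \<open>auto intro!: always_eventually less_imp_le\<close>)
      then have "(\<lambda>n. h (a n)) \<longlonglongrightarrow> h v" by (rule h[OF a(1) v(1)])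
      then have "eventually (\<lambda>n. h (a n) \<in> S) sequentially" using S v(2) by (auto dest: topological_tendstoD)
      then show False using a(3) by (auto simp: eventually_sequentially)
    qed
    then show "v \<in> T \<inter> B" using v B by (auto simp: T_def)
  qed
  ultimately show "openin (subtopology (W10_topology q \<Omega>) B) {x \<in> topspace (subtopology (W10_topology q \<Omega>) B). h x \<in> S}"
    unfolding openin_subtopology by blast
qed simp

text \<open>The analogue of a lower bound for the genus, with sequential continuity in \<open>L^q\<close>. It is the form that
  survives closure in \<open>L^q\<close>, and the one that a map which is continuous only from \<open>L^q\<close> can transport.\<close>

definition lq_genus_ge :: "nat \<Rightarrow> ('a \<Rightarrow> real) set \<Rightarrow> bool" where
  "lq_genus_ge k A \<longleftrightarrow> (\<forall>m (\<phi> :: ('a \<Rightarrow> real) \<Rightarrow> nat \<Rightarrow> real).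
     (\<forall>u\<in>A. \<forall>i<m. \<phi> (\<lambda>x. - u x) i = - \<phi> u i) \<and> (\<forall>u\<in>A. \<exists>i<m. \<phi> u i \<noteq> 0) \<and>
     (\<forall>i<m. \<forall>u v. (\<forall>n. u n \<in> A) \<and> v \<in> A \<and> (\<lambda>n. powint q (\<lambda>x. u n x - v x)) \<longlonglongrightarrow> 0 \<longrightarrow> (\<lambda>n. \<phi> (u n) i) \<longlonglongrightarrow> \<phi> v i)
     \<longrightarrow> k \<le> m)"

text \<open>Maps that are continuous with respect to \<open>L^q\<close> are continuous in the Sobolev space by the Poincare
  inequality, so they are among the maps tested by the genus.\<close>

lemma lq_genus_geI_genus:
  assumes B: "B \<subseteq> W10 q \<Omega>" "enat k \<le> genus (W10_topology q \<Omega>) B" and A: "B \<subseteq> A"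
  shows "lq_genus_ge k A"
  unfolding lq_genus_ge_def
proof (intro allI impI, elim conjE)
  fix m and \<phi> :: "('a \<Rightarrow> real) \<Rightarrow> nat \<Rightarrow> real"
  assume odd: "\<forall>u\<in>A. \<forall>i<m. \<phi> (\<lambda>x. - u x) i = - \<phi> u i" and nz: "\<forall>u\<in>A. \<exists>i<m. \<phi> u i \<noteq> 0"
    and cont: "\<forall>i<m. \<forall>u v. (\<forall>n. u n \<in> A) \<and> v \<in> A \<and> (\<lambda>n. powint q (\<lambda>x. u n x - v x)) \<longlonglongrightarrow> 0 \<longrightarrow> (\<lambda>n. \<phi> (u n) i) \<longlonglongrightarrow> \<phi> v i"
  define \<psi> where "\<psi> = (\<lambda>u i. if i < m then \<phi> u i else 0)"
  have "continuous_map (subtopology (W10_topology q \<Omega>) B) euclideanreal (\<lambda>u. \<phi> u i)" if i: "i < m" for i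
  proof (rule tendsto_imp_continuous_map[OF B(1)])
    fix u v assume u: "\<And>n. u n \<in> B" "v \<in> B" and "(\<lambda>n. gdist v (u n)) \<longlonglongrightarrow> 0"
    then have "(\<lambda>n. powint q (\<lambda>x. u n x - v x)) \<longlonglongrightarrow> 0" using B(1) by (intro gdist_tendsto_imp_Lp) auto
    then show "(\<lambda>n. \<phi> (u n) i) \<longlonglongrightarrow> \<phi> v i" using cont[rule_format, OF i, of u v] u A by blast
  qed
  then have "continuous_map (subtopology (W10_topology q \<Omega>) B) (Euclidean_space m) \<psi>"
    unfolding \<psi>_def by (simp add: continuous_map_componentwise_Euclidean_space)
  moreover have "\<psi> u \<noteq> (\<lambda>_. 0)" if uB: "u \<in> B" for u
  proof -
    obtain i where i: "i < m" "\<phi> u i \<noteq> 0" using bspec[OF nz subsetD[OF A uB]] by (elim exE conjE)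
    then have "\<psi> u i \<noteq> 0" by (simp add: \<psi>_def)
    then show ?thesis by auto
  qed
  ultimately have cm: "continuous_map (subtopology (W10_topology q \<Omega>) B) (subtopology (Euclidean_space m) (- {\<lambda>_. 0})) \<psi>"
    by (auto simp: continuous_map_in_subtopology)
  have "\<forall>u\<in>B. \<psi> (- u) = - \<psi> u"
  proof (intro ballI ext)
    fix u i assume "u \<in> B"
    then have "u \<in> A" using A by blast
    then show "\<psi> (- u) i = (- \<psi> u) i" using odd by (simp add: \<psi>_def fun_Compl_def)
  qed
  then show "k \<le> m"
    by (rule B(2)[unfolded le_genus_iff, THEN spec, THEN spec, THEN mp, OF conjI[OF cm]])
qed

text \<open>A relation instead of a function, because minimisers are determined only up to null sets.\<close>

definition step :: "real \<Rightarrow> ('a \<Rightarrow> real) \<Rightarrow> ('a \<Rightarrow> real) \<Rightarrow> bool" where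
  "step e u w \<longleftrightarrow> (\<exists>v g. is_min e u v g \<and> w \<in> Lp q \<Omega> \<and> (AE x in M. w x = powint q v powr (-1/q) * v x))"

text \<open>By Young's inequality \<open>1 = \<integral>|u|^(q-2) u v\<close> forces \<open>\<integral>|v|^q \<ge> 1\<close>, so the
  normalising factor is at most \<open>1\<close> and cannot increase the energy.\<close>

lemma is_min_powint_ge_1:
  assumes "u \<in> unit_sphere" "is_min e u v g" shows "1 \<le> powint q v"
proof -
  have "1 \<le> powint q v / q + (1 - 1 / q) * 1"
    using pairing_young[OF q_gt_1 _ Lp_p_q[OF W0_Lp(1)[OF is_minD(1)[OF assms(2)]]], of u] assms(1) is_minD(2)[OF assms(2)]
    by (simp add: unit_sphere_def)
  then have "1 / q \<le> powint q v / q" by simp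
  then show ?thesis using exponents(1) by (simp add: divide_le_cancel)
qed

lemma normalizer:
  assumes "1 \<le> t" shows "0 < t powr (-1/q)" "t powr (-1/q) \<le> 1" "(t powr (-1/q)) powr q * t = 1"
proof -
  show "0 < t powr (-1/q)" using assms by simp
  have "t powr (-1/q) \<le> t powr 0" using assms exponents(1) by (intro powr_mono) auto
  then show "t powr (-1/q) \<le> 1" using assms by simp
  have "(-1/q) * q = -1" using exponents(1) by simp
  then have "(t powr (-1/q)) powr q = t powr (-1)" by (simp only: powr_powr)
  then show "(t powr (-1/q)) powr q * t = 1" using assms by (simp add: powr_minus)
qed

lemma stepE:
  assumes s: "step e u w" and u: "u \<in> unit_sphere" and e: "0 < e"
  obtains v g c where "is_min e u v g" "c = powint q v powr (-1/q)" "0 < c" "c \<le> 1" "W0 p w (\<lambda>x. c *\<^sub>R g x)" "w \<in> unit_sphere"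
    "energy e (weak_grad \<Omega> w) \<le> energy e g"
proof -
  obtain v g where m: "is_min e u v g" and w: "w \<in> Lp q \<Omega>" "AE x in M. w x = powint q v powr (-1/q) * v x"
    using s by (auto simp: step_def)
  define c where "c = powint q v powr (-1/q)"
  note n = normalizer[OF is_min_powint_ge_1[OF u m], folded c_def]
  have AE: "AE x in M. c * v x = w x" using w(2) by eventually_elim (simp add: c_def)
  have W: "W0 p w (\<lambda>x. c *\<^sub>R g x)"
    by (rule W0_cong_AE[OF W0_scale[OF is_minD(1)[OF m] exponents(4)] AE _ exponents(4)]) simp
  have "powint q w = powint q (\<lambda>x. c * v x)"
    by (rule powint_cong_AE[symmetric, OF LpD(1)[OF Lp_mult[OF Lp_p_q[OF W0_Lp(1)[OF is_minD(1)[OF m]]]]] LpD(1)[OF w(1)] AE])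
  then have "w \<in> unit_sphere" using n w(1) by (simp add: unit_sphere_def powint_mult)
  moreover have "energy e (weak_grad \<Omega> w) \<le> energy e g"
  proof -
    have "AE x in M. c *\<^sub>R g x = weak_grad \<Omega> w x" using weak_grad_W0(1)[OF W exponents(5)] by eventually_elim simp
    then have "energy e (weak_grad \<Omega> w) = energy e (\<lambda>x. c *\<^sub>R g x)"
      using energy_cong_AE[OF W0_Lp(2)[OF W]] by simp
    also have "\<dots> \<le> max 1 (\<bar>c\<bar> powr p) * energy e g" by (rule energy_scaleR_le) (use e in simp)
    also have "max 1 (\<bar>c\<bar> powr p) = 1"
    proof -
      have "c powr p \<le> 1" using n(1,2) exponents(4) by (intro powr_le1) auto
      then show ?thesis using n(1) by simp
    qed
    finally show ?thesis by simp
  qed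
  ultimately show ?thesis using that[OF m c_def n(1,2) W] by blast
qed

lemma step_exists:
  assumes "u \<in> unit_sphere" "0 < e" obtains w where "step e u w"
proof -
  obtain v g where m: "is_min e u v g" by (rule is_min_exists[OF assms])
  have "(\<lambda>x. powint q v powr (-1/q) * v x) \<in> Lp q \<Omega>" by (rule Lp_mult[OF Lp_p_q[OF W0_Lp(1)[OF is_minD(1)[OF m]]]])
  then show ?thesis using m by (intro that[of "\<lambda>x. powint q v powr (-1/q) * v x"]) (auto simp: step_def)
qed

lemma is_min_minus:
  assumes m: "is_min e u v g" shows "is_min e (\<lambda>x. - u x) (\<lambda>x. - v x) (\<lambda>x. - g x)"
  unfolding is_min_def
proof (intro conjI allI impI)
  show "W0 p (\<lambda>x. - v x) (\<lambda>x. - g x)" by (rule W0_minus[OF is_minD(1)[OF m] exponents(4)])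
  show "pairing q (\<lambda>x. - u x) (\<lambda>x. - v x) = 1" using is_minD(2)[OF m] by simp
  fix v' g' assume W: "W0 p v' g'" and "pairing q (\<lambda>x. - u x) v' = 1"
  then have "pairing q u (\<lambda>x. - v' x) = 1" using pairing_minus_minus[of q u "\<lambda>x. - v' x"] by simp
  then show "energy e (\<lambda>x. - g x) \<le> energy e g'"
    using is_minD(3)[OF m W0_minus[OF W exponents(4)]] by simp
qed

lemma step_minus:
  assumes "step e u w" shows "step e (\<lambda>x. - u x) (\<lambda>x. - w x)"
proof -
  obtain v g where m: "is_min e u v g" and w: "w \<in> Lp q \<Omega>" "AE x in M. w x = powint q v powr (-1/q) * v x"
    using assms by (auto simp: step_def)
  have "AE x in M. - w x = powint q (\<lambda>x. - v x) powr (-1/q) * - v x" using w(2) by eventually_elim simp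
  then show ?thesis unfolding step_def using is_min_minus[OF m] Lp_minus[OF w(1)] by blast
qed

lemma step_cong_AE:
  assumes "step e u w" "AE x in M. w x = w' x" shows "step e u w'"
proof -
  obtain v g where m: "is_min e u v g" and w: "w \<in> Lp q \<Omega>" "AE x in M. w x = powint q v powr (-1/q) * v x"
    using assms(1) by (auto simp: step_def)
  have "AE x in M. w' x = powint q v powr (-1/q) * v x" using w(2) assms(2) by eventually_elim simp
  then show ?thesis unfolding step_def using m Lp_cong_AE[OF w(1) assms(2)] by blast
qed

lemma step_W10:
  assumes "step e u w" "u \<in> unit_sphere" "0 < e" shows "w \<in> W10 q \<Omega>" "w \<in> unit_sphere" "W0 p w (weak_grad \<Omega> w)"
proof -
  obtain v g c where c: "is_min e u v g" "c = powint q v powr (-1/q)" "0 < c" "c \<le> 1" "W0 p w (\<lambda>x. c *\<^sub>R g x)" "w \<in> unit_sphere"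
    by (rule stepE[OF assms])
  show "w \<in> W10 q \<Omega>" by (rule W0_W10_q[OF W0_p_q[OF c(5)]])
  show "w \<in> unit_sphere" by (rule c(6))
  show "W0 p w (weak_grad \<Omega> w)" by (rule weak_grad_W0(2)[OF c(5) exponents(5)])
qed

lemma step_tendsto:
  assumes e: "0 < e" and u: "\<And>n. u n \<in> unit_sphere" "u' \<in> unit_sphere" and lim: "(\<lambda>n. powint q (\<lambda>x. u n x - u' x)) \<longlonglongrightarrow> 0"
    and s: "\<And>n. step e (u n) (w n)" and s': "step e u' w'"
  shows "(\<lambda>n. gdist w' (w n)) \<longlonglongrightarrow> 0"
proof -
  have "\<exists>v g. is_min e (u n) v g \<and> W0 p (w n) (\<lambda>x. (powint q v powr (-1/q)) *\<^sub>R g x)" for n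
    by (rule stepE[OF s u(1) e]) blast
  then obtain v g where m: "\<And>n. is_min e (u n) (v n) (g n)" and W: "\<And>n. W0 p (w n) (\<lambda>x. (powint q (v n) powr (-1/q)) *\<^sub>R g n x)"
    by metis
  obtain v' g' where m': "is_min e u' v' g'" and W': "W0 p w' (\<lambda>x. (powint q v' powr (-1/q)) *\<^sub>R g' x)"
    by (rule stepE[OF s' u(2) e]) blast
  define c where "c n = powint q (v n) powr (-1/q)" for n
  define c' where "c' = powint q v' powr (-1/q)"
  note Wv = is_minD(1)[OF m] and Wv' = is_minD(1)[OF m']
  note L = W0_Lp[OF Wv] and L' = W0_Lp[OF Wv']
  have gp: "(\<lambda>n. powint p (\<lambda>x. g n x - g' x)) \<longlonglongrightarrow> 0" by (rule is_min_tendsto(1)[OF e u lim m m'])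
  have gq: "(\<lambda>n. powint q (\<lambda>x. g n x - g' x)) \<longlonglongrightarrow> 0"
    by (rule powint_tendsto_lower_exponent[OF Lp_diff[OF L(2) L'(2) exponents(4)] exponents(1) q_le_p gp])
  have "(\<lambda>n. gdist v' (v n)) \<longlonglongrightarrow> 0" using gq by (simp add: gdist_W0[OF W0_p_q[OF Wv'] W0_p_q[OF Wv]])
  then have vq: "(\<lambda>n. powint q (\<lambda>x. v n x - v' x)) \<longlonglongrightarrow> 0"
    by (rule gdist_tendsto_imp_Lp[OF W0_W10_q[OF W0_p_q[OF Wv]] W0_W10_q[OF W0_p_q[OF Wv']]])
  have "(\<lambda>n. powint q (v n)) \<longlonglongrightarrow> powint q v'"
    by (rule powint_tendsto[OF Lp_p_q[OF L(1)] Lp_p_q[OF L'(1)] exponents(1) vq])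
  then have c: "c \<longlonglongrightarrow> c'"
    unfolding c_def[abs_def] c'_def using is_min_powint_ge_1[OF u(2) m'] by (intro tendsto_powr tendsto_const) auto
  have c1: "\<bar>c n\<bar> powr q \<le> 1" for n
    using normalizer[OF is_min_powint_ge_1[OF u(1) m]] exponents(1) by (auto simp: c_def intro!: powr_le1)
  have le: "gdist w' (w n) \<le> 2 powr q * (powint q (\<lambda>x. g n x - g' x) + \<bar>c n - c'\<bar> powr q * powint q g')" for n
  proof -
    have eq: "(\<lambda>x. c n *\<^sub>R g n x - c' *\<^sub>R g' x) = (\<lambda>x. c n *\<^sub>R (g n x - g' x) + (c n - c') *\<^sub>R g' x)"
      by (auto simp: algebra_simps)
    have "gdist w' (w n) = powint q (\<lambda>x. c n *\<^sub>R g n x - c' *\<^sub>R g' x)"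
      unfolding c_def c'_def by (rule gdist_W0[OF W0_p_q[OF W'] W0_p_q[OF W]])
    also have "\<dots> \<le> 2 powr q * (powint q (\<lambda>x. c n *\<^sub>R (g n x - g' x)) + powint q (\<lambda>x. (c n - c') *\<^sub>R g' x))"
      unfolding eq by (intro powint_add_le Lp_scaleR Lp_diff Lp_p_q[OF L(2)] Lp_p_q[OF L'(2)] exponents(1))
    also have "\<dots> \<le> 2 powr q * (1 * powint q (\<lambda>x. g n x - g' x) + \<bar>c n - c'\<bar> powr q * powint q g')"
      unfolding powint_scaleR using c1 by (intro mult_left_mono add_right_mono mult_right_mono) auto
    finally show ?thesis by simp
  qed
  have "(\<lambda>n. 2 powr q * (powint q (\<lambda>x. g n x - g' x) + \<bar>c n - c'\<bar> powr q * powint q g')) \<longlonglongrightarrow> 2 powr q * (0 + \<bar>c' - c'\<bar> powr q * powint q g')"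
    using exponents(1) by (intro tendsto_intros tendsto_powr' gq c) auto
  then have "(\<lambda>n. 2 powr q * (powint q (\<lambda>x. g n x - g' x) + \<bar>c n - c'\<bar> powr q * powint q g')) \<longlonglongrightarrow> 0" by simp
  then show ?thesis
    by (rule tendsto_sandwich[OF _ _ tendsto_const, rotated 2]) (use le in auto)
qed

lemma step_unique:
  assumes "0 < e" "u \<in> unit_sphere" "step e u w" "step e u w'" shows "gdist w w' = 0"
  using step_tendsto[OF assms(1) assms(2,2) _ assms(4,3)] by (simp add: LIMSEQ_const_iff)

definition seq_compact_Lq :: "('a \<Rightarrow> real) set \<Rightarrow> bool" where
  "seq_compact_Lq A \<longleftrightarrow> (\<forall>u. (\<forall>n. u n \<in> A) \<longrightarrow>
    (\<exists>(\<sigma>::nat \<Rightarrow> nat) v. strict_mono \<sigma> \<and> v \<in> A \<and> (\<lambda>n. powint q (\<lambda>x. u (\<sigma> n) x - v x)) \<longlonglongrightarrow> 0))"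

text \<open>The sets that can be iterated. They need not consist of Sobolev functions.\<close>

definition admissible :: "nat \<Rightarrow> ('a \<Rightarrow> real) set \<Rightarrow> bool" where
  "admissible k A \<longleftrightarrow> A \<subseteq> unit_sphere \<and> (\<forall>u\<in>A. (\<lambda>x. - u x) \<in> A) \<and> seq_compact_Lq A \<and> lq_genus_ge k A"

definition step_set :: "real \<Rightarrow> ('a \<Rightarrow> real) set \<Rightarrow> ('a \<Rightarrow> real) set" where
  "step_set e A = {w. \<exists>u\<in>A. step e u w}"

text \<open>Closedness is reduced to sequential compactness up to null sets, which is how it is available for
  images of compact sets.\<close>

lemma Sigma_kI:
  assumes B: "B \<subseteq> W10 q \<Omega>" "B \<subseteq> unit_sphere" and sym: "\<And>u. u \<in> B \<Longrightarrow> (\<lambda>x. - u x) \<in> B"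
    and sat: "\<And>u v. u \<in> B \<Longrightarrow> v \<in> W10 q \<Omega> \<Longrightarrow> AE x in M. u x = v x \<Longrightarrow> v \<in> B"
    and comp: "\<And>v. (\<And>n. v n \<in> B) \<Longrightarrow> \<exists>(\<sigma>::nat \<Rightarrow> nat) w. strict_mono \<sigma> \<and> w \<in> B \<and> (\<lambda>n. gdist w (v (\<sigma> n))) \<longlonglongrightarrow> 0"
    and g: "enat k \<le> genus (W10_topology q \<Omega>) B"
  shows "B \<in> Sigma_k q \<Omega> k"
proof -
  have "closedin (W10_topology q \<Omega>) B"
    unfolding closedin_def openin_W10_iff topspace_W10_topology
  proof (intro conjI B ballI)
    fix w assume w: "w \<in> W10 q \<Omega> - B"
    show "\<exists>d>0. \<forall>v\<in>W10 q \<Omega>. gdist w v < d \<longrightarrow> v \<in> W10 q \<Omega> - B"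
    proof (rule ccontr)
      assume "\<not> ?thesis"
      then have "\<not> (\<forall>v\<in>W10 q \<Omega>. gdist w v < inverse (real (Suc n)) \<longrightarrow> v \<in> W10 q \<Omega> - B)" for n
        using positive_imp_inverse_positive[of "real (Suc n)"] by (metis of_nat_0_less_iff zero_less_Suc)
      then have "\<exists>v\<in>B. gdist w v < inverse (real (Suc n))" for n by blast
      then obtain v where v: "\<And>n. v n \<in> B" "\<And>n. gdist w (v n) < inverse (real (Suc n))" by metis
      have vw: "(\<lambda>n. gdist w (v n)) \<longlonglongrightarrow> 0"
        by (rule tendsto_sandwich[OF _ _ tendsto_const LIMSEQ_inverse_real_of_nat])
          (use v(2) in \<open>auto intro!: always_eventually less_imp_le\<close>)
      obtain \<sigma> w' where \<sigma>: "strict_mono (\<sigma> :: nat \<Rightarrow> nat)" "w' \<in> B" "(\<lambda>n. gdist w' (v (\<sigma> n))) \<longlonglongrightarrow> 0"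
        using comp[of v, OF v(1)] by (elim exE conjE) (rule that)
      have 1: "(\<lambda>n. powint q (\<lambda>x. v (\<sigma> n) x - w' x)) \<longlonglongrightarrow> 0"
        by (rule gdist_tendsto_imp_Lp[OF _ _ \<sigma>(3)]) (use v(1) \<sigma>(2) B in auto)
      have "(\<lambda>n. gdist w (v (\<sigma> n))) \<longlonglongrightarrow> 0" using LIMSEQ_subseq_LIMSEQ[OF vw \<sigma>(1)] by (simp add: o_def)
      then have 2: "(\<lambda>n. powint q (\<lambda>x. v (\<sigma> n) x - w x)) \<longlonglongrightarrow> 0"
        by (rule gdist_tendsto_imp_Lp[rotated 2]) (use v(1) w B in auto)
      have "AE x in M. w' x = w x"
        by (rule Lp_lim_unique[OF _ _ _ exponents(1) 1 2]) (use v(1) \<sigma>(2) w B W0_Lp(1)[OF W10_q] in auto)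
      then show False using sat[OF \<sigma>(2)] w by blast
    qed
  qed blast
  moreover have "B = uminus ` B"
  proof -
    have "- w \<in> B" if "w \<in> B" for w using sym[OF that] by (simp add: fun_Compl_def)
    moreover have "w \<in> uminus ` B" if "w \<in> B" for w
      using sym[OF that] by (intro image_eqI[of _ _ "\<lambda>x. - w x"]) (auto simp: fun_Compl_def)
    ultimately show ?thesis by blast
  qed
  moreover have "B \<subseteq> D1 q \<Omega>"
    using B by (auto simp: D1_def unit_sphere_def powint_def)
  ultimately show ?thesis using g by (simp add: Sigma_k_def)
qed

text \<open>Composition with the step turns a test map for the genus of the image into one for the \<open>L^q\<close> genus of
  the given set. A choice of the step is odd and continuous only up to null sets, which a continuous map
  into a Euclidean space does not notice.\<close>

lemma step_set_genus:
  assumes A: "admissible k A" and e: "0 < e"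
  shows "enat k \<le> genus (W10_topology q \<Omega>) (step_set e A)"
  unfolding le_genus_iff
proof (intro allI impI, elim conjE)
  fix m \<phi> assume cm: "continuous_map (subtopology (W10_topology q \<Omega>) (step_set e A)) (subtopology (Euclidean_space m) (- {\<lambda>_. 0})) \<phi>"
    and odd: "\<forall>w\<in>step_set e A. \<phi> (- w) = - \<phi> w"
  have sph: "u \<in> unit_sphere" if "u \<in> A" for u using A that by (auto simp: admissible_def)
  have sym: "(\<lambda>x. - u x) \<in> A" if "u \<in> A" for u using A that by (auto simp: admissible_def)
  have B: "step_set e A \<subseteq> W10 q \<Omega>" using step_W10(1)[OF _ sph e] by (auto simp: step_set_def)
  \<comment> \<open>The oddness and continuity of this choice are those of the step relation, up to \<open>gdist\<close> zero.\<close>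
  define T where "T u = (SOME w. step e u w)" for u
  have T: "step e u (T u)" if uA: "u \<in> A" for u
  proof -
    obtain w where "step e u w" by (rule step_exists[OF sph[OF uA] e])
    then show ?thesis unfolding T_def by (rule someI[of "step e u" w])
  qed
  have TB: "T u \<in> step_set e A" if "u \<in> A" for u using T that by (auto simp: step_set_def)
  have eq: "\<phi> w = \<phi> w'" if "w \<in> step_set e A" "w' \<in> step_set e A" "gdist w w' = 0" for w w'
  proof
    fix i
    have "(\<lambda>n::nat. \<phi> w' i) \<longlonglongrightarrow> \<phi> w i" by (rule continuous_map_imp_tendsto[OF cm B that(2,1)]) (simp add: that(3))
    then show "\<phi> w i = \<phi> w' i" by (simp add: LIMSEQ_const_iff)
  qed
  have lg: "lq_genus_ge k A" using A by (simp add: admissible_def)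
  show "k \<le> m"
  proof (rule lg[unfolded lq_genus_ge_def, rule_format, of m "\<lambda>u. \<phi> (T u)"], intro conjI ballI allI impI)
    fix u i assume u: "u \<in> A" and "i < m"
    have s1: "step e (\<lambda>x. - u x) (T (\<lambda>x. - u x))" by (rule T[OF sym[OF u]])
    have s2: "step e (\<lambda>x. - u x) (- T u)" using step_minus[OF T[OF u]] by (simp add: fun_Compl_def)
    have "\<phi> (T (\<lambda>x. - u x)) = \<phi> (- T u)"
      by (rule eq[OF TB[OF sym[OF u]] _ step_unique[OF e sph[OF sym[OF u]] s1 s2]]) (use s2 sym[OF u] in \<open>auto simp: step_set_def\<close>)
    then show "\<phi> (T (\<lambda>x. - u x)) i = - \<phi> (T u) i" using odd TB[OF u] by (simp add: fun_Compl_def)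
  next
    fix u assume "u \<in> A"
    then show "\<exists>i<m. \<phi> (T u) i \<noteq> 0" by (rule continuous_map_nonzero[OF cm B TB])
  next
    fix i :: nat and u :: "nat \<Rightarrow> 'a \<Rightarrow> real" and v assume "i < m" and u: "(\<forall>n. u n \<in> A) \<and> v \<in> A \<and> (\<lambda>n. powint q (\<lambda>x. u n x - v x)) \<longlonglongrightarrow> 0"
    have "(\<lambda>n. gdist (T v) (T (u n))) \<longlonglongrightarrow> 0"
      by (rule step_tendsto[OF e _ _ _ T T]) (use u sph in auto)
    then show "(\<lambda>n. \<phi> (T (u n)) i) \<longlonglongrightarrow> \<phi> (T v) i"
      by (intro continuous_map_imp_tendsto[OF cm B]) (use u TB in auto)
  qed
qed

lemma step_set_compact:
  assumes A: "admissible k A" and e: "0 < e" and w: "\<And>n. w n \<in> step_set e A"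
  obtains \<sigma> :: "nat \<Rightarrow> nat" and w' where "strict_mono \<sigma>" "w' \<in> step_set e A" "(\<lambda>n. gdist w' (w (\<sigma> n))) \<longlonglongrightarrow> 0"
proof -
  have sph: "u \<in> unit_sphere" if "u \<in> A" for u using A that by (auto simp: admissible_def)
  obtain u where u: "\<And>n. u n \<in> A" "\<And>n. step e (u n) (w n)" using w unfolding step_set_def by simp metis
  obtain \<sigma> :: "nat \<Rightarrow> nat" and v where v: "strict_mono \<sigma>" "v \<in> A" "(\<lambda>n. powint q (\<lambda>x. u (\<sigma> n) x - v x)) \<longlonglongrightarrow> 0"
    using A u(1) unfolding admissible_def seq_compact_Lq_def by blast
  obtain w' where w': "step e v w'" by (rule step_exists[OF sph[OF v(2)] e])
  have "(\<lambda>n. gdist w' (w (\<sigma> n))) \<longlonglongrightarrow> 0" by (rule step_tendsto[OF e sph[OF u(1)] sph[OF v(2)] v(3) u(2) w'])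
  then show ?thesis using that[OF v(1), of w'] v(2) w' by (auto simp: step_set_def)
qed

lemma step_set_admissible:
  assumes A: "admissible k A" and e: "0 < e"
  shows "admissible k (step_set e A)" "step_set e A \<in> Sigma_k q \<Omega> k"
proof -
  have sph: "u \<in> unit_sphere" if "u \<in> A" for u using A that by (auto simp: admissible_def)
  have B: "step_set e A \<subseteq> W10 q \<Omega>" using step_W10(1)[OF _ sph e] by (auto simp: step_set_def)
  have S: "step_set e A \<subseteq> unit_sphere" using step_W10(2)[OF _ sph e] by (auto simp: step_set_def)
  have sym: "(\<lambda>x. - w x) \<in> step_set e A" if "w \<in> step_set e A" for w
    using that A step_minus unfolding step_set_def admissible_def by blast
  have g: "enat k \<le> genus (W10_topology q \<Omega>) (step_set e A)" by (rule step_set_genus[OF A e])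
  have "seq_compact_Lq (step_set e A)"
    unfolding seq_compact_Lq_def
  proof (intro allI impI)
    fix w :: "nat \<Rightarrow> 'a \<Rightarrow> real" assume w: "\<forall>n. w n \<in> step_set e A"
    obtain \<sigma> w' where \<sigma>: "strict_mono (\<sigma> :: nat \<Rightarrow> nat)" "w' \<in> step_set e A" "(\<lambda>n. gdist w' (w (\<sigma> n))) \<longlonglongrightarrow> 0"
      by (rule step_set_compact[OF A e w[rule_format]])
    have "(\<lambda>n. powint q (\<lambda>x. w (\<sigma> n) x - w' x)) \<longlonglongrightarrow> 0"
      by (rule gdist_tendsto_imp_Lp[OF _ _ \<sigma>(3)]) (use w \<sigma>(2) B in auto)
    then show "\<exists>(\<sigma>::nat \<Rightarrow> nat) v. strict_mono \<sigma> \<and> v \<in> step_set e A \<and> (\<lambda>n. powint q (\<lambda>x. w (\<sigma> n) x - v x)) \<longlonglongrightarrow> 0"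
      using \<sigma> by blast
  qed
  then show "admissible k (step_set e A)"
    unfolding admissible_def using S sym lq_genus_geI_genus[OF B g order_refl] by blast
  show "step_set e A \<in> Sigma_k q \<Omega> k"
  proof (rule Sigma_kI[OF B S sym _ _ g])
    fix u v assume "u \<in> step_set e A" "AE x in M. u x = v x"
    then show "v \<in> step_set e A" using step_cong_AE unfolding step_set_def by blast
  next
    fix v :: "nat \<Rightarrow> 'a \<Rightarrow> real" assume "\<And>n. v n \<in> step_set e A"
    then show "\<exists>(\<sigma>::nat \<Rightarrow> nat) w. strict_mono \<sigma> \<and> w \<in> step_set e A \<and> (\<lambda>n. gdist w (v (\<sigma> n))) \<longlonglongrightarrow> 0"
      by (rule step_set_compact[OF A e]) (intro exI conjI)
  qed
qed

text \<open>Closed sets of Sobolev functions with bounded energy need not be compact in \<open>L^q\<close>; by Rellich's theorem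
  their closures are.\<close>

definition Lq_closure :: "('a \<Rightarrow> real) set \<Rightarrow> ('a \<Rightarrow> real) set" where
  "Lq_closure A = {v \<in> Lp q \<Omega>. \<exists>u. (\<forall>n. u n \<in> A) \<and> (\<lambda>n. powint q (\<lambda>x. u n x - v x)) \<longlonglongrightarrow> 0}"

lemma Lq_closure_admissible:
  assumes A: "A \<in> Sigma_k q \<Omega> k" and R: "\<And>u. u \<in> A \<Longrightarrow> powint q (weak_grad \<Omega> u) \<le> R"
  shows "admissible k (Lq_closure A)"
proof -
  have B: "A \<subseteq> W10 q \<Omega>" and one: "\<And>u. u \<in> A \<Longrightarrow> powint q u = 1" and sym: "A = uminus ` A" and g: "enat k \<le> genus (W10_topology q \<Omega>) A"
    using A by (auto simp: Sigma_k_def D1_def powint_def)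
  have L: "u \<in> Lp q \<Omega>" if "u \<in> A" for u using W0_Lp(1)[OF W10_q] B that by blast
  have sub: "A \<subseteq> Lq_closure A"
  proof
    fix u assume u: "u \<in> A"
    show "u \<in> Lq_closure A" unfolding Lq_closure_def using u L by (auto intro!: exI[of _ "\<lambda>_. u"])
  qed
  have "Lq_closure A \<subseteq> unit_sphere"
  proof
    fix v assume "v \<in> Lq_closure A"
    then obtain u where v: "v \<in> Lp q \<Omega>" and u: "\<And>n. u n \<in> A" "(\<lambda>n. powint q (\<lambda>x. u n x - v x)) \<longlonglongrightarrow> 0"
      by (auto simp: Lq_closure_def)
    have "(\<lambda>n. powint q (u n)) \<longlonglongrightarrow> powint q v" by (rule powint_tendsto[OF L[OF u(1)] v exponents(1) u(2)])
    then show "v \<in> unit_sphere" using one[OF u(1)] v by (simp add: LIMSEQ_const_iff unit_sphere_def)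
  qed
  moreover have "(\<lambda>x. - v x) \<in> Lq_closure A" if vA: "v \<in> Lq_closure A" for v
  proof -
    obtain u where v: "v \<in> Lp q \<Omega>" and u: "\<And>n. u n \<in> A" "(\<lambda>n. powint q (\<lambda>x. u n x - v x)) \<longlonglongrightarrow> 0"
      using vA by (auto simp: Lq_closure_def)
    have "- u n \<in> A" for n using u(1)[of n] sym by blast
    then have "(\<lambda>x. - u n x) \<in> A" for n by (simp add: fun_Compl_def)
    moreover have "(\<lambda>n. powint q (\<lambda>x. - u n x - - v x)) \<longlonglongrightarrow> 0"
      using u(2) powint_minus_commute[of q "u _" v] by simp
    ultimately show ?thesis
      unfolding Lq_closure_def using Lp_minus[OF v] by (auto intro!: exI[of _ "\<lambda>n x. - u n x"])
  qed
  moreover have "seq_compact_Lq (Lq_closure A)"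
    unfolding seq_compact_Lq_def
  proof (intro allI impI)
    fix v :: "nat \<Rightarrow> 'a \<Rightarrow> real" assume v: "\<forall>n. v n \<in> Lq_closure A"
    then have vL: "v n \<in> Lp q \<Omega>" for n by (simp add: Lq_closure_def)
    have "\<exists>a\<in>A. powint q (\<lambda>x. a x - v n x) < inverse (real (Suc n))" for n
    proof -
      obtain u where u: "\<And>k. u k \<in> A" "(\<lambda>k. powint q (\<lambda>x. u k x - v n x)) \<longlonglongrightarrow> 0"
        using v by (auto simp: Lq_closure_def)
      have "eventually (\<lambda>k. powint q (\<lambda>x. u k x - v n x) < inverse (real (Suc n))) sequentially"
        by (rule order_tendstoD(2)[OF u(2)]) simp
      then show ?thesis using u(1) by (auto simp: eventually_sequentially)
    qed
    then obtain a where a: "\<And>n. a n \<in> A" "\<And>n. powint q (\<lambda>x. a n x - v n x) < inverse (real (Suc n))" by metis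
    have Wa: "W0 q (a n) (weak_grad \<Omega> (a n))" for n using W10_q a(1) B by blast
    obtain \<sigma> w where \<sigma>: "strict_mono (\<sigma> :: nat \<Rightarrow> nat)" "w \<in> Lp q \<Omega>" "(\<lambda>n. powint q (\<lambda>x. a (\<sigma> n) x - w x)) \<longlonglongrightarrow> 0"
      by (rule rellich[OF q_gt_1 Wa R[OF a(1)]])
    have a2: "powint q (\<lambda>x. v n x - a n x) < inverse (real (Suc n))" for n
      using a(2)[of n] by (subst powint_minus_commute)
    have av: "(\<lambda>n. powint q (\<lambda>x. v n x - a n x)) \<longlonglongrightarrow> 0"
      by (rule tendsto_sandwich[OF _ _ tendsto_const LIMSEQ_inverse_real_of_nat]) (use a2 in \<open>auto intro!: always_eventually less_imp_le\<close>)
    have "(\<lambda>n. 2 powr q * (powint q (\<lambda>x. v (\<sigma> n) x - a (\<sigma> n) x) + powint q (\<lambda>x. a (\<sigma> n) x - w x))) \<longlonglongrightarrow> 2 powr q * (0 + 0)"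
      using LIMSEQ_subseq_LIMSEQ[OF av \<sigma>(1)] \<sigma>(3) by (intro tendsto_intros) (simp_all add: o_def)
    then have "(\<lambda>n. 2 powr q * (powint q (\<lambda>x. v (\<sigma> n) x - a (\<sigma> n) x) + powint q (\<lambda>x. a (\<sigma> n) x - w x))) \<longlonglongrightarrow> 0" by simp
    then have "(\<lambda>n. powint q (\<lambda>x. v (\<sigma> n) x - w x)) \<longlonglongrightarrow> 0"
      by (rule tendsto_sandwich[OF _ _ tendsto_const, rotated 2])
        (use powint_triangle[OF vL L[OF a(1)] \<sigma>(2) exponents(1)] in auto)
    moreover have "w \<in> Lq_closure A" unfolding Lq_closure_def using \<sigma>(2,3) a(1) by (auto intro!: exI[of _ "\<lambda>n. a (\<sigma> n)"])
    ultimately show "\<exists>(\<sigma>::nat \<Rightarrow> nat) w. strict_mono \<sigma> \<and> w \<in> Lq_closure A \<and> (\<lambda>n. powint q (\<lambda>x. v (\<sigma> n) x - w x)) \<longlonglongrightarrow> 0"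
      using \<sigma>(1) by blast
  qed
  ultimately show ?thesis unfolding admissible_def using lq_genus_geI_genus[OF B g sub] by blast
qed

end

section \<open>Fixed points of the iteration at the minimax level\<close>

context two_exponents
begin

text \<open>Semicontinuity of the energy for two equal exponents, where the energy is twice the \<open>q\<close>-energy.\<close>

lemma powint_lower_semicontinuous:
  assumes W: "\<And>n. W0 q (u n) (g n)" and B: "\<And>n. powint q (g n) \<le> B"
    and u': "u' \<in> Lp q \<Omega>" "(\<lambda>n. powint q (\<lambda>x. u n x - u' x)) \<longlonglongrightarrow> 0"
  obtains h where "W0 q u' h" "powint q h \<le> B"
proof -
  interpret qq: two_exponents \<Omega> q q by unfold_locales (use q_gt_1 in auto)
  have "qq.energy 1 (g n) \<le> 2 * B" for n using B[of n] by (simp add: qq.energy_def)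
  then obtain h where "W0 q u' h" "qq.energy 1 h \<le> 2 * B"
    by (rule qq.energy_lower_semicontinuous[OF zero_less_one W _ u', of "2 * B"])
  then show ?thesis by (intro that[of h]) (auto simp: qq.energy_def)
qed

lemma unit_sphereD: "u \<in> unit_sphere \<Longrightarrow> u \<in> Lp q \<Omega>" "u \<in> unit_sphere \<Longrightarrow> powint q u = 1"
  by (auto simp: unit_sphere_def)

lemma unit_sphere_closed:
  assumes u: "\<And>n. u n \<in> unit_sphere" and u': "u' \<in> Lp q \<Omega>" "(\<lambda>n. powint q (\<lambda>x. u n x - u' x)) \<longlonglongrightarrow> 0"
  shows "u' \<in> unit_sphere"
proof -
  have "(\<lambda>n. powint q (u n)) \<longlonglongrightarrow> powint q u'"
    by (rule powint_tendsto[OF unit_sphereD(1)[OF u] u'(1) exponents(1) u'(2)])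
  then show ?thesis using unit_sphereD(2)[OF u] u'(1) by (simp add: LIMSEQ_const_iff unit_sphere_def)
qed

text \<open>Otherwise there were functions in the closure, which is compact, with parameters tending to \<open>0\<close> and
  large minima; their limit has \<open>q\<close>-energy at most \<open>R\<close> by semicontinuity, contradicting
  \<open>energy_recovery\<close>.\<close>

lemma uniform_bound_on_closure:
  assumes A: "A \<in> Sigma_k q \<Omega> k" and R: "\<And>u. u \<in> A \<Longrightarrow> powint q (weak_grad \<Omega> u) \<le> R" and \<eta>: "R < \<eta>"
  obtains e0 where "0 < e0"
    "\<And>e u v g. 0 < e \<Longrightarrow> e < e0 \<Longrightarrow> u \<in> Lq_closure A \<Longrightarrow> is_min e u v g \<Longrightarrow> energy e g < \<eta>"
proof -
  have adm: "admissible k (Lq_closure A)" by (rule Lq_closure_admissible[OF A R])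
  have AW: "A \<subseteq> W10 q \<Omega>" using A by (auto simp: Sigma_k_def D1_def)
  have "\<exists>e0>0. \<forall>e u v g. 0 < e \<and> e < e0 \<and> u \<in> Lq_closure A \<and> is_min e u v g \<longrightarrow> energy e g < \<eta>"
  proof (rule ccontr)
    assume neg: "\<not> ?thesis"
    have "\<exists>e u v g. 0 < e \<and> e < inverse (real (Suc n)) \<and> u \<in> Lq_closure A \<and> is_min e u v g \<and> \<eta> \<le> energy e g" for n
    proof -
      have "0 < inverse (real (Suc n))" by simp
      with neg have "\<not> (\<forall>e u v g. 0 < e \<and> e < inverse (real (Suc n)) \<and> u \<in> Lq_closure A \<and> is_min e u v g \<longrightarrow> energy e g < \<eta>)" by blast
      then show ?thesis by (meson not_le)
    qed
    then obtain e u v g where s: "\<And>n. 0 < e n" "\<And>n. e n < inverse (real (Suc n))" "\<And>n. u n \<in> Lq_closure A"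
      "\<And>n. is_min (e n) (u n) (v n) (g n)" "\<And>n. \<eta> \<le> energy (e n) (g n)" by metis
    have elim: "e \<longlonglongrightarrow> 0"
      by (rule tendsto_sandwich[OF _ _ tendsto_const LIMSEQ_inverse_real_of_nat])
        (use s(1,2) in \<open>auto intro!: always_eventually less_imp_le\<close>)
    obtain \<sigma> :: "nat \<Rightarrow> nat" and u' where \<sigma>: "strict_mono \<sigma>" "u' \<in> Lq_closure A" "(\<lambda>n. powint q (\<lambda>x. u (\<sigma> n) x - u' x)) \<longlonglongrightarrow> 0"
      using adm s(3) unfolding admissible_def seq_compact_Lq_def by blast
    obtain a where a: "u' \<in> Lp q \<Omega>" "\<And>n. a n \<in> A" "(\<lambda>n. powint q (\<lambda>x. a n x - u' x)) \<longlonglongrightarrow> 0"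
      using \<sigma>(2) by (auto simp: Lq_closure_def)
    obtain h where h: "W0 q u' h" "powint q h \<le> R"
      by (rule powint_lower_semicontinuous[OF W10_q[OF subsetD[OF AW a(2)]] R[OF a(2)] a(1,3)])
    have sph: "x \<in> unit_sphere" if "x \<in> Lq_closure A" for x using adm that by (auto simp: admissible_def)
    have e\<sigma>: "(\<lambda>n. e (\<sigma> n)) \<longlonglongrightarrow> 0" using LIMSEQ_subseq_LIMSEQ[OF elim \<sigma>(1)] by (simp add: o_def)
    have "powint q h < \<eta>" using h(2) \<eta> by simp
    then have "eventually (\<lambda>n. energy (e (\<sigma> n)) (g (\<sigma> n)) < \<eta>) sequentially"
      by (rule energy_recovery[OF s(1) e\<sigma> sph[OF s(3)] sph[OF \<sigma>(2)] \<sigma>(3) h(1) s(4)])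
    then have "eventually (\<lambda>n. False) sequentially" by eventually_elim (use s(5) in \<open>simp add: not_less[symmetric]\<close>)
    then show False by simp
  qed
  then show ?thesis using that by blast
qed

primrec orbit_set :: "real \<Rightarrow> ('a \<Rightarrow> real) set \<Rightarrow> nat \<Rightarrow> ('a \<Rightarrow> real) set" where
  "orbit_set e A 0 = A"
| "orbit_set e A (Suc n) = step_set e (orbit_set e A n)"

lemma orbit_set_admissible: "admissible k A \<Longrightarrow> 0 < e \<Longrightarrow> admissible k (orbit_set e A n)"
  by (induction n) (auto intro: step_set_admissible)

lemma orbit_set_chain:
  "w \<in> orbit_set e A n \<Longrightarrow> \<exists>u. u 0 \<in> A \<and> (\<forall>i<n. step e (u i) (u (Suc i))) \<and> u n = w"
proof (induction n arbitrary: w)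
  case 0
  then show ?case by (intro exI[of _ "\<lambda>_. w"]) auto
next
  case (Suc n)
  then obtain v where v: "v \<in> orbit_set e A n" "step e v w" by (auto simp: step_set_def)
  then obtain u where u: "u 0 \<in> A" "\<forall>i<n. step e (u i) (u (Suc i))" "u n = v" using Suc.IH by blast
  show ?case
    using u v by (intro exI[of _ "u(Suc n := w)"]) (auto simp: less_Suc_eq)
qed

text \<open>Along an orbit the energy decreases from at most \<open>\<beta>\<close> to at least \<open>\<alpha>\<close>, so some step decreases it
  by at most the average. The end point exists because the last set of the orbit lies in \<open>Sigma_k\<close>.\<close>

lemma almost_fixed_point:
  assumes adm: "admissible k A" and e: "0 < e"
    and \<beta>: "\<And>u v g. u \<in> A \<Longrightarrow> is_min e u v g \<Longrightarrow> energy e g \<le> \<beta>"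
    and low: "\<And>B. B \<in> Sigma_k q \<Omega> k \<Longrightarrow> \<exists>u\<in>B. \<alpha> \<le> powint q (weak_grad \<Omega> u)"
  shows "\<exists>u v g. u \<in> unit_sphere \<and> W0 p u (weak_grad \<Omega> u) \<and> is_min e u v g \<and> \<alpha> \<le> energy e g \<and>
    energy e (weak_grad \<Omega> u) \<le> \<beta> \<and> energy e (weak_grad \<Omega> u) - energy e g \<le> (\<beta> - \<alpha>) / real (Suc n)"
proof -
  have "orbit_set e A (Suc (Suc n)) \<in> Sigma_k q \<Omega> k"
    using step_set_admissible(2)[OF orbit_set_admissible[OF adm e, of "Suc n"] e] by simp
  then obtain w where w: "w \<in> orbit_set e A (Suc (Suc n))" "\<alpha> \<le> powint q (weak_grad \<Omega> w)" using low by blast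
  obtain u where u: "u 0 \<in> A" "\<And>i. i < Suc (Suc n) \<Longrightarrow> step e (u i) (u (Suc i))" "u (Suc (Suc n)) = w"
    using orbit_set_chain[OF w(1)] by blast
  have sph: "u i \<in> unit_sphere" if "i \<le> Suc (Suc n)" for i
    using that
  proof (induction i)
    case 0 then show ?case using adm u(1) by (auto simp: admissible_def)
  next
    case (Suc i) show ?case by (rule step_W10(2)[OF u(2) Suc.IH e]) (use Suc.prems in auto)
  qed
  define E where "E i = energy e (weak_grad \<Omega> (u i))" for i
  have "\<exists>v g. is_min e (u i) v g \<and> E (Suc i) \<le> energy e g" if i: "i \<le> Suc n" for i
  proof -
    have "step e (u i) (u (Suc i))" "u i \<in> unit_sphere" using u(2) sph i by auto
    then show ?thesis unfolding E_def by (rule stepE[OF _ _ e]) blast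
  qed
  then obtain v g where vg: "\<And>i. i \<le> Suc n \<Longrightarrow> is_min e (u i) (v i) (g i)" "\<And>i. i \<le> Suc n \<Longrightarrow> E (Suc i) \<le> energy e (g i)"
    by metis
  have W: "W0 p (u (Suc i)) (weak_grad \<Omega> (u (Suc i)))" if "i \<le> Suc n" for i
    by (rule step_W10(3)[OF u(2) sph e]) (use that in auto)
  \<comment> \<open>On the sphere \<open>u (Suc i)\<close> competes in its own problem. The start \<open>u 0\<close> is excluded: it need not
    have finite energy.\<close>
  have gE: "energy e (g (Suc i)) \<le> E (Suc i)" if i: "i \<le> n" for i
  proof -
    have "pairing q (u (Suc i)) (u (Suc i)) = 1" using sph[of "Suc i"] i by (simp add: pairing_self unit_sphere_def)
    then show ?thesis unfolding E_def using is_minD(3)[OF vg(1) W] i by simp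
  qed
  have dec: "E (Suc (Suc i)) \<le> E (Suc i)" if "i \<le> n" for i using vg(2)[of "Suc i"] gE[of i] that by simp
  have E1: "E (Suc i) \<le> \<beta>" if "i \<le> Suc n" for i
    using that
  proof (induction i)
    case 0 show ?case using vg(2)[of 0] \<beta>[OF u(1) vg(1)[of 0]] by simp
  next
    case (Suc i) then show ?case using dec[of i] by simp
  qed
  have \<alpha>E: "\<alpha> \<le> E (Suc (Suc n) - i)" if "i \<le> Suc n" for i
    using that
  proof (induction i)
    case 0 show ?case using w(2) u(3) energy_ge(1)[of e "weak_grad \<Omega> w"] e by (simp add: E_def)
  next
    case (Suc i)
    have "Suc (Suc n) - i = Suc (Suc (n - i))" "Suc (Suc n) - Suc i = Suc (n - i)" using Suc.prems by auto
    then show ?case using Suc dec[of "n - i"] by simp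
  qed
  have \<alpha>E': "\<alpha> \<le> E (Suc i)" if "i \<le> Suc n" for i using \<alpha>E[of "Suc n - i"] that by (simp add: Suc_diff_le)
  \<comment> \<open>Telescoping: \<open>n + 1\<close> differences add up to at most \<open>\<beta> - \<alpha>\<close>.\<close>
  have "\<exists>i\<le>n. E (Suc i) - E (Suc (Suc i)) \<le> (\<beta> - \<alpha>) / real (Suc n)"
  proof (rule ccontr)
    assume "\<not> ?thesis"
    then have gt: "\<And>i. i \<in> {..<Suc n} \<Longrightarrow> (\<beta> - \<alpha>) / real (Suc n) < E (Suc i) - E (Suc (Suc i))"
      by (meson lessThan_iff less_Suc_eq_le not_le)
    have "(\<Sum>i<Suc n. (\<beta> - \<alpha>) / real (Suc n)) < (\<Sum>i<Suc n. E (Suc i) - E (Suc (Suc i)))"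
      by (rule sum_strict_mono[OF _ _ gt]) auto
    also have "\<dots> = E (Suc 0) - E (Suc (Suc n))"
      using sum_lessThan_telescope'[of "\<lambda>i. E (Suc i)" "Suc n"] by simp
    also have "(\<Sum>i<Suc n. (\<beta> - \<alpha>) / real (Suc n)) = \<beta> - \<alpha>" by (simp del: of_nat_Suc)
    finally show False using E1[of 0] \<alpha>E'[of "Suc n"] by simp
  qed
  then obtain i where i: "i \<le> n" "E (Suc i) - E (Suc (Suc i)) \<le> (\<beta> - \<alpha>) / real (Suc n)" by blast
  have "is_min e (u (Suc i)) (v (Suc i)) (g (Suc i))" using vg(1) i by simp
  moreover have "E (Suc (Suc i)) \<le> energy e (g (Suc i))" using vg(2) i by simp
  ultimately show ?thesis
    using sph[of "Suc i"] W[of i] \<alpha>E'[of "Suc i"] E1[of i] i unfolding E_def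
    by (intro exI[of _ "u (Suc i)"] exI[of _ "v (Suc i)"] exI[of _ "g (Suc i)"] conjI) (auto simp del: of_nat_Suc)
qed

text \<open>In the limit of almost fixed points, semicontinuity bounds the energy of the limit by the minimum of its
  own problem, so the limit solves that problem itself.\<close>

lemma fixed_point_exists:
  assumes adm: "admissible k A" and e: "0 < e"
    and \<beta>: "\<And>u v g. u \<in> A \<Longrightarrow> is_min e u v g \<Longrightarrow> energy e g \<le> \<beta>"
    and low: "\<And>B. B \<in> Sigma_k q \<Omega> k \<Longrightarrow> \<exists>u\<in>B. \<alpha> \<le> powint q (weak_grad \<Omega> u)"
  obtains w where "w \<in> unit_sphere" "is_min e w w (weak_grad \<Omega> w)"
    "\<alpha> \<le> energy e (weak_grad \<Omega> w)" "energy e (weak_grad \<Omega> w) \<le> \<beta>"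
proof -
  have "\<forall>n. \<exists>u v g. u \<in> unit_sphere \<and> W0 p u (weak_grad \<Omega> u) \<and> is_min e u v g \<and> \<alpha> \<le> energy e g \<and>
    energy e (weak_grad \<Omega> u) \<le> \<beta> \<and> energy e (weak_grad \<Omega> u) - energy e g \<le> (\<beta> - \<alpha>) / real (Suc n)"
    by (rule allI, rule almost_fixed_point[OF adm e \<beta> low])
  then obtain u v g where u: "\<And>n. u n \<in> unit_sphere" "\<And>n. W0 p (u n) (weak_grad \<Omega> (u n))" "\<And>n. is_min e (u n) (v n) (g n)"
    "\<And>n. \<alpha> \<le> energy e (g n)" "\<And>n. energy e (weak_grad \<Omega> (u n)) \<le> \<beta>"
    "\<And>n. energy e (weak_grad \<Omega> (u n)) - energy e (g n) \<le> (\<beta> - \<alpha>) / real (Suc n)" by metis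
  have R: "powint q (weak_grad \<Omega> (u n)) \<le> \<beta>" for n using u(5)[of n] energy_ge(1)[of e "weak_grad \<Omega> (u n)"] e by linarith
  obtain \<sigma> w where \<sigma>: "strict_mono (\<sigma> :: nat \<Rightarrow> nat)" "w \<in> Lp q \<Omega>" "(\<lambda>n. powint q (\<lambda>x. u (\<sigma> n) x - w x)) \<longlonglongrightarrow> 0"
    by (rule rellich[OF q_gt_1 W0_p_q[OF u(2)] R])
  have w: "w \<in> unit_sphere" by (rule unit_sphere_closed[OF u(1) \<sigma>(2,3)])
  obtain v' g' where m': "is_min e w v' g'" by (rule is_min_exists[OF w e])
  have lim: "(\<lambda>n. energy e (g (\<sigma> n))) \<longlonglongrightarrow> energy e g'"
    by (rule is_min_tendsto(2)[OF e u(1) w \<sigma>(3) u(3) m'])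
  have \<alpha>: "\<alpha> \<le> energy e g'" using LIMSEQ_le_const[OF lim, of \<alpha>] u(4) by blast
  obtain h where h: "W0 p w h" "energy e h \<le> \<beta>"
    by (rule energy_lower_semicontinuous[OF e u(2) u(5) \<sigma>(2,3)])
  have Ww: "W0 p w (weak_grad \<Omega> w)" by (rule weak_grad_W0(2)[OF h(1) exponents(5)])
  have same: "energy e (weak_grad \<Omega> w) = energy e k" if k: "W0 p w k" for k
    unfolding energy_def using weak_grad_W0(3)[OF k exponents(5)] weak_grad_W0(3)[OF W0_p_q[OF k] exponents(2)] by simp
  \<comment> \<open>Semicontinuity for the tails, on which the energies exceed the minima by little.\<close>
  have "energy e (weak_grad \<Omega> w) \<le> energy e g' + \<eta>" if \<eta>: "0 < \<eta>" for \<eta>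
  proof -
    have "(\<lambda>n. (\<beta> - \<alpha>) * inverse (real (Suc n))) \<longlonglongrightarrow> (\<beta> - \<alpha>) * 0" by (intro tendsto_intros LIMSEQ_inverse_real_of_nat)
    then have "(\<lambda>n. (\<beta> - \<alpha>) / real (Suc n)) \<longlonglongrightarrow> 0" by (simp add: divide_inverse)
    then have "(\<lambda>n. (\<beta> - \<alpha>) / real (Suc (\<sigma> n))) \<longlonglongrightarrow> 0" using LIMSEQ_subseq_LIMSEQ[OF _ \<sigma>(1)] by (fastforce simp: o_def)
    then have "(\<lambda>n. energy e (g (\<sigma> n)) + (\<beta> - \<alpha>) / real (Suc (\<sigma> n))) \<longlonglongrightarrow> energy e g' + 0" by (intro tendsto_add lim)
    then have "eventually (\<lambda>n. energy e (g (\<sigma> n)) + (\<beta> - \<alpha>) / real (Suc (\<sigma> n)) < energy e g' + \<eta>) sequentially"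
      by (rule order_tendstoD(2)) (use \<eta> in simp)
    then obtain N where N: "\<And>n. N \<le> n \<Longrightarrow> energy e (g (\<sigma> n)) + (\<beta> - \<alpha>) / real (Suc (\<sigma> n)) < energy e g' + \<eta>"
      by (auto simp: eventually_sequentially)
    have le: "energy e (weak_grad \<Omega> (u (\<sigma> (n + N)))) \<le> energy e g' + \<eta>" for n using N[of "n + N"] u(6)[of "\<sigma> (n + N)"] by simp
    have sh: "(\<lambda>n. powint q (\<lambda>x. u (\<sigma> (n + N)) x - w x)) \<longlonglongrightarrow> 0" using \<sigma>(3) by (rule LIMSEQ_ignore_initial_segment)
    obtain h where "W0 p w h" "energy e h \<le> energy e g' + \<eta>"
      by (rule energy_lower_semicontinuous[OF e u(2) le \<sigma>(2) sh])
    then show ?thesis using same by simp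
  qed
  then have le: "energy e (weak_grad \<Omega> w) \<le> energy e g'" by (rule field_le_epsilon)
  have p1: "pairing q w w = 1" using w by (simp add: pairing_self unit_sphere_def)
  have m: "is_min e w w (weak_grad \<Omega> w)"
    unfolding is_min_def using Ww p1 le is_minD(3)[OF m'] order_trans by blast
  show ?thesis
    by (rule that[OF w m]) (use \<alpha> is_minD(3)[OF m' Ww p1] h same in auto)
qed

text \<open>Both halves of the minimax characterisation of a real eigenvalue, without extended reals.\<close>

definition minimax_level :: "nat \<Rightarrow> real \<Rightarrow> bool" where
  "minimax_level k L \<longleftrightarrow>
    (\<forall>\<alpha><L. \<forall>A\<in>Sigma_k q \<Omega> k. \<exists>u\<in>A. \<alpha> \<le> powint q (weak_grad \<Omega> u)) \<and>
    (\<forall>\<beta>>L. \<exists>A\<in>Sigma_k q \<Omega> k. \<forall>u\<in>A. powint q (weak_grad \<Omega> u) \<le> \<beta>)"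

lemma critical_sequence:
  assumes l: "minimax_level k L"
  obtains e w where "\<And>n::nat. 0 < e n" "e \<longlonglongrightarrow> 0" "\<And>n. w n \<in> unit_sphere" "\<And>n. is_min (e n) (w n) (w n) (weak_grad \<Omega> (w n))"
    "(\<lambda>n. energy (e n) (weak_grad \<Omega> (w n))) \<longlonglongrightarrow> L"
proof -
  have "\<exists>e w. 0 < e \<and> e < inverse (real (Suc n)) \<and> w \<in> unit_sphere \<and> is_min e w w (weak_grad \<Omega> w) \<and>
    L - inverse (real (Suc n)) \<le> energy e (weak_grad \<Omega> w) \<and> energy e (weak_grad \<Omega> w) \<le> L + inverse (real (Suc n))" for n
  proof -
    define d where "d = inverse (real (Suc n))"
    have d: "0 < d" by (simp add: d_def)
    obtain A where A: "A \<in> Sigma_k q \<Omega> k" "\<And>u. u \<in> A \<Longrightarrow> powint q (weak_grad \<Omega> u) \<le> L + d / 2"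
      using l d unfolding minimax_level_def by (metis half_gt_zero less_add_same_cancel1)
    obtain e0 where e0: "0 < e0" "\<And>e u v g. 0 < e \<Longrightarrow> e < e0 \<Longrightarrow> u \<in> Lq_closure A \<Longrightarrow> is_min e u v g \<Longrightarrow> energy e g < L + d"
      by (rule uniform_bound_on_closure[OF A, of "L + d"]) (use d in auto)
    define e where "e = min e0 d / 2"
    have e: "0 < e" "e < e0" "e < d" using d e0(1) by (auto simp: e_def min_def)
    have low: "\<And>B. B \<in> Sigma_k q \<Omega> k \<Longrightarrow> \<exists>u\<in>B. L - d \<le> powint q (weak_grad \<Omega> u)"
      using l d unfolding minimax_level_def by (metis diff_less_eq less_add_same_cancel1)
    obtain w where w: "w \<in> unit_sphere" "is_min e w w (weak_grad \<Omega> w)"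
      "L - d \<le> energy e (weak_grad \<Omega> w)" "energy e (weak_grad \<Omega> w) \<le> L + d"
      by (rule fixed_point_exists[OF Lq_closure_admissible[OF A] e(1) less_imp_le[OF e0(2)[OF e(1,2)]] low])
    then show ?thesis using e unfolding d_def by blast
  qed
  then obtain e w where w: "\<And>n. 0 < e n" "\<And>n. e n < inverse (real (Suc n))" "\<And>n. w n \<in> unit_sphere"
    "\<And>n. is_min (e n) (w n) (w n) (weak_grad \<Omega> (w n))" "\<And>n. L - inverse (real (Suc n)) \<le> energy (e n) (weak_grad \<Omega> (w n))"
    "\<And>n. energy (e n) (weak_grad \<Omega> (w n)) \<le> L + inverse (real (Suc n))" by metis
  have elim: "e \<longlonglongrightarrow> 0"
    by (rule tendsto_sandwich[OF _ _ tendsto_const LIMSEQ_inverse_real_of_nat])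
      (use w(1,2) in \<open>auto intro!: always_eventually less_imp_le\<close>)
  have "(\<lambda>n. energy (e n) (weak_grad \<Omega> (w n))) \<longlonglongrightarrow> L"
  proof (rule tendsto_sandwich)
    show "(\<lambda>n. L - inverse (real (Suc n))) \<longlonglongrightarrow> L" using tendsto_diff[OF tendsto_const LIMSEQ_inverse_real_of_nat, of L] by simp
    show "(\<lambda>n. L + inverse (real (Suc n))) \<longlonglongrightarrow> L" using tendsto_add[OF tendsto_const LIMSEQ_inverse_real_of_nat, of L] by simp
  qed (use w(5,6) in auto)
  then show ?thesis using that w elim by blast
qed

text \<open>If the \<open>q\<close>-energy stayed below the level along a subsequence, a limit would have too small
  \<open>q\<close>-energy, and by \<open>energy_recovery\<close> the minima for small \<open>e\<close> would lie below the level as well.\<close>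

lemma critical_sequence_perturbation_vanishes:
  assumes e: "\<And>n::nat. 0 < e n" "e \<longlonglongrightarrow> 0" and w: "\<And>n. w n \<in> unit_sphere" "\<And>n. is_min (e n) (w n) (w n) (weak_grad \<Omega> (w n))"
    and lim: "(\<lambda>n. energy (e n) (weak_grad \<Omega> (w n))) \<longlonglongrightarrow> L"
  shows "(\<lambda>n. e n * powint p (weak_grad \<Omega> (w n))) \<longlonglongrightarrow> 0"
proof (rule LIMSEQ_I)
  fix c :: real assume c: "0 < c"
  let ?E = "\<lambda>n. energy (e n) (weak_grad \<Omega> (w n))" and ?Q = "\<lambda>n. powint q (weak_grad \<Omega> (w n))"
  have "eventually (\<lambda>n. L - c / 2 < ?Q n) sequentially"
  proof (rule ccontr)
    assume "\<not> ?thesis"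
    then have "\<forall>N. \<exists>n>N. ?Q n \<le> L - c / 2"
      unfolding eventually_sequentially by (meson Suc_leD Suc_le_lessD not_le_imp_less Suc_le_eq not_less)
    then have "infinite {n. ?Q n \<le> L - c / 2}" by (auto simp: infinite_nat_iff_unbounded)
    then obtain \<tau> :: "nat \<Rightarrow> nat" where \<tau>: "strict_mono \<tau>" "\<And>n. ?Q (\<tau> n) \<le> L - c / 2"
      using infinite_enumerate[of "{n. ?Q n \<le> L - c / 2}"] by auto
    have Wq: "W0 q (w n) (weak_grad \<Omega> (w n))" for n by (rule W0_p_q[OF is_minD(1)[OF w(2)]])
    obtain \<sigma> u where \<sigma>: "strict_mono (\<sigma> :: nat \<Rightarrow> nat)" "u \<in> Lp q \<Omega>" "(\<lambda>n. powint q (\<lambda>x. w (\<tau> (\<sigma> n)) x - u x)) \<longlonglongrightarrow> 0"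
      by (rule rellich[OF q_gt_1 Wq \<tau>(2)])
    obtain h where h: "W0 q u h" "powint q h \<le> L - c / 2"
      by (rule powint_lower_semicontinuous[OF Wq \<tau>(2) \<sigma>(2,3)])
    \<comment> \<open>The \<open>q\<close>-energy and the full energy are compared along the same subsequence.\<close>
    have sm: "strict_mono (\<tau> \<circ> \<sigma>)" using \<tau>(1) \<sigma>(1) by (rule strict_mono_o)
    have e2: "(\<lambda>n. e (\<tau> (\<sigma> n))) \<longlonglongrightarrow> 0" using LIMSEQ_subseq_LIMSEQ[OF e(2) sm] by (simp add: o_def)
    have "powint q h < L - c / 4" using h(2) c by simp
    then have "eventually (\<lambda>n. ?E (\<tau> (\<sigma> n)) < L - c / 4) sequentially"
      by (rule energy_recovery[OF e(1) e2 w(1) unit_sphere_closed[OF w(1) \<sigma>(2,3)] \<sigma>(3) h(1) w(2)])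
    moreover have "(\<lambda>n. ?E (\<tau> (\<sigma> n))) \<longlonglongrightarrow> L" using LIMSEQ_subseq_LIMSEQ[OF lim sm] by (simp add: o_def)
    then have "eventually (\<lambda>n. L - c / 4 < ?E (\<tau> (\<sigma> n))) sequentially" by (rule order_tendstoD(1)) (use c in simp)
    ultimately have "eventually (\<lambda>n. False) sequentially" by eventually_elim simp
    then show False by simp
  qed
  moreover have "eventually (\<lambda>n. ?E n < L + c / 2) sequentially" by (rule order_tendstoD(2)[OF lim]) (use c in simp)
  ultimately have "eventually (\<lambda>n. norm (e n * powint p (weak_grad \<Omega> (w n)) - 0) < c) sequentially"
  proof eventually_elim
    case (elim n)
    have "0 \<le> e n * powint p (weak_grad \<Omega> (w n))" using e(1)[of n] by simp
    then show ?case using elim unfolding energy_def by simp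
  qed
  then show "\<exists>N. \<forall>n\<ge>N. norm (e n * powint p (weak_grad \<Omega> (w n)) - 0) < c" by (simp add: eventually_sequentially)
qed

end

section \<open>The Borsuk-Ulam theorem\<close>

definition antipode :: "(nat \<Rightarrow> real) \<Rightarrow> nat \<Rightarrow> real" where
  "antipode x = (\<lambda>i. - x i)"

lemma antipode_antipode: "antipode \<circ> antipode = id"
  by (auto simp: antipode_def)

definition punctured_space :: "nat \<Rightarrow> (nat \<Rightarrow> real) topology" where
  "punctured_space m = subtopology (Euclidean_space m) (- {\<lambda>_. 0})"

text \<open>The sum of the coefficients, expressed through the chain map to a point so that additivity is
  inherited.\<close>

definition augmentation :: "'a chain \<Rightarrow> int" where
  "augmentation c = Poly_Mapping.lookup (frag_extend (\<lambda>_. frag_of ()) c) ()"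

lemma augmentation_simps [simp]:
  "augmentation 0 = 0" "augmentation (a + b) = augmentation a + augmentation b"
  "augmentation (a - b) = augmentation a - augmentation b" "augmentation (frag_cmul k a) = k * augmentation a"
  "augmentation (frag_of f) = 1"
  by (simp_all add: augmentation_def frag_extend_add frag_extend_diff frag_extend_cmul lookup_add lookup_minus)

lemma augmentation_chain_map [simp]: "augmentation (chain_map n g c) = augmentation c"
  by (simp add: augmentation_def chain_map_def frag_extend_compose)

lemma augmentation_boundary: "augmentation (chain_boundary (Suc 0) c) = 0"
  using subset_UNIV
  by (induction c rule: frag_induction) (auto simp: chain_boundary_diff chain_boundary_of)

text \<open>Chains as they arise from the hemispheres of a sphere: \<open>c 0\<close> is a point, and \<open>c (i + 1)\<close> is a
  hemisphere bounded by the sphere that is the union of \<open>c i\<close> and its antipodal image. The signs make that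
  union a cycle. Such a tower is what an antipodal space of dimension less than its length cannot carry.\<close>

definition tower :: "nat \<Rightarrow> (nat \<Rightarrow> real) topology \<Rightarrow> (nat \<Rightarrow> (nat \<Rightarrow> real) chain) \<Rightarrow> bool" where
  "tower n X c \<longleftrightarrow> (\<forall>i\<le>n. singular_chain i X (c i)) \<and>
    (\<forall>i<n. chain_boundary (Suc i) (c (Suc i)) = c i + frag_cmul ((-1) ^ Suc i) (chain_map i antipode (c i))) \<and>
    odd (augmentation (c 0))"

lemma towerD:
  assumes "tower n X c"
  shows "i \<le> n \<Longrightarrow> singular_chain i X (c i)"
    "i < n \<Longrightarrow> chain_boundary (Suc i) (c (Suc i)) = c i + frag_cmul ((-1) ^ Suc i) (chain_map i antipode (c i))"
    "odd (augmentation (c 0))"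
  using assms by (auto simp: tower_def)

lemma chain_map_antipode_twice:
  assumes "singular_chain i X c" shows "chain_map i antipode (chain_map i antipode c) = c"
proof -
  have "chain_map i antipode (chain_map i antipode c) = chain_map i (antipode \<circ> antipode) c" by (simp add: chain_map_compose)
  also have "\<dots> = c" using chain_map_ident[OF assms] by (simp add: antipode_antipode)
  finally show ?thesis .
qed

lemma tower_image:
  assumes t: "tower n X c" and f: "continuous_map X Y f" and odd: "\<And>x. x \<in> topspace X \<Longrightarrow> f (antipode x) = antipode (f x)"
  shows "tower n Y (\<lambda>i. chain_map i f (c i))"
  unfolding tower_def
proof (intro conjI allI impI)
  fix i assume "i \<le> n" then show "singular_chain i Y (chain_map i f (c i))" by (rule singular_chain_chain_map[OF towerD(1)[OF t] f])
next
  fix i assume i: "i < n"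
  have "chain_map i f (chain_map i antipode (c i)) = chain_map i (f \<circ> antipode) (c i)" by (simp add: chain_map_compose)
  also have "\<dots> = chain_map i (antipode \<circ> f) (c i)"
    by (rule chain_map_eq[OF towerD(1)[OF t]]) (use i odd in auto)
  finally have 1: "chain_map i f (chain_map i antipode (c i)) = chain_map i antipode (chain_map i f (c i))" by (simp add: chain_map_compose)
  have "chain_boundary (Suc i) (chain_map (Suc i) f (c (Suc i))) = chain_map i f (chain_boundary (Suc i) (c (Suc i)))"
    using chain_boundary_chain_map[OF towerD(1)[OF t, of "Suc i"], of f] i by simp
  then show "chain_boundary (Suc i) (chain_map (Suc i) f (c (Suc i))) =
      chain_map i f (c i) + frag_cmul ((-1) ^ Suc i) (chain_map i antipode (chain_map i f (c i)))"
    by (simp only: towerD(2)[OF t i] chain_map_add chain_map_cmul 1)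
qed (use towerD(3)[OF t] in simp)

lemma iterated_subdivision_facts:
  assumes c: "singular_chain i X c"
  shows "singular_chain i X ((singular_subdivision i ^^ N) c)"
    "chain_boundary i ((singular_subdivision i ^^ N) c) = (singular_subdivision (i - 1) ^^ N) (chain_boundary i c)"
    "(singular_subdivision i ^^ N) (chain_map i g c) = chain_map i g ((singular_subdivision i ^^ N) c)"
proof -
  have 1: "singular_chain i X ((singular_subdivision i ^^ N) c)" for N
    by (induction N) (auto intro: singular_chain_singular_subdivision c)
  then show "singular_chain i X ((singular_subdivision i ^^ N) c)" .
  show "chain_boundary i ((singular_subdivision i ^^ N) c) = (singular_subdivision (i - 1) ^^ N) (chain_boundary i c)"
    by (induction N) (auto simp: chain_boundary_singular_subdivision[OF 1])
  show "(singular_subdivision i ^^ N) (chain_map i g c) = chain_map i g ((singular_subdivision i ^^ N) c)"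
    by (induction N) (auto simp: naturality_singular_subdivision[OF 1])
qed

lemma iterated_subdivision_add:
  "(singular_subdivision i ^^ N) (a + b) = (singular_subdivision i ^^ N) a + (singular_subdivision i ^^ N) b"
  "(singular_subdivision i ^^ N) (frag_cmul k a) = frag_cmul k ((singular_subdivision i ^^ N) a)"
proof -
  have "singular_subdivision i (frag_cmul k x) = frag_cmul k (singular_subdivision i x)" for x :: "'a chain"
    by (simp add: singular_subdivision_def frag_extend_cmul)
  then show "(singular_subdivision i ^^ N) (frag_cmul k a) = frag_cmul k ((singular_subdivision i ^^ N) a)"
    by (induction N) auto
  show "(singular_subdivision i ^^ N) (a + b) = (singular_subdivision i ^^ N) a + (singular_subdivision i ^^ N) b"
    by (induction N) (auto simp: singular_subdivision_add)
qed

text \<open>Finitely many chains can be subdivided a common number of times, and subdivision commutes with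
  boundaries and with the antipodal map. Points are not changed by subdivision.\<close>

lemma tower_subdivide:
  assumes t: "tower n X c" and C: "\<And>U. U \<in> \<C> \<Longrightarrow> openin X U" "topspace X \<subseteq> \<Union>\<C>"
  obtains b where "tower n X b" "\<And>i f. i \<le> n \<Longrightarrow> f \<in> Poly_Mapping.keys (b i) \<Longrightarrow> \<exists>V\<in>\<C>. f \<in> standard_simplex i \<rightarrow> V"
proof -
  have "\<exists>N. \<forall>m f. N \<le> m \<longrightarrow> f \<in> Poly_Mapping.keys ((singular_subdivision i ^^ m) (c i)) \<longrightarrow> (\<exists>V\<in>\<C>. f \<in> standard_simplex i \<rightarrow> V)"
    if i: "i \<le> n" for i
    by (rule sufficient_iterated_singular_subdivision_exists[OF C towerD(1)[OF t i]]) blast+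
  then obtain N where N: "\<And>i m f. i \<le> n \<Longrightarrow> N i \<le> m \<Longrightarrow> f \<in> Poly_Mapping.keys ((singular_subdivision i ^^ m) (c i)) \<Longrightarrow>
    \<exists>V\<in>\<C>. f \<in> standard_simplex i \<rightarrow> V" by metis
  define K where "K = Max (N ` {..n})"
  have K: "N i \<le> K" if "i \<le> n" for i unfolding K_def using that by (intro Max_ge) auto
  define b where "b i = (singular_subdivision i ^^ K) (c i)" for i
  have "tower n X b"
    unfolding tower_def
  proof (intro conjI allI impI)
    fix i assume "i \<le> n" then show "singular_chain i X (b i)" unfolding b_def by (intro iterated_subdivision_facts(1) towerD(1)[OF t])
  next
    fix i assume i: "i < n"
    have "chain_boundary (Suc i) (b (Suc i)) = (singular_subdivision i ^^ K) (chain_boundary (Suc i) (c (Suc i)))"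
      unfolding b_def using iterated_subdivision_facts(2)[OF towerD(1)[OF t, of "Suc i"]] i by simp
    then show "chain_boundary (Suc i) (b (Suc i)) = b i + frag_cmul ((-1) ^ Suc i) (chain_map i antipode (b i))"
      by (simp only: towerD(2)[OF t i] iterated_subdivision_add b_def iterated_subdivision_facts(3)[OF towerD(1)[OF t less_imp_le[OF i]]])
  next
    have "(singular_subdivision 0 ^^ j) (c 0) = c 0" for j
      by (induction j) (auto simp: singular_subdivision_zero[OF towerD(1)[OF t]])
    then show "odd (augmentation (b 0))" using towerD(3)[OF t] by (simp add: b_def)
  qed
  then show ?thesis by (rule that) (use N K in \<open>unfold b_def, blast\<close>)
qed

lemma punctured_space_topspace: "topspace (punctured_space m) = {x. (\<forall>i\<ge>m. x i = 0) \<and> x \<noteq> (\<lambda>_. 0)}"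
  by (auto simp: punctured_space_def topspace_Euclidean_space)

lemma punctured_space_projection: "continuous_map (punctured_space m) euclideanreal (\<lambda>x. x i)"
  unfolding punctured_space_def Euclidean_space_def subtopology_subtopology
  by (intro continuous_map_from_subtopology continuous_map_product_projection) auto

lemma continuous_map_into_punctured_space:
  "continuous_map X (punctured_space m) f \<longleftrightarrow>
    (\<forall>i. continuous_map X euclideanreal (\<lambda>x. f x i)) \<and> (\<forall>x\<in>topspace X. (\<forall>i\<ge>m. f x i = 0) \<and> f x \<noteq> (\<lambda>_. 0))"
  unfolding punctured_space_def Euclidean_space_def subtopology_subtopology
  by (auto simp: continuous_map_in_subtopology continuous_map_componentwise_UNIV Pi_iff)

lemma frag_sign: "((-1)::int) ^ i = 1 \<or> ((-1)::int) ^ i = -1"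
  by (induction i) auto

text \<open>Cover the punctured space by \<open>U\<close>, where the last coordinate is positive or another one is nonzero, and
  by its antipodal image \<open>V\<close>. After subdivision every chain is \<open>b i = u i + T (v i)\<close> with chains \<open>u i\<close>
  and \<open>v i\<close> in \<open>U\<close>. In the equation for the boundary of \<open>b (i + 1)\<close> the terms in \<open>U\<close> and the terms
  in \<open>V\<close> need not balance separately, but their defect \<open>d i\<close> lies in the intersection. There one of
  the first \<open>m\<close> coordinates is nonzero, hence forgetting the last coordinate is possible, and the images
  of the \<open>d i\<close> form a tower up to signs. Its length drops by one because \<open>d i\<close> involves \<open>u (i + 1)\<close>.
  The parity of the augmentation is preserved as \<open>u 0 - v 0\<close> and \<open>u 0 + v 0\<close> differ by an even
  chain.\<close>

lemma tower_reduce: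
  assumes t: "tower (Suc n) (punctured_space (Suc m)) c"
  obtains d where "tower n (punctured_space m) d"
proof -
  let ?X = "punctured_space (Suc m)"
  define U where "U = {x \<in> topspace ?X. 0 < x m \<or> (\<exists>i<m. x i \<noteq> 0)}"
  define V where "V = {x \<in> topspace ?X. x m < 0 \<or> (\<exists>i<m. x i \<noteq> 0)}"
  have pos: "openin ?X {x \<in> topspace ?X. x i \<in> S}" if "open S" for S i
    using openin_continuous_map_preimage[OF punctured_space_projection] that by auto
  have U_eq: "U = {x \<in> topspace ?X. x m \<in> {0<..}} \<union> (\<Union>i<m. {x \<in> topspace ?X. x i \<in> - {0}})"
    and V_eq: "V = {x \<in> topspace ?X. x m \<in> {..<0}} \<union> (\<Union>i<m. {x \<in> topspace ?X. x i \<in> - {0}})"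
    by (auto simp: U_def V_def)
  have W: "openin ?X (\<Union>i<m. {x \<in> topspace ?X. x i \<in> - {0}})"
  proof (rule openin_Union)
    fix S assume "S \<in> (\<lambda>i. {x \<in> topspace ?X. x i \<in> - {0}}) ` {..<m}"
    then obtain i where "S = {x \<in> topspace ?X. x i \<in> - {0}}" by blast
    then show "openin ?X S" by (simp only: pos[OF open_Compl[OF closed_singleton]])
  qed
  have op: "openin ?X U" "openin ?X V"
    unfolding U_eq V_eq by (rule openin_Un[OF pos[OF open_greaterThan] W], rule openin_Un[OF pos[OF open_lessThan] W])
  have cover: "topspace ?X \<subseteq> \<Union>{U, V}"
  proof
    fix x assume x: "x \<in> topspace ?X"
    then have h: "\<forall>i\<ge>Suc m. x i = 0" "x \<noteq> (\<lambda>_. 0)" by (simp_all add: punctured_space_topspace)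
    then obtain i where i: "x i \<noteq> 0" by auto
    then have "i < Suc m" using h(1) by (meson not_le)
    show "x \<in> \<Union>{U, V}"
      using x i \<open>i < Suc m\<close> by (cases "i = m") (auto simp: U_def V_def less_Suc_eq not_less)
  qed
  have anti: "continuous_map (subtopology ?X V) (subtopology ?X U) antipode" "continuous_map (subtopology ?X U) (subtopology ?X V) antipode"
  proof -
    have "continuous_map ?X ?X antipode"
      unfolding continuous_map_into_punctured_space antipode_def
      by (auto simp: punctured_space_topspace fun_eq_iff intro!: continuous_intros punctured_space_projection)
    then have "continuous_map (subtopology ?X W) ?X antipode" for W by (rule continuous_map_from_subtopology)
    moreover have "antipode x \<in> topspace ?X \<longleftrightarrow> x \<in> topspace ?X" for x
      by (auto simp: punctured_space_topspace antipode_def fun_eq_iff)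
    ultimately show "continuous_map (subtopology ?X V) (subtopology ?X U) antipode" "continuous_map (subtopology ?X U) (subtopology ?X V) antipode"
      by (auto simp: continuous_map_in_subtopology U_def V_def) (auto simp: antipode_def)
  qed
  obtain b where b: "tower (Suc n) ?X b" "\<And>i f. i \<le> Suc n \<Longrightarrow> f \<in> Poly_Mapping.keys (b i) \<Longrightarrow> \<exists>W\<in>{U, V}. f \<in> standard_simplex i \<rightarrow> W"
    by (rule tower_subdivide[OF t _ cover]) (use op in auto)
  have "\<exists>u x. singular_chain i (subtopology ?X U) u \<and> singular_chain i (subtopology ?X V) x \<and> b i = u + x" if i: "i \<le> Suc n" for i
  proof -
    have "Poly_Mapping.keys (b i) \<subseteq> singular_simplex_set i (subtopology ?X U) \<union> singular_simplex_set i (subtopology ?X V)"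
      using b(2)[OF i] towerD(1)[OF b(1) i] by (fastforce simp: singular_chain_def singular_simplex_subtopology)
    then obtain u x where "Poly_Mapping.keys u \<subseteq> singular_simplex_set i (subtopology ?X U)"
      "Poly_Mapping.keys x \<subseteq> singular_simplex_set i (subtopology ?X V)" "u + x = b i" by (rule frag_split)
    then show ?thesis unfolding singular_chain_def by metis
  qed
  then obtain u x where ux: "\<And>i. i \<le> Suc n \<Longrightarrow> singular_chain i (subtopology ?X U) (u i)"
    "\<And>i. i \<le> Suc n \<Longrightarrow> singular_chain i (subtopology ?X V) (x i)" "\<And>i. i \<le> Suc n \<Longrightarrow> b i = u i + x i" by metis
  let ?T = "\<lambda>i. chain_map i antipode" and ?s = "\<lambda>i. (-1) ^ Suc i :: int"
  define v where "v i = ?T i (x i)" for i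
  have v: "singular_chain i (subtopology ?X U) (v i)" "?T i (v i) = x i" "singular_chain i ?X (v i)" if "i \<le> Suc n" for i
    unfolding v_def using chain_map_antipode_twice ux(2)[OF that] singular_chain_chain_map[OF ux(2)[OF that] anti(1)]
    by (auto simp: singular_chain_subtopology)
  have uX: "singular_chain i ?X (u i)" if "i \<le> Suc n" for i using ux(1)[OF that] by (simp add: singular_chain_subtopology)
  define w where "w i = u i + frag_cmul (?s i) (v i)" for i
  define d where "d i = w i - chain_boundary (Suc i) (u (Suc i))" for i
  have wU: "singular_chain i (subtopology ?X U) (w i)" if "i \<le> Suc n" for i
    unfolding w_def using ux(1) v(1) that by (intro singular_chain_add singular_chain_cmul) auto
  \<comment> \<open>The second expression for \<open>d i\<close> shows that it is also a chain in \<open>V\<close>.\<close>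
  have d_alt: "d i = ?T i (chain_boundary (Suc i) (v (Suc i))) - frag_cmul (?s i) (?T i (w i))" if i: "i \<le> n" for i
  proof -
    have 1: "chain_boundary (Suc i) (b (Suc i)) = b i + frag_cmul (?s i) (?T i (b i))" by (rule towerD(2)[OF b(1)]) (use i in simp)
    have 2: "chain_boundary (Suc i) (b (Suc i)) = chain_boundary (Suc i) (u (Suc i)) + ?T i (chain_boundary (Suc i) (v (Suc i)))"
    proof -
      have "b (Suc i) = u (Suc i) + ?T (Suc i) (v (Suc i))" using ux(3)[of "Suc i"] v(2)[of "Suc i"] i by simp
      then show ?thesis using chain_boundary_chain_map[OF v(3)[of "Suc i"], of antipode] i by (simp add: chain_boundary_add)
    qed
    have 3: "b i = u i + ?T i (v i)" "?T i (b i) = ?T i (u i) + v i"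
      using ux(3)[of i] v(2)[of i] i chain_map_antipode_twice[OF v(3)[of i]] by (simp_all add: chain_map_add)
    have 4: "?T i (w i) = ?T i (u i) + frag_cmul (?s i) (?T i (v i))" by (simp add: w_def chain_map_add chain_map_cmul del: power_Suc)
    show ?thesis
      using 1 2 3 frag_sign[of "Suc i"] unfolding d_def 4 by (auto simp: w_def algebra_simps simp del: power_Suc)
  qed
  have dU: "singular_chain i (subtopology ?X U) (d i)" if "i \<le> n" for i
    unfolding d_def using wU[of i] singular_chain_boundary_alt[OF ux(1)[of "Suc i"]] that by (intro singular_chain_diff) auto
  have dV: "singular_chain i (subtopology ?X V) (d i)" if i: "i \<le> n" for i
    unfolding d_alt[OF i]
    using singular_chain_chain_map[OF wU anti(2), of i] singular_chain_chain_map[OF singular_chain_boundary_alt[OF v(1)[of "Suc i"]] anti(2)] i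
    by (intro singular_chain_diff singular_chain_cmul) auto
  let ?Z = "subtopology ?X (U \<inter> V)"
  have dZ: "singular_chain i ?Z (d i)" if "i \<le> n" for i
    using dU[OF that] dV[OF that] by (auto simp: singular_chain_subtopology)
  have bd: "chain_boundary (Suc i) (d (Suc i)) = - (d i + frag_cmul (?s i) (?T i (d i)))" if i: "i < n" for i
  proof -
    have "chain_boundary (Suc i) (chain_boundary (Suc (Suc i)) (u (Suc (Suc i)))) = 0"
      by (rule chain_boundary_boundary_alt[OF uX]) (use i in simp)
    then have 1: "chain_boundary (Suc i) (d (Suc i)) = chain_boundary (Suc i) (u (Suc i)) + frag_cmul (?s (Suc i)) (chain_boundary (Suc i) (v (Suc i)))"
      by (simp add: d_def w_def chain_boundary_diff chain_boundary_add chain_boundary_cmul del: power_Suc)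
    have 2: "chain_boundary (Suc i) (u (Suc i)) = w i - d i" by (simp add: d_def)
    have "?T i (d i) = ?T i (?T i (chain_boundary (Suc i) (v (Suc i)))) - frag_cmul (?s i) (?T i (?T i (w i)))"
      using d_alt[of i] i by (simp add: chain_map_diff chain_map_cmul del: power_Suc)
    also have "?T i (?T i (chain_boundary (Suc i) (v (Suc i)))) = chain_boundary (Suc i) (v (Suc i))"
      by (rule chain_map_antipode_twice[OF singular_chain_boundary_alt[OF v(3)]]) (use i in simp)
    also have "?T i (?T i (w i)) = w i" by (rule chain_map_antipode_twice[OF wU]) (use i in simp)
    finally have 3: "chain_boundary (Suc i) (v (Suc i)) = ?T i (d i) + frag_cmul (?s i) (w i)" by (simp add: algebra_simps del: power_Suc)
    have s: "?s (Suc i) = - ?s i" by simp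
    show ?thesis unfolding 1 2 3 s using frag_sign[of "Suc i"] by (auto simp: algebra_simps frag_cmul_distrib2 simp del: power_Suc)
  qed
  \<comment> \<open>Setting the last coordinate to zero does not lead to the origin on the intersection.\<close>
  define \<rho> where "\<rho> x = (\<lambda>i. if i < m then x i else 0)" for x :: "nat \<Rightarrow> real"
  have \<rho>: "continuous_map ?Z (punctured_space m) \<rho>"
    unfolding continuous_map_into_punctured_space
  proof (intro conjI allI ballI)
    fix i show "continuous_map ?Z euclideanreal (\<lambda>x. \<rho> x i)"
      unfolding \<rho>_def by (cases "i < m") (auto intro: continuous_map_from_subtopology punctured_space_projection)
  next
    fix x assume "x \<in> topspace ?Z"
    then obtain i where "i < m" "x i \<noteq> 0" by (auto simp: U_def V_def)
    then have "\<rho> x i \<noteq> 0" by (simp add: \<rho>_def)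
    then show "\<rho> x \<noteq> (\<lambda>_. 0)" by auto
  qed (simp add: \<rho>_def)
  have comm: "\<rho> \<circ> antipode = antipode \<circ> \<rho>" by (simp add: \<rho>_def antipode_def fun_eq_iff)
  have "tower n (punctured_space m) (\<lambda>i. frag_cmul ((-1) ^ i) (chain_map i \<rho> (d i)))"
    unfolding tower_def
  proof (intro conjI allI impI)
    fix i assume "i \<le> n" then show "singular_chain i (punctured_space m) (frag_cmul ((-1) ^ i) (chain_map i \<rho> (d i)))"
      by (intro singular_chain_cmul singular_chain_chain_map[OF dZ \<rho>])
  next
    fix i assume i: "i < n"
    have 1: "chain_map i \<rho> (?T i (d i)) = ?T i (chain_map i \<rho> (d i))"
      using comm chain_map_compose[of i \<rho> antipode] chain_map_compose[of i antipode \<rho>] by (metis comp_apply)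
    have 2: "chain_boundary (Suc i) (chain_map (Suc i) \<rho> (d (Suc i))) = chain_map i \<rho> (chain_boundary (Suc i) (d (Suc i)))"
      using chain_boundary_chain_map[OF dZ[of "Suc i"], of \<rho>] i by simp
    show "chain_boundary (Suc i) (frag_cmul ((-1) ^ Suc i) (chain_map (Suc i) \<rho> (d (Suc i)))) =
        frag_cmul ((-1) ^ i) (chain_map i \<rho> (d i)) + frag_cmul ((-1) ^ Suc i) (chain_map i antipode (frag_cmul ((-1) ^ i) (chain_map i \<rho> (d i))))"
      unfolding chain_boundary_cmul 2 bd[OF i] chain_map_minus chain_map_add chain_map_cmul 1
      using frag_sign[of i] by auto
  next
    have "augmentation (d 0) = augmentation (u 0) - augmentation (v 0)" by (simp add: d_def w_def augmentation_boundary)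
    moreover have "augmentation (b 0) = augmentation (u 0) + augmentation (v 0)" using ux(3)[of 0] v(2)[of 0] augmentation_chain_map[of 0 antipode "v 0"] by simp
    ultimately show "odd (augmentation (frag_cmul ((-1) ^ 0) (chain_map 0 \<rho> (d 0))))" using towerD(3)[OF b(1)] by simp
  qed
  then show ?thesis by (rule that)
qed

lemma no_tower: "m \<le> n \<Longrightarrow> \<not> tower n (punctured_space m) c"
proof (induction m arbitrary: n c)
  case 0
  have "topspace (punctured_space 0) = {}" by (auto simp: punctured_space_topspace)
  then show ?case using towerD(1,3)[of n "punctured_space 0" c] singular_chain_empty[of "punctured_space 0" 0 "c 0"] by auto
next
  case (Suc m)
  then obtain n' where n': "n = Suc n'" "m \<le> n'" by (cases n) auto
  show ?case
  proof
    assume "tower n (punctured_space (Suc m)) c"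
    then obtain d where "tower n' (punctured_space m) d" unfolding n' by (rule tower_reduce)
    then show False using Suc.IH[OF n'(2)] by blast
  qed
qed

text \<open>The union of a hemisphere and its antipodal image is a cycle in the equator of the next sphere, whose
  upper hemisphere is contractible. So the cycle bounds there once its image in a point does: this image
  vanishes in even dimensions by cancellation, and is a boundary in odd dimensions.\<close>

lemma tower_nsphere: "\<exists>c. tower n (nsphere n) c"
proof (induction n)
  case 0
  define a :: "nat \<Rightarrow> real" where "a = (\<lambda>n. if n = 0 then 1 else 0)"
  have "a \<in> topspace (nsphere 0)" unfolding a_def by (rule in_topspace_nsphere)
  then have "singular_simplex 0 (nsphere 0) (restrict (\<lambda>_. a) (standard_simplex 0))"
    by (auto simp: singular_simplex_def)
  then have "tower 0 (nsphere 0) (\<lambda>_. frag_of (restrict (\<lambda>_. a) (standard_simplex 0)))"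
    by (simp add: tower_def singular_chain_of)
  then show ?case by blast
next
  case (Suc n)
  then obtain c where c: "tower n (nsphere n) c" by blast
  let ?S = "nsphere (Suc n)" and ?H = "subtopology (nsphere (Suc n)) {x. 0 \<le> x (Suc n)}"
  let ?T = "chain_map n antipode" and ?s = "(-1) ^ Suc n :: int"
  have eq: "nsphere n = subtopology ?S {x. x (Suc n) = 0}" by (simp add: subtopology_nsphere_equator)
  have up: "singular_chain i ?S e" "singular_chain i ?H e" if "singular_chain i (nsphere n) e" for i e
  proof -
    have h: "singular_chain i (subtopology ?S {x. x (Suc n) = 0}) e" using that by (simp only: eq)
    show "singular_chain i ?H e" by (rule singular_chain_mono[OF h]) auto
    then show "singular_chain i ?S e" by (simp add: singular_chain_subtopology)
  qed
  have anti: "continuous_map (nsphere n) (nsphere n) antipode"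
    unfolding nsphere by (auto simp: continuous_map_in_subtopology continuous_map_componentwise_UNIV antipode_def Pi_iff
        intro!: continuous_intros continuous_map_from_subtopology continuous_map_product_projection)
  define z where "z = c n + frag_cmul ?s (?T (c n))"
  have zn: "singular_chain n (nsphere n) z"
    unfolding z_def using towerD(1)[OF c, of n] anti by (intro singular_chain_add singular_chain_cmul singular_chain_chain_map) auto
  have "chain_boundary n z = 0"
  proof (cases n)
    case 0 then show ?thesis by (simp add: chain_boundary_def)
  next
    case (Suc i)
    have b: "chain_boundary (Suc i) (c (Suc i)) = c i + frag_cmul ((-1) ^ Suc i) (chain_map i antipode (c i))"
      by (rule towerD(2)[OF c]) (simp add: Suc)
    have "chain_boundary (Suc i) (chain_map (Suc i) antipode (c (Suc i))) = chain_map i antipode (chain_boundary (Suc i) (c (Suc i)))"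
      using chain_boundary_chain_map[OF towerD(1)[OF c, of "Suc i"], of antipode] Suc by simp
    also have "\<dots> = chain_map i antipode (c i) + frag_cmul ((-1) ^ Suc i) (c i)"
      unfolding b using chain_map_antipode_twice[OF towerD(1)[OF c, of i]] Suc by (simp add: chain_map_add chain_map_cmul del: power_Suc)
    finally show ?thesis unfolding z_def Suc using b frag_sign[of i] by (auto simp: chain_boundary_add chain_boundary_cmul)
  qed
  then have cyc: "singular_relcycle n ?H {} z" using up(2)[OF zn] by (simp add: singular_cycle)
  have "contractible_space ?H" by (rule contractible_space_upper_hemisphere) simp
  then obtain a where a: "homotopic_with (\<lambda>x. True) ?H ?H id (\<lambda>x. a)" by (auto simp: contractible_space_def)
  have aH: "a \<in> topspace ?H"
  proof -
    have "(\<lambda>i. if i = 0 then 1 else 0) \<in> topspace ?H" using in_topspace_nsphere[of "Suc n"] by auto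
    then show ?thesis using homotopic_with_imp_continuous_maps[OF a] unfolding continuous_map_def by blast
  qed
  have "homologous_rel n ?H {} (chain_map n id z) (chain_map n (\<lambda>_. a) z)"
    by (rule homotopic_imp_homologous_rel_chain_maps[OF _ cyc]) (use a in simp)
  then have hom: "singular_relboundary n ?H {} (z - chain_map n (\<lambda>_. a) z)"
    using chain_map_ident[OF up(2)[OF zn]] by (simp add: homologous_rel_def)
  \<comment> \<open>For even \<open>n\<close> the sign in \<open>z\<close> is negative and the two images in the point cancel.\<close>
  have "singular_relboundary n ?H {} (chain_map n (\<lambda>_. a) z)"
  proof (cases "even n")
    case True
    have "(\<lambda>_. a) \<circ> antipode = (\<lambda>_. a)" by auto
    then have "chain_map n (\<lambda>_. a) (?T (c n)) = chain_map n (\<lambda>_. a) (c n)" using chain_map_compose[of n "\<lambda>_. a" antipode] by (metis comp_apply)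
    then have "chain_map n (\<lambda>_. a) z = 0" unfolding z_def using True by (simp add: chain_map_diff)
    then show ?thesis by simp
  next
    case False
    have top: "topspace (subtopology ?H {a}) = {a}" using aH by auto
    have "continuous_map ?H (subtopology ?H {a}) (\<lambda>_. a)" using aH by auto
    then have "singular_chain n (subtopology ?H {a}) (chain_map n (\<lambda>_. a) z)" by (rule singular_chain_chain_map[OF up(2)[OF zn]])
    then have "singular_relboundary n (subtopology ?H {a}) {} (chain_map n (\<lambda>_. a) z)"
      using singular_boundary_singleton[OF top] False by blast
    then show ?thesis unfolding singular_boundary by (auto simp: singular_chain_subtopology)
  qed
  from singular_relboundary_add[OF hom this] have "singular_relboundary n ?H {} z" by simp
  then obtain d where d: "singular_chain (Suc n) ?H d" "chain_boundary (Suc n) d = z" by (auto simp: singular_boundary)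
  have "tower (Suc n) ?S (c(Suc n := d))"
    unfolding tower_def using up(1) towerD[OF c] d
    by (auto simp: le_Suc_eq less_Suc_eq z_def singular_chain_subtopology)
  then show ?case by blast
qed

text \<open>An odd map would push the tower of the sphere into the punctured space, but there a tower of length at
  least \<open>m\<close> would reduce to one in the empty space, where the augmentation is zero.\<close>

theorem borsuk_ulam:
  assumes "continuous_map (nsphere n) (subtopology (Euclidean_space m) (- {\<lambda>_. 0})) f"
    and "\<And>x. x \<in> topspace (nsphere n) \<Longrightarrow> f (\<lambda>i. - x i) = (\<lambda>i. - f x i)"
  shows "n < m"
proof (rule ccontr)
  assume "\<not> n < m"
  obtain c where "tower n (nsphere n) c" using tower_nsphere by blast
  then have "tower n (punctured_space m) (\<lambda>i. chain_map i f (c i))"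
    by (rule tower_image) (use assms in \<open>auto simp: punctured_space_def antipode_def\<close>)
  then show False using no_tower \<open>\<not> n < m\<close> by (meson not_le)
qed

section \<open>Finiteness of the minimax values\<close>

text \<open>Cubes of half side \<open>\<delta>\<close>, at distance \<open>3 \<delta>\<close> along one coordinate direction inside a ball.\<close>

lemma disjoint_cboxes:
  fixes \<Omega> :: "'a::euclidean_space set"
  assumes "open \<Omega>" "\<Omega> \<noteq> {}"
  obtains a b :: "nat \<Rightarrow> 'a" where "\<And>j. j \<le> n \<Longrightarrow> cbox (a j) (b j) \<subseteq> \<Omega>" "\<And>j. box (a j) (b j) \<noteq> {}"
    "\<And>i j. i \<noteq> j \<Longrightarrow> cbox (a i) (b i) \<inter> cbox (a j) (b j) = {}"
proof -
  obtain z r where r: "0 < r" "ball z r \<subseteq> \<Omega>" using assms openE by blast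
  obtain e :: 'a where e: "e \<in> Basis" using nonempty_Basis by blast
  define \<delta> where "\<delta> = r / (3 * real n + real DIM('a) + 1)"
  have D: "0 < 3 * real n + real DIM('a) + 1" by simp
  have \<delta>: "0 < \<delta>" using r(1) D by (simp add: \<delta>_def)
  have \<delta>r: "\<delta> * (3 * real n + real DIM('a) + 1) = r" using D by (simp add: \<delta>_def)
  define x where "x j = z + (3 * \<delta> * real j) *\<^sub>R e" for j :: nat
  have box: "\<bar>(y - x j) \<bullet> i\<bar> \<le> \<delta>" if "y \<in> cbox (x j - \<delta> *\<^sub>R One) (x j + \<delta> *\<^sub>R One)" "i \<in> Basis" for y j and i :: 'a
  proof -
    have "(x j - \<delta> *\<^sub>R One) \<bullet> i \<le> y \<bullet> i" "y \<bullet> i \<le> (x j + \<delta> *\<^sub>R One) \<bullet> i" using that unfolding mem_box by blast+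
    then show ?thesis using that(2) by (simp add: inner_diff_left inner_add_left abs_le_iff)
  qed
  show ?thesis
  proof (rule that[of "\<lambda>j. x j - \<delta> *\<^sub>R One" "\<lambda>j. x j + \<delta> *\<^sub>R One"])
    fix j assume j: "j \<le> n"
    show "cbox (x j - \<delta> *\<^sub>R One) (x j + \<delta> *\<^sub>R One) \<subseteq> \<Omega>"
    proof
      fix y assume y: "y \<in> cbox (x j - \<delta> *\<^sub>R One) (x j + \<delta> *\<^sub>R One)"
      have "norm (y - x j) \<le> (\<Sum>i\<in>Basis. \<bar>(y - x j) \<bullet> i\<bar>)" by (rule norm_le_l1)
      also have "\<dots> \<le> (\<Sum>i\<in>(Basis::'a set). \<delta>)" by (rule sum_mono) (rule box[OF y])
      finally have 1: "norm (y - x j) \<le> \<delta> * real DIM('a)" by (simp add: mult.commute)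
      have 2: "norm (x j - z) = \<delta> * (3 * real j)" using \<delta> e by (simp add: x_def)
      have "norm (y - z) \<le> norm (y - x j) + norm (x j - z)" using norm_triangle_ineq[of "y - x j" "x j - z"] by simp
      also have "\<dots> \<le> \<delta> * real DIM('a) + \<delta> * (3 * real j)" using 1 2 by simp
      also have "\<dots> \<le> \<delta> * real DIM('a) + \<delta> * (3 * real n)" using j \<delta> by simp
      also have "\<dots> < \<delta> * (3 * real n + real DIM('a) + 1)" using \<delta> by (simp add: algebra_simps)
      finally show "y \<in> \<Omega>" using r(2) \<delta>r by (auto simp: dist_norm norm_minus_commute)
    qed
  next
    fix j show "box (x j - \<delta> *\<^sub>R One) (x j + \<delta> *\<^sub>R One) \<noteq> {}"
      using \<delta> by (auto simp: box_ne_empty inner_diff_left inner_add_left)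
  next
    fix i j :: nat assume ij: "i \<noteq> j"
    have "False" if y: "y \<in> cbox (x i - \<delta> *\<^sub>R One) (x i + \<delta> *\<^sub>R One)" "y \<in> cbox (x j - \<delta> *\<^sub>R One) (x j + \<delta> *\<^sub>R One)" for y
    proof -
      have xe: "x k \<bullet> e = z \<bullet> e + 3 * \<delta> * real k" for k using e by (simp add: x_def inner_add_left)
      have "\<bar>y \<bullet> e - x i \<bullet> e\<bar> \<le> \<delta>" "\<bar>y \<bullet> e - x j \<bullet> e\<bar> \<le> \<delta>" using box[OF y(1) e] box[OF y(2) e] by (simp_all add: inner_diff_left)
      then have "\<bar>x i \<bullet> e - x j \<bullet> e\<bar> \<le> 2 * \<delta>" by linarith
      moreover have "x i \<bullet> e - x j \<bullet> e = 3 * \<delta> * (real i - real j)" unfolding xe by (simp add: algebra_simps)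
      moreover have "1 \<le> \<bar>real i - real j\<bar>" using ij by linarith
      then have "3 * \<delta> * 1 \<le> 3 * \<delta> * \<bar>real i - real j\<bar>" using \<delta> by (intro mult_left_mono) auto
      ultimately show False using \<delta> by (simp add: abs_mult)
    qed
    then show "cbox (x i - \<delta> *\<^sub>R One) (x i + \<delta> *\<^sub>R One) \<inter> cbox (x j - \<delta> *\<^sub>R One) (x j + \<delta> *\<^sub>R One) = {}" by blast
  qed
qed

lemma norm_disjoint_sum_powr:
  fixes F :: "'i \<Rightarrow> 'b::real_normed_vector"
  assumes J: "finite J" and dis: "\<And>i j. i \<in> J \<Longrightarrow> j \<in> J \<Longrightarrow> i \<noteq> j \<Longrightarrow> F i = 0 \<or> F j = 0" and s: "0 < s"
  shows "norm (\<Sum>j\<in>J. a j *\<^sub>R F j) powr s = (\<Sum>j\<in>J. \<bar>a j\<bar> powr s * norm (F j) powr s)"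
proof (cases "\<exists>i\<in>J. F i \<noteq> 0")
  case True
  then obtain i where i: "i \<in> J" "F i \<noteq> 0" by blast
  then have 0: "F j = 0" if "j \<in> J - {i}" for j using dis[of i j] that by auto
  have "(\<Sum>j\<in>J. a j *\<^sub>R F j) = a i *\<^sub>R F i" "(\<Sum>j\<in>J. \<bar>a j\<bar> powr s * norm (F j) powr s) = \<bar>a i\<bar> powr s * norm (F i) powr s"
    using 0 by (simp_all add: sum.remove[OF J i(1)])
  then show ?thesis by (simp add: powr_mult)
qed (auto)

context bounded_domain
begin

lemma powint_disjoint_sum:
  fixes F :: "'i \<Rightarrow> 'a \<Rightarrow> 'b::euclidean_space"
  assumes J: "finite J" and dis: "\<And>i j x. i \<in> J \<Longrightarrow> j \<in> J \<Longrightarrow> i \<noteq> j \<Longrightarrow> F i x = 0 \<or> F j x = 0"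
    and L: "\<And>j. j \<in> J \<Longrightarrow> F j \<in> Lp s \<Omega>" and s: "0 < s"
  shows "powint s (\<lambda>x. \<Sum>j\<in>J. a j *\<^sub>R F j x) = (\<Sum>j\<in>J. \<bar>a j\<bar> powr s * powint s (F j))"
  unfolding powint_def using LpD(2)[OF L] norm_disjoint_sum_powr[OF J dis s] by simp

lemma W0_sum:
  assumes "finite J" "\<And>j. j \<in> J \<Longrightarrow> W0 s (u j) (g j)" "0 < s"
  shows "W0 s (\<lambda>x. \<Sum>j\<in>J. c j * u j x) (\<lambda>x. \<Sum>j\<in>J. c j *\<^sub>R g j x)"
  using assms
proof (induction J rule: finite_induct)
  case empty
  have "test_functions \<Omega> \<noteq> {} \<Longrightarrow> W0 s (\<lambda>x. 0) (\<lambda>x. 0)"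
  proof -
    assume "test_functions \<Omega> \<noteq> {}"
    then obtain f where "f \<in> test_functions \<Omega>" by blast
    from W0_scale[OF W0_test[OF this \<open>0 < s\<close>] \<open>0 < s\<close>, of 0] show "W0 s (\<lambda>x. 0) (\<lambda>x. 0)" by simp
  qed
  moreover have "(\<lambda>x. 0) \<in> test_functions \<Omega>" using smooth_on_const by (simp add: test_functions_def)
  ultimately show ?case by auto
next
  case (insert j J)
  then show ?case by (simp add: W0_add W0_scale)
qed

lemma disjoint_test_functions:
  assumes ne: "\<Omega> \<noteq> {}" and s: "0 < s"
  obtains f where "\<And>j::nat. j \<le> n \<Longrightarrow> f j \<in> test_functions \<Omega>" "\<And>j. j \<le> n \<Longrightarrow> powint s (f j) = 1"
    "\<And>i j x. i \<noteq> j \<Longrightarrow> f i x = 0 \<or> f j x = 0" "\<And>i j x. i \<noteq> j \<Longrightarrow> gradient (f i) x = 0 \<or> gradient (f j) x = 0"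
proof -
  obtain a b :: "nat \<Rightarrow> 'a" where ab: "\<And>j. j \<le> n \<Longrightarrow> cbox (a j) (b j) \<subseteq> \<Omega>" "\<And>j. box (a j) (b j) \<noteq> {}"
    "\<And>i j. i \<noteq> j \<Longrightarrow> cbox (a i) (b i) \<inter> cbox (a j) (b j) = {}"
    by (rule disjoint_cboxes[OF open_dom ne, of n]) blast
  define h where "h j = (bump 1 (a j) (b j) :: 'a \<Rightarrow> real)" for j
  \<comment> \<open>Normalised such that the \<open>s\<close>-th power integral is \<open>1\<close>.\<close>
  define f where "f j = (\<lambda>x. powint s (h j) powr (-1/s) * h j x)" for j
  have hT: "h j \<in> test_functions \<Omega>" if "j \<le> n" for j unfolding h_def by (rule bump_test_function[OF _ ab(1)[OF that]]) simp
  have pos: "0 < powint s (h j)" if j: "j \<le> n" for j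
  proof (rule ccontr)
    assume "\<not> 0 < powint s (h j)"
    then have "powint s (h j) = 0" using powint_nonneg[of s "h j"] by linarith
    then have "AE x in M. h j x = 0" by (rule powint_eq_0D[OF test_function_Lp(1)[OF hT[OF j] s]])
    then have "AE x in lebesgue. x \<in> \<Omega> \<longrightarrow> h j x = 0" using open_dom by (simp add: AE_restrict_space_iff borel_open)
    then have "AE x in lborel. x \<in> \<Omega> \<longrightarrow> h j x = 0" by (simp add: AE_completion_iff)
    then have "AE x in lborel. x \<notin> box (a j) (b j)"
      by eventually_elim (use bump_nonzero_iff[of 1 "a j" "b j"] ab(1)[OF j] box_subset_cbox[of "a j" "b j"] in \<open>auto simp: h_def\<close>)
    then have "emeasure lborel (box (a j) (b j)) = 0" by (subst (asm) AE_iff_measurable[of "box (a j) (b j)"]) auto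
    moreover have lt: "\<forall>i\<in>Basis. a j \<bullet> i < b j \<bullet> i" using ab(2)[of j] by (simp add: box_ne_empty)
    then have "0 < (\<Prod>i\<in>Basis. (b j - a j) \<bullet> i)" by (intro prod_pos) (auto simp: inner_diff_left)
    moreover have "\<And>i. i \<in> Basis \<Longrightarrow> a j \<bullet> i \<le> b j \<bullet> i" using lt by (auto intro: less_imp_le)
    ultimately show False by (simp add: emeasure_lborel_box ennreal_eq_0_iff)
  qed
  have sup: "f j x = 0 \<and> gradient (f j) x = 0" if "x \<notin> cbox (a j) (b j)" for j x
  proof -
    have "closure {x. f j x \<noteq> 0} \<subseteq> cbox (a j) (b j)"
      using bump_nonzero_iff[of 1 "a j" "b j"] box_subset_cbox[of "a j" "b j"]
      by (intro closure_minimal) (auto simp: f_def h_def)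
    then show ?thesis using test_functions_outside_support[of x "f j"] that by blast
  qed
  show ?thesis
  proof (rule that[of f])
    fix j assume j: "j \<le> n"
    show "f j \<in> test_functions \<Omega>" unfolding f_def by (rule test_functions_cmult[OF hT[OF j]])
    have "(-1/s) * s = -1" using s by simp
    then have "(powint s (h j) powr (-1/s)) powr s = powint s (h j) powr (-1)" by (simp only: powr_powr)
    then show "powint s (f j) = 1" unfolding f_def powint_mult using pos[OF j] by (simp add: powr_minus)
  next
    fix i j :: nat and x :: 'a assume "i \<noteq> j"
    then have "x \<notin> cbox (a i) (b i) \<or> x \<notin> cbox (a j) (b j)" using ab(3)[of i j] by blast
    then show "f i x = 0 \<or> f j x = 0" "gradient (f i) x = 0 \<or> gradient (f j) x = 0" using sup by blast+
  qed
qed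

end

context two_exponents
begin

text \<open>Since \<open>gdist\<close> only satisfies a triangle inequality with a constant, continuity is tested with
  neighbourhoods of image points.\<close>

lemma continuous_map_into_W10:
  assumes w: "\<And>x. x \<in> topspace X \<Longrightarrow> w x \<in> W10 q \<Omega>"
    and c: "\<And>x. x \<in> topspace X \<Longrightarrow> continuous_map X euclideanreal (\<lambda>y. gdist (w x) (w y))"
  shows "continuous_map X (W10_topology q \<Omega>) w"
  unfolding continuous_map_def
proof (intro conjI allI impI)
  show "w \<in> topspace X \<rightarrow> topspace (W10_topology q \<Omega>)" using w by auto
  fix U assume U: "openin (W10_topology q \<Omega>) U"
  show "openin X {x \<in> topspace X. w x \<in> U}"
  proof (subst openin_subopen, intro ballI)
    fix x assume x: "x \<in> {x \<in> topspace X. w x \<in> U}"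
    then obtain e where e: "0 < e" "\<And>v. v \<in> W10 q \<Omega> \<Longrightarrow> gdist (w x) v < e \<Longrightarrow> v \<in> U" using U unfolding openin_W10_iff by blast
    have "openin X {y \<in> topspace X. gdist (w x) (w y) \<in> {..<e}}"
      using c x by (intro openin_continuous_map_preimage) auto
    then show "\<exists>T. openin X T \<and> x \<in> T \<and> T \<subseteq> {x \<in> topspace X. w x \<in> U}"
      using e w x by (intro exI[of _ "{y \<in> topspace X. gdist (w x) (w y) \<in> {..<e}}"]) auto
  qed
qed

lemma nsphere_topspace: "topspace (nsphere n) = {x. (\<Sum>i\<le>n. x i ^ 2) = (1::real) \<and> (\<forall>i>n. x i = 0)}"
  by (simp add: nsphere)

lemma nsphere_seq_compact:
  assumes x: "\<And>k::nat. x k \<in> topspace (nsphere n)"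
  obtains \<sigma> :: "nat \<Rightarrow> nat" and y where "strict_mono \<sigma>" "y \<in> topspace (nsphere n)" "\<And>i. (\<lambda>k. x (\<sigma> k) i) \<longlonglongrightarrow> y i"
proof -
  have "norm (x k i) \<le> 1" for k i
  proof (cases "i \<le> n")
    case True
    have "(x k i)^2 \<le> (\<Sum>i\<le>n. (x k i)^2)" by (rule member_le_sum) (use True in auto)
    then have "(x k i)^2 \<le> 1" using x[of k] by (simp add: nsphere_topspace)
    then show ?thesis by (simp add: abs_square_le_1)
  qed (use x[of k] in \<open>simp add: nsphere_topspace\<close>)
  then obtain \<sigma> where \<sigma>: "strict_mono (\<sigma> :: nat \<Rightarrow> nat)" "\<And>i. i \<in> UNIV \<Longrightarrow> \<exists>l. (\<lambda>k. x (\<sigma> k) i) \<longlonglongrightarrow> l"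
    by (rule function_convergent_subsequence[of UNIV x 1, rotated 1]) auto
  then obtain y where y: "\<And>i. (\<lambda>k. x (\<sigma> k) i) \<longlonglongrightarrow> y i" by (metis UNIV_I)
  have "(\<lambda>k. \<Sum>i\<le>n. (x (\<sigma> k) i)^2) \<longlonglongrightarrow> (\<Sum>i\<le>n. (y i)^2)" by (intro tendsto_intros y)
  then have 1: "(\<Sum>i\<le>n. (y i)^2) = 1" using x by (simp add: nsphere_topspace LIMSEQ_const_iff)
  have "y i = 0" if "n < i" for i using y[of i] x that by (simp add: nsphere_topspace LIMSEQ_const_iff)
  with 1 show ?thesis using that[OF \<sigma>(1) _ y] by (simp add: nsphere_topspace)
qed

text \<open>For functions \<open>f j\<close> with disjoint supports, the combination with coefficients of absolute value
  \<open>|x j|^(2/q)\<close> has \<open>q\<close>-th power integral \<open>\<Sum> x j^2\<close>. This maps the sphere of dimension \<open>n\<close> oddly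
  and continuously onto a compact set of normalised functions, up to null sets, and a map that is tested
  for the genus yields by composition a map on the sphere.\<close>

lemma Sigma_k_bounded_member:
  assumes ne: "\<Omega> \<noteq> {}"
  obtains A R where "A \<in> Sigma_k q \<Omega> (Suc n)" "\<And>u. u \<in> A \<Longrightarrow> powint q (weak_grad \<Omega> u) \<le> R"
proof -
  obtain f where f: "\<And>j::nat. j \<le> n \<Longrightarrow> f j \<in> test_functions \<Omega>" "\<And>j. j \<le> n \<Longrightarrow> powint q (f j) = 1"
    "\<And>i j x. i \<noteq> j \<Longrightarrow> f i x = 0 \<or> f j x = 0" "\<And>i j x. i \<noteq> j \<Longrightarrow> gradient (f i) x = 0 \<or> gradient (f j) x = 0"
    by (rule disjoint_test_functions[OF ne exponents(1), of n]) blast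
  let ?S = "topspace (nsphere n)"
  \<comment> \<open>An odd continuous function with \<open>\<bar>c t\<bar> powr q = t^2\<close>.\<close>
  define c where "c = spow (2 / q + 1)"
  have c_cont: "continuous_on UNIV c" unfolding c_def by (rule continuous_on_spow) (use exponents(1) in simp)
  have c_powr: "\<bar>c t\<bar> powr q = t^2" for t
  proof -
    have "\<bar>c t\<bar> powr q = \<bar>t\<bar> powr (2 / q * q)" by (simp add: c_def abs_spow powr_powr)
    also have "\<dots> = \<bar>t\<bar> powr 2" using exponents(1) by simp
    finally show ?thesis by simp
  qed
  define w where "w x = (\<lambda>y. \<Sum>j\<le>n. c (x j) * f j y)" for x :: "nat \<Rightarrow> real"
  define g where "g x = (\<lambda>y. \<Sum>j\<le>n. c (x j) *\<^sub>R gradient (f j) y)" for x :: "nat \<Rightarrow> real"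
  have W: "W0 q (w x) (g x)" for x
    unfolding w_def g_def by (rule W0_sum) (use f(1) exponents(1) in \<open>auto intro: W0_test\<close>)
  have Lf: "f j \<in> Lp q \<Omega>" "gradient (f j) \<in> Lp q \<Omega>" if "j \<le> n" for j
    using test_function_Lp(1,2)[OF f(1)[OF that] exponents(1)] .
  have pw: "powint q (w x) = (\<Sum>j\<le>n. (x j)^2)" for x
    using powint_disjoint_sum[of "{..n}" f q "\<lambda>j. c (x j)"] f(2,3) Lf(1) exponents(1) by (simp add: w_def c_powr)
  have pg: "powint q (\<lambda>y. \<Sum>j\<le>n. a j *\<^sub>R gradient (f j) y) = (\<Sum>j\<le>n. \<bar>a j\<bar> powr q * powint q (gradient (f j)))" for a
    using f(4) Lf(2) exponents(1) by (intro powint_disjoint_sum) auto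
  have gd: "gdist (w x) (w y) = (\<Sum>j\<le>n. \<bar>c (y j) - c (x j)\<bar> powr q * powint q (gradient (f j)))" for x y
  proof -
    have "(\<lambda>z. g y z - g x z) = (\<lambda>z. \<Sum>j\<le>n. (c (y j) - c (x j)) *\<^sub>R gradient (f j) z)"
      by (simp add: g_def sum_subtractf scaleR_left_diff_distrib)
    then show ?thesis using gdist_W0[OF W W, of x y] pg[of "\<lambda>j. c (y j) - c (x j)"] by simp
  qed
  define A where "A = {u \<in> W10 q \<Omega>. \<exists>x\<in>?S. AE y in M. w x y = u y}"
  have AW: "A \<subseteq> W10 q \<Omega>" by (auto simp: A_def)
  have wA: "w x \<in> A" if "x \<in> ?S" for x unfolding A_def using W0_W10_q[OF W] that by auto
  have A_same: "\<exists>x\<in>?S. W0 q u (g x) \<and> powint q u = powint q (w x)" if u: "u \<in> A" for u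
  proof -
    obtain x where x: "x \<in> ?S" "AE y in M. w x y = u y" using u by (auto simp: A_def)
    have Wu: "W0 q u (g x)" by (rule W0_cong_AE[OF W x(2) _ exponents(1)]) simp
    have "powint q u = powint q (w x)"
      by (rule powint_cong_AE[symmetric, OF LpD(1)[OF W0_Lp(1)[OF W]] LpD(1)[OF W0_Lp(1)[OF Wu]] x(2)])
    with x Wu show ?thesis by blast
  qed
  have w_minus: "w (\<lambda>i. - x i) = (\<lambda>y. - w x y)" for x by (simp add: w_def c_def sum_negf)
  have S_minus: "(\<lambda>i. - x i) \<in> ?S" if "x \<in> ?S" for x using that by (simp add: nsphere_topspace)
  have cm: "continuous_map (nsphere n) (subtopology (W10_topology q \<Omega>) A) w"
    unfolding continuous_map_in_subtopology
  proof
    show "continuous_map (nsphere n) (W10_topology q \<Omega>) w"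
    proof (rule continuous_map_into_W10)
      fix x assume "x \<in> ?S"
      then show "w x \<in> W10 q \<Omega>" by (rule subsetD[OF AW wA])
      have "continuous_on UNIV (\<lambda>t. \<bar>c t - c (x j)\<bar> powr q)" for j
        using exponents(1) by (intro continuous_on_powr' continuous_intros c_cont) auto
      then have 1: "continuous_map euclideanreal euclideanreal (\<lambda>t. \<bar>c t - c (x j)\<bar> powr q)" for j by simp
      have "continuous_map (nsphere n) euclideanreal (\<lambda>y. \<bar>c (y j) - c (x j)\<bar> powr q)" for j
        using continuous_map_compose[OF continuous_map_nsphere_projection[of n j] 1] by (simp add: o_def)
      then show "continuous_map (nsphere n) euclideanreal (\<lambda>y. gdist (w x) (w y))"
        unfolding gd by (intro continuous_intros) auto
    qed
  qed (use wA in auto)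
  have "A \<in> Sigma_k q \<Omega> (Suc n)"
  proof (rule Sigma_kI[OF AW])
    show "A \<subseteq> unit_sphere"
    proof
      fix u assume "u \<in> A"
      then obtain x where "x \<in> ?S" "W0 q u (g x)" "powint q u = powint q (w x)" using A_same by blast
      then show "u \<in> unit_sphere" unfolding unit_sphere_def pw using W0_Lp(1) by (auto simp: nsphere_topspace)
    qed
    fix u assume u: "u \<in> A"
    then obtain x where x: "x \<in> ?S" "AE y in M. w x y = u y" by (auto simp: A_def)
    then have "AE y in M. w (\<lambda>i. - x i) y = - u y" unfolding w_minus by simp
    moreover have "(\<lambda>y. - u y) \<in> W10 q \<Omega>" by (rule W0_W10_q[OF W0_minus[OF W10_q exponents(1)]]) (use u AW in auto)
    ultimately show "(\<lambda>y. - u y) \<in> A" unfolding A_def using S_minus[OF x(1)] by blast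
    fix v assume v: "v \<in> W10 q \<Omega>" and uv: "AE y in M. u y = v y"
    have "AE y in M. w x y = v y" using x(2) uv by eventually_elim simp
    then show "v \<in> A" using v x(1) by (auto simp: A_def)
  next
    fix v assume v: "\<And>k::nat. v k \<in> A"
    then have "\<forall>k. \<exists>x\<in>?S. W0 q (v k) (g x)" using A_same by blast
    then obtain x where x: "\<And>k. x k \<in> ?S" "\<And>k. W0 q (v k) (g (x k))" by metis
    obtain \<sigma> :: "nat \<Rightarrow> nat" and y where \<sigma>: "strict_mono \<sigma>" "y \<in> ?S" "\<And>i. (\<lambda>k. x (\<sigma> k) i) \<longlonglongrightarrow> y i"
      by (rule nsphere_seq_compact[of x, OF x(1)]) (rule that)
    have "gdist (w y) (v k) = gdist (w y) (w (x k))" for k unfolding gdist_W0[OF W x(2)] gdist_W0[OF W W] ..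
    moreover have "(\<lambda>k. c (x (\<sigma> k) j)) \<longlonglongrightarrow> c (y j)" for j
      using c_cont \<sigma>(3)[of j] by (auto simp: continuous_on_eq_continuous_at intro: isCont_tendsto_compose)
    then have "(\<lambda>k. gdist (w y) (w (x (\<sigma> k)))) \<longlonglongrightarrow> (\<Sum>j\<le>n. \<bar>c (y j) - c (y j)\<bar> powr q * powint q (gradient (f j)))"
      unfolding gd using exponents(1) by (intro tendsto_intros tendsto_powr') auto
    ultimately have "(\<lambda>k. gdist (w y) (v (\<sigma> k))) \<longlonglongrightarrow> 0" by simp
    then show "\<exists>(\<sigma>::nat \<Rightarrow> nat) w. strict_mono \<sigma> \<and> w \<in> A \<and> (\<lambda>k. gdist w (v (\<sigma> k))) \<longlonglongrightarrow> 0"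
      using \<sigma>(1) wA[OF \<sigma>(2)] by blast
  next
    show "enat (Suc n) \<le> genus (W10_topology q \<Omega>) A"
      unfolding le_genus_iff
    proof (intro allI impI, elim conjE)
      fix m \<phi> assume \<phi>: "continuous_map (subtopology (W10_topology q \<Omega>) A) (subtopology (Euclidean_space m) (- {\<lambda>_. 0})) \<phi>"
        and odd: "\<forall>u\<in>A. \<phi> (- u) = - \<phi> u"
      have "continuous_map (nsphere n) (subtopology (Euclidean_space m) (- {\<lambda>_. 0})) (\<phi> \<circ> w)"
        by (rule continuous_map_compose[OF cm \<phi>])
      moreover have "(\<phi> \<circ> w) (\<lambda>i. - x i) = (\<lambda>i. - (\<phi> \<circ> w) x i)" if "x \<in> ?S" for x
        using odd wA[OF that] by (simp add: w_minus fun_Compl_def)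
      ultimately have "n < m" by (rule borsuk_ulam)
      then show "Suc n \<le> m" by simp
    qed
  qed
  moreover have "powint q (weak_grad \<Omega> u) \<le> (\<Sum>j\<le>n. powint q (gradient (f j)))" if u: "u \<in> A" for u
  proof -
    obtain x where x: "x \<in> ?S" "W0 q u (g x)" using A_same[OF u] by blast
    have "powint q (weak_grad \<Omega> u) = (\<Sum>j\<le>n. (x j)^2 * powint q (gradient (f j)))"
      using weak_grad_W0(3)[OF x(2) exponents(2)] pg[of "\<lambda>j. c (x j)"] by (simp add: g_def c_powr)
    also have "\<dots> \<le> (\<Sum>j\<le>n. 1 * powint q (gradient (f j)))"
    proof (intro sum_mono mult_right_mono)
      fix j assume "j \<in> {..n}"
      then have "(x j)^2 \<le> (\<Sum>i\<le>n. (x i)^2)" by (intro member_le_sum) auto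
      then show "(x j)^2 \<le> 1" using x(1) by (simp add: nsphere_topspace)
    qed simp
    finally show ?thesis by simp
  qed
  ultimately show ?thesis by (rule that)
qed

lemma Sigma_k_nonempty: assumes "A \<in> Sigma_k q \<Omega> k" "0 < k" shows "A \<noteq> {}"
proof
  assume "A = {}"
  then have "enat k \<le> genus (W10_topology q \<Omega>) {}" using assms by (simp add: Sigma_k_def)
  then have "k \<le> 0" unfolding le_genus_iff by (rule allE[where x=0]) (auto simp: continuous_map_def)
  then show False using assms(2) by simp
qed

lemma dirichlet_eigenvalue_finite:
  assumes ne: "\<Omega> \<noteq> {}" and k: "0 < k"
  obtains L where "dirichlet_eigenvalue q \<Omega> k = ereal L" "minimax_level k L"
proof -
  let ?P = "\<lambda>u. ereal (powint q (weak_grad \<Omega> u))"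
  let ?D = "dirichlet_eigenvalue q \<Omega> k"
  have D: "?D = (INF A\<in>Sigma_k q \<Omega> k. SUP u\<in>A. ?P u)" by (simp add: dirichlet_eigenvalue_def powint_def)
  obtain n where n: "k = Suc n" using k by (cases k) auto
  obtain A R where A: "A \<in> Sigma_k q \<Omega> k" "\<And>u. u \<in> A \<Longrightarrow> powint q (weak_grad \<Omega> u) \<le> R"
    unfolding n by (rule Sigma_k_bounded_member[OF ne]) blast
  have "?D \<le> (SUP u\<in>A. ?P u)" unfolding D by (rule INF_lower[OF A(1)])
  also have "\<dots> \<le> ereal R" using A(2) by (intro SUP_least) simp
  finally have up: "?D \<le> ereal R" .
  have lo: "0 \<le> ?D"
    unfolding D
  proof (rule INF_greatest)
    fix B assume "B \<in> Sigma_k q \<Omega> k"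
    then obtain u where "u \<in> B" using Sigma_k_nonempty k by blast
    then have "?P u \<le> (SUP u\<in>B. ?P u)" by (rule SUP_upper)
    moreover have "0 \<le> ?P u" by simp
    ultimately show "0 \<le> (SUP u\<in>B. ?P u)" by (rule order_trans[rotated])
  qed
  obtain L where L: "?D = ereal L" using up lo by (cases ?D) auto
  have "minimax_level k L"
    unfolding minimax_level_def
  proof (intro conjI allI impI ballI)
    fix \<alpha> B assume \<alpha>: "\<alpha> < L" and B: "B \<in> Sigma_k q \<Omega> k"
    have "ereal \<alpha> < ?D" using \<alpha> L by simp
    also have "?D \<le> (SUP u\<in>B. ?P u)" unfolding D by (rule INF_lower[OF B])
    finally show "\<exists>u\<in>B. \<alpha> \<le> powint q (weak_grad \<Omega> u)" by (auto simp: less_SUP_iff intro: less_imp_le)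
  next
    fix \<beta> assume "L < \<beta>"
    then have "?D < ereal \<beta>" using L by simp
    then obtain B where B: "B \<in> Sigma_k q \<Omega> k" "(SUP u\<in>B. ?P u) < ereal \<beta>" unfolding D by (auto simp: INF_less_iff)
    have "powint q (weak_grad \<Omega> u) \<le> \<beta>" if "u \<in> B" for u
      using SUP_upper[OF that, of ?P] B(2) by (metis ereal_less_eq(3) less_imp_le order_trans)
    then show "\<exists>A\<in>Sigma_k q \<Omega> k. \<forall>u\<in>A. powint q (weak_grad \<Omega> u) \<le> \<beta>" using B(1) by blast
  qed
  with L show ?thesis by (rule that)
qed

end

section \<open>The Euler-Lagrange equation and the bifurcating solutions\<close>

text \<open>The tangent to the convex function \<open>norm a powr s\<close> at \<open>c\<close> lies below its graph; this follows from the
  inequalities of Cauchy-Schwarz and Young.\<close>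

lemma norm_powr_gradient_inequality:
  fixes a c :: "'b::real_inner"
  assumes s: "1 < s"
  shows "norm c powr s + s * (norm c powr (s - 2) * (c \<bullet> (a - c))) \<le> norm a powr s"
proof (cases "c = 0")
  case False
  have e: "norm c powr (s - 2) * norm c = norm c powr (s - 1)" "norm c powr (s - 1) * norm c = norm c powr s"
    using False powr_add[of "norm c" "s - 2" 1] powr_add[of "norm c" "s - 1" 1] by simp_all
  have "norm c powr (s - 2) * (c \<bullet> c) = norm c powr s" using e by (simp add: dot_square_norm power2_eq_square flip: mult.assoc)
  moreover have "norm c powr (s - 2) * (c \<bullet> a) \<le> norm a powr s / s + (1 - 1 / s) * norm c powr s"
  proof -
    have "norm c powr (s - 2) * (c \<bullet> a) \<le> norm c powr (s - 2) * (norm c * norm a)"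
      by (intro mult_left_mono norm_cauchy_schwarz) auto
    also have "\<dots> = norm c powr (s - 1) * norm a" using e by (simp flip: mult.assoc)
    also have "\<dots> \<le> norm a powr s / s + (1 - 1 / s) * norm c powr s" by (rule young_powr) (use s in auto)
    finally show ?thesis .
  qed
  then have "s * (norm c powr (s - 2) * (c \<bullet> a)) \<le> s * (norm a powr s / s + (1 - 1 / s) * norm c powr s)"
    using s by (intro mult_left_mono) auto
  moreover have "s * (norm a powr s / s + (1 - 1 / s) * norm c powr s) = norm a powr s + (s - 1) * norm c powr s"
    using s by (simp add: field_simps)
  ultimately show ?thesis by (simp add: inner_diff_right right_diff_distrib algebra_simps)
qed simp

lemma norm_powr_inner_bound:
  fixes a b :: "'b::real_inner"
  assumes s: "1 < s" shows "\<bar>norm a powr (s - 2) * (a \<bullet> b)\<bar> \<le> norm a powr s + norm b powr s"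
proof (cases "a = 0")
  case False
  have e: "norm a powr (s - 2) * norm a = norm a powr (s - 1)" using False powr_add[of "norm a" "s - 2" 1] by simp
  have "\<bar>norm a powr (s - 2) * (a \<bullet> b)\<bar> \<le> norm a powr (s - 2) * (norm a * norm b)"
    unfolding abs_mult by (simp add: mult_left_mono Cauchy_Schwarz_ineq2)
  also have "\<dots> = norm a powr (s - 1) * norm b" using e by (simp flip: mult.assoc)
  also have "\<dots> \<le> norm b powr s / s + (1 - 1 / s) * norm a powr s" by (rule young_powr) (use s in auto)
  also have "\<dots> \<le> norm b powr s + 1 * norm a powr s"
  proof (intro add_mono mult_right_mono)
    have "norm b powr s * 1 \<le> norm b powr s * s" using s by (intro mult_left_mono) auto
    then show "norm b powr s / s \<le> norm b powr s" using s by (simp add: divide_le_eq)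
  qed (use s in auto)
  finally show ?thesis by simp
qed simp

text \<open>At \<open>a = 0\<close> the possibly negative exponent is compensated by homogeneity of degree \<open>s - 1\<close>.\<close>

lemma norm_powr_inner_tendsto:
  fixes a b :: "'b::real_inner"
  assumes s: "1 < s" and t: "t \<longlonglongrightarrow> 0" "\<And>n. 0 < t n"
  shows "(\<lambda>n. norm (a + t n *\<^sub>R b) powr (s - 2) * ((a + t n *\<^sub>R b) \<bullet> b)) \<longlonglongrightarrow> norm a powr (s - 2) * (a \<bullet> b)"
proof (cases "a = 0")
  case False
  have "(\<lambda>n. norm (a + t n *\<^sub>R b) powr (s - 2) * ((a + t n *\<^sub>R b) \<bullet> b)) \<longlonglongrightarrow> norm (a + 0 *\<^sub>R b) powr (s - 2) * ((a + 0 *\<^sub>R b) \<bullet> b)"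
    using False by (intro tendsto_intros t) auto
  then show ?thesis by simp
next
  case True
  have eq: "norm (a + t n *\<^sub>R b) powr (s - 2) * ((a + t n *\<^sub>R b) \<bullet> b) = t n powr (s - 1) * (norm b powr (s - 2) * (b \<bullet> b))" for n
  proof -
    have "t n powr (s - 1) = t n powr (s - 2) * t n" using powr_add[of "t n" "s - 2" 1] t(2)[of n] by simp
    then show ?thesis using True t(2)[of n] by (simp add: powr_mult)
  qed
  have "(\<lambda>n. t n powr (s - 1)) \<longlonglongrightarrow> 0"
    using tendsto_powr'[OF t(1) tendsto_const[of "s - 1"]] s t(2) by (auto intro: always_eventually less_imp_le)
  then have "(\<lambda>n. t n powr (s - 1) * (norm b powr (s - 2) * (b \<bullet> b))) \<longlonglongrightarrow> 0" by (rule tendsto_mult_left_zero)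
  then show ?thesis unfolding eq using True by simp
qed

context bounded_domain
begin

text \<open>The weak form of the \<open>s\<close>-Laplacian.\<close>

definition grad_pairing :: "real \<Rightarrow> ('a \<Rightarrow> 'a) \<Rightarrow> ('a \<Rightarrow> 'a) \<Rightarrow> real" where
  "grad_pairing s g h = (\<integral>x. norm (g x) powr (s - 2) * (g x \<bullet> h x) \<partial>M)"

lemma integrable_grad_pairing:
  assumes s: "1 < s" and L: "g \<in> Lp s \<Omega>" "h \<in> Lp s \<Omega>"
  shows "integrable M (\<lambda>x. norm (g x) powr (s - 2) * (g x \<bullet> h x))"
proof (rule Bochner_Integration.integrable_bound)
  show "integrable M (\<lambda>x. norm (g x) powr s + norm (h x) powr s)" using LpD(2)[OF L(1)] LpD(2)[OF L(2)] by simp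
  show "(\<lambda>x. norm (g x) powr (s - 2) * (g x \<bullet> h x)) \<in> borel_measurable M" using LpD(1)[OF L(1)] LpD(1)[OF L(2)] by measurable
  show "AE x in M. norm (norm (g x) powr (s - 2) * (g x \<bullet> h x)) \<le> norm (norm (g x) powr s + norm (h x) powr s)"
    using norm_powr_inner_bound[OF s, of "g _" "h _"] by simp
qed

lemma grad_pairing_diff_scaleR:
  assumes s: "1 < s" and L: "g \<in> Lp s \<Omega>" "h \<in> Lp s \<Omega>" "k \<in> Lp s \<Omega>"
  shows "grad_pairing s g (\<lambda>x. h x - c *\<^sub>R k x) = grad_pairing s g h - c * grad_pairing s g k"
proof -
  have "grad_pairing s g (\<lambda>x. h x - c *\<^sub>R k x)
      = (\<integral>x. norm (g x) powr (s - 2) * (g x \<bullet> h x) - c * (norm (g x) powr (s - 2) * (g x \<bullet> k x)) \<partial>M)"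
    unfolding grad_pairing_def by (simp add: inner_diff_right right_diff_distrib mult.left_commute)
  then show ?thesis
    using integrable_grad_pairing[OF s L(1,2)] integrable_grad_pairing[OF s L(1,3)] by (simp add: grad_pairing_def)
qed

lemma grad_pairing_minus: "grad_pairing s g (\<lambda>x. - h x) = - grad_pairing s g h"
  by (simp add: grad_pairing_def)

lemma grad_pairing_self: "grad_pairing s g g = powint s g"
proof -
  have "norm a powr (s - 2) * (a \<bullet> a) = norm a powr s" for a :: 'a
    using powr_add[of "norm a" "s - 2" 2] by (cases "a = 0") (simp_all add: dot_square_norm)
  then show ?thesis by (simp add: grad_pairing_def powint_def)
qed

lemma grad_pairing_scaleR:
  assumes "0 < t" shows "grad_pairing s (\<lambda>x. t *\<^sub>R g x) h = t powr (s - 1) * grad_pairing s g h"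
proof -
  have "t powr (s - 1) = t powr (s - 2) * t" using powr_add[of t "s - 2" 1] assms by simp
  then show ?thesis using assms by (simp add: grad_pairing_def powr_mult mult.assoc mult.left_commute)
qed

lemma grad_pairing_cong_AE:
  assumes L: "g \<in> Lp s \<Omega>" "g' \<in> Lp s \<Omega>" "h \<in> Lp s \<Omega>" and AE: "AE x in M. g x = g' x"
  shows "grad_pairing s g h = grad_pairing s g' h"
proof -
  have [measurable]: "g \<in> borel_measurable M" "g' \<in> borel_measurable M" "h \<in> borel_measurable M" using L LpD(1) by blast+
  show ?thesis unfolding grad_pairing_def by (rule integral_cong_AE) (use AE in \<open>auto elim!: eventually_mono\<close>)
qed

lemma powint_gradient_inequality:
  assumes s: "1 < s" and L: "g \<in> Lp s \<Omega>" "h \<in> Lp s \<Omega>"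
  shows "powint s (\<lambda>x. g x + h x) - s * grad_pairing s (\<lambda>x. g x + h x) h \<le> powint s g"
proof -
  have Lgh: "(\<lambda>x. g x + h x) \<in> Lp s \<Omega>" using s by (intro Lp_add L) auto
  have "(\<integral>x. norm (g x + h x) powr s - s * (norm (g x + h x) powr (s - 2) * ((g x + h x) \<bullet> h x)) \<partial>M) \<le> (\<integral>x. norm (g x) powr s \<partial>M)"
  proof (rule integral_mono)
    show "integrable M (\<lambda>x. norm (g x + h x) powr s - s * (norm (g x + h x) powr (s - 2) * ((g x + h x) \<bullet> h x)))"
      using LpD(2)[OF Lgh] integrable_grad_pairing[OF s Lgh L(2)] by simp
    fix x
    show "norm (g x + h x) powr s - s * (norm (g x + h x) powr (s - 2) * ((g x + h x) \<bullet> h x)) \<le> norm (g x) powr s"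
      using norm_powr_gradient_inequality[OF s, of "g x + h x" "g x"] by simp
  qed (rule LpD(2)[OF L(1)])
  then show ?thesis
    using LpD(2)[OF Lgh] integrable_grad_pairing[OF s Lgh L(2)] by (simp add: powint_def grad_pairing_def)
qed

lemma grad_pairing_tendsto:
  assumes s: "1 < s" and L: "g \<in> Lp s \<Omega>" "h \<in> Lp s \<Omega>" and t: "t \<longlonglongrightarrow> 0" "\<And>n. 0 < t n" "\<And>n. t n \<le> 1"
  shows "(\<lambda>n. grad_pairing s (\<lambda>x. g x + t n *\<^sub>R h x) h) \<longlonglongrightarrow> grad_pairing s g h"
  unfolding grad_pairing_def
proof (rule integral_dominated_convergence)
  have Lt: "(\<lambda>x. g x + t n *\<^sub>R h x) \<in> Lp s \<Omega>" for n using s by (intro Lp_add Lp_scaleR L) auto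
  show "(\<lambda>x. norm (g x) powr (s - 2) * (g x \<bullet> h x)) \<in> borel_measurable M"
    by (rule borel_measurable_integrable[OF integrable_grad_pairing[OF s L]])
  show "(\<lambda>x. norm (g x + t n *\<^sub>R h x) powr (s - 2) * ((g x + t n *\<^sub>R h x) \<bullet> h x)) \<in> borel_measurable M" for n
    by (rule borel_measurable_integrable[OF integrable_grad_pairing[OF s Lt L(2)]])
  show "integrable M (\<lambda>x. 2 powr s * (norm (g x) powr s + norm (h x) powr s) + norm (h x) powr s)"
    using LpD(2)[OF L(1)] LpD(2)[OF L(2)] by simp
  show "AE x in M. (\<lambda>n. norm (g x + t n *\<^sub>R h x) powr (s - 2) * ((g x + t n *\<^sub>R h x) \<bullet> h x)) \<longlonglongrightarrow> norm (g x) powr (s - 2) * (g x \<bullet> h x)"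
    by (intro AE_I2 norm_powr_inner_tendsto[OF s t(1,2)])
  show "AE x in M. norm (norm (g x + t n *\<^sub>R h x) powr (s - 2) * ((g x + t n *\<^sub>R h x) \<bullet> h x))
      \<le> 2 powr s * (norm (g x) powr s + norm (h x) powr s) + norm (h x) powr s" for n
  proof (rule AE_I2)
    fix x
    have "norm (t n *\<^sub>R h x) powr s \<le> norm (h x) powr s"
      using t(2,3)[of n] s by (intro powr_mono2) (auto intro: mult_left_le_one_le)
    then have 1: "2 powr s * (norm (g x) powr s + norm (t n *\<^sub>R h x) powr s) \<le> 2 powr s * (norm (g x) powr s + norm (h x) powr s)"
      by (intro mult_left_mono) auto
    have 2: "norm (g x + t n *\<^sub>R h x) powr s \<le> 2 powr s * (norm (g x) powr s + norm (t n *\<^sub>R h x) powr s)"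
      by (rule norm_add_powr_le) (use s in simp)
    show "norm (norm (g x + t n *\<^sub>R h x) powr (s - 2) * ((g x + t n *\<^sub>R h x) \<bullet> h x))
      \<le> 2 powr s * (norm (g x) powr s + norm (h x) powr s) + norm (h x) powr s"
      using norm_powr_inner_bound[OF s, of "g x + t n *\<^sub>R h x" "h x"] 1 2 unfolding real_norm_def by linarith
  qed
qed

end

context two_exponents
begin

text \<open>The gradient inequality at the competitor \<open>g + t h\<close> shows that the derivative there in the direction
  \<open>h\<close> is nonnegative, and it tends to the derivative at \<open>g\<close>. Directions are first taken tangent to the
  constraint; the multiplier comes from testing with \<open>w\<close> itself.\<close>

lemma euler_lagrange:
  assumes e: "0 < e" and w: "w \<in> Lp q \<Omega>" and m: "is_min e w w g" and v: "W0 p v h"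
  shows "e * p * grad_pairing p g h + q * grad_pairing q g h = (e * p * powint p g + q * powint q g) * pairing q w v"
proof -
  note W = is_minD(1)[OF m]
  define D where "D k h = e * p * grad_pairing p k h + q * grad_pairing q k h" for k h
  have nonneg: "0 \<le> D g h" if V: "W0 p v h" "pairing q w v = 0" for v h
  proof -
    note Lg = W0_Lp(2)[OF W] and Lh = W0_Lp(2)[OF V(1)]
    define t where "t n = inverse (real (Suc n))" for n
    have t: "t \<longlonglongrightarrow> 0" "\<And>n. 0 < t n" "\<And>n. t n \<le> 1"
      unfolding t_def using LIMSEQ_inverse_real_of_nat by (auto simp: inverse_le_1_iff)
    have pos: "0 \<le> D (\<lambda>x. g x + t n *\<^sub>R h x) h" for n
    proof -
      have "pairing q w (\<lambda>x. w x + t n * v x) = 1"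
        using pairing_add[OF q_gt_1 w w Lp_mult[OF Lp_p_q[OF W0_Lp(1)[OF V(1)]]]] V(2) is_minD(2)[OF m]
        by (simp add: pairing_mult)
      then have 1: "energy e g \<le> energy e (\<lambda>x. g x + t n *\<^sub>R h x)"
        by (rule is_minD(3)[OF m W0_add[OF W W0_scale[OF V(1) exponents(4)] exponents(4)]])
      have gs: "grad_pairing s k (\<lambda>x. t n *\<^sub>R h x) = t n * grad_pairing s k h" for s k
        by (simp add: grad_pairing_def mult.left_commute)
      have 2: "powint p (\<lambda>x. g x + t n *\<^sub>R h x) - p * (t n * grad_pairing p (\<lambda>x. g x + t n *\<^sub>R h x) h) \<le> powint p g"
        using powint_gradient_inequality[OF exponents(3) Lg Lp_scaleR[OF Lh, of "t n"]] by (simp only: gs)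
      have 3: "powint q (\<lambda>x. g x + t n *\<^sub>R h x) - q * (t n * grad_pairing q (\<lambda>x. g x + t n *\<^sub>R h x) h) \<le> powint q g"
        using powint_gradient_inequality[OF q_gt_1 Lp_p_q[OF Lg] Lp_scaleR[OF Lp_p_q[OF Lh], of "t n"]] by (simp only: gs)
      have "energy e (\<lambda>x. g x + t n *\<^sub>R h x) - t n * D (\<lambda>x. g x + t n *\<^sub>R h x) h \<le> energy e g"
        using mult_left_mono[OF 2, of e] 3 e unfolding energy_def D_def by (simp add: algebra_simps)
      then have "0 \<le> t n * D (\<lambda>x. g x + t n *\<^sub>R h x) h" using 1 by linarith
      then show ?thesis using t(2)[of n] by (simp add: zero_le_mult_iff)
    qed
    have "(\<lambda>n. D (\<lambda>x. g x + t n *\<^sub>R h x) h) \<longlonglongrightarrow> D g h"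
      unfolding D_def
      by (intro tendsto_intros grad_pairing_tendsto exponents(3) q_gt_1 Lg Lh Lp_p_q[OF Lg] Lp_p_q[OF Lh] t)
    then show ?thesis by (rule LIMSEQ_le_const) (use pos in blast)
  qed
  \<comment> \<open>Subtracting the component along \<open>w\<close> makes the direction tangent to the constraint.\<close>
  let ?c = "pairing q w v"
  have V: "W0 p (\<lambda>x. v x - ?c * w x) (\<lambda>x. h x - ?c *\<^sub>R g x)"
    by (rule W0_diff[OF v W0_scale[OF W exponents(4)] exponents(4)])
  have V0: "pairing q w (\<lambda>x. v x - ?c * w x) = 0"
    using pairing_add[OF q_gt_1 w Lp_p_q[OF W0_Lp(1)[OF v]] Lp_mult[OF w], of "- ?c"] is_minD(2)[OF m]
    unfolding pairing_mult by simp
  have V0': "pairing q w (\<lambda>x. - (v x - ?c * w x)) = 0" 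
    using V0 pairing_mult[of q w "-1" "\<lambda>x. v x - ?c * w x"] by simp
  have "D g (\<lambda>x. h x - ?c *\<^sub>R g x) = 0"
  proof (rule antisym)
    have "D g (\<lambda>x. - (h x - ?c *\<^sub>R g x)) = - D g (\<lambda>x. h x - ?c *\<^sub>R g x)" unfolding D_def grad_pairing_minus by simp
    then show "D g (\<lambda>x. h x - ?c *\<^sub>R g x) \<le> 0" using nonneg[OF W0_minus[OF V exponents(4)] V0'] by linarith
  qed (rule nonneg[OF V V0])
  then show ?thesis
    using grad_pairing_diff_scaleR[OF exponents(3) W0_Lp(2)[OF W] W0_Lp(2)[OF v] W0_Lp(2)[OF W], of ?c]
      grad_pairing_diff_scaleR[OF q_gt_1 Lp_p_q[OF W0_Lp(2)[OF W]] Lp_p_q[OF W0_Lp(2)[OF v]] Lp_p_q[OF W0_Lp(2)[OF W]], of ?c]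
    unfolding D_def grad_pairing_self by (simp add: algebra_simps)
qed

text \<open>The factor \<open>t\<close> is chosen such that \<open>t powr (p - q) = e * p / q\<close>, which makes the weights of the two
  operators equal.\<close>

lemma rescaled_weak_solution:
  assumes pq: "q < p" and e: "0 < e" and w: "w \<in> unit_sphere" and m: "is_min e w w (weak_grad \<Omega> w)"
  defines "g \<equiv> weak_grad \<Omega> w" and "e' \<equiv> e * p / q" and "t \<equiv> (e * p / q) powr (1 / (p - q))"
  shows "weak_solution p q \<Omega> (e' * powint p g + powint q g) (\<lambda>x. t * w x)" "\<not> (AE x in M. t * w x = 0)"
    "grad_norm p \<Omega> (\<lambda>x. t * w x) = (e' powr (q / (p - q)) * (e' * powint p g)) powr (1 / p)"
proof -
  have e': "0 < e'" using e exponents by (simp add: e'_def)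
  have t: "0 < t" "t = e' powr (1 / (p - q))" using e' unfolding t_def e'_def by (simp_all only: powr_gt_zero)
  have tpq: "t powr (p - 1) = t powr (q - 1) * e'"
  proof -
    have "t powr (p - 1) = t powr ((q - 1) + (p - q))" by simp
    also have "\<dots> = t powr (q - 1) * t powr (p - q)" by (rule powr_add)
    also have "t powr (p - q) = e'" unfolding t(2) using pq e' by (simp add: powr_powr)
    finally show ?thesis .
  qed
  have W: "W0 p w g" using is_minD(1)[OF m] by (simp only: g_def)
  have wL: "w \<in> Lp q \<Omega>" by (rule unit_sphereD(1)[OF w])
  have Wt: "W0 p (\<lambda>x. t * w x) (\<lambda>x. t *\<^sub>R g x)" by (rule W0_scale[OF W exponents(4)])
  note G = weak_grad_W0[OF Wt exponents(5)]
  show "weak_solution p q \<Omega> (e' * powint p g + powint q g) (\<lambda>x. t * w x)"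
    unfolding weak_solution_def
  proof (intro conjI ballI)
    show "(\<lambda>x. t * w x) \<in> W10 p \<Omega>" using Wt W10_iff[OF exponents(5)] by blast
    fix v assume "v \<in> W10 p \<Omega>"
    then have V: "W0 p v (weak_grad \<Omega> v)" using W10_iff[OF exponents(5)] weak_grad_W0(2)[OF _ exponents(5)] by blast
    have 1: "grad_pairing p (weak_grad \<Omega> (\<lambda>x. t * w x)) (weak_grad \<Omega> v) = t powr (p - 1) * grad_pairing p g (weak_grad \<Omega> v)"
      using grad_pairing_cong_AE[OF W0_Lp(2)[OF G(2)] W0_Lp(2)[OF Wt] W0_Lp(2)[OF V] G(1)] grad_pairing_scaleR[OF t(1)] by simp
    have 2: "grad_pairing q (weak_grad \<Omega> (\<lambda>x. t * w x)) (weak_grad \<Omega> v) = t powr (q - 1) * grad_pairing q g (weak_grad \<Omega> v)"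
      using grad_pairing_cong_AE[OF Lp_p_q[OF W0_Lp(2)[OF G(2)]] Lp_p_q[OF W0_Lp(2)[OF Wt]] Lp_p_q[OF W0_Lp(2)[OF V]] G(1)]
        grad_pairing_scaleR[OF t(1)] by simp
    have 3: "pairing q (\<lambda>x. t * w x) v = t powr (q - 1) * pairing q w v"
      by (simp add: pairing_def spow_scale[OF t(1)] mult.assoc)
    have "e * p * grad_pairing p g (weak_grad \<Omega> v) + q * grad_pairing q g (weak_grad \<Omega> v)
        = (e * p * powint p g + q * powint q g) * pairing q w v"
      by (rule euler_lagrange[OF e wL _ V]) (use m in \<open>simp only: g_def\<close>)
    moreover have "e * p = q * e'" using exponents(1) by (simp add: e'_def)
    ultimately have "q * (e' * grad_pairing p g (weak_grad \<Omega> v) + grad_pairing q g (weak_grad \<Omega> v))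
        = q * ((e' * powint p g + powint q g) * pairing q w v)" by (simp add: algebra_simps)
    then have 4: "e' * grad_pairing p g (weak_grad \<Omega> v) + grad_pairing q g (weak_grad \<Omega> v) = (e' * powint p g + powint q g) * pairing q w v"
      using exponents(1) by simp
    have "grad_pairing p (weak_grad \<Omega> (\<lambda>x. t * w x)) (weak_grad \<Omega> v) + grad_pairing q (weak_grad \<Omega> (\<lambda>x. t * w x)) (weak_grad \<Omega> v)
        = t powr (q - 1) * (e' * grad_pairing p g (weak_grad \<Omega> v) + grad_pairing q g (weak_grad \<Omega> v))"
      unfolding 1 2 tpq by (simp add: algebra_simps)
    also have "\<dots> = (e' * powint p g + powint q g) * pairing q (\<lambda>x. t * w x) v" unfolding 3 4 by (simp only: mult_ac)
    finally show "(\<integral>x. norm (weak_grad \<Omega> (\<lambda>x. t * w x) x) powr (p - 2) * (weak_grad \<Omega> (\<lambda>x. t * w x) x \<bullet> weak_grad \<Omega> v x) \<partial>M) +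
      (\<integral>x. norm (weak_grad \<Omega> (\<lambda>x. t * w x) x) powr (q - 2) * (weak_grad \<Omega> (\<lambda>x. t * w x) x \<bullet> weak_grad \<Omega> v x) \<partial>M)
      = (e' * powint p g + powint q g) * (\<integral>x. \<bar>t * w x\<bar> powr (q - 2) * (t * w x) * v x \<partial>M)"
      unfolding grad_pairing_def pairing_def spow_def .
  qed
  show "\<not> (AE x in M. t * w x = 0)"
  proof
    assume "AE x in M. t * w x = 0"
    then have "AE x in M. w x = 0" using t(1) by simp
    then have "powint q w = powint q (\<lambda>x. 0 :: real)" by (intro powint_cong_AE LpD(1)[OF wL]) auto
    then show False using unit_sphereD(2)[OF w] by simp
  qed
  have "powint p (weak_grad \<Omega> (\<lambda>x. t * w x)) = t powr p * powint p g" using G(3) t(1) by (simp add: powint_scaleR)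
  also have "t powr p = e' powr (q / (p - q) + 1)"
  proof -
    have "p / (p - q) = q / (p - q) + 1" using pq by (simp add: field_simps)
    then show ?thesis unfolding t(2) powr_powr by simp
  qed
  also have "\<dots> = e' powr (q / (p - q)) * e'" using e' by (simp add: powr_add)
  finally have "powint p (weak_grad \<Omega> (\<lambda>x. t * w x)) = e' powr (q / (p - q)) * (e' * powint p g)" by simp
  then show "grad_norm p \<Omega> (\<lambda>x. t * w x) = (e' powr (q / (p - q)) * (e' * powint p g)) powr (1 / p)"
    unfolding grad_norm_def powint_def by simp
qed

lemma bifurcation_at_minimax_level:
  assumes pq: "q < p" and l: "minimax_level k L"
  shows "bifurcation_point p q \<Omega> L"
proof -
  obtain e w where w: "\<And>n::nat. 0 < e n" "e \<longlonglongrightarrow> 0" "\<And>n. w n \<in> unit_sphere" "\<And>n. is_min (e n) (w n) (w n) (weak_grad \<Omega> (w n))"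
    "(\<lambda>n. energy (e n) (weak_grad \<Omega> (w n))) \<longlonglongrightarrow> L"
    by (rule critical_sequence[OF l]) (rule that)
  define e' where "e' n = e n * p / q" for n
  define g where "g n = weak_grad \<Omega> (w n)" for n
  define t where "t n = (e n * p / q) powr (1 / (p - q))" for n
  define \<mu> where "\<mu> n = e' n * powint p (g n) + powint q (g n)" for n
  define u where "u n = (\<lambda>x. t n * w n x)" for n
  have sol: "weak_solution p q \<Omega> (\<mu> n) (u n)" "\<not> (AE x in M. u n x = 0)"
    "grad_norm p \<Omega> (u n) = (e' n powr (q / (p - q)) * (e' n * powint p (g n))) powr (1 / p)" for n
    using rescaled_weak_solution[OF pq w(1,3,4), of n] unfolding e'_def g_def t_def \<mu>_def u_def .
  have eP: "(\<lambda>n. e n * powint p (g n)) \<longlonglongrightarrow> 0"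
    unfolding g_def by (rule critical_sequence_perturbation_vanishes[OF w])
  have e'P: "(\<lambda>n. e' n * powint p (g n)) \<longlonglongrightarrow> 0"
    using tendsto_mult[OF tendsto_const[of "p / q"] eP] by (simp add: e'_def mult_ac)
  have e'0: "e' \<longlonglongrightarrow> 0" using tendsto_mult[OF tendsto_const[of "p / q"] w(2)] by (simp add: e'_def[abs_def] mult_ac)
  have e'_nonneg: "0 \<le> e' n" for n using w(1)[of n] exponents by (simp add: e'_def)
  \<comment> \<open>The multiplier differs from the energy by a multiple of the vanishing perturbation term.\<close>
  have "(\<lambda>n. (energy (e n) (g n) - e n * powint p (g n)) + e' n * powint p (g n)) \<longlonglongrightarrow> (L - 0) + 0"
    using w(5) by (intro tendsto_add tendsto_diff eP e'P) (simp add: g_def)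
  then have \<mu>: "\<mu> \<longlonglongrightarrow> L" by (simp add: energy_def \<mu>_def[abs_def] add.commute)
  have "(\<lambda>n. e' n powr (q / (p - q))) \<longlonglongrightarrow> 0 powr (q / (p - q))"
    using e'0 e'_nonneg pq exponents by (intro tendsto_powr' tendsto_const) auto
  then have "(\<lambda>n. e' n powr (q / (p - q)) * (e' n * powint p (g n))) \<longlonglongrightarrow> 0 * 0" using e'P by (intro tendsto_mult) auto
  then have "(\<lambda>n. (e' n powr (q / (p - q)) * (e' n * powint p (g n))) powr (1 / p)) \<longlonglongrightarrow> (0 * 0) powr (1 / p)"
    using e'_nonneg exponents by (intro tendsto_powr' tendsto_const) (auto intro!: always_eventually)
  then have "(\<lambda>n. grad_norm p \<Omega> (u n)) \<longlonglongrightarrow> 0" by (simp add: sol(3))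
  then show ?thesis unfolding bifurcation_point_def using sol(1,2) \<mu> by (auto simp: weak_solution_def intro!: exI[of _ \<mu>] exI[of _ u])
qed

end

theorem theorem5p3:
  fixes \<Omega> :: "(real ^ 'n) set" and p q :: real and k :: nat
  assumes "CARD('n) \<ge> 2"
    and "open \<Omega>" and "connected \<Omega>" and "\<Omega> \<noteq> {}" and "bounded \<Omega>" and "smooth_boundary \<Omega>"
    and "1 < q" and "q < p"
    and "k > 0"
  shows "\<exists>l::real. dirichlet_eigenvalue q \<Omega> k = ereal l \<and> bifurcation_point p q \<Omega> l"
proof -
  interpret two_exponents \<Omega> p q by unfold_locales (use assms in auto)
  obtain l where l: "dirichlet_eigenvalue q \<Omega> k = ereal l" "minimax_level k l"
    by (rule dirichlet_eigenvalue_finite[OF assms(4,9)])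
  from bifurcation_at_minimax_level[OF assms(8) l(2)] l(1) show ?thesis by blast
qed

end
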